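(* In the setting of the context (elliptic curve $C$, $D=t_1+t_2$ with $t_1=(t,r)$, exponents $\nu=(\nu_1,\nu_2)$), if $\nu_1+\nu_2+1\neq0$, then the rational map $$Bun\times App\ :\ {\rm Con}^\nu_<(C,D)\longrightarrow(\mathbb P^1_{z_1}\times\mathbb P^1_{z_2})\times\mathbb P^2$$ is birational. More precisely, for $\mathbf p\in X_<\simeq\mathbb P^1_{z_1}\times\mathbb P^1_{z_2}$, the restriction $$App\ :\ Bun^{-1}(\mathbf p)\longrightarrow\mathbb P^2$$ is injective if and only if $\mathbf p$ lies outside $\{z_1=t\}\cup\{z_2=t\}$.
   Context: Curve. Let $\lambda\in\mathbb C\setminus\{0,1\}$ and let $C\subset\mathbb P^2$ be the elliptic curve $zy^2=x(x-z)(x-\lambda z)$, with $w_\infty=(0:1:0)$ and $w_0,w_1,w_\lambda$ the points with affine coordinates $(0,0),(1,0),(\lambda,0)$. Let $D=t_1+t_2$ with $t_1=(t,r)$, $t_2=(t,-r)$ in affine coordinates $(x,y)$, $t\ne 0,1,\lambda,\infty$. Exponents. $\nu=(\nu_1,\nu_2)\in\mathbb C^2$ with $\nu_1\pm\nu_2$ not an odd integer; set $\nu_1^{\pm}=\pm\frac{\nu_1}2-\frac12$, $\nu_2^\pm=\pm\frac{\nu_2}2$. Fix a logarithmic connection $\nabla_{\det}$ on $\mathcal O_C(w_\infty)$ with only pole $t_1$ and residue $-1$ there. Moduli. Let $E_1$ be the unique non-trivial extension $0\to\mathcal O_C\to E_1\to\mathcal O_C(w_\infty)\to0$. ${\rm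 Con}^\nu_<(C,D)$ is the moduli space of triples $(E_1,\nabla,\mathbf p)$, up to isomorphism, where $\nabla:E_1\to E_1\otimes\Omega^1_C(D)$ is a logarithmic connection with trace $\nabla_{\det}$ whose residue at $t_k$ has eigenvalues $\nu_k^+,\nu_k^-$, and $\mathbf p=(p_1,p_2)$ with $p_k\subset E_1|_{t_k}$ a line on which ${\rm Res}_{t_k}\nabla$ acts by $\nu_k^+$. $X_<$ is the moduli space of parabolic bundles $(E_1,\mathbf p)$; since automorphisms of $E_1$ are scalar, $X_<=\mathbb P(E_1|_{t_1})\times\mathbb P(E_1|_{t_2})$. $Bun$ is the forgetful map $(E_1,\nabla,\mathbf p)\mapsto(E_1,\mathbf p)\in X_<$. Coordinates. For $i\in\{0,1,\lambda\}$ let $L_i\subset E_1$ be the image of the unique (up to scalar) non-zero map $\mathcal O_C(w_i-w_\infty)\to E_1$. The coordinate $z_k$ on $\mathbb P(E_1|_{t_k})\simeq\mathbb P^1$ is the one for which the lines $L_0|_{t_k},L_1|_{t_k},L_\lambda|_{t_k}$ have coordinates $0,1,\lambda$; this gives $X_<\simeq\mathbb P^1_{z_1}\times\mathbb P^1_{z_2}$. (The line $\mathcal O_C|_{t_k}$, for the unique subbundle $\mathcal O_C\subset E_1$, then has coordinate $t$.) Apparent map. For $\nabla$ on $E_1$, the composition $\mathcal O_C\hookrightarrow E_1\xrightarrow{\nabla}E_1\otimes\Omega^1_C(D)\to(E_1/\mathcal O_C)\otimes\Omega^1_C(D)$ is $\mathcal O_C$-linear; its zero divisor is an element $App(\nabla)$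 of $\mathbb P H^0(C,(E_1/\mathcal O_C)\otimes\Omega^1_C(D))=|\mathcal O_C(w_\infty+t_1+t_2)|\simeq\mathbb P^2$. *)

theory Defs
  imports "HOL-Analysis.Analysis" "HOL-Computational_Algebra.Formal_Laurent_Series"
begin

unbundle no fps_syntax

section \<open>The elliptic curve and its function field\<close>

text \<open>
  Points of the plane cubic $zy^2 = x(x-z)(x-\lambda z)$: \<open>Aff a b\<close> is $(a:b:1)$, and \<open>Inf\<close> is
  $w_\infty = (0:1:0)$, the only point with $z = 0$.
\<close>

datatype point = Inf | Aff complex complex

definition curve :: "complex \<Rightarrow> point set" where
  "curve lam = {Inf} \<union> {Aff a b | a b. b\<^sup>2 = a * (a - 1) * (a - lam)}"

text \<open>
  A rational function on the curve is identified with its Laurent expansion at $w_\infty$ in the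
  formal parameter $u$ for which $x = u^{-2}$ and $y = u^{-3}\sqrt{(1-u^2)(1-\lambda u^2)}$. The
  function field is thus the subfield $\mathbb{C}(x,y)$ of $\mathbb{C}((u))$.
\<close>

definition x_fun :: "complex fls" where
  "x_fun = fls_X_inv ^ 2"

definition y_fun :: "complex \<Rightarrow> complex fls" where
  "y_fun lam = fls_X_inv ^ 3 *
     fps_to_fls (fps_radical (\<lambda>_ _. 1) 2 ((1 - fps_X\<^sup>2) * (1 - fps_const lam * fps_X\<^sup>2)))"

lemma curve_equation:
  "(y_fun lam)\<^sup>2 = x_fun * (x_fun - 1) * (x_fun - fls_const lam)"
proof -
  let ?a = "(1 - fps_X\<^sup>2) * (1 - fps_const lam * fps_X\<^sup>2) :: complex fps"
  have a0: "fps_nth ?a 0 = 1"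
    by simp
  have "fps_radical (\<lambda>_ _. 1) (Suc 1) ?a ^ Suc 1 = ?a"
    by (rule iffD1[OF power_radical]) (simp_all add: a0)
  then have "fps_to_fls (fps_radical (\<lambda>_ _. 1) 2 ?a) ^ 2 = fps_to_fls ?a"
    by (metis One_nat_def Suc_1 fps_to_fls_power)
  also have "\<dots> = (1 - fls_X\<^sup>2) * (1 - fls_const lam * fls_X\<^sup>2)"
    by (simp add: fls_times_fps_to_fls fps_to_fls_power)
  finally have sq: "fps_to_fls (fps_radical (\<lambda>_ _. 1) 2 ?a) ^ 2
      = (1 - fls_X\<^sup>2) * (1 - fls_const lam * fls_X\<^sup>2)" .
  have X: "fls_X_inv * fls_X = (1 :: complex fls)"
    by (simp add: fls_inverse_X[symmetric])
  have poly_id: "(v^3)\<^sup>2 * ((1 - u\<^sup>2) * (1 - c * u\<^sup>2)) = v^2 * (v^2 - 1) * (v^2 - c)"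
    if "v * u = 1" for u v c :: "complex fls"
    using that by algebra
  show ?thesis
    unfolding y_fun_def x_fun_def power_mult_distrib sq by (rule poly_id[OF X])
qed

text \<open>Value of a polynomial in $\mathbb{C}[X][Y]$ at $X = f$, $Y = g$.\<close>

definition eval2 :: "complex poly poly \<Rightarrow> complex fls \<Rightarrow> complex fls \<Rightarrow> complex fls" where
  "eval2 P f g = poly (map_poly (\<lambda>p. poly (map_poly fls_const p) f) P) g"

definition rat_funs :: "complex \<Rightarrow> complex fls set" where
  "rat_funs lam = {eval2 P x_fun (y_fun lam) / eval2 Q x_fun (y_fun lam) | P Q. True}"

text \<open>
  The local ring of the curve at a point, computed in the chart $z \ne 0$ with coordinates
  $(x, y)$, respectively in the chart $y \ne 0$ with coordinates $(x/y, 1/y)$.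
\<close>

fun loc_ring :: "complex \<Rightarrow> point \<Rightarrow> complex fls set" where
  "loc_ring lam (Aff a b) =
     {eval2 P x_fun (y_fun lam) / eval2 Q x_fun (y_fun lam) | P Q. poly (poly Q [:b:]) a \<noteq> 0}"
| "loc_ring lam Inf =
     {eval2 P (x_fun / y_fun lam) (1 / y_fun lam) / eval2 Q (x_fun / y_fun lam) (1 / y_fun lam)
       | P Q. poly (poly Q [:0:]) 0 \<noteq> 0}"

definition max_ideal :: "complex \<Rightarrow> point \<Rightarrow> complex fls set" where
  "max_ideal lam w = {f \<in> loc_ring lam w. \<not> (\<exists>g \<in> loc_ring lam w. f * g = 1)}"

definition uniformizer :: "complex \<Rightarrow> point \<Rightarrow> complex fls \<Rightarrow> bool" where
  "uniformizer lam w \<pi> \<longleftrightarrow> max_ideal lam w = {\<pi> * f | f. f \<in> loc_ring lam w}"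

text \<open>The stalk at \<open>w\<close> of $\mathcal{O}_C(D)$, as a set of rational functions.\<close>

definition div_stalk :: "complex \<Rightarrow> (point \<Rightarrow> int) \<Rightarrow> point \<Rightarrow> complex fls set" where
  "div_stalk lam D w =
     {f * \<pi> powi (- D w) | f \<pi>. f \<in> loc_ring lam w \<and> uniformizer lam w \<pi>}"

text \<open>
  A rational $1$-form $f\,dg$ is represented by the coefficient of $du$ in its expansion, that is,
  by \<open>f * fls_deriv g\<close>; the differential of \<open>f\<close> is \<open>fls_deriv f\<close>.
\<close>

definition rat_forms :: "complex \<Rightarrow> complex fls set" where
  "rat_forms lam = {f * fls_deriv x_fun | f. f \<in> rat_funs lam}"

text \<open>
  The stalk at \<open>w\<close> of $\Omega^1_C(S)$, for a reduced divisor given as a set \<open>S\<close> of points: it is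
  generated by $d\pi/\pi$ if $w \in S$ and by $d\pi$ otherwise.
\<close>

definition form_stalk :: "complex \<Rightarrow> point set \<Rightarrow> point \<Rightarrow> complex fls set" where
  "form_stalk lam S w =
     {f * (fls_deriv \<pi> / (if w \<in> S then \<pi> else 1)) | f \<pi>.
        f \<in> loc_ring lam w \<and> uniformizer lam w \<pi>}"


section \<open>Vector bundles and logarithmic connections\<close>

text \<open>
  A vector bundle is a locally free subsheaf of full rank of the constant sheaf $K^n$, where $K$
  is the function field, i.e. it comes with a frame of its generic fibre. It is given by its stalks
  \<open>E w \<subseteq> K^n\<close>. Maps of sheaves are then given by matrices over $K$ that are compatible with all
  stalks.
\<close>

type_synonym 'n vbundle = "point \<Rightarrow> (complex fls ^ 'n) set"

definition vector_bundle :: "complex \<Rightarrow> ('n::finite) vbundle \<Rightarrow> bool" where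
  "vector_bundle lam E \<longleftrightarrow>
     (\<forall>w \<in> curve lam. \<exists>M :: complex fls ^ 'n ^ 'n. (\<forall>i j. M $ i $ j \<in> rat_funs lam) \<and> det M \<noteq> 0 \<and>
        E w = {M *v v | v. \<forall>i. v $ i \<in> loc_ring lam w}) \<and>
     finite {w \<in> curve lam. E w \<noteq> {v. \<forall>i. v $ i \<in> loc_ring lam w}}"

definition line_bundle :: "complex \<Rightarrow> (point \<Rightarrow> int) \<Rightarrow> 1 vbundle" where
  "line_bundle lam D w = {v. v $ 1 \<in> div_stalk lam D w}"

text \<open>The fibre of \<open>E\<close> at \<open>w\<close> is the quotient of \<open>E w\<close> by the following subspace.\<close>

definition fibre_zero :: "complex \<Rightarrow> ('n::finite) vbundle \<Rightarrow> point \<Rightarrow> (complex fls ^ 'n) set" where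
  "fibre_zero lam E w = {f *s v | f v. f \<in> max_ideal lam w \<and> v \<in> E w}"

text \<open>
  The projectivised fibre $\mathbb{P}(E|_w)$: a line of the fibre is represented by its preimage in
  the stalk \<open>E w\<close>.
\<close>

definition fibre_lines ::
    "complex \<Rightarrow> ('n::finite) vbundle \<Rightarrow> point \<Rightarrow> (complex fls ^ 'n) set set" where
  "fibre_lines lam E w =
     {{fls_const c *s v + z | c z. z \<in> fibre_zero lam E w} | v. v \<in> E w - fibre_zero lam E w}"

text \<open>
  The connection $d + A$ on the generic fibre $K^n$, where \<open>A\<close> is a matrix of rational $1$-forms.
\<close>

definition conn :: "complex fls ^ 'n ^ 'n \<Rightarrow> complex fls ^ 'n \<Rightarrow> complex fls ^ ('n::finite)" where
  "conn A s = (\<chi> i. fls_deriv (s $ i)) + A *v s"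

definition log_connection ::
    "complex \<Rightarrow> point set \<Rightarrow> ('n::finite) vbundle \<Rightarrow> complex fls ^ 'n ^ 'n \<Rightarrow> bool" where
  "log_connection lam S E A \<longleftrightarrow>
     (\<forall>i j. A $ i $ j \<in> rat_forms lam) \<and>
     (\<forall>w \<in> curve lam. \<forall>s \<in> E w. \<exists>\<theta> \<in> form_stalk lam S w. \<exists>v \<in> E w. conn A s = \<theta> *s v)"

text \<open>
  For a logarithmic connection with a pole at \<open>w\<close> this is a representative in \<open>E w\<close> of the residue
  applied to the class of \<open>s\<close>; modulo \<open>fibre_zero\<close> the choice of the uniformizer does not matter.
\<close>

definition res_rep ::
    "complex \<Rightarrow> point \<Rightarrow> complex fls ^ 'n ^ 'n \<Rightarrow> complex fls ^ 'n \<Rightarrow> complex fls ^ ('n::finite)" where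
  "res_rep lam w A s = (let \<pi> = (SOME \<pi>. uniformizer lam w \<pi>) in (\<pi> / fls_deriv \<pi>) *s conn A s)"

definition res_eigenvalues ::
    "complex \<Rightarrow> ('n::finite) vbundle \<Rightarrow> point \<Rightarrow> complex fls ^ 'n ^ 'n \<Rightarrow> complex set" where
  "res_eigenvalues lam E w A =
     {c. \<exists>s \<in> E w - fibre_zero lam E w. res_rep lam w A s - fls_const c *s s \<in> fibre_zero lam E w}"

text \<open>
  Non-trivial extensions $0 \to \mathcal{O}_C \to E \to \mathcal{O}_C(w_\infty) \to 0$. The frame of
  the generic fibre is chosen such that the two maps are $f \mapsto (f, 0)$ and
  $(v_1, v_2) \mapsto v_2$. Then $e_1 \wedge v \mapsto v_2$ identifies $\det E$ with
  $\mathcal{O}_C(w_\infty)$, and the trace of the connection $d + A$ is the connection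
  $d + \mathrm{tr} A$ on $\mathcal{O}_C(w_\infty)$.
\<close>

definition div_inf :: "point \<Rightarrow> int" where
  "div_inf w = of_bool (w = Inf)"

definition nontrivial_extension :: "complex \<Rightarrow> 2 vbundle \<Rightarrow> bool" where
  "nontrivial_extension lam E \<longleftrightarrow>
     vector_bundle lam E \<and>
     (\<forall>w \<in> curve lam. {f. f *s axis 1 1 \<in> E w} = loc_ring lam w) \<and>
     (\<forall>w \<in> curve lam. {v $ 2 | v. v \<in> E w} = div_stalk lam div_inf w) \<and>
     \<not> (\<exists>s. s $ 2 = 1 \<and> (\<forall>w \<in> curve lam. \<forall>f \<in> div_stalk lam div_inf w. f *s s \<in> E w))"

text \<open>The rank one connections allowed as \<open>\<nabla>\<^sub>d\<^sub>e\<^sub>t\<close>.\<close>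

definition det_connection :: "complex \<Rightarrow> point \<Rightarrow> complex fls ^ 1 ^ 1 \<Rightarrow> bool" where
  "det_connection lam t1 a \<longleftrightarrow>
     log_connection lam {t1} (line_bundle lam div_inf) a \<and>
     res_eigenvalues lam (line_bundle lam div_inf) t1 a = {-1}"


section \<open>Spaces with regular functions\<close>

text \<open>
  A variety is described by its set \<open>X\<close> of points and a set \<open>G\<close> of partial functions generating
  its structure sheaf: the functions in \<open>G\<close> have open domains and are regular there, and every
  regular function is locally a rational expression in functions from \<open>G\<close>. Subvarieties carry the
  generators of the ambient variety, and products those of both factors.
\<close>

inductive_set regular_partial :: "('a \<Rightarrow> complex option) set \<Rightarrow> ('a \<Rightarrow> complex option) set"
  for G where
  gen: "g \<in> G \<Longrightarrow> g \<in> regular_partial G"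
| const: "(\<lambda>_. Some c) \<in> regular_partial G"
| add: "f \<in> regular_partial G \<Longrightarrow> g \<in> regular_partial G \<Longrightarrow>
    (\<lambda>p. case (f p, g p) of (Some a, Some b) \<Rightarrow> Some (a + b) | _ \<Rightarrow> None) \<in> regular_partial G"
| mult: "f \<in> regular_partial G \<Longrightarrow> g \<in> regular_partial G \<Longrightarrow>
    (\<lambda>p. case (f p, g p) of (Some a, Some b) \<Rightarrow> Some (a * b) | _ \<Rightarrow> None) \<in> regular_partial G"
| inv: "f \<in> regular_partial G \<Longrightarrow>
    (\<lambda>p. case f p of Some a \<Rightarrow> if a = 0 then None else Some (inverse a) | None \<Rightarrow> None)
      \<in> regular_partial G"

definition zariski :: "'a set \<Rightarrow> ('a \<Rightarrow> complex option) set \<Rightarrow> 'a topology" where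
  "zariski X G = topology_generated_by {X \<inter> dom f | f. f \<in> regular_partial G}"

definition regular_map ::
    "'a set \<Rightarrow> ('a \<Rightarrow> complex option) set \<Rightarrow> ('b \<Rightarrow> complex option) set \<Rightarrow> ('a \<Rightarrow> 'b) \<Rightarrow> bool" where
  "regular_map U G H F \<longleftrightarrow>
     (\<forall>p \<in> U. \<forall>h \<in> H. F p \<in> dom h \<longrightarrow>
        (\<exists>f \<in> regular_partial G. p \<in> dom f \<and> (\<forall>q \<in> U \<inter> dom f. h (F q) = f q)))"

definition birational_map ::
    "'a set \<Rightarrow> ('a \<Rightarrow> complex option) set \<Rightarrow> 'b set \<Rightarrow> ('b \<Rightarrow> complex option) set \<Rightarrow> ('a \<Rightarrow> 'b) \<Rightarrow> bool"
  where
  "birational_map X G Y H F \<longleftrightarrow>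
     (\<exists>U V. openin (zariski X G) U \<and> zariski X G closure_of U = X \<and>
            openin (zariski Y H) V \<and> zariski Y H closure_of V = Y \<and>
            bij_betw F U V \<and> regular_map U G H F \<and> regular_map V H G (inv_into U F))"

definition prod_gens ::
    "('a \<Rightarrow> complex option) set \<Rightarrow> ('b \<Rightarrow> complex option) set \<Rightarrow> ('a \<times> 'b \<Rightarrow> complex option) set" where
  "prod_gens G H = {g \<circ> fst | g. g \<in> G} \<union> {h \<circ> snd | h. h \<in> H}"

text \<open>$\mathbb{P}^1 = \mathbb{C} \cup \{\infty\}$ with \<open>None\<close> for $\infty$; its charts are $z$ and $1/z$.\<close>

definition P1_gens :: "(complex option \<Rightarrow> complex option) set" where
  "P1_gens = {\<lambda>z. z,
     \<lambda>z. case z of None \<Rightarrow> Some 0 | Some c \<Rightarrow> if c = 0 then None else Some (inverse c)}"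

text \<open>
  The quotient of two linear forms as a partial function on a projective space whose points
  \<open>l\<close> are sets of vectors. A point where \<open>\<beta>\<close> vanishes is mapped to \<open>None\<close>.
\<close>

definition ratio :: "('v \<Rightarrow> complex) \<Rightarrow> ('v \<Rightarrow> complex) \<Rightarrow> 'v set \<Rightarrow> complex option" where
  "ratio \<alpha> \<beta> l = (if \<exists>v \<in> l. \<beta> v \<noteq> 0 then Some (THE c. \<forall>v \<in> l. \<alpha> v = c * \<beta> v) else None)"

definition proj_gens :: "('v \<Rightarrow> complex) set \<Rightarrow> ('v set \<Rightarrow> complex option) set" where
  "proj_gens L = {ratio \<alpha> \<beta> | \<alpha> \<beta>. \<alpha> \<in> L \<and> \<beta> \<in> L}"

definition fls_functionals :: "(complex fls \<Rightarrow> complex) set" where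
  "fls_functionals = {l. Vector_Spaces.linear (\<lambda>c f. fls_const c * f) (*) l}"

definition fibre_functionals ::
    "complex \<Rightarrow> ('n::finite) vbundle \<Rightarrow> point \<Rightarrow> (complex fls ^ 'n \<Rightarrow> complex) set" where
  "fibre_functionals lam E w =
     {\<alpha>. (\<forall>u \<in> E w. \<forall>v \<in> E w. \<alpha> (u + v) = \<alpha> u + \<alpha> v) \<and>
         (\<forall>c. \<forall>v \<in> E w. \<alpha> (fls_const c *s v) = c * \<alpha> v) \<and>
         (\<forall>v \<in> fibre_zero lam E w. \<alpha> v = 0)}"

definition proj_coordinate ::
    "complex \<Rightarrow> 2 vbundle \<Rightarrow> point \<Rightarrow> ((complex fls ^ 2) set \<Rightarrow> complex option) \<Rightarrow> bool" where
  "proj_coordinate lam E w z \<longleftrightarrow>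
     (\<exists>\<alpha> \<in> fibre_functionals lam E w. \<exists>\<beta> \<in> fibre_functionals lam E w.
        (\<forall>v \<in> E w - fibre_zero lam E w. \<alpha> v \<noteq> 0 \<or> \<beta> v \<noteq> 0) \<and>
        (\<forall>l \<in> fibre_lines lam E w. z l = ratio \<alpha> \<beta> l))"


section \<open>Moduli of connections and of parabolic bundles, and the apparent map\<close>

text \<open>
  The bundle \<open>E\<close> is fixed and has only scalar automorphisms, which act trivially on connections and
  on lines in fibres. Hence isomorphism classes of triples $(E, \nabla, \mathbf{p})$ are the same as
  pairs $(\nabla, \mathbf{p})$.
\<close>

type_synonym connection = "complex fls ^ 2 ^ 2"
type_synonym parabolic = "(complex fls ^ 2) set \<times> (complex fls ^ 2) set"

definition parabolic_space :: "complex \<Rightarrow> point \<Rightarrow> point \<Rightarrow> 2 vbundle \<Rightarrow> parabolic set" where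
  "parabolic_space lam t1 t2 E = fibre_lines lam E t1 \<times> fibre_lines lam E t2"

definition Con ::
    "complex \<Rightarrow> point \<Rightarrow> point \<Rightarrow> complex \<Rightarrow> complex \<Rightarrow> complex fls ^ 1 ^ 1 \<Rightarrow> 2 vbundle \<Rightarrow>
     (connection \<times> parabolic) set" where
  "Con lam t1 t2 nu1 nu2 a E =
     {(A, p1, p2).
        log_connection lam {t1, t2} E A \<and> trace A = a $ 1 $ 1 \<and>
        res_eigenvalues lam E t1 A = {nu1 / 2 - 1 / 2, - nu1 / 2 - 1 / 2} \<and>
        res_eigenvalues lam E t2 A = {nu2 / 2, - nu2 / 2} \<and>
        (p1, p2) \<in> parabolic_space lam t1 t2 E \<and>
        (\<forall>s \<in> p1. res_rep lam t1 A s - fls_const (nu1 / 2 - 1 / 2) *s s \<in> fibre_zero lam E t1) \<and>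
        (\<forall>s \<in> p2. res_rep lam t2 A s - fls_const (nu2 / 2) *s s \<in> fibre_zero lam E t2)}"

text \<open>
  Connections with fixed poles and trace on \<open>E\<close> form a finite-dimensional affine space of matrices,
  whose regular functions are generated by the linear forms in the matrix entries.
\<close>

definition conn_gens :: "(complex fls ^ 2 ^ 2 \<Rightarrow> complex option) set" where
  "conn_gens = {\<lambda>A. Some (l (A $ i $ j)) | l i j. l \<in> fls_functionals}"

definition Con_gens ::
    "complex \<Rightarrow> point \<Rightarrow> point \<Rightarrow> 2 vbundle \<Rightarrow>
     (connection \<times> parabolic \<Rightarrow> complex option) set" where
  "Con_gens lam t1 t2 E =
     prod_gens conn_gens
       (prod_gens (proj_gens (fibre_functionals lam E t1)) (proj_gens (fibre_functionals lam E t2)))"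

definition Bun :: "connection \<times> parabolic \<Rightarrow> parabolic" where
  "Bun = snd"

definition Bun_fibre ::
    "complex \<Rightarrow> point \<Rightarrow> point \<Rightarrow> complex \<Rightarrow> complex \<Rightarrow> complex fls ^ 1 ^ 1 \<Rightarrow> 2 vbundle \<Rightarrow> parabolic \<Rightarrow>
     (connection \<times> parabolic) set" where
  "Bun_fibre lam t1 t2 nu1 nu2 a E p = {m \<in> Con lam t1 t2 nu1 nu2 a E. Bun m = p}"

text \<open>
  \<open>s\<close> is the image of the rational section $1$ under a non-zero map
  $\mathcal{O}_C(w_i - w_\infty) \to E$, where $w_i = (i, 0)$.
\<close>

definition L_section :: "complex \<Rightarrow> 2 vbundle \<Rightarrow> complex \<Rightarrow> complex fls ^ 2 \<Rightarrow> bool" where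
  "L_section lam E i s \<longleftrightarrow> s \<noteq> 0 \<and>
     (\<forall>w \<in> curve lam. \<forall>f \<in> div_stalk lam (\<lambda>w. of_bool (w = Aff i 0) - of_bool (w = Inf)) w.
        f *s s \<in> E w)"

text \<open>The preimage in \<open>E w\<close> of the line $L_i|_w$ of the fibre.\<close>

definition L_line ::
    "complex \<Rightarrow> 2 vbundle \<Rightarrow> complex \<Rightarrow> complex fls ^ 2 \<Rightarrow> point \<Rightarrow> (complex fls ^ 2) set" where
  "L_line lam E i s w =
     {f *s s + z | f z. f \<in> div_stalk lam (\<lambda>w. of_bool (w = Aff i 0) - of_bool (w = Inf)) w \<and>
                        z \<in> fibre_zero lam E w}"

definition normalized_coordinate ::
    "complex \<Rightarrow> 2 vbundle \<Rightarrow> point \<Rightarrow> ((complex fls ^ 2) set \<Rightarrow> complex option) \<Rightarrow> bool" where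
  "normalized_coordinate lam E w z \<longleftrightarrow> proj_coordinate lam E w z \<and>
     (\<forall>i \<in> {0, 1, lam}. \<forall>s. L_section lam E i s \<longrightarrow> z (L_line lam E i s w) = Some i)"

text \<open>
  The map $\mathcal{O}_C \to (E/\mathcal{O}_C) \otimes \Omega^1_C(D)$ induced by a connection is given
  by the image of $1$, a section of $\mathcal{O}_C(w_\infty) \otimes \Omega^1_C(D)$. The apparent map
  takes its class in the projective space of lines in the space of sections; by passing to
  zero divisors, this is the linear system $|\mathcal{O}_C(w_\infty + t_1 + t_2)|$.
\<close>

definition app_sections :: "complex \<Rightarrow> point \<Rightarrow> point \<Rightarrow> complex fls set" where
  "app_sections lam t1 t2 =
     {\<omega>. \<forall>w \<in> curve lam. \<exists>f \<in> div_stalk lam div_inf w. \<exists>\<theta> \<in> form_stalk lam {t1, t2} w. \<omega> = f * \<theta>}"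

definition app_space :: "complex \<Rightarrow> point \<Rightarrow> point \<Rightarrow> complex fls set set" where
  "app_space lam t1 t2 = {{fls_const c * \<omega> | c. True} | \<omega>. \<omega> \<in> app_sections lam t1 t2 - {0}}"

definition App :: "connection \<times> parabolic \<Rightarrow> complex fls set" where
  "App m = {fls_const c * (conn (fst m) (axis 1 1)) $ 2 | c. True}"

end

theory Submission
  imports Defs "HOL-Computational_Algebra.Fundamental_Theorem_Algebra"
begin

unbundle no Formal_Power_Series.fps_syntax

text \<open>
  The bundle is explicit: \<open>E\<close> is obtained from two generators, glued at infinity by a transition
  matrix whose off-diagonal entry is a non-zero multiple \<open>\<kappa>\<close> of a function with a double pole.
  In these coordinates regularity is linear algebra in the space spanned by \<open>1\<close>, \<open>x\<close>, \<open>y\<close>,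
  \<open>x\<^sup>2\<close>, \<open>x y\<close>, and a connection with the prescribed trace is the same as an arbitrary pair of residues
  \<open>(\<alpha>\<^sub>k, \<beta>\<^sub>k; \<gamma>\<^sub>k, *)\<close> at \<open>t\<^sub>k\<close> with the prescribed traces. The apparent map is
  \<open>(\<gamma>\<^sub>1 : \<gamma>\<^sub>2 : \<alpha>\<^sub>1 + \<alpha>\<^sub>2)\<close> in suitable coordinates.

  If the parabolic lines are spanned by \<open>(q\<^sub>k, 1)\<close>, that is, if both differ from the line of the
  subbundle, the residues are determined by \<open>q\<^sub>k\<close> and \<open>\<gamma>\<^sub>k\<close>, which are arbitrary, and
  \<open>\<alpha>\<^sub>1 + \<alpha>\<^sub>2 = \<gamma>\<^sub>1 q\<^sub>1 + \<gamma>\<^sub>2 q\<^sub>2 - (\<nu>\<^sub>1 + \<nu>\<^sub>2 + 1) / 2\<close>. As the constant term is non-zero, the \<open>\<gamma>\<^sub>k\<close> are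
  recovered from their ratio with \<open>\<alpha>\<^sub>1 + \<alpha>\<^sub>2\<close>, so that the apparent map is an affine chart of the
  projective plane. If one of the lines is the line of the subbundle, then \<open>\<gamma>\<^sub>k = 0\<close> and \<open>\<beta>\<^sub>k\<close> is
  free, but invisible to the apparent map.
\<close>

section \<open>The function field\<close>

text \<open>Pole orders 0, 2, 3, 4, ... at infinity are realised by polynomials in \<open>x\<close>
  and \<open>y\<close>, and only order 1 is missing. This gap makes the extensions of O(w_inf) by O
  a one-dimensional family with coordinate \<kappa>; the same gap, together with \<kappa> being
  nonzero, makes the bundle simple. Two logarithmic connections with equal traces and equal residues
  therefore coincide. Two residue matrices with fixed traces have six free entries, and solving the
  regularity conditions at infinity explicitly shows that all six can be prescribed. The diagonal
  sum enters the apparent map because regularity at infinity ties the principal part of the upper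
  left entry to the lower left entry through \<kappa>, while the residue theorem ties that principal
  part to the sum of the upper left residues. Birationality asks for dense open subsets, and
  irreducibility of the moduli space is not assumed; so the connections with both lines off the
  subbundle are shown to be dense by deforming the residues at the two points independently.\<close>

lemma poly_map_poly_add:
  fixes \<phi> :: "'a::comm_ring_1 \<Rightarrow> 'b::comm_ring_1"
  assumes "\<phi> 0 = 0" and "\<And>a b. \<phi> (a + b) = \<phi> a + \<phi> b"
  shows "poly (map_poly \<phi> (P + Q)) g = poly (map_poly \<phi> P) g + poly (map_poly \<phi> Q) g"
  by (induction P Q rule: poly_induct2) (simp_all add: map_poly_pCons assms algebra_simps)

lemma poly_map_poly_mult:
  fixes \<phi> :: "'a::comm_ring_1 \<Rightarrow> 'b::comm_ring_1"
  assumes "\<phi> 0 = 0" and "\<And>a b. \<phi> (a + b) = \<phi> a + \<phi> b" and "\<And>a b. \<phi> (a * b) = \<phi> a * \<phi> b"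
  shows "poly (map_poly \<phi> (P * Q)) g = poly (map_poly \<phi> P) g * poly (map_poly \<phi> Q) g"
proof (induction P)
  case (pCons a P)
  have "map_poly \<phi> (smult a Q) = smult (\<phi> a) (map_poly \<phi> Q)"
    by (rule map_poly_smult) (use assms in auto)
  then show ?case
    by (simp add: poly_map_poly_add[OF assms(1,2)] map_poly_pCons assms pCons.IH algebra_simps)
qed simp

text \<open>The inner of the two nested evaluations in \<open>eval2\<close>; naming it gives both
  evaluations recursion equations along \<open>pCons\<close>.\<close>

definition evalx :: "complex fls \<Rightarrow> complex poly \<Rightarrow> complex fls" where
  "evalx f p = poly (map_poly fls_const p) f"

lemma fls_const_add: "fls_const (a + b) = fls_const a + fls_const b"
  by (simp add: fls_plus_const)
lemma fls_const_mult: "fls_const (a * b) = fls_const a * fls_const (b::complex)"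
  by (rule fls_const_mult_const[symmetric])
lemma fls_const_diff: "fls_const (a - b) = fls_const a - fls_const b"
  by (simp add: fls_minus_const)
lemma fls_const_divide: "fls_const (a / b) = fls_const a / fls_const (b::complex)"
  by (simp add: fls_const_divide_const)

lemma evalx_0 [simp]: "evalx f 0 = 0"
  and evalx_pCons [simp]: "evalx f (pCons a p) = fls_const a + f * evalx f p"
  by (simp_all add: evalx_def map_poly_pCons)

lemma evalx_1 [simp]: "evalx f 1 = 1"
  by (simp add: one_pCons)

lemma evalx_add: "evalx f (p + q) = evalx f p + evalx f q"
  unfolding evalx_def by (rule poly_map_poly_add) (simp_all add: fls_const_add)

lemma evalx_mult: "evalx f (p * q) = evalx f p * evalx f q"
  unfolding evalx_def by (rule poly_map_poly_mult) (simp_all add: fls_const_add)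

lemma evalx_uminus: "evalx f (- p) = - evalx f p"
  by (metis add.right_inverse add_eq_0_iff evalx_0 evalx_add)

lemma evalx_diff: "evalx f (p - q) = evalx f p - evalx f q"
  by (simp only: diff_conv_add_uminus evalx_add evalx_uminus)

lemma evalx_power: "evalx f (p ^ n) = evalx f p ^ n"
  by (induction n) (simp_all add: evalx_mult)

lemma eval2_0 [simp]: "eval2 0 f g = 0"
  and eval2_pCons [simp]: "eval2 (pCons p P) f g = evalx f p + g * eval2 P f g"
  by (simp_all add: eval2_def evalx_def map_poly_pCons)

lemma eval2_1 [simp]: "eval2 1 f g = 1"
  by (simp add: one_pCons)

lemma eval2_add: "eval2 (P + Q) f g = eval2 P f g + eval2 Q f g"
proof -
  have "eval2 P f g = poly (map_poly (evalx f) P) g" for P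
    by (simp add: eval2_def evalx_def[abs_def])
  then show ?thesis
    by (simp add: poly_map_poly_add evalx_add)
qed

lemma eval2_mult: "eval2 (P * Q) f g = eval2 P f g * eval2 Q f g"
proof -
  have "eval2 P f g = poly (map_poly (evalx f) P) g" for P
    by (simp add: eval2_def evalx_def[abs_def])
  then show ?thesis
    by (simp add: poly_map_poly_mult evalx_add evalx_mult)
qed

lemma eval2_uminus: "eval2 (- P) f g = - eval2 P f g"
  by (metis add.right_inverse add_eq_0_iff eval2_0 eval2_add)

lemma eval2_diff: "eval2 (P - Q) f g = eval2 P f g - eval2 Q f g"
  by (simp only: diff_conv_add_uminus eval2_add eval2_uminus)

abbreviation val2 :: "complex \<Rightarrow> complex \<Rightarrow> complex poly poly \<Rightarrow> complex" where
  "val2 a b P \<equiv> poly (poly P [:b:]) a"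

text \<open>Common shape of both cases of \<open>loc_ring\<close>: \<open>(x, y)\<close> at
  \<open>(a, b)\<close> in the affine chart, and \<open>(x / y, 1 / y)\<close> at the origin near
  infinity. One locale can then treat all points.\<close>

definition chart_ring :: "complex fls \<Rightarrow> complex fls \<Rightarrow> complex \<Rightarrow> complex \<Rightarrow> complex fls set" where
  "chart_ring f g a b = {eval2 P f g / eval2 Q f g | P Q. val2 a b Q \<noteq> 0}"

section \<open>The affine coordinate ring, its fraction field and pole orders at infinity\<close>

locale elliptic =
  fixes lam :: complex
  assumes lam: "lam \<notin> {0, 1}"
begin

abbreviation X :: "complex fls" where "X \<equiv> x_fun"
abbreviation Y :: "complex fls" where "Y \<equiv> y_fun lam"
abbreviation L :: "complex fls" where "L \<equiv> fls_const lam"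
abbreviation K :: "complex fls set" where "K \<equiv> rat_funs lam"

definition cubic :: "complex poly" where
  "cubic = [:0, lam, - (1 + lam), 1:]"

definition cub :: "complex \<Rightarrow> complex" where
  "cub a = a * (a - 1) * (a - lam)"

lemma poly_cubic: "poly cubic a = cub a"
  by (simp add: cubic_def cub_def algebra_simps)

lemma lam_nz: "lam \<noteq> 0" "lam \<noteq> 1"
  using lam by auto

lemma curve_iff: "Aff a b \<in> curve lam \<longleftrightarrow> b\<^sup>2 = cub a"
  and Inf_curve: "Inf \<in> curve lam"
  by (auto simp: curve_def cub_def)

lemma Y2: "Y\<^sup>2 = X ^ 3 - (1 + L) * X\<^sup>2 + L * X"
  unfolding curve_equation by (simp add: algebra_simps power2_eq_square power3_eq_cube)

lemma Y2': "Y * Y = X ^ 3 - (1 + L) * X\<^sup>2 + L * X"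
  using Y2 by (simp add: power2_eq_square)

lemma evalx_cubic: "evalx X cubic = Y\<^sup>2"
proof -
  have "evalx X cubic = X * (L + X * (fls_const (- 1 - lam) + X))"
    by (simp add: cubic_def)
  also have "fls_const (- 1 - lam) = - 1 - L"
    by (simp only: fls_const_diff fls_const_uminus fls_const_1)
  finally show ?thesis
    unfolding Y2 by (simp add: algebra_simps power2_eq_square power3_eq_cube)
qed

lemma subdegree_X [simp]: "fls_subdegree X = -2"
  by (simp add: x_fun_def)

lemma X_nz [simp]: "X \<noteq> 0"
  by (simp add: x_fun_def)

lemma subdegree_Y [simp]: "fls_subdegree Y = -3" and Y_nz [simp]: "Y \<noteq> 0"
proof -
  define s where "s = fps_radical (\<lambda>_ _. 1) 2 ((1 - fps_X\<^sup>2) * (1 - fps_const lam * fps_X\<^sup>2))"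
  have s0: "fps_nth s 0 = 1"
    unfolding s_def by (simp add: numeral_2_eq_2)
  then have "s \<noteq> 0" "subdegree s = 0"
    by (auto simp: subdegree_eq_0_iff)
  moreover have "Y = fls_X_inv ^ 3 * fps_to_fls s"
    by (simp add: y_fun_def s_def)
  ultimately show "fls_subdegree Y = -3" "Y \<noteq> 0"
    by (auto simp: fls_subdegree_fls_to_fps)
qed

text \<open>Every polynomial in \<open>x\<close>, \<open>y\<close> reduces modulo the equation of the curve to this form.\<close>

definition fe :: "complex poly \<Rightarrow> complex poly \<Rightarrow> complex fls" where
  "fe p q = evalx X p + evalx X q * Y"

text \<open>Multiplication by \<open>Y\<close> turns \<open>fe p q\<close> into
  \<open>fe (cubic * q) p\<close>, which drives the induction. Recording the values at the points of
  the curve along the way is what later shows that a polynomial vanishing in the field vanishes at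
  every affine point.\<close>

lemma eval2_fe:
  "\<exists>p q. eval2 P X Y = fe p q \<and> (\<forall>a b. b\<^sup>2 = cub a \<longrightarrow> val2 a b P = poly p a + poly q a * b)"
proof (induction P)
  case 0
  show ?case
    by (rule exI[of _ 0], rule exI[of _ 0]) (simp add: fe_def)
next
  case (pCons c P)
  then obtain p q where *: "eval2 P X Y = fe p q"
      "\<And>a b. b\<^sup>2 = cub a \<Longrightarrow> val2 a b P = poly p a + poly q a * b"
    by blast
  have "eval2 (pCons c P) X Y = fe (c + cubic * q) p"
    by (simp add: * fe_def evalx_add evalx_mult evalx_cubic algebra_simps power2_eq_square)
  moreover have "val2 a b (pCons c P) = poly (c + cubic * q) a + poly p a * b" if "b\<^sup>2 = cub a" for a b
    using *(2)[OF that] that by (simp add: poly_cubic algebra_simps flip: that) (simp add: power2_eq_square)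
  ultimately show ?case by blast
qed

lemma fe_eval2: "fe p q = eval2 [:p, q:] X Y"
  by (simp add: fe_def)

lemma subdegree_evalx: "p \<noteq> 0 \<Longrightarrow> evalx X p \<noteq> 0 \<and> fls_subdegree (evalx X p) = - 2 * int (degree p)"
proof (induction p)
  case (pCons a p)
  show ?case
  proof (cases "p = 0")
    case True
    then show ?thesis using pCons by auto
  next
    case False
    with pCons have IH: "evalx X p \<noteq> 0" "fls_subdegree (evalx X p) = - 2 * int (degree p)"
      by auto
    then have 1: "X * evalx X p \<noteq> 0" "fls_subdegree (X * evalx X p) = - 2 - 2 * int (degree p)"
      by auto
    then have 2: "fls_subdegree (X * evalx X p + fls_const a) = - 2 - 2 * int (degree p)"
      by (subst fls_subdegree_add_eq1) auto
    then show ?thesis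
      using False by (auto simp: add.commute)
  qed
qed auto

text \<open>The two summands have orders of different parity, so their leading terms never cancel.
  In particular 1 and \<open>Y\<close> are independent over the rational functions of
  \<open>X\<close>, and order -1 does not occur.\<close>

lemma subdegree_fe:
  assumes "p \<noteq> 0 \<or> q \<noteq> 0"
  shows "fe p q \<noteq> 0"
    "p \<noteq> 0 \<Longrightarrow> fls_subdegree (fe p q) \<le> - 2 * int (degree p)"
    "q \<noteq> 0 \<Longrightarrow> fls_subdegree (fe p q) \<le> - 2 * int (degree q) - 3"
    "fls_subdegree (fe p q) = - 2 * int (degree p) \<or> fls_subdegree (fe p q) = - 2 * int (degree q) - 3"
proof -
  have *: "q \<noteq> 0 \<Longrightarrow> evalx X q * Y \<noteq> 0 \<and> fls_subdegree (evalx X q * Y) = - 2 * int (degree q) - 3"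
    using subdegree_evalx[of q] by auto
  have **: "p \<noteq> 0 \<Longrightarrow> evalx X p \<noteq> 0 \<and> fls_subdegree (evalx X p) = - 2 * int (degree p)"
    using subdegree_evalx[of p] by auto
  have "fe p q \<noteq> 0 \<and> (p \<noteq> 0 \<longrightarrow> fls_subdegree (fe p q) \<le> - 2 * int (degree p)) \<and>
    (q \<noteq> 0 \<longrightarrow> fls_subdegree (fe p q) \<le> - 2 * int (degree q) - 3) \<and>
    (fls_subdegree (fe p q) = - 2 * int (degree p) \<or> fls_subdegree (fe p q) = - 2 * int (degree q) - 3)"
  proof (cases "p = 0 \<or> q = 0")
    case True
    then show ?thesis
      using * ** assms by (auto simp: fe_def)
  next
    case False
    then have p: "evalx X p \<noteq> 0" "fls_subdegree (evalx X p) = - 2 * int (degree p)"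
      and q: "evalx X q * Y \<noteq> 0" "fls_subdegree (evalx X q * Y) = - 2 * int (degree q) - 3"
      using * ** by auto
    have "- 2 * int (degree p) \<noteq> - 2 * int (degree q) - 3"
      by presburger
    then consider "- 2 * int (degree p) < - 2 * int (degree q) - 3" |
      "- 2 * int (degree q) - 3 < - 2 * int (degree p)"
      by linarith
    then show ?thesis
    proof cases
      case 1
      then have "fls_subdegree (evalx X p + evalx X q * Y) = - 2 * int (degree p)"
        using p q by (subst fls_subdegree_add_eq1) auto
      moreover from this have "fe p q \<noteq> 0"
        using 1 by (auto simp: fe_def)
      ultimately show ?thesis
        using 1 by (auto simp: fe_def)
    next
      case 2
      then have *: "fls_subdegree (evalx X p + evalx X q * Y) = - 2 * int (degree q) - 3"
        using p q by (subst fls_subdegree_add_eq2) auto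
      moreover from this have "fe p q \<noteq> 0"
        by (auto simp: fe_def)
      ultimately show ?thesis
        using 2 by (auto simp: fe_def)
    qed
  qed
  then show "fe p q \<noteq> 0"
    "p \<noteq> 0 \<Longrightarrow> fls_subdegree (fe p q) \<le> - 2 * int (degree p)"
    "q \<noteq> 0 \<Longrightarrow> fls_subdegree (fe p q) \<le> - 2 * int (degree q) - 3"
    "fls_subdegree (fe p q) = - 2 * int (degree p) \<or> fls_subdegree (fe p q) = - 2 * int (degree q) - 3"
    by auto
qed

lemma fe_eq_0_iff [simp]: "fe p q = 0 \<longleftrightarrow> p = 0 \<and> q = 0"
  using subdegree_fe(1)[of p q] by (auto simp: fe_def)

text \<open>The coordinate ring of the affine curve. With the normal form as definition, ring
  closure comes from \<open>eval2_fe\<close> and pole orders at infinity from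
  \<open>subdegree_fe\<close>.\<close>

definition R :: "complex fls set" where
  "R = {fe p q | p q. True}"

lemma R_eval2: "eval2 P X Y \<in> R"
  using eval2_fe[of P] by (auto simp: R_def)

lemma R_iff: "f \<in> R \<longleftrightarrow> (\<exists>P. f = eval2 P X Y)"
proof
  assume "f \<in> R"
  then obtain p q where "f = fe p q" by (auto simp: R_def)
  then show "\<exists>P. f = eval2 P X Y" unfolding fe_eval2 by blast
qed (auto simp: R_eval2)

lemma R_add: "f \<in> R \<Longrightarrow> g \<in> R \<Longrightarrow> f + g \<in> R"
  unfolding R_iff by (metis eval2_add)
lemma R_mult: "f \<in> R \<Longrightarrow> g \<in> R \<Longrightarrow> f * g \<in> R"
  unfolding R_iff by (metis eval2_mult)
lemma R_uminus: "f \<in> R \<Longrightarrow> - f \<in> R"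
  unfolding R_iff by (metis eval2_uminus)
lemma R_diff: "f \<in> R \<Longrightarrow> g \<in> R \<Longrightarrow> f - g \<in> R"
  unfolding R_iff by (metis eval2_diff)
lemma R_const [simp]: "fls_const c \<in> R"
  unfolding R_iff by (rule exI[of _ "[:[:c:]:]"]) simp
lemma R_X [simp]: "X \<in> R"
  unfolding R_iff by (rule exI[of _ "[:[:0,1:]:]"]) simp
lemma R_Y [simp]: "Y \<in> R"
  unfolding R_iff by (rule exI[of _ "[:0,1:]"]) simp
lemma R_power: "f \<in> R \<Longrightarrow> f ^ n \<in> R"
  by (induction n) (use R_const[of 1] in \<open>auto intro: R_mult\<close>)
lemma R_evalx [simp]: "evalx X p \<in> R"
  unfolding R_iff by (rule exI[of _ "[:p:]"]) simp
lemma R_01 [simp]: "0 \<in> R" "1 \<in> R"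
  using R_const[of 0] R_const[of 1] by auto

lemma K_iff: "f \<in> K \<longleftrightarrow> (\<exists>g\<in>R. \<exists>h\<in>R. f = g / h)"
  unfolding rat_funs_def Bex_def R_iff by blast

text \<open>Division by 0 yields 0, so a fraction with denominator 0 can be rewritten as
  \<open>0 / 1\<close>.\<close>

lemma K_iff': "f \<in> K \<longleftrightarrow> (\<exists>g\<in>R. \<exists>h\<in>R. h \<noteq> 0 \<and> f = g / h)"
  unfolding K_iff by (metis R_01 div_by_0 div_by_1 zero_neq_one)

lemma K_R: "f \<in> R \<Longrightarrow> f \<in> K"
  unfolding K_iff by (metis R_01(2) div_by_1)

lemma K_add: "f \<in> K \<Longrightarrow> g \<in> K \<Longrightarrow> f + g \<in> K"
  unfolding K_iff'
  apply (elim bexE conjE)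
  subgoal for a b c d
    by (rule bexI[of _ "a * d + b * c"], rule bexI[of _ "c * d"])
      (auto simp: add_frac_eq intro: R_add R_mult)
  done

lemma K_mult: "f \<in> K \<Longrightarrow> g \<in> K \<Longrightarrow> f * g \<in> K"
  unfolding K_iff by (metis R_mult times_divide_times_eq)

lemma K_const [simp]: "fls_const c \<in> K"
  by (simp add: K_R)

lemma K_01 [simp]: "0 \<in> K" "1 \<in> K"
  using K_const[of 0] K_const[of 1] by auto

lemma K_uminus: "f \<in> K \<Longrightarrow> - f \<in> K"
  using K_mult[OF K_const[of "- 1"], of f] by (simp add: fls_const_uminus)

lemma K_diff: "f \<in> K \<Longrightarrow> g \<in> K \<Longrightarrow> f - g \<in> K"
  using K_add[of f "- g"] K_uminus by simp

lemma K_divide: "f \<in> K \<Longrightarrow> g \<in> K \<Longrightarrow> f / g \<in> K"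
  unfolding K_iff by (metis R_mult divide_divide_times_eq)

lemma K_XY [simp]: "X \<in> K" "Y \<in> K"
  by (simp_all add: K_R)

lemma K_power: "f \<in> K \<Longrightarrow> f ^ n \<in> K"
  by (induction n) (auto intro: K_mult)

lemmas R_intros = R_add R_mult R_uminus R_diff R_power
lemmas K_intros = K_add K_mult K_uminus K_diff K_divide K_power

lemma K_numeral [simp]: "numeral n \<in> K" "numeral n \<in> R"
  using K_const[of "numeral n"] R_const[of "numeral n"] by auto

text \<open>The generator \<open>dx / y\<close> of the canonical bundle, and the derivation \<open>df / (dx / y)\<close>.\<close>

definition eta :: "complex fls" where
  "eta = fls_deriv X / Y"

definition del :: "complex fls \<Rightarrow> complex fls" where
  "del f = fls_deriv f / eta"

lemma dX: "fls_deriv X = - 2 * fls_X_inv ^ 3"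
  by (simp add: x_fun_def fls_deriv_power power2_eq_square power3_eq_cube)

lemma eta_nz [simp]: "eta \<noteq> 0"
  by (simp add: eta_def dX)

lemma deriv_eq_del: "fls_deriv f = del f * eta"
  by (simp add: del_def)

lemma del_add: "del (f + g) = del f + del g"
  and del_mult: "del (f * g) = del f * g + f * del g"
  and del_const [simp]: "del (fls_const c) = 0"
  and del_diff: "del (f - g) = del f - del g"
  by (simp_all add: del_def field_simps)

lemma del_01 [simp]: "del 0 = 0" "del 1 = 0" "del (numeral n) = 0"
  by (simp_all add: del_def)

lemma del_X [simp]: "del X = Y"
  by (simp add: del_def eta_def dX)

text \<open>Differentiating the equation of the curve gives twice \<open>Y * del Y\<close>, and a
  factor \<open>Y\<close> cancels. The result is a polynomial in \<open>X\<close>, so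
  \<open>del\<close> creates no poles on the affine curve.\<close>

lemma del_Y: "del Y = (3 * X\<^sup>2 - 2 * (1 + L) * X + L) / 2"
proof -
  have "del (Y * Y) = del (X ^ 3 - (1 + L) * X\<^sup>2 + L * X)"
    by (simp only: Y2')
  then have "Y * (2 * del Y) = Y * (3 * X\<^sup>2 - 2 * (1 + L) * X + L)"
    by (simp add: del_mult del_add del_diff power2_eq_square power3_eq_cube algebra_simps)
  then have "2 * del Y = 3 * X\<^sup>2 - 2 * (1 + L) * X + L"
    by (simp only: mult_cancel_left Y_nz simp_thms)
  then show ?thesis
    by (metis nonzero_mult_div_cancel_left zero_neq_numeral)
qed

lemma del_divide: "g \<noteq> 0 \<Longrightarrow> del (f / g) = (del f * g - f * del g) / g\<^sup>2"
  using del_mult[of "f / g" g] by (simp add: field_simps power2_eq_square)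

lemma del_evalx: "del (evalx f p) \<in> {del f * evalx f q | q. True}"
proof (induction p)
  case 0
  then show ?case by (auto intro: exI[of _ 0])
next
  case (pCons a p)
  then obtain q where "del (evalx f p) = del f * evalx f q" by auto
  then have "del (evalx f (pCons a p)) = del f * evalx f (p + pCons 0 q)"
    by (simp add: del_add del_mult evalx_add algebra_simps)
  then show ?case by blast
qed

text \<open>A chain rule whose partial derivatives stay anonymous: its applications only ask that
  \<open>del\<close> preserves rational and regular functions.\<close>

lemma del_eval2: "del (eval2 P f g) \<in> {del f * eval2 Q f g + del g * eval2 S f g | Q S. True}"
proof (induction P)
  case 0
  then show ?case by (auto intro!: exI[of _ 0])
next
  case (pCons p P)
  then obtain Q S where 1: "del (eval2 P f g) = del f * eval2 Q f g + del g * eval2 S f g" by auto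
  obtain q where 2: "del (evalx f p) = del f * evalx f q" using del_evalx by blast
  have "del (eval2 (pCons p P) f g) = del f * eval2 (pCons q Q) f g + del g * eval2 (P + pCons 0 S) f g"
    by (simp add: 1 2 del_add del_mult eval2_add algebra_simps)
  then show ?case by blast
qed

lemma del_R: "f \<in> R \<Longrightarrow> del f \<in> K"
proof -
  assume "f \<in> R"
  then obtain P where P: "f = eval2 P X Y" by (auto simp: R_iff)
  obtain Q S where "del (eval2 P X Y) = del X * eval2 Q X Y + del Y * eval2 S X Y"
    using del_eval2[of P X Y] by blast
  then show "del f \<in> K"
    unfolding P del_Y del_X by (auto intro!: K_intros K_R[OF R_eval2])
qed

lemma del_K: "f \<in> K \<Longrightarrow> del f \<in> K"
proof -
  assume "f \<in> K"
  then obtain g h where gh: "g \<in> R" "h \<in> R" "h \<noteq> 0" "f = g / h" by (auto simp: K_iff')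
  then show "del f \<in> K"
    unfolding gh(4) del_divide[OF gh(3)] by (intro K_intros del_R K_R)
qed

lemma rat_forms_iff: "\<omega> \<in> rat_forms lam \<longleftrightarrow> \<omega> / eta \<in> K"
proof
  assume "\<omega> \<in> rat_forms lam"
  then obtain f where "f \<in> K" "\<omega> = f * fls_deriv X" by (auto simp: rat_forms_def)
  then have "\<omega> / eta = f * Y" by (simp add: deriv_eq_del)
  then show "\<omega> / eta \<in> K" using \<open>f \<in> K\<close> by (auto intro: K_intros)
next
  assume "\<omega> / eta \<in> K"
  then have "\<omega> / eta / Y \<in> K" by (intro K_divide[of "\<omega> / eta"]) auto
  moreover have "\<omega> = \<omega> / eta / Y * fls_deriv X" by (simp add: deriv_eq_del)
  ultimately show "\<omega> \<in> rat_forms lam" unfolding rat_forms_def by blast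
qed

end

section \<open>Local rings\<close>

text \<open>What makes a chart ring a local ring with parameter \<open>\<pi>\<close>:
  \<open>wd\<close> lets evaluation at the point descend to functions, and both coordinates agree
  with their values up to multiples of \<open>\<pi>\<close>. Regularity of \<open>del f\<close> and
  \<open>del g\<close> says that dx/y has no zero at the point.\<close>

locale local_chart = elliptic +
  fixes f g :: "complex fls" and a b :: complex and \<pi> :: "complex fls"
  assumes wd: "eval2 P f g = 0 \<Longrightarrow> val2 a b P = 0"
    and fK: "f \<in> K" and gK: "g \<in> K"
    and pi: "\<exists>P Q. \<pi> = eval2 P f g / eval2 Q f g \<and> val2 a b P = 0 \<and> val2 a b Q \<noteq> 0"
    and f_a: "\<exists>h\<in>chart_ring f g a b. f - fls_const a = \<pi> * h"
    and g_b: "\<exists>h\<in>chart_ring f g a b. g - fls_const b = \<pi> * h"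
    and del_f: "del f \<in> chart_ring f g a b" and del_g: "del g \<in> chart_ring f g a b"
begin

abbreviation C :: "complex fls set" where "C \<equiv> chart_ring f g a b"

lemma eval2_nz: "val2 a b Q \<noteq> 0 \<Longrightarrow> eval2 Q f g \<noteq> 0"
  using wd by blast

lemma C_I: "val2 a b Q \<noteq> 0 \<Longrightarrow> eval2 P f g / eval2 Q f g \<in> C"
  unfolding chart_ring_def by blast

lemma C_eval2: "eval2 P f g \<in> C"
  using C_I[of 1 P] by simp

lemma C_const [simp]: "fls_const c \<in> C"
  using C_eval2[of "[:[:c:]:]"] by simp

lemma C_add: "h \<in> C \<Longrightarrow> k \<in> C \<Longrightarrow> h + k \<in> C"
proof -
  assume "h \<in> C" "k \<in> C"
  then obtain P Q P' Q' where *: "h = eval2 P f g / eval2 Q f g" "k = eval2 P' f g / eval2 Q' f g"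
    "val2 a b Q \<noteq> 0" "val2 a b Q' \<noteq> 0"
    unfolding chart_ring_def by blast
  then have "h + k = eval2 (P * Q' + P' * Q) f g / eval2 (Q * Q') f g"
    by (simp add: eval2_add eval2_mult add_frac_eq eval2_nz)
  then show ?thesis
    using C_I[of "Q * Q'"] * by simp
qed

lemma C_mult: "h \<in> C \<Longrightarrow> k \<in> C \<Longrightarrow> h * k \<in> C"
proof -
  assume "h \<in> C" "k \<in> C"
  then obtain P Q P' Q' where *: "h = eval2 P f g / eval2 Q f g" "k = eval2 P' f g / eval2 Q' f g"
    "val2 a b Q \<noteq> 0" "val2 a b Q' \<noteq> 0"
    unfolding chart_ring_def by blast
  then have "h * k = eval2 (P * P') f g / eval2 (Q * Q') f g"
    by (simp add: eval2_mult)
  then show ?thesis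
    using C_I[of "Q * Q'"] * by simp
qed

lemma C_pi: "\<pi> \<in> C"
  using pi C_I by auto

lemma C_uminus: "h \<in> C \<Longrightarrow> - h \<in> C"
  using C_mult[OF C_const[of "- 1"], of h] by (simp add: fls_const_uminus)

lemma C_diff: "h \<in> C \<Longrightarrow> k \<in> C \<Longrightarrow> h - k \<in> C"
  using C_add[of h "- k"] C_uminus by simp

lemma C_K: "h \<in> C \<Longrightarrow> h \<in> K"
proof -
  have "evalx f p \<in> K" for p
    by (induction p) (auto intro!: K_intros fK)
  then have "eval2 P f g \<in> K" for P
    by (induction P) (auto intro!: K_intros gK)
  then show "h \<in> C \<Longrightarrow> h \<in> K"
    unfolding chart_ring_def by (auto intro: K_intros)
qed

text \<open>A first order Taylor expansion, built by Horner recursion: in a product of two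
  expansions the constant terms multiply and everything else is divisible by
  \<open>\<pi>\<close>.\<close>

lemma eval2_dec: "\<exists>h\<in>C. eval2 P f g = fls_const (val2 a b P) + \<pi> * h"
proof -
  obtain hf hg where hf: "hf \<in> C" "f = fls_const a + \<pi> * hf" and hg: "hg \<in> C" "g = fls_const b + \<pi> * hg"
    using f_a g_b by (metis diff_add_cancel add.commute)
  have x: "\<exists>h\<in>C. evalx f p = fls_const (poly p a) + \<pi> * h" for p
  proof (induction p)
    case 0
    show ?case using C_const[of 0] by (auto intro!: bexI[of _ 0])
  next
    case (pCons c p)
    then obtain h where h: "h \<in> C" "evalx f p = fls_const (poly p a) + \<pi> * h" by auto
    have "evalx f (pCons c p) = fls_const c + (fls_const a + \<pi> * hf) * (fls_const (poly p a) + \<pi> * h)"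
      using h hf by simp
    also have "\<dots> = fls_const (poly (pCons c p) a) + \<pi> * (hf * (fls_const (poly p a) + \<pi> * h) + fls_const a * h)"
      unfolding poly_pCons fls_const_add fls_const_mult by (simp add: algebra_simps del: fls_const_mult_const)
    finally show ?case
      by (rule bexI) (intro C_add C_mult C_pi C_const h hf)
  qed
  show ?thesis
  proof (induction P)
    case 0
    show ?case using C_const[of 0] by (auto intro!: bexI[of _ 0])
  next
    case (pCons c P)
    then obtain h where h: "h \<in> C" "eval2 P f g = fls_const (val2 a b P) + \<pi> * h" by auto
    obtain k where k: "k \<in> C" "evalx f c = fls_const (poly c a) + \<pi> * k" using x by blast
    have "eval2 (pCons c P) f g = (fls_const (poly c a) + \<pi> * k) +
        (fls_const b + \<pi> * hg) * (fls_const (val2 a b P) + \<pi> * h)"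
      using h k hg by simp
    also have "\<dots> = fls_const (val2 a b (pCons c P)) +
        \<pi> * (k + hg * (fls_const (val2 a b P) + \<pi> * h) + fls_const b * h)"
      by (simp add: algebra_simps fls_const_add fls_const_mult del: fls_const_mult_const)
    finally show ?case
      by (rule bexI) (intro C_add C_mult C_pi C_const h hg k)
  qed
qed

lemma C_dec: "h \<in> C \<Longrightarrow> \<exists>c. \<exists>k\<in>C. h = fls_const c + \<pi> * k"
proof -
  assume "h \<in> C"
  then obtain P Q where *: "h = eval2 P f g / eval2 Q f g" "val2 a b Q \<noteq> 0"
    unfolding chart_ring_def by blast
  define u v where "u = val2 a b P" and "v = val2 a b Q"
  obtain k l where kl: "k \<in> C" "eval2 P f g = fls_const u + \<pi> * k"
    "l \<in> C" "eval2 Q f g = fls_const v + \<pi> * l"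
    using eval2_dec unfolding u_def v_def by blast
  have v: "v \<noteq> 0" "eval2 Q f g \<noteq> 0"
    using * eval2_nz by (auto simp: v_def)
  have iQ: "1 / eval2 Q f g \<in> C"
    using C_I[of Q 1] * by simp
  have c: "fls_const (u / v) * fls_const v = fls_const u"
    using v by simp
  \<comment> \<open>After subtracting \<open>u / v\<close>, the constant terms of the numerator
    cancel, so the difference is divisible by \<open>\<pi>\<close>.\<close>
  have "fls_const (u / v) + \<pi> * ((k - fls_const (u / v) * l) * (1 / eval2 Q f g))
      = (fls_const (u / v) * eval2 Q f g + \<pi> * (k - fls_const (u / v) * l)) / eval2 Q f g"
    using v by (simp add: field_simps)
  also have "fls_const (u / v) * eval2 Q f g + \<pi> * (k - fls_const (u / v) * l) = fls_const u + \<pi> * k"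
    unfolding kl c[symmetric] by (simp only: ring_distribs mult.left_commute) simp
  also have "\<dots> = eval2 P f g" using kl by simp
  finally have "h = fls_const (u / v) + \<pi> * ((k - fls_const (u / v) * l) * (1 / eval2 Q f g))"
    using * by simp
  then show ?thesis
    using iQ kl by (blast intro: C_mult C_diff C_const)
qed

text \<open>Clearing denominators turns the equation into a polynomial that vanishes as a function,
  hence by \<open>wd\<close> at the point. There the numerator of \<open>\<pi>\<close> is 0 and both
  denominators are not, so only \<open>c = 0\<close> remains.\<close>

lemma C_nonunit: "k \<in> C \<Longrightarrow> fls_const c = \<pi> * k \<Longrightarrow> c = 0"
proof -
  assume "k \<in> C" and k: "fls_const c = \<pi> * k"
  then obtain P' Q' where *: "k = eval2 P' f g / eval2 Q' f g" "val2 a b Q' \<noteq> 0"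
    unfolding chart_ring_def by blast
  from pi obtain P Q where pi': "\<pi> = eval2 P f g / eval2 Q f g" "val2 a b P = 0" "val2 a b Q \<noteq> 0"
    by auto
  have "eval2 Q f g \<noteq> 0" "eval2 Q' f g \<noteq> 0"
    using * pi' eval2_nz by auto
  then have "fls_const c * (eval2 Q f g * eval2 Q' f g) = eval2 P f g * eval2 P' f g"
    unfolding k pi' * by simp
  then have "eval2 ([:[:c:]:] * (Q * Q') - P * P') f g = 0"
    unfolding eval2_diff eval2_mult by simp
  then have "val2 a b ([:[:c:]:] * (Q * Q') - P * P') = 0"
    by (rule wd)
  then show "c = 0" using * pi' by simp
qed

lemma C_unit: "h \<in> C \<Longrightarrow> \<not> (\<exists>k\<in>C. h = \<pi> * k) \<Longrightarrow> \<exists>k\<in>C. h * k = 1"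
proof -
  assume "h \<in> C" and nu: "\<not> (\<exists>k\<in>C. h = \<pi> * k)"
  then obtain P Q where *: "h = eval2 P f g / eval2 Q f g" "val2 a b Q \<noteq> 0"
    unfolding chart_ring_def by blast
  have "val2 a b P \<noteq> 0"
  proof
    assume "val2 a b P = 0"
    then obtain k where "k \<in> C" "eval2 P f g = \<pi> * k"
      using eval2_dec[of P] by auto
    then have "h = \<pi> * (k * (1 / eval2 Q f g))" using * by simp
    moreover have "k * (1 / eval2 Q f g) \<in> C"
      using \<open>k \<in> C\<close> C_I[of Q 1] * by (simp add: C_mult del: times_divide_eq_right)
    ultimately show False using nu by blast
  qed
  then show ?thesis
    using * C_I[of P Q] eval2_nz by (intro bexI[of _ "eval2 Q f g / eval2 P f g"]) auto
qed

lemma C_del: "h \<in> C \<Longrightarrow> del h \<in> C"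
proof -
  assume "h \<in> C"
  then obtain P Q where *: "h = eval2 P f g / eval2 Q f g" "val2 a b Q \<noteq> 0"
    unfolding chart_ring_def by blast
  have e: "del (eval2 P f g) \<in> C" for P
    using del_eval2[of P f g] by (auto intro!: C_add C_mult del_f del_g C_eval2)
  have "eval2 Q f g \<noteq> 0" using * eval2_nz by auto
  then have "del h = (del (eval2 P f g) * eval2 Q f g - eval2 P f g * del (eval2 Q f g)) * (1 / eval2 (Q * Q) f g)"
    by (simp add: * del_divide eval2_mult power2_eq_square)
  also have "\<dots> \<in> C"
    using C_I[of "Q * Q" 1] * by (intro C_mult C_diff e C_eval2) auto
  finally show ?thesis .
qed

end

section \<open>Explicit uniformizers at all points of the curve\<close>

context elliptic
begin

text \<open>One formula covers all affine points. If \<open>b\<close> is nonzero, the denominator is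
  a unit and \<open>X - a\<close> is a parameter; if \<open>b = 0\<close>, the quotient equals
  \<open>Y\<close> divided by \<open>slope a\<close>. Its reciprocal serves later as a function with
  a single simple pole on the affine curve.\<close>

definition unif :: "point \<Rightarrow> complex fls" where
  "unif w = (case w of Inf \<Rightarrow> X / Y | Aff a b \<Rightarrow> (X - fls_const a) / (Y + fls_const b))"

text \<open>The difference quotient of the cubic at \<open>a\<close>; its value at \<open>a\<close>
  is the derivative.\<close>

definition slope :: "complex \<Rightarrow> complex poly" where
  "slope a = [:a\<^sup>2 - (1 + lam) * a + lam, a - (1 + lam), 1:]"

lemma slope_factor: "cubic - [:cub a:] = [:- a, 1:] * slope a"
  by (simp add: cubic_def slope_def cub_def algebra_simps power2_eq_square)

lemma slope_at: "poly (slope a) a = 3 * a\<^sup>2 - 2 * (1 + lam) * a + lam"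
  by (simp add: slope_def algebra_simps power2_eq_square)

text \<open>The roots 0, 1 and \<open>lam\<close> are distinct, so none is a double root: this is
  smoothness of the curve at its points with \<open>y = 0\<close>.\<close>

lemma slope_nz: "cub a = 0 \<Longrightarrow> poly (slope a) a \<noteq> 0"
proof -
  assume "cub a = 0"
  then consider "a = 0" | "a = 1" | "a = lam" by (auto simp: cub_def)
  then show ?thesis
    by cases (use lam in \<open>auto simp: slope_at algebra_simps power2_eq_square\<close>)
qed

lemma Y_shift_nz: "Y + fls_const b \<noteq> 0" "Y - fls_const b \<noteq> 0"
proof -
  have "fe [:b:] 1 \<noteq> 0" "fe [:-b:] 1 \<noteq> 0" by (simp_all del: pCons_eq_0_iff)
  then show "Y + fls_const b \<noteq> 0" "Y - fls_const b \<noteq> 0"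
    unfolding fe_def by (simp_all add: add.commute fls_const_uminus)
qed

lemma X_shift_nz: "X - fls_const a \<noteq> 0"
proof -
  have "fe [:-a,1:] 0 \<noteq> 0" by simp
  then show ?thesis unfolding fe_def by (simp add: fls_const_uminus)
qed

lemma slope_eq: "b\<^sup>2 = cub a \<Longrightarrow> (Y + fls_const b) * (Y - fls_const b) = (X - fls_const a) * evalx X (slope a)"
proof -
  assume b: "b\<^sup>2 = cub a"
  have "(Y + fls_const b) * (Y - fls_const b) = Y\<^sup>2 - fls_const (b\<^sup>2)"
    by (simp add: algebra_simps power2_eq_square)
  also have "\<dots> = evalx X (cubic - [:cub a:])"
    by (simp add: evalx_diff evalx_cubic b)
  also have "\<dots> = (X - fls_const a) * evalx X (slope a)"
    unfolding slope_factor evalx_mult by (simp add: fls_const_uminus)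
  finally show ?thesis .
qed

lemma unif_Aff:
  assumes "b\<^sup>2 = cub a"
  shows "X - fls_const a = unif (Aff a b) * (Y + fls_const b)"
    "Y - fls_const b = unif (Aff a b) * evalx X (slope a)"
    "unif (Aff a b) \<noteq> 0"
  using slope_eq[OF assms] Y_shift_nz[of b] X_shift_nz[of a] by (auto simp: unif_def field_simps)

lemma loc_ring_Aff: "loc_ring lam (Aff a b) = chart_ring X Y a b"
  by (simp add: chart_ring_def)

lemma loc_ring_Inf: "loc_ring lam Inf = chart_ring (X / Y) (1 / Y) 0 0"
  by (simp add: chart_ring_def)

lemma local_chart_Aff:
  assumes b: "b\<^sup>2 = cub a"
  shows "local_chart lam X Y a b (unif (Aff a b))"
proof
  have eval: "eval2 P X Y \<in> chart_ring X Y a b" for P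
    unfolding chart_ring_def mem_Collect_eq by (intro exI[of _ P] exI[of _ 1]) simp
  show "eval2 P X Y = 0 \<Longrightarrow> val2 a b P = 0" for P
    using eval2_fe[of P] b by fastforce
  show "X \<in> K" "Y \<in> K" by simp_all
  show "\<exists>P Q. unif (Aff a b) = eval2 P X Y / eval2 Q X Y \<and> val2 a b P = 0 \<and> val2 a b Q \<noteq> 0"
  proof (cases "b = 0")
    case False
    then show ?thesis
      by (intro exI[of _ "[:[:-a,1:]:]"] exI[of _ "[:[:b:],1:]"])
        (simp add: unif_def fls_const_uminus add.commute)
  next
    case True
    \<comment> \<open>For \<open>b = 0\<close> the denominator in \<open>unif\<close> vanishes at
      the point. The equal fraction \<open>Y / slope a\<close> has an admissible
      denominator.\<close>
    have "evalx X (slope a) \<noteq> 0"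
      using slope_eq[OF b] Y_shift_nz[of b] by (metis mult_eq_0_iff)
    then show ?thesis
      using unif_Aff(2)[OF b] slope_nz[of a] b True
      by (intro exI[of _ "[:0,1:]"] exI[of _ "[:slope a:]"]) (simp add: field_simps)
  qed
  show "\<exists>h\<in>chart_ring X Y a b. X - fls_const a = unif (Aff a b) * h"
    using unif_Aff(1)[OF b] eval[of "[:[:b:],1:]"]
    by (intro bexI[of _ "Y + fls_const b"]) (auto simp: add.commute)
  show "\<exists>h\<in>chart_ring X Y a b. Y - fls_const b = unif (Aff a b) * h"
    using unif_Aff(2)[OF b] eval[of "[:slope a:]"]
    by (intro bexI[of _ "evalx X (slope a)"]) auto
  show "del X \<in> chart_ring X Y a b"
    using eval[of "[:0,1:]"] by simp
  have "\<exists>P. del Y = eval2 P X Y"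
  proof -
    have "eval2 [:[:lam/2,-(1+lam),3/2:]:] X Y = (3 * X\<^sup>2 - 2 * (1 + L) * X + L) / 2"
      unfolding eval2_pCons evalx_pCons fls_const_divide fls_const_uminus fls_const_add
      by (simp add: field_simps power2_eq_square)
    then show ?thesis using del_Y by metis
  qed
  then show "del Y \<in> chart_ring X Y a b"
    using eval by auto
qed

text \<open>With \<open>\<xi> = x / y\<close> and \<open>\<zeta> = 1 / y\<close>, the curve near
  infinity is \<open>\<zeta> = \<xi> (\<xi> - \<zeta>) (\<xi> - lam \<zeta>)\<close>. Collecting the
  multiples of \<open>\<zeta>\<close> gives \<open>\<zeta> * g_inf = \<xi>^3\<close>, where
  \<open>g_inf\<close> is a unit with value 1 at infinity.\<close>

definition g_inf :: "complex fls" where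
  "g_inf = 1 + (1 + L) * (X / Y)\<^sup>2 - L * (X / Y) * (1 / Y)"

lemma inf_cubic: "(1 / Y) * g_inf = (X / Y) ^ 3"
proof -
  have "(1 / Y) * g_inf = (Y\<^sup>2 + (1 + L) * X\<^sup>2 - L * X) / Y ^ 3"
    unfolding g_inf_def by (simp add: divide_simps) (simp add: algebra_simps power2_eq_square power3_eq_cube)
  also have "Y\<^sup>2 + (1 + L) * X\<^sup>2 - L * X = X ^ 3" using Y2 by simp
  finally show ?thesis by (simp add: power_divide)
qed

text \<open>In the expansion parameter \<open>u\<close>, to leading order, dx/y is -2 du and
  \<open>X / Y\<close> is \<open>u\<close>. This explains the constant term -1/2 in
  \<open>del (X / Y)\<close>.\<close>

lemma del_inf:
  "del (1 / Y) = - (3 * (X / Y)\<^sup>2 - 2 * (1 + L) * (X / Y) * (1 / Y) + L * (1 / Y)\<^sup>2) / 2"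
  "del (X / Y) = - 1 / 2 - ((1 + L) * (X / Y)\<^sup>2 - 2 * L * (X / Y) * (1 / Y)) / 2"
proof -
  show "del (1 / Y) = - (3 * (X / Y)\<^sup>2 - 2 * (1 + L) * (X / Y) * (1 / Y) + L * (1 / Y)\<^sup>2) / 2"
    by (simp add: del_divide del_Y field_simps power2_eq_square)
  have "del (X / Y) = (2 * Y\<^sup>2 - X * (3 * X\<^sup>2 - 2 * (1 + L) * X + L)) / (2 * Y\<^sup>2)"
    by (simp add: del_divide del_Y field_simps power2_eq_square)
  also have "2 * Y\<^sup>2 - X * (3 * X\<^sup>2 - 2 * (1 + L) * X + L) = - Y\<^sup>2 - ((1 + L) * X\<^sup>2 - 2 * L * X)"
    unfolding Y2 by (simp add: algebra_simps power2_eq_square power3_eq_cube)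
  also have "\<dots> / (2 * Y\<^sup>2) = - 1 / 2 - ((1 + L) * (X / Y)\<^sup>2 - 2 * L * (X / Y) * (1 / Y)) / 2"
    by (simp add: field_simps power2_eq_square)
  finally show "del (X / Y) = - 1 / 2 - ((1 + L) * (X / Y)\<^sup>2 - 2 * L * (X / Y) * (1 / Y)) / 2" .
qed

text \<open>Both coordinates at infinity have positive order, so a polynomial in them is a power
  series whose constant coefficient is its value at the origin. Evaluation at infinity is thus well
  defined.\<close>

lemma eval2_inf: "\<exists>E. eval2 P (X / Y) (1 / Y) = fps_to_fls E \<and> fps_nth E 0 = val2 0 0 P"
proof -
  have "fls_subdegree (X / Y) = 1" "fls_subdegree (1 / Y) = 3"
    by (simp_all add: fls_divide_subdegree)
  then obtain f g where f: "X / Y = fps_to_fls f" "fps_nth f 0 = 0" and g: "1 / Y = fps_to_fls g" "fps_nth g 0 = 0"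
    by (metis fls_eq0_below_subdegree fls_regpart_nth fls_regpart_to_fls_trivial int_ops(1)
        zero_le_numeral zero_le_one zero_less_numeral zero_less_one)
  have x: "\<exists>E. evalx (X / Y) p = fps_to_fls E \<and> fps_nth E 0 = poly p 0" for p
  proof (induction p)
    case 0
    show ?case by (rule exI[of _ 0]) simp
  next
    case (pCons c p)
    then obtain E where "evalx (X / Y) p = fps_to_fls E" "fps_nth E 0 = poly p 0" by auto
    then show ?case using f
      by (intro exI[of _ "fps_const c + f * E"]) (simp add: fls_times_fps_to_fls)
  qed
  show ?thesis
  proof (induction P)
    case 0
    show ?case by (rule exI[of _ 0]) simp
  next
    case (pCons c P)
    then obtain E where E: "eval2 P (X / Y) (1 / Y) = fps_to_fls E" "fps_nth E 0 = val2 0 0 P" by auto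
    obtain E' where "evalx (X / Y) c = fps_to_fls E'" "fps_nth E' 0 = poly c 0" using x by blast
    then show ?case using g E
      by (intro exI[of _ "E' + g * E"]) (simp add: fls_times_fps_to_fls)
  qed
qed

lemma local_chart_Inf: "local_chart lam (X / Y) (1 / Y) 0 0 (unif Inf)"
proof
  define f g where "f = X / Y" and "g = 1 / Y"
  have eval: "eval2 P f g \<in> chart_ring f g 0 0" for P
    unfolding chart_ring_def mem_Collect_eq by (intro exI[of _ P] exI[of _ 1]) simp
  show wd: "eval2 P (X / Y) (1 / Y) = 0 \<Longrightarrow> val2 0 0 P = 0" for P
    using eval2_inf[of P] by (auto simp: fps_to_fls_eq_0_iff)
  show "X / Y \<in> K" "1 / Y \<in> K" by (auto intro!: K_intros)
  show "\<exists>P Q. unif Inf = eval2 P (X / Y) (1 / Y) / eval2 Q (X / Y) (1 / Y) \<and> val2 0 0 P = 0 \<and> val2 0 0 Q \<noteq> 0"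
    by (intro exI[of _ "[:[:0,1:]:]"] exI[of _ 1]) (simp add: unif_def)
  show "\<exists>h\<in>chart_ring (X / Y) (1 / Y) 0 0. X / Y - fls_const 0 = unif Inf * h"
    using eval[of 1] by (intro bexI[of _ 1]) (auto simp: unif_def f_def g_def)
  have g_inf: "g_inf = eval2 [:[:1,0,1+lam:],[:0,-lam:]:] f g"
    unfolding g_inf_def f_def[symmetric] g_def[symmetric] eval2_pCons evalx_pCons fls_const_uminus fls_const_add
    by (simp add: algebra_simps power2_eq_square)
  have 1: "g_inf \<noteq> 0"
    using wd[of "[:[:1,0,1+lam:],[:0,-lam:]:]"] unfolding g_inf f_def g_def by auto
  have "eval2 [:[:0,0,1:]:] f g / eval2 [:[:1,0,1+lam:],[:0,-lam:]:] f g \<in> chart_ring f g 0 0"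
    unfolding chart_ring_def mem_Collect_eq by (rule exI, rule exI, rule conjI, rule refl) simp
  then have 2: "f\<^sup>2 / g_inf \<in> chart_ring f g 0 0"
    unfolding g_inf[symmetric] by (simp add: power2_eq_square)
  have "g = f * (f\<^sup>2 / g_inf)"
    using inf_cubic 1 by (simp add: f_def g_def field_simps power2_eq_square power3_eq_cube)
  then show "\<exists>h\<in>chart_ring (X / Y) (1 / Y) 0 0. 1 / Y - fls_const 0 = unif Inf * h"
    using 2 by (intro bexI[of _ "f\<^sup>2 / g_inf"]) (auto simp: unif_def f_def g_def)
  have "del f = eval2 [:[:-1/2,0,-(1+lam)/2:],[:0,lam:]:] f g"
    unfolding f_def g_def del_inf eval2_pCons evalx_pCons fls_const_uminus fls_const_add fls_const_divide
    by (simp add: field_simps power2_eq_square)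
  then show "del (X / Y) \<in> chart_ring (X / Y) (1 / Y) 0 0"
    using eval unfolding f_def g_def by metis
  have "del g = eval2 [:[:0,0,-3/2:],[:0,1+lam:],[:-lam/2:]:] f g"
    unfolding f_def g_def del_inf eval2_pCons evalx_pCons fls_const_uminus fls_const_add fls_const_divide
    by (simp add: field_simps power2_eq_square)
  then show "del (1 / Y) \<in> chart_ring (X / Y) (1 / Y) 0 0"
    using eval unfolding f_def g_def by metis
qed

end

declare loc_ring.simps [simp del]

context elliptic
begin

lemma ex_local_chart:
  assumes "w \<in> curve lam"
  shows "\<exists>f g a b. local_chart lam f g a b (unif w) \<and> loc_ring lam w = chart_ring f g a b"
proof (cases w)
  case Inf
  then show ?thesis using local_chart_Inf loc_ring_Inf by blast
next
  case (Aff a b)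
  then show ?thesis using local_chart_Aff[of b a] loc_ring_Aff[of a b] assms curve_iff by blast
qed

definition ev :: "point \<Rightarrow> complex fls \<Rightarrow> complex" where
  "ev w f = (THE c. \<exists>k\<in>loc_ring lam w. f = fls_const c + unif w * k)"

end

text \<open>Facts common to both charts. They come before \<open>curve_point\<close> because they
  are first applied at infinity to describe that local ring by pole orders, and this description
  enters the remaining facts.\<close>

locale curve_point_base = elliptic +
  fixes w :: point
  assumes w_curve: "w \<in> curve lam"
begin

abbreviation O_w :: "complex fls set" where "O_w \<equiv> loc_ring lam w"
abbreviation \<pi> :: "complex fls" where "\<pi> \<equiv> unif w"

lemma O_const [simp]: "fls_const c \<in> O_w"
  and O_add: "f \<in> O_w \<Longrightarrow> g \<in> O_w \<Longrightarrow> f + g \<in> O_w"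
  and O_mult: "f \<in> O_w \<Longrightarrow> g \<in> O_w \<Longrightarrow> f * g \<in> O_w"
  and O_uminus: "f \<in> O_w \<Longrightarrow> - f \<in> O_w"
  and O_diff: "f \<in> O_w \<Longrightarrow> g \<in> O_w \<Longrightarrow> f - g \<in> O_w"
  and O_K: "f \<in> O_w \<Longrightarrow> f \<in> K"
  and O_pi [simp]: "\<pi> \<in> O_w"
  and O_dec: "f \<in> O_w \<Longrightarrow> \<exists>c. \<exists>k\<in>O_w. f = fls_const c + \<pi> * k"
  and O_nonunit: "f \<in> O_w \<Longrightarrow> fls_const c = \<pi> * f \<Longrightarrow> c = 0"
  and O_unit: "f \<in> O_w \<Longrightarrow> \<not> (\<exists>k\<in>O_w. f = \<pi> * k) \<Longrightarrow> \<exists>k\<in>O_w. f * k = 1"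
  and O_del: "f \<in> O_w \<Longrightarrow> del f \<in> O_w"
proof -
  obtain f0 g0 a b where c: "local_chart lam f0 g0 a b \<pi>" and O: "O_w = chart_ring f0 g0 a b"
    using ex_local_chart w_curve by blast
  interpret local_chart lam f0 g0 a b \<pi> by (fact c)
  show "fls_const c \<in> O_w"
    "f \<in> O_w \<Longrightarrow> g \<in> O_w \<Longrightarrow> f + g \<in> O_w"
    "f \<in> O_w \<Longrightarrow> g \<in> O_w \<Longrightarrow> f * g \<in> O_w"
    "f \<in> O_w \<Longrightarrow> - f \<in> O_w"
    "f \<in> O_w \<Longrightarrow> g \<in> O_w \<Longrightarrow> f - g \<in> O_w"
    "f \<in> O_w \<Longrightarrow> f \<in> K"
    "\<pi> \<in> O_w"
    "f \<in> O_w \<Longrightarrow> \<exists>c. \<exists>k\<in>O_w. f = fls_const c + \<pi> * k"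
    "f \<in> O_w \<Longrightarrow> fls_const c = \<pi> * f \<Longrightarrow> c = 0"
    "f \<in> O_w \<Longrightarrow> \<not> (\<exists>k\<in>O_w. f = \<pi> * k) \<Longrightarrow> \<exists>k\<in>O_w. f * k = 1"
    "f \<in> O_w \<Longrightarrow> del f \<in> O_w" for f g c
    unfolding O by (fact C_const C_add C_mult C_uminus C_diff C_K C_pi C_dec C_nonunit C_unit C_del)+
qed

lemma O_01 [simp]: "0 \<in> O_w" "1 \<in> O_w" "numeral n \<in> O_w"
  using O_const[of 0] O_const[of 1] O_const[of "numeral n"] by auto

lemma O_power: "f \<in> O_w \<Longrightarrow> f ^ n \<in> O_w"
  by (induction n) (auto intro: O_mult)

lemmas O_intros = O_add O_mult O_uminus O_diff O_power

lemma pi_nz [simp]: "\<pi> \<noteq> 0"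
proof (cases w)
  case Inf
  then show ?thesis by (simp add: unif_def)
next
  case (Aff a b)
  then show ?thesis using unif_Aff(3)[of b a] w_curve curve_iff by auto
qed

lemma ev_eq: "k \<in> O_w \<Longrightarrow> f = fls_const c + \<pi> * k \<Longrightarrow> ev w f = c"
  unfolding ev_def
proof (rule the_equality)
  fix d assume "k \<in> O_w" "f = fls_const c + \<pi> * k" "\<exists>k\<in>O_w. f = fls_const d + \<pi> * k"
  then obtain l where "l \<in> O_w" "fls_const c + \<pi> * k = fls_const d + \<pi> * l" by auto
  then have "fls_const (d - c) = \<pi> * (k - l)"
    unfolding fls_const_diff by (simp add: algebra_simps)
  then have "d - c = 0" using O_nonunit O_diff \<open>k \<in> O_w\<close> \<open>l \<in> O_w\<close> by blast
  then show "d = c" by simp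
qed blast

lemma ev_dec: "f \<in> O_w \<Longrightarrow> \<exists>k\<in>O_w. f = fls_const (ev w f) + \<pi> * k"
proof -
  assume "f \<in> O_w"
  then obtain c k where k: "k \<in> O_w" "f = fls_const c + \<pi> * k" using O_dec by blast
  then have "ev w f = c" by (rule ev_eq)
  with k show ?thesis by auto
qed

lemma ev_const [simp]: "ev w (fls_const c) = c"
  by (rule ev_eq[of 0]) auto

lemma ev_01 [simp]: "ev w 0 = 0" "ev w 1 = 1" "ev w (numeral n) = numeral n"
  using ev_const[of 0] ev_const[of 1] ev_const[of "numeral n"] by auto

lemma ev_pi [simp]: "ev w \<pi> = 0"
  by (rule ev_eq[of 1]) auto

lemma ev_add: "f \<in> O_w \<Longrightarrow> g \<in> O_w \<Longrightarrow> ev w (f + g) = ev w f + ev w g"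
proof -
  assume "f \<in> O_w" "g \<in> O_w"
  then obtain k l where *: "k \<in> O_w" "f = fls_const (ev w f) + \<pi> * k" "l \<in> O_w" "g = fls_const (ev w g) + \<pi> * l"
    using ev_dec by blast
  have "f + g = fls_const (ev w f + ev w g) + \<pi> * (k + l)"
    unfolding fls_const_add by (subst *(2), subst *(4)) (simp add: algebra_simps)
  then show ?thesis using * by (intro ev_eq[of "k + l"]) (auto intro: O_add)
qed

lemma ev_mult: "f \<in> O_w \<Longrightarrow> g \<in> O_w \<Longrightarrow> ev w (f * g) = ev w f * ev w g"
proof -
  assume fg: "f \<in> O_w" "g \<in> O_w"
  then obtain k l where *: "k \<in> O_w" "f = fls_const (ev w f) + \<pi> * k" "l \<in> O_w" "g = fls_const (ev w g) + \<pi> * l"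
    using ev_dec by blast
  have "f * g = (fls_const (ev w f) + \<pi> * k) * (fls_const (ev w g) + \<pi> * l)"
    using * by simp
  also have "\<dots> = fls_const (ev w f * ev w g) + \<pi> * (k * (fls_const (ev w g) + \<pi> * l) + fls_const (ev w f) * l)"
    unfolding fls_const_mult by (simp add: algebra_simps)
  finally show ?thesis
    by (rule ev_eq[rotated]) (intro O_add O_mult O_const O_pi *)
qed

lemma ev_uminus: "f \<in> O_w \<Longrightarrow> ev w (- f) = - ev w f"
  using ev_add[of f "- f"] by (simp add: O_uminus eq_neg_iff_add_eq_0 add.commute)

lemma ev_diff: "f \<in> O_w \<Longrightarrow> g \<in> O_w \<Longrightarrow> ev w (f - g) = ev w f - ev w g"
  using ev_add[of f "- g"] by (simp add: O_uminus ev_uminus)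

lemma ev_power: "f \<in> O_w \<Longrightarrow> ev w (f ^ n) = ev w f ^ n"
  by (induction n) (auto simp: ev_mult O_power)

lemma ev_0_iff: "f \<in> O_w \<Longrightarrow> ev w f = 0 \<longleftrightarrow> f / \<pi> \<in> O_w"
proof
  assume "f \<in> O_w" "ev w f = 0"
  then obtain k where "k \<in> O_w" "f = \<pi> * k" using ev_dec by fastforce
  then show "f / \<pi> \<in> O_w" by simp
next
  assume "f / \<pi> \<in> O_w"
  then show "ev w f = 0" by (intro ev_eq[of "f / \<pi>"]) auto
qed

lemma O_inverse: "f \<in> O_w \<Longrightarrow> ev w f \<noteq> 0 \<Longrightarrow> 1 / f \<in> O_w"
proof -
  assume f: "f \<in> O_w" "ev w f \<noteq> 0"
  then have "\<not> (\<exists>k\<in>O_w. f = \<pi> * k)" using ev_0_iff by auto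
  then obtain k where "k \<in> O_w" "f * k = 1" using O_unit f by auto
  then have "f \<noteq> 0" by auto
  with \<open>f * k = 1\<close> have "1 / f = k" by (simp add: divide_eq_eq mult.commute)
  then show ?thesis using \<open>k \<in> O_w\<close> by simp
qed

lemma ev_nz: "ev w f \<noteq> 0 \<Longrightarrow> f \<noteq> 0"
  by auto

lemma O_divide: "f \<in> O_w \<Longrightarrow> g \<in> O_w \<Longrightarrow> ev w g \<noteq> 0 \<Longrightarrow> f / g \<in> O_w"
  using O_mult[of f "1 / g"] O_inverse[of g] by simp

lemma ev_divide: "f \<in> O_w \<Longrightarrow> g \<in> O_w \<Longrightarrow> ev w g \<noteq> 0 \<Longrightarrow> ev w (f / g) = ev w f / ev w g"
  using ev_mult[of "f / g" g] O_divide[of f g] ev_nz[of g] by (simp add: field_simps)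

end

context elliptic
begin

lemma curve_point_base: "w \<in> curve lam \<Longrightarrow> curve_point_base lam w"
  by unfold_locales

lemma Aff_point:
  assumes b: "b\<^sup>2 = cub a"
  shows "R \<subseteq> loc_ring lam (Aff a b)" "ev (Aff a b) X = a" "ev (Aff a b) Y = b"
    "ev (Aff a b) (evalx X p) = poly p a"
proof -
  interpret curve_point_base lam "Aff a b"
    by unfold_locales (simp add: curve_iff b)
  interpret c: local_chart lam X Y a b "unif (Aff a b)"
    by (rule local_chart_Aff[OF b])
  have e: "eval2 P X Y \<in> loc_ring lam (Aff a b)" for P
    unfolding loc_ring_Aff by (rule c.C_eval2)
  then show 1: "R \<subseteq> loc_ring lam (Aff a b)"
    unfolding R_iff subset_iff by blast
  have m: "ev (Aff a b) (eval2 P X Y) = val2 a b P" for P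
    using c.eval2_dec[of P] ev_eq unfolding loc_ring_Aff by blast
  show "ev (Aff a b) X = a" "ev (Aff a b) Y = b" "ev (Aff a b) (evalx X p) = poly p a"
    using m[of "[:[:0,1:]:]"] m[of "[:0,1:]"] m[of "[:p:]"] by auto
qed

lemma Inf_unif: "unif Inf = X / Y"
  by (simp add: unif_def)

lemma inf_pow: "g_inf = (X / Y)\<^sup>2 * X" "g_inf = (X / Y) ^ 3 * Y"
  using inf_cubic by (simp_all add: field_simps power2_eq_square power3_eq_cube)

lemma O_Inf_subdegree: "f \<in> loc_ring lam Inf \<Longrightarrow> f = 0 \<or> fls_subdegree f \<ge> 0"
proof -
  assume "f \<in> loc_ring lam Inf"
  then obtain P Q where f: "f = eval2 P (X / Y) (1 / Y) / eval2 Q (X / Y) (1 / Y)" "val2 0 0 Q \<noteq> 0"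
    unfolding loc_ring_Inf chart_ring_def by auto
  obtain A B where "eval2 P (X / Y) (1 / Y) = fps_to_fls A" "eval2 Q (X / Y) (1 / Y) = fps_to_fls B"
    "fps_nth B 0 \<noteq> 0"
    using eval2_inf f by metis
  moreover from this have "B \<noteq> 0" "subdegree B = 0" by (auto simp: subdegree_eq_0_iff)
  ultimately show ?thesis
    using f(1) by (cases "A = 0") (auto simp: fls_divide_subdegree fls_subdegree_fls_to_fps fps_to_fls_eq_0_iff)
qed

interpretation I: curve_point_base lam Inf
  by unfold_locales (rule Inf_curve)

text \<open>Each factor \<open>X\<close> is absorbed by two factors \<open>X / Y\<close>, since
  \<open>(X / Y)^2 * X\<close> is the regular function \<open>g_inf\<close>.\<close>

lemma inf_evalx: "2 * degree p \<le> k \<Longrightarrow> (X / Y) ^ k * evalx X p \<in> loc_ring lam Inf"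
proof (induction p arbitrary: k)
  case (pCons c p)
  have XY: "X / Y \<in> loc_ring lam Inf" using I.O_pi by (simp add: Inf_unif)
  show ?case
  proof (cases "p = 0")
    case True
    then show ?thesis using XY by (auto intro: I.O_intros)
  next
    case False
    then have "2 * degree p \<le> k - 2" "k = 2 + (k - 2)" using pCons.prems by auto
    then have "(X / Y) ^ (k - 2) * evalx X p \<in> loc_ring lam Inf"
      using pCons.IH by blast
    moreover have "g_inf \<in> loc_ring lam Inf"
    proof -
      have "1 / Y \<in> loc_ring lam Inf"
        unfolding loc_ring_Inf chart_ring_def mem_Collect_eq
        by (intro exI[of _ "[:0,1:]"] exI[of _ 1]) simp
      then show ?thesis unfolding g_inf_def using XY by (intro I.O_intros) auto
    qed
    moreover have "(X / Y) ^ k * evalx X (pCons c p) =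
        (X / Y) ^ k * fls_const c + g_inf * ((X / Y) ^ (k - 2) * evalx X p)"
    proof -
      have "(X / Y) ^ k = (X / Y)\<^sup>2 * (X / Y) ^ (k - 2)"
        using \<open>k = 2 + (k - 2)\<close> by (metis power_add)
      then show ?thesis by (simp only: evalx_pCons inf_pow(1)) (simp only: ring_distribs ac_simps)
    qed
    ultimately show ?thesis
      using XY by (auto intro!: I.O_intros)
  qed
qed auto

text \<open>The exponent is the pole order, so the product has order 0. If its value at infinity
  were 0, it could be divided by \<open>X / Y\<close>, giving a regular function of order
  -1.\<close>

lemma inf_R_unit:
  assumes "n \<in> R" "n \<noteq> 0"
  shows "fls_subdegree n \<le> 0"
    "(X / Y) ^ nat (- fls_subdegree n) * n \<in> loc_ring lam Inf"
    "ev Inf ((X / Y) ^ nat (- fls_subdegree n) * n) \<noteq> 0"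
proof -
  obtain p q where n: "n = fe p q" using assms by (auto simp: R_def)
  with assms have nz: "p \<noteq> 0 \<or> q \<noteq> 0" by auto
  have XY: "X / Y \<in> loc_ring lam Inf" using I.O_pi by (simp add: Inf_unif)
  note sd = subdegree_fe[OF nz]
  show le: "fls_subdegree n \<le> 0" using sd(4) n by auto
  define k where "k = nat (- fls_subdegree n)"
  have "(X / Y) ^ k * evalx X p \<in> loc_ring lam Inf"
  proof (cases "p = 0")
    case False
    then show ?thesis using sd(2) le n by (intro inf_evalx) (auto simp: k_def)
  qed auto
  moreover have "(X / Y) ^ k * (evalx X q * Y) \<in> loc_ring lam Inf"
  proof (cases "q = 0")
    case False
    then have k: "2 * degree q \<le> k - 3" "k = (k - 3) + 3" using sd(3) le n by (auto simp: k_def)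
    have "g_inf \<in> loc_ring lam Inf"
      using inf_evalx[of "[:0,1:]" 2] inf_pow(1) by simp
    then have "((X / Y) ^ (k - 3) * evalx X q) * g_inf \<in> loc_ring lam Inf"
      by (intro I.O_mult inf_evalx k)
    moreover have "((X / Y) ^ (k - 3) * evalx X q) * g_inf = (X / Y) ^ k * (evalx X q * Y)"
      by (subst (2) k(2), subst inf_pow(2)) (simp add: power_add)
    ultimately show ?thesis by simp
  qed auto
  ultimately have 1: "(X / Y) ^ k * n \<in> loc_ring lam Inf"
    unfolding n fe_def distrib_left by (rule I.O_add)
  have s0: "fls_subdegree ((X / Y) ^ k * n) = 0"
    using assms le by (simp add: fls_divide_subdegree k_def fls_subdegree_pow)
  have "ev Inf ((X / Y) ^ k * n) \<noteq> 0"
  proof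
    assume "ev Inf ((X / Y) ^ k * n) = 0"
    then have "(X / Y) ^ k * n / (X / Y) \<in> loc_ring lam Inf"
      using I.ev_0_iff[OF 1] by (simp add: Inf_unif)
    then have "(X / Y) ^ k * n / (X / Y) = 0 \<or> fls_subdegree ((X / Y) ^ k * n / (X / Y)) \<ge> 0"
      by (rule O_Inf_subdegree)
    moreover have "fls_subdegree ((X / Y) ^ k * n / (X / Y)) = - 1"
      using s0 assms by (subst fls_divide_subdegree) (auto simp: fls_divide_subdegree)
    ultimately show False using assms by auto
  qed
  with 1 show "(X / Y) ^ nat (- fls_subdegree n) * n \<in> loc_ring lam Inf"
    "ev Inf ((X / Y) ^ nat (- fls_subdegree n) * n) \<noteq> 0"
    by (auto simp: k_def)
qed

lemma inf_K:
  assumes "f \<in> K" "f \<noteq> 0"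
  shows "\<exists>u\<in>loc_ring lam Inf. f = u * (X / Y) powi fls_subdegree f"
proof -
  obtain n d where nd: "n \<in> R" "d \<in> R" "d \<noteq> 0" "f = n / d" using assms by (auto simp: K_iff')
  then have "n \<noteq> 0" using assms by auto
  note N = inf_R_unit[OF \<open>n \<in> R\<close> \<open>n \<noteq> 0\<close>] and D = inf_R_unit[OF \<open>d \<in> R\<close> \<open>d \<noteq> 0\<close>]
  define k l where "k = nat (- fls_subdegree n)" and "l = nat (- fls_subdegree d)"
  have "((X / Y) ^ k * n) / ((X / Y) ^ l * d) \<in> loc_ring lam Inf"
    using N D unfolding k_def l_def by (intro I.O_divide)
  moreover have "fls_subdegree f = int l - int k"
    using nd \<open>n \<noteq> 0\<close> N(1) D(1) by (simp add: fls_divide_subdegree k_def l_def)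
  then have "((X / Y) ^ k * n) / ((X / Y) ^ l * d) * (X / Y) powi fls_subdegree f = f"
    using nd by (simp add: power_int_diff)
  ultimately show ?thesis by metis
qed

text \<open>Numerator and denominator become units after multiplication by powers of
  \<open>X / Y\<close>, so a rational function is regular times the power of \<open>X / Y\<close>
  given by its order. From here on, regularity at infinity is a comparison of pole orders.\<close>

lemma O_Inf_iff: "f \<in> loc_ring lam Inf \<longleftrightarrow> f \<in> K \<and> (f = 0 \<or> fls_subdegree f \<ge> 0)"
proof
  assume "f \<in> K \<and> (f = 0 \<or> fls_subdegree f \<ge> 0)"
  then consider "f = 0" | "f \<in> K" "f \<noteq> 0" "fls_subdegree f \<ge> 0" by auto
  then show "f \<in> loc_ring lam Inf"
  proof cases
    case 2
    then obtain u where "u \<in> loc_ring lam Inf" "f = u * (X / Y) powi fls_subdegree f" using inf_K by blast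
    moreover have "(X / Y) powi fls_subdegree f = (X / Y) ^ nat (fls_subdegree f)"
      using 2 by (simp add: power_int_def)
    moreover have "X / Y \<in> loc_ring lam Inf" using I.O_pi by (simp add: Inf_unif)
    ultimately show ?thesis by (metis I.O_mult I.O_power)
  qed simp
qed (auto simp: O_Inf_subdegree I.O_K)

end

locale curve_point = curve_point_base
begin

text \<open>At an affine point, multiplying the denominator by its conjugate
  \<open>fe p (- q)\<close> gives its norm, a polynomial \<open>N\<close> in \<open>X\<close> alone.
  Only the root \<open>a\<close> of \<open>N\<close> matters, and each factor \<open>X - a\<close>
  is cancelled by two factors of the uniformizer.\<close>

lemma K_pi:
  assumes "f \<in> K"
  shows "\<exists>n. \<pi> ^ n * f \<in> O_w"
proof (cases w)
  case Inf
  show ?thesis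
  proof (cases "f = 0")
    case False
    then obtain u where u: "u \<in> O_w" "f = u * (X / Y) powi fls_subdegree f"
      using inf_K assms Inf by blast
    define s where "s = fls_subdegree f"
    have "\<pi> ^ nat (- s) * f = u * ((X / Y) ^ nat (- s) * (X / Y) powi s)"
      using u by (simp add: Inf Inf_unif s_def)
    also have "(X / Y) ^ nat (- s) * (X / Y) powi s = \<pi> ^ nat s"
      by (cases "s \<ge> 0") (auto simp: Inf Inf_unif power_int_def simp flip: power_mult_distrib)
    finally show ?thesis using u by (metis O_mult O_power O_pi)
  qed auto
next
  case (Aff a b)
  then have b: "b\<^sup>2 = cub a" using w_curve curve_iff by auto
  note A = Aff_point[OF b] and U = unif_Aff[OF b]
  obtain n d where nd: "n \<in> R" "d \<in> R" "d \<noteq> 0" "f = n / d" using assms by (auto simp: K_iff')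
  obtain p q where d: "d = fe p q" using nd by (auto simp: R_def)
  define N where "N = p\<^sup>2 - q\<^sup>2 * cubic"
  have N: "d * fe p (- q) = evalx X N"
    by (simp add: d N_def fe_def evalx_diff evalx_uminus evalx_mult evalx_power evalx_cubic algebra_simps power2_eq_square)
  then have Nnz: "evalx X N \<noteq> 0" "N \<noteq> 0"
    using nd d by auto
  obtain h where h: "N = [:- a, 1:] ^ order a N * h" "\<not> [:- a, 1:] dvd h"
    using order_decomp[OF Nnz(2)] by blast
  define m where "m = order a N"
  have h0: "poly h a \<noteq> 0" using h(2) by (simp add: poly_eq_0_iff_dvd)
  have Nx: "evalx X N = (X - fls_const a) ^ m * evalx X h"
    by (subst h(1)) (simp add: evalx_mult evalx_power m_def fls_const_uminus)
  \<comment> \<open>\<open>X - a\<close> vanishes at the point to order 2 if \<open>b = 0\<close>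
    and to order 1 otherwise, so the square of the uniformizer suffices in both cases.\<close>
  have "\<exists>u\<in>O_w. \<pi>\<^sup>2 = (X - fls_const a) * u"
  proof (cases "b = 0")
    case True
    have "1 / evalx X (slope a) \<in> O_w"
      using A slope_nz[of a] b True by (intro O_inverse) (auto simp: Aff)
    moreover have "\<pi>\<^sup>2 = (X - fls_const a) * (1 / evalx X (slope a))"
    proof -
      have "X - fls_const a = \<pi> * (\<pi> * evalx X (slope a))"
        using U(1,2) True by (simp add: Aff)
      moreover have "evalx X (slope a) \<noteq> 0"
        using A slope_nz[of a] b True by (metis ev_nz Aff power_zero_numeral)
      ultimately show ?thesis by (simp add: power2_eq_square)
    qed
    ultimately show ?thesis by blast
  next
    case False
    have "\<pi> * (1 / (Y + fls_const b)) \<in> O_w"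
    proof -
      have "Y \<in> O_w" using A(1) R_Y Aff by auto
      then show ?thesis using A(3) False by (intro O_mult O_inverse O_pi O_add O_const) (auto simp: Aff[symmetric] ev_add)
    qed
    moreover have "\<pi>\<^sup>2 = (X - fls_const a) * (\<pi> * (1 / (Y + fls_const b)))"
      using U(1) Y_shift_nz[of b] by (simp add: Aff power2_eq_square)
    ultimately show ?thesis by blast
  qed
  then obtain u where u: "u \<in> O_w" "\<pi>\<^sup>2 = (X - fls_const a) * u" by blast
  have "1 / evalx X h \<in> O_w"
    using A h0 by (intro O_inverse) (auto simp: Aff)
  moreover have "n * fe p (- q) \<in> O_w"
  proof -
    have "fe p (- q) \<in> R" by (auto simp: R_def)
    then show ?thesis using A(1) R_mult nd(1) unfolding Aff by blast
  qed
  ultimately have "(n * fe p (- q)) * u ^ m * (1 / evalx X h) \<in> O_w"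
    by (metis O_mult O_power u(1))
  also have "(n * fe p (- q)) * u ^ m * (1 / evalx X h) = \<pi> ^ (2 * m) * f"
  proof -
    have "fe p (- q) \<noteq> 0" using N Nnz(1) by (metis mult_zero_right)
    then have "f = n * fe p (- q) / evalx X N"
      using nd by (simp add: N[symmetric])
    then have "\<pi> ^ (2 * m) * f = ((X - fls_const a) * u) ^ m * (n * fe p (- q)) / evalx X N"
      by (simp add: power_mult u)
    then show ?thesis
      using X_shift_nz[of a] Nnz by (simp add: Nx power_mult_distrib)
  qed
  finally show ?thesis by blast
qed

text \<open>Together with regularity of \<open>del \<pi>\<close> this says that dx/y generates the
  differentials at every point, which reduces forms to functions. The value at infinity is -1/2. At
  an affine point it follows by differentiating \<open>X - a = \<pi> * (Y + b)\<close> if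
  \<open>b\<close> is nonzero, and \<open>Y = \<pi> * slope a\<close> if \<open>b = 0\<close>, and
  then evaluating.\<close>

lemma ev_del_pi: "ev w (del \<pi>) \<noteq> 0"
proof (cases w)
  case Inf
  have "1 / Y \<in> O_w"
    unfolding Inf loc_ring_Inf chart_ring_def mem_Collect_eq
    by (intro exI[of _ "[:0,1:]"] exI[of _ 1]) simp
  moreover have "(1 / Y) / \<pi> \<in> O_w"
    unfolding Inf Inf_unif O_Inf_iff by (auto intro!: K_intros simp: fls_divide_subdegree)
  ultimately have 1: "1 / Y \<in> O_w" "ev w (1 / Y) = 0" using ev_0_iff by auto
  have 2: "X / Y \<in> O_w" "ev w (X / Y) = 0" using O_pi ev_pi by (auto simp: Inf Inf_unif)
  define Q where "Q = (1 + L) * ((X / Y) * (X / Y)) - 2 * L * (X / Y) * (1 / Y)"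
  have "(1 + L) * ((X / Y) * (X / Y)) \<in> O_w" "2 * L * (X / Y) * (1 / Y) \<in> O_w"
    by (intro O_intros 1 2; simp)+
  moreover have "ev w ((1 + L) * ((X / Y) * (X / Y))) = 0" "ev w (2 * L * (X / Y) * (1 / Y)) = 0"
    by (subst ev_mult; (intro O_intros 1 2)?; simp add: ev_mult 1 2 del: times_divide_eq_right times_divide_eq_left times_divide_times_eq)+
  ultimately have Q: "Q \<in> O_w" "ev w Q = 0"
    unfolding Q_def by (simp_all only: O_diff ev_diff) simp
  have "del \<pi> = fls_const (- 1 / 2) - fls_const (1 / 2) * Q"
    unfolding Inf Inf_unif del_inf(2) Q_def fls_const_divide fls_const_uminus by (simp add: power2_eq_square field_simps)
  also have "ev w \<dots> = - 1 / 2"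
    by (simp only: ev_diff ev_mult ev_const O_const O_mult Q mult_zero_right diff_0_right)
  finally show ?thesis by simp
next
  case (Aff a b)
  then have b: "b\<^sup>2 = cub a" using w_curve curve_iff by auto
  note A = Aff_point[OF b, folded Aff] and U = unif_Aff[OF b, folded Aff]
  have YX: "Y \<in> O_w" "X \<in> O_w" "evalx X (slope a) \<in> O_w" using A(1) by auto
  have d: "del \<pi> \<in> O_w" "del Y \<in> O_w" by (auto intro: O_del YX)
  show ?thesis
  proof (cases "b = 0")
    case False
    have "del (X - fls_const a) = Y" by (simp add: del_diff)
    then have "Y = del \<pi> * (Y + fls_const b) + \<pi> * del Y"
      unfolding U(1) by (simp add: del_mult del_add)
    then have "ev w Y = ev w (del \<pi> * (Y + fls_const b) + \<pi> * del Y)" by metis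
    then have "b = ev w (del \<pi>) * (b + b)"
      using YX d A by (simp add: ev_add ev_mult O_intros)
    then show ?thesis using False by auto
  next
    case True
    have "del (Y - fls_const b) = del Y" by (simp add: del_diff)
    then have "del Y = del \<pi> * evalx X (slope a) + \<pi> * del (evalx X (slope a))"
      unfolding U(2) by (simp add: del_mult)
    then have "ev w (del Y) = ev w (del \<pi>) * poly (slope a) a"
      using YX d A by (simp add: ev_add ev_mult O_intros O_del)
    moreover have "ev w (del Y) \<noteq> 0"
    proof -
      have "del Y = fls_const (1 / 2) * (3 * (X * X) - 2 * (1 + L) * X + L)"
        by (simp add: del_Y fls_const_divide power2_eq_square)
      then have "ev w (del Y) = 1 / 2 * (3 * (a * a) - 2 * (1 + lam) * a + lam)"
        using YX A by (simp add: ev_add ev_mult ev_diff O_intros)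
      also have "\<dots> = 1 / 2 * poly (slope a) a" by (simp add: slope_at power2_eq_square)
      finally show ?thesis using slope_nz[of a] b True by auto
    qed
    ultimately show ?thesis by auto
  qed
qed

lemma max_ideal_eq: "max_ideal lam w = {\<pi> * f | f. f \<in> O_w}"
proof -
  have "f \<in> O_w \<and> \<not> (\<exists>g\<in>O_w. f * g = 1) \<longleftrightarrow> (\<exists>k\<in>O_w. f = \<pi> * k)" for f
  proof
    assume "f \<in> O_w \<and> \<not> (\<exists>g\<in>O_w. f * g = 1)"
    then show "\<exists>k\<in>O_w. f = \<pi> * k" using O_unit by blast
  next
    assume "\<exists>k\<in>O_w. f = \<pi> * k"
    then obtain k where k: "k \<in> O_w" "f = \<pi> * k" by blast
    have "f * g \<noteq> 1" if "g \<in> O_w" for g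
    proof
      assume "f * g = 1"
      then have "ev w (\<pi> * (k * g)) = 1" using k by (simp add: mult.assoc)
      then show False using k that by (simp add: ev_mult O_mult)
    qed
    with k show "f \<in> O_w \<and> \<not> (\<exists>g\<in>O_w. f * g = 1)" by (auto intro: O_mult)
  qed
  then show ?thesis by (auto simp: max_ideal_def)
qed

lemma max_ideal_iff: "f \<in> max_ideal lam w \<longleftrightarrow> f / \<pi> \<in> O_w"
  unfolding max_ideal_eq mem_Collect_eq
  by (metis nonzero_mult_div_cancel_left pi_nz nonzero_mult_div_cancel_right times_divide_eq_right)

lemma max_ideal_ev: "f \<in> max_ideal lam w \<longleftrightarrow> f \<in> O_w \<and> ev w f = 0"
  unfolding max_ideal_iff using ev_0_iff O_mult[of \<pi> "f / \<pi>"] by auto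

lemma uniformizer_iff: "uniformizer lam w \<rho> \<longleftrightarrow> (\<exists>u\<in>O_w. ev w u \<noteq> 0 \<and> \<rho> = \<pi> * u)"
proof
  assume "uniformizer lam w \<rho>"
  then have eq: "{\<pi> * f | f. f \<in> O_w} = {\<rho> * f | f. f \<in> O_w}"
    by (simp add: uniformizer_def max_ideal_eq)
  moreover have "\<rho> \<in> {\<rho> * f | f. f \<in> O_w}" "\<pi> \<in> {\<pi> * f | f. f \<in> O_w}"
    by (auto intro: exI[of _ 1])
  ultimately obtain u v where u: "u \<in> O_w" "\<rho> = \<pi> * u" and v: "v \<in> O_w" "\<pi> = \<rho> * v"
    by blast
  then have "\<pi> * (u * v) = \<pi> * 1" by (metis mult.assoc mult.right_neutral)
  then have "u * v = 1" by (metis mult_cancel_left pi_nz)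
  then have "ev w u * ev w v = 1" using u v by (metis ev_mult ev_01(2))
  then have "ev w u \<noteq> 0" by auto
  with u show "\<exists>u\<in>O_w. ev w u \<noteq> 0 \<and> \<rho> = \<pi> * u" by blast
next
  assume "\<exists>u\<in>O_w. ev w u \<noteq> 0 \<and> \<rho> = \<pi> * u"
  then obtain u where u: "u \<in> O_w" "ev w u \<noteq> 0" "\<rho> = \<pi> * u" by blast
  have "u \<noteq> 0" using u ev_nz by blast
  have "(\<exists>f. g = \<pi> * f \<and> f \<in> O_w) \<longleftrightarrow> (\<exists>f. g = \<rho> * f \<and> f \<in> O_w)" for g
  proof
    assume "\<exists>f. g = \<pi> * f \<and> f \<in> O_w"
    then obtain f where "f \<in> O_w" "g = \<pi> * f" by blast
    then have "g = \<rho> * (f / u)" "f / u \<in> O_w"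
      using u \<open>u \<noteq> 0\<close> by (auto intro: O_divide)
    then show "\<exists>f. g = \<rho> * f \<and> f \<in> O_w" by blast
  next
    assume "\<exists>f. g = \<rho> * f \<and> f \<in> O_w"
    then show "\<exists>f. g = \<pi> * f \<and> f \<in> O_w"
      using u O_mult by (auto simp: mult.assoc)
  qed
  then show "uniformizer lam w \<rho>"
    by (simp add: uniformizer_def max_ideal_eq)
qed

lemma uniformizer_unif [simp]: "uniformizer lam w \<pi>"
  unfolding uniformizer_iff by (rule bexI[of _ 1]) auto

lemma O_powi: "u \<in> O_w \<Longrightarrow> ev w u \<noteq> 0 \<Longrightarrow> u powi k \<in> O_w"
  by (cases "k \<ge> 0") (auto simp: power_int_def O_power inverse_eq_divide O_inverse intro!: O_power)

lemma div_stalk_iff: "f \<in> div_stalk lam D w \<longleftrightarrow> f * \<pi> powi D w \<in> O_w"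
proof
  assume "f \<in> div_stalk lam D w"
  then obtain g u where "g \<in> O_w" "u \<in> O_w" "ev w u \<noteq> 0" "f = g * (\<pi> * u) powi (- D w)"
    unfolding div_stalk_def uniformizer_iff by auto
  moreover from this have "f * \<pi> powi D w = g * u powi (- D w)"
    by (simp add: power_int_mult_distrib power_int_minus)
  ultimately show "f * \<pi> powi D w \<in> O_w" using O_mult O_powi by metis
next
  assume *: "f * \<pi> powi D w \<in> O_w"
  have "f = (f * \<pi> powi D w) * \<pi> powi (- D w)"
    by (simp add: power_int_minus)
  with * show "f \<in> div_stalk lam D w"
    unfolding div_stalk_def using uniformizer_unif by blast
qed

lemma del_unif:
  assumes "u \<in> O_w" "ev w u \<noteq> 0"
  shows "del (\<pi> * u) \<in> O_w" "ev w (del (\<pi> * u)) = ev w (del \<pi>) * ev w u" "del (\<pi> * u) \<noteq> 0"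
proof -
  have *: "del \<pi> \<in> O_w" "del u \<in> O_w" using assms by (auto intro: O_del)
  then show 1: "del (\<pi> * u) \<in> O_w"
    using assms by (simp add: del_mult O_add O_mult)
  show 2: "ev w (del (\<pi> * u)) = ev w (del \<pi>) * ev w u"
    using assms * by (simp add: del_mult ev_add ev_mult O_mult)
  show "del (\<pi> * u) \<noteq> 0"
    by (rule ev_nz) (use 2 assms ev_del_pi in auto)
qed

text \<open>Another uniformizer changes the generator of the stalk by a unit, and
  \<open>del \<pi>\<close> is itself a unit; so it is enough to compare with \<open>eta\<close> and
  the fixed \<open>unif w\<close>.\<close>

lemma form_stalk_iff: "\<omega> \<in> form_stalk lam S w \<longleftrightarrow> \<omega> / eta * (if w \<in> S then \<pi> else 1) \<in> O_w"
proof
  assume "\<omega> \<in> form_stalk lam S w"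
  then obtain f u where *: "f \<in> O_w" "u \<in> O_w" "ev w u \<noteq> 0"
      "\<omega> = f * (fls_deriv (\<pi> * u) / (if w \<in> S then \<pi> * u else 1))"
    unfolding form_stalk_def uniformizer_iff by auto
  then have "\<omega> / eta * (if w \<in> S then \<pi> else 1) = f * del (\<pi> * u) / (if w \<in> S then u else 1)"
    by (simp add: deriv_eq_del)
  also have "\<dots> \<in> O_w"
    using * del_unif(1)[of u] by (auto intro!: O_divide O_mult)
  finally show "\<omega> / eta * (if w \<in> S then \<pi> else 1) \<in> O_w" .
next
  assume *: "\<omega> / eta * (if w \<in> S then \<pi> else 1) \<in> O_w"
  have d: "del \<pi> \<noteq> 0" "del \<pi> \<in> O_w" using ev_del_pi O_del by auto
  then have "(\<omega> / eta * (if w \<in> S then \<pi> else 1)) / del \<pi> \<in> O_w"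
    using * ev_del_pi by (intro O_divide)
  moreover have "\<omega> = (\<omega> / eta * (if w \<in> S then \<pi> else 1)) / del \<pi> * (fls_deriv \<pi> / (if w \<in> S then \<pi> else 1))"
    using d by (simp add: deriv_eq_del)
  ultimately show "\<omega> \<in> form_stalk lam S w"
    unfolding form_stalk_def using uniformizer_unif by blast
qed

text \<open>The residue at \<open>w\<close> of the form \<open>f dx / y\<close>, if it has at most a simple pole.\<close>

definition res :: "complex fls \<Rightarrow> complex" where
  "res f = ev w (\<pi> * f / del \<pi>)"

text \<open>If \<open>\<rho> = \<pi> * u\<close>, then \<open>del \<rho>\<close> has the value of
  \<open>del \<pi> * u\<close> at the point, and \<open>u\<close> cancels. The independence is
  needed because \<open>res_rep\<close> picks its uniformizer by choice.\<close>

lemma res_uniformizer: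
  assumes "uniformizer lam w \<rho>" "\<pi> * f \<in> O_w"
  shows "\<rho> / del \<rho> * f \<in> O_w" "ev w (\<rho> / del \<rho> * f) = res f" "\<rho> / del \<rho> \<in> O_w" "ev w (\<rho> / del \<rho>) = 0"
    "\<rho> \<noteq> 0" "del \<rho> \<noteq> 0"
proof -
  obtain u where u: "u \<in> O_w" "ev w u \<noteq> 0" "\<rho> = \<pi> * u" using assms uniformizer_iff by blast
  note d = del_unif[OF u(1,2), folded u(3)]
  have nz: "u \<noteq> 0" "del \<pi> \<noteq> 0" "del \<pi> \<in> O_w" using u ev_nz ev_del_pi O_del by auto
  have "ev w (del \<rho>) \<noteq> 0" using d u ev_del_pi by simp
  have e: "\<rho> / del \<rho> * f = (\<pi> * f) * u / del \<rho>" by (simp add: u)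
  have "(\<pi> * f) * u / del \<rho> \<in> O_w"
    by (rule O_divide[OF O_mult[OF assms(2) u(1)] d(1)]) fact
  moreover have "ev w ((\<pi> * f) * u / del \<rho>) = ev w (\<pi> * f) / ev w (del \<pi>)"
    using assms u d \<open>ev w (del \<rho>) \<noteq> 0\<close> by (subst ev_divide) (auto intro: O_mult simp: ev_mult)
  ultimately show "\<rho> / del \<rho> * f \<in> O_w" "ev w (\<rho> / del \<rho> * f) = res f"
    unfolding res_def e using assms ev_del_pi nz by (simp_all add: ev_divide[OF assms(2) nz(3) ev_del_pi])
  show "\<rho> / del \<rho> \<in> O_w" "ev w (\<rho> / del \<rho>) = 0"
    using u d \<open>ev w (del \<rho>) \<noteq> 0\<close> by (auto intro!: O_divide O_mult simp: ev_divide ev_mult O_mult)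
  show "\<rho> \<noteq> 0" "del \<rho> \<noteq> 0" using u nz d by auto
qed

lemma some_uniformizer: "uniformizer lam w (SOME \<rho>. uniformizer lam w \<rho>)"
  using uniformizer_unif by (rule someI)

lemma res_eq_0: "\<pi> * f \<in> O_w \<Longrightarrow> res f = 0 \<Longrightarrow> f \<in> O_w"
proof -
  assume f: "\<pi> * f \<in> O_w" "res f = 0"
  have d: "del \<pi> \<in> O_w" using O_del by auto
  have "ev w (\<pi> * f) = 0"
    using f ev_del_pi by (simp add: res_def ev_divide[OF f(1) d ev_del_pi])
  then show "f \<in> O_w" using ev_0_iff[OF f(1)] by simp
qed

end

section \<open>Global functions with prescribed principal parts\<close>

context elliptic
begin

lemma curve_point: "w \<in> curve lam \<Longrightarrow> curve_point lam w"
  by unfold_locales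

text \<open>A function without poles in the affine part is a polynomial in \<open>x\<close> and \<open>y\<close>.\<close>

lemma regular_affine_R:
  assumes "\<And>a b. b\<^sup>2 = cub a \<Longrightarrow> f \<in> loc_ring lam (Aff a b)"
  shows "f \<in> R"
proof -
  \<comment> \<open>The denominator may be taken in \<open>X\<close> alone, by passing to the norm
    below. Its roots are then cancelled one at a time, by induction on the degree.\<close>
  have main: "fe p q / evalx X N \<in> R"
    if "N \<noteq> 0" "\<And>a b. b\<^sup>2 = cub a \<Longrightarrow> fe p q / evalx X N \<in> loc_ring lam (Aff a b)" for p q N
    using that
  proof (induction "degree N" arbitrary: p q N rule: less_induct)
    case less
    show ?case
    proof (cases "degree N = 0")
      case True
      then obtain c where "N = [:c:]" "c \<noteq> 0" using less.prems(1) by (metis degree_eq_zeroE pCons_0_0)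
      then have "fe p q / evalx X N = fls_const (1 / c) * fe p q"
        by (simp add: fls_const_divide)
      moreover have "fe p q \<in> R" by (auto simp: R_def)
      ultimately show ?thesis by (simp add: R_mult)
    next
      case False
      then obtain a where a: "poly N a = 0"
        using fundamental_theorem_of_algebra[of N] by (auto simp: constant_degree)
      then obtain N' where N': "N = [:- a, 1:] * N'" by (auto simp: poly_eq_0_iff_dvd)
      with less.prems have "N' \<noteq> 0" by auto
      then have deg: "degree N' < degree N" unfolding N' by (subst degree_mult_eq) auto
      have Nnz: "evalx X N' \<noteq> 0" using \<open>N' \<noteq> 0\<close> subdegree_evalx by blast
      have Nx: "evalx X N = (X - fls_const a) * evalx X N'"
        unfolding N' evalx_mult by (simp add: fls_const_uminus)
      define b where "b = csqrt (cub a)"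
      have b: "b\<^sup>2 = cub a" "(- b)\<^sup>2 = cub a" by (auto simp: b_def)
      have vanish: "fe p q / (X - fls_const a) \<in> loc_ring lam (Aff a c)"
        "poly p a + poly q a * c = 0" if c: "c\<^sup>2 = cub a" for c
      proof -
        interpret w: curve_point lam "Aff a c" using c curve_iff by unfold_locales auto
        note A = Aff_point[OF c]
        have XY: "X \<in> w.O_w" "Y \<in> w.O_w" "evalx X q \<in> w.O_w" for q using A(1) by auto
        have "fe p q / evalx X N * evalx X N' \<in> w.O_w"
          using less.prems(2)[OF c] XY by (intro w.O_mult)
        moreover have e: "fe p q / evalx X N * evalx X N' = fe p q / (X - fls_const a)"
          using Nnz by (simp add: Nx)
        ultimately show 1: "fe p q / (X - fls_const a) \<in> loc_ring lam (Aff a c)" by simp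
        have "fe p q = fe p q / (X - fls_const a) * (X - fls_const a)"
          using X_shift_nz[of a] by simp
        then have "ev (Aff a c) (fe p q) = ev (Aff a c) (fe p q / (X - fls_const a)) * ev (Aff a c) (X - fls_const a)"
          using 1 XY by (metis w.ev_mult w.O_diff w.O_const)
        also have "ev (Aff a c) (X - fls_const a) = 0"
          using XY A by (simp add: w.ev_diff)
        finally have "ev (Aff a c) (fe p q) = 0" by simp
        then show "poly p a + poly q a * c = 0"
          using XY A by (simp add: fe_def w.ev_add w.ev_mult w.O_mult)
      qed
      \<comment> \<open>Two linear equations are needed to make both components divisible by
        \<open>X - a\<close>. If \<open>b\<close> is nonzero, the two points over \<open>a\<close>
        supply them; over a branch point only one comes from evaluation.\<close>
      have 0: "poly p a = 0 \<and> poly q a = 0"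
      proof (cases "b = 0")
        case False
        have "poly p a + poly q a * b = 0" "poly p a + poly q a * (- b) = 0"
          using vanish(2) b by blast+
        then have "2 * poly p a = 0" "2 * (poly q a * b) = 0" by (simp_all add: algebra_simps)
        then show ?thesis using False by auto
      next
        case True
        then have "poly p a = 0" using vanish(2)[OF b(1)] by simp
        then obtain p' where p': "p = [:- a, 1:] * p'" by (auto simp: poly_eq_0_iff_dvd)
        interpret w: curve_point lam "Aff a b" using b curve_iff by unfold_locales auto
        note A = Aff_point[OF b(1)]
        have XY: "X \<in> w.O_w" "Y \<in> w.O_w" "evalx X q \<in> w.O_w" for q using A(1) by auto
        have px: "evalx X p = (X - fls_const a) * evalx X p'"
          unfolding p' evalx_mult by (simp add: fls_const_uminus)
        have sl: "Y * Y = (X - fls_const a) * evalx X (slope a)"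
          using slope_eq[OF b(1)] True by simp
        \<comment> \<open>The second equation at a branch point: without the divisible part
          \<open>p\<close>, the regular function left over is \<open>q * Y / (X - a)\<close>. Times
          \<open>Y\<close> it becomes \<open>q * slope a\<close>, whose value is 0 because
          \<open>Y\<close> vanishes there, while the slope does not.\<close>
        have "(fe p q / (X - fls_const a) - evalx X p') * Y = evalx X q * (Y * Y / (X - fls_const a))"
          using X_shift_nz[of a] by (simp add: fe_def px field_simps)
        also have "Y * Y / (X - fls_const a) = evalx X (slope a)"
          using sl X_shift_nz[of a] by simp
        finally have "ev (Aff a b) (evalx X q * evalx X (slope a)) =
            ev (Aff a b) (fe p q / (X - fls_const a) - evalx X p') * ev (Aff a b) Y"
          using XY vanish(1)[OF b(1)] by (metis w.ev_mult w.O_diff)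
        then have "poly q a * poly (slope a) a = ev (Aff a b) (fe p q / (X - fls_const a) - evalx X p') * b"
          using XY A by (simp only: w.ev_mult)
        then show ?thesis using \<open>poly p a = 0\<close> slope_nz[of a] True b by auto
      qed
      then have "[:- a, 1:] dvd p" "[:- a, 1:] dvd q" by (simp_all add: poly_eq_0_iff_dvd)
      then obtain p' q' where pq: "p = [:- a, 1:] * p'" "q = [:- a, 1:] * q'"
        unfolding dvd_def by (elim exE) (rule that)
      have "fe p q = (X - fls_const a) * fe p' q'"
        unfolding pq fe_def evalx_mult by (simp add: fls_const_uminus algebra_simps)
      then have e: "fe p q / evalx X N = fe p' q' / evalx X N'"
        using X_shift_nz[of a] by (simp add: Nx)
      show ?thesis
        using less.hyps[OF deg \<open>N' \<noteq> 0\<close>, of p' q'] less.prems(2) unfolding e by blast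
    qed
  qed
  obtain b where "b\<^sup>2 = cub 0" by (metis power2_csqrt)
  then have "f \<in> K"
    using assms curve_point_base.O_K[of lam "Aff 0 b" f] curve_point_base[of "Aff 0 b"] curve_iff by auto
  then obtain n d where nd: "n \<in> R" "d \<in> R" "d \<noteq> 0" "f = n / d" by (auto simp: K_iff')
  obtain p q where d: "d = fe p q" using nd by (auto simp: R_def)
  define N where "N = p\<^sup>2 - q\<^sup>2 * cubic"
  have N: "d * fe p (- q) = evalx X N"
    by (simp add: d N_def fe_def evalx_diff evalx_uminus evalx_mult evalx_power evalx_cubic algebra_simps power2_eq_square)
  have pq: "fe p (- q) \<noteq> 0" using nd d by auto
  then have "N \<noteq> 0" using N nd by auto
  have "n * fe p (- q) \<in> R" using nd by (intro R_mult) (auto simp: R_def)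
  then obtain p' q' where "n * fe p (- q) = fe p' q'" by (auto simp: R_def)
  moreover have "f = n * fe p (- q) / evalx X N" using nd pq by (simp add: N[symmetric])
  ultimately have f: "f = fe p' q' / evalx X N" by simp
  show ?thesis unfolding f by (rule main[OF \<open>N \<noteq> 0\<close>]) (use assms f in auto)
qed

lemma regular_affine_R_iff: "f \<in> R \<longleftrightarrow> (\<forall>w\<in>curve lam - {Inf}. f \<in> loc_ring lam w)"
proof
  assume "f \<in> R"
  then show "\<forall>w\<in>curve lam - {Inf}. f \<in> loc_ring lam w"
    using Aff_point(1) curve_iff by (metis DiffE insertCI point.exhaust subsetD)
next
  assume "\<forall>w\<in>curve lam - {Inf}. f \<in> loc_ring lam w"
  then show "f \<in> R"
    using curve_iff by (intro regular_affine_R) auto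
qed

text \<open>A pole of order exactly 1 at infinity never occurs in \<open>R\<close>: the even orders
  come from \<open>p\<close>, and the odd ones start at 3.\<close>

lemma R_subdegree_const:
  assumes "f \<in> R" "f = 0 \<or> fls_subdegree f \<ge> - 1"
  shows "\<exists>c. f = fls_const c"
proof -
  obtain p q where f: "f = fe p q" using assms by (auto simp: R_def)
  show ?thesis
  proof (cases "p = 0 \<and> q = 0")
    case True
    then show ?thesis using f by (auto intro: exI[of _ 0])
  next
    case False
    then have nz: "p \<noteq> 0 \<or> q \<noteq> 0" by auto
    have sd: "fls_subdegree f \<ge> - 1" using assms False f by auto
    have "q = 0" "degree p = 0"
      using subdegree_fe(2,3)[OF nz] sd f by force+
    then show ?thesis using f by (metis add.right_neutral degree_eq_zeroE evalx_0 evalx_pCons fe_def mult_zero_left mult_zero_right)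
  qed
qed

lemma R_subdegree_3:
  assumes "f \<in> R" "f = 0 \<or> fls_subdegree f \<ge> - 3"
  shows "\<exists>c0 c1 c2. f = fls_const c0 + fls_const c1 * X + fls_const c2 * Y"
proof -
  obtain p q where f: "f = fe p q" using assms by (auto simp: R_def)
  have "degree p \<le> 1 \<and> degree q = 0"
  proof (cases "p = 0 \<and> q = 0")
    case False
    then have nz: "p \<noteq> 0 \<or> q \<noteq> 0" by auto
    have sd: "fls_subdegree f \<ge> - 3" using assms False f by auto
    show ?thesis
      using subdegree_fe(2,3)[OF nz] sd f by (cases "p = 0"; cases "q = 0") auto
  qed auto
  then obtain c0 c1 c2 where "p = [:c0, c1:]" "q = [:c2:]"
    by (metis degree1_coeffs degree_eq_zeroE le_SucE One_nat_def le_zero_eq pCons_0_0)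
  then have "f = fls_const c0 + fls_const c1 * X + fls_const c2 * Y"
    unfolding f fe_def by (simp add: mult.commute)
  then show ?thesis by blast
qed

text \<open>\<open>(y + b) / (x - a)\<close> has a simple pole at \<open>(a, b)\<close> and no other pole in the affine part.\<close>

lemma principal_part_affine:
  assumes b: "b\<^sup>2 = cub a" and "c \<in> K"
  shows "\<exists>h\<in>K. h - c \<in> loc_ring lam (Aff a b) \<and>
           (\<forall>w\<in>curve lam - {Inf, Aff a b}. h \<in> loc_ring lam w)"
proof -
  interpret w: curve_point lam "Aff a b" using b curve_iff by unfold_locales auto
  define \<phi> where "\<phi> = 1 / w.\<pi>"
  have phi: "\<phi> = (Y + fls_const b) / (X - fls_const a)" by (simp add: \<phi>_def unif_def)
  have phi_reg: "\<phi> \<in> loc_ring lam v" if that_v: "v \<in> curve lam - {Inf, Aff a b}" for v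
  proof -
    obtain a' b' where v: "v = Aff a' b'" "b'\<^sup>2 = cub a'" "a' \<noteq> a \<or> b' \<noteq> b"
    proof (cases v)
      case (Aff a' b')
      with that_v curve_iff show ?thesis by (intro that[of a' b']) auto
    qed (use that_v in auto)
    interpret v: curve_point lam v using that by unfold_locales auto
    note A = Aff_point[OF v(2), folded v(1)]
    have XY: "X \<in> v.O_w" "Y \<in> v.O_w" "evalx X q \<in> v.O_w" for q using A(1) by auto
    show ?thesis
    proof (cases "a' = a")
      case False
      then show ?thesis
        unfolding phi using XY A by (intro v.O_divide) (auto intro!: v.O_add v.O_diff simp: v.ev_diff)
    next
      case True
      then have "b'\<^sup>2 = b\<^sup>2" "b' \<noteq> b" using v b by auto
      then have "b' = - b" by (simp add: power2_eq_iff)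
      \<comment> \<open>At the conjugate point \<open>(a, -b)\<close> numerator and denominator of
        \<open>\<phi>\<close> both vanish; this other expression has a nonvanishing
        denominator.\<close>
      have "\<phi> = evalx X (slope a) / (Y - fls_const b)"
        using slope_eq[OF b] X_shift_nz[of a] Y_shift_nz[of b] by (simp add: phi field_simps)
      then show ?thesis
        using XY A \<open>b' \<noteq> b\<close> by (simp only:) (intro v.O_divide, auto intro!: v.O_diff simp: v.ev_diff)
    qed
  qed
  \<comment> \<open>Induction on a bound for the pole order: a multiple of
    \<open>\<phi> ^ Suc n\<close> removes the leading term, with \<open>e\<close> its
    coefficient.\<close>
  have main: "w.\<pi> ^ n * c \<in> w.O_w \<Longrightarrow> c \<in> K \<Longrightarrow> \<exists>h\<in>K. h - c \<in> w.O_w \<and>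
           (\<forall>v\<in>curve lam - {Inf, Aff a b}. h \<in> loc_ring lam v)" for n c
  proof (induction n arbitrary: c)
    case 0
    show ?case
      using 0 curve_point_base curve_point_base.O_01(1) w.O_uminus
      by (intro bexI[of _ 0]) auto
  next
    case (Suc n)
    define e where "e = ev (Aff a b) (w.\<pi> ^ Suc n * c)"
    obtain k where k: "k \<in> w.O_w" "w.\<pi> ^ Suc n * c = fls_const e + w.\<pi> * k"
      using w.ev_dec[OF Suc.prems(1)] unfolding e_def by blast
    define c' where "c' = c - fls_const e * \<phi> ^ Suc n"
    have "w.\<pi> * (w.\<pi> ^ n * c') = w.\<pi> * k"
      using k(2) w.pi_nz by (simp add: c'_def \<phi>_def power_one_over field_simps)
    then have "w.\<pi> ^ n * c' = k" using w.pi_nz by simp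
    moreover have "\<phi> \<in> K" unfolding phi by (intro K_intros) auto
    ultimately have "c' \<in> K" "w.\<pi> ^ n * c' \<in> w.O_w"
      using Suc.prems k unfolding c'_def by (auto intro!: K_intros simp del: power_Suc)
    then obtain h where h: "h \<in> K" "h - c' \<in> w.O_w" "\<forall>v\<in>curve lam - {Inf, Aff a b}. h \<in> loc_ring lam v"
      using Suc.IH by blast
    show ?case
    proof (intro bexI[of _ "h + fls_const e * \<phi> ^ Suc n"] conjI ballI)
      show "h + fls_const e * \<phi> ^ Suc n - c \<in> w.O_w"
        using h by (simp add: c'_def algebra_simps)
      show "h + fls_const e * \<phi> ^ Suc n \<in> K"
        using h \<open>\<phi> \<in> K\<close> by (intro K_intros) auto
      fix v assume v: "v \<in> curve lam - {Inf, Aff a b}"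
      interpret v: curve_point lam v using v by unfold_locales auto
      show "h + fls_const e * \<phi> ^ Suc n \<in> loc_ring lam v"
        using h v phi_reg[OF v] by (intro v.O_add v.O_mult v.O_power v.O_const) auto
    qed
  qed
  show ?thesis using w.K_pi[OF \<open>c \<in> K\<close>] main[OF _ \<open>c \<in> K\<close>] by blast
qed

text \<open>A new point is treated by a correction that is regular at all other affine points and
  hence preserves the principal parts already achieved. Poles at infinity remain unrestricted, which
  is why no obstruction arises.\<close>

lemma mittag_leffler:
  assumes "finite B" "B \<subseteq> curve lam - {Inf}" "\<And>w. w \<in> B \<Longrightarrow> c w \<in> K"
  shows "\<exists>h\<in>K. (\<forall>w\<in>B. h - c w \<in> loc_ring lam w) \<and> (\<forall>w\<in>curve lam - {Inf} - B. h \<in> loc_ring lam w)"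
  using assms
proof (induction B rule: finite_induct)
  case empty
  show ?case using R_01(1) regular_affine_R_iff by (intro bexI[of _ 0]) auto
next
  case (insert w B)
  then obtain h where h: "h \<in> K" "\<forall>w\<in>B. h - c w \<in> loc_ring lam w" "\<forall>w\<in>curve lam - {Inf} - B. h \<in> loc_ring lam w"
    by auto
  obtain a b where w: "w = Aff a b" "b\<^sup>2 = cub a" using insert.prems curve_iff by (cases w) auto
  have "c w - h \<in> K" using insert.prems h by (auto intro: K_intros)
  then obtain h' where h': "h' \<in> K" "h' - (c w - h) \<in> loc_ring lam w" "\<forall>v\<in>curve lam - {Inf, w}. h' \<in> loc_ring lam v"
    using principal_part_affine[OF w(2)] w(1) by blast
  show ?case
  proof (intro bexI[of _ "h + h'"] conjI ballI)
    show "h + h' \<in> K" using h h' by (intro K_intros)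
    fix v assume v: "v \<in> insert w B"
    interpret v: curve_point lam v using v insert.prems by unfold_locales auto
    show "h + h' - c v \<in> loc_ring lam v"
    proof (cases "v = w")
      case True
      then show ?thesis using h'(2) by (simp add: algebra_simps)
    next
      case False
      then have "h - c v \<in> v.O_w" "h' \<in> v.O_w" using v h h' insert.prems by auto
      then have "(h - c v) + h' \<in> v.O_w" by (rule v.O_add)
      then show ?thesis by (simp add: algebra_simps)
    qed
  next
    fix v assume v: "v \<in> curve lam - {Inf} - insert w B"
    interpret v: curve_point lam v using v by unfold_locales auto
    show "h + h' \<in> loc_ring lam v"
      using h h' v by (intro v.O_add) auto
  qed
qed

text \<open>There is no function with a single simple pole, hence the extra term.\<close>

lemma principal_part_Inf:
  assumes "f \<in> K"
  shows "\<exists>\<rho>\<in>R. \<exists>\<kappa>. (f - \<rho> - fls_const \<kappa> * (X\<^sup>2 / Y)) * (Y / X) \<in> loc_ring lam Inf"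
proof -
  have main: "\<forall>n < - int k. fls_nth f n = 0 \<Longrightarrow> f \<in> K \<Longrightarrow>
      \<exists>\<rho>\<in>R. \<exists>\<kappa>. (f - \<rho> - fls_const \<kappa> * (X\<^sup>2 / Y)) * (Y / X) \<in> loc_ring lam Inf" for k f
  proof (induction k arbitrary: f rule: less_induct)
    case (less k)
    have step: "\<exists>c. \<forall>n<1 - int k. fls_nth (f - fls_const c * g) n = 0" if g: "g \<noteq> 0" "fls_subdegree g = - int k" for g
    proof (intro exI allI impI)
      fix n assume "n < 1 - int k"
      then consider "n < - int k" | "n = - int k" by linarith
      then show "fls_nth (f - fls_const (fls_nth f (- int k) / fls_nth g (- int k)) * g) n = 0"
      proof cases
        case 2
        have "fls_nth g (- int k) \<noteq> 0" using nth_fls_subdegree_nonzero g by metis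
        then show ?thesis using 2 by simp
      qed (use less.prems g in auto)
    qed
    have red: ?case if k: "k > 0" and g: "g \<in> R" "g \<noteq> 0" "fls_subdegree g = - int k" for g
    proof -
      have k1: "- int (k - 1) = 1 - int k" using k by auto
      obtain c where c: "\<forall>n<1 - int k. fls_nth (f - fls_const c * g) n = 0"
        using step g by blast
      have "f - fls_const c * g \<in> K" using less.prems g by (intro K_intros) (auto intro: K_R)
      then obtain \<rho> \<kappa> where "\<rho> \<in> R" and *: "((f - fls_const c * g) - \<rho> - fls_const \<kappa> * (X\<^sup>2 / Y)) * (Y / X) \<in> loc_ring lam Inf"
        using less.IH[of "k - 1", OF _ c[folded k1]] k by auto
      have "(f - fls_const c * g) - \<rho> = f - (fls_const c * g + \<rho>)" by simp
      with * have "(f - (fls_const c * g + \<rho>) - fls_const \<kappa> * (X\<^sup>2 / Y)) * (Y / X) \<in> loc_ring lam Inf" by simp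
      moreover have "fls_const c * g + \<rho> \<in> R" using \<open>\<rho> \<in> R\<close> g by (intro R_intros) auto
      ultimately show ?thesis by blast
    qed
    \<comment> \<open>A pole of order \<open>2 * j\<close> is removed by \<open>X ^ j\<close> and
      one of order \<open>2 * j + 3\<close> by \<open>X ^ j * Y\<close>, both in \<open>R\<close>.
      Order 1 is the gap, filled by \<open>X\<^sup>2 / Y\<close>.\<close>
    consider "k = 0" | "k = 1" | j where "k = 2 * j" "j > 0" | j where "k = 2 * j + 3"
    proof -
      have "k = 0 \<or> k = 1 \<or> (\<exists>j. k = 2 * j \<and> j > 0) \<or> (\<exists>j. k = 2 * j + 3)" by presburger
      then show ?thesis using that by blast
    qed
    then show ?case
    proof cases
      case 1
      then obtain c where c: "\<forall>n<1. fls_nth (f - fls_const c) n = 0"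
        using step[of 1] by auto
      \<comment> \<open>The remainder must vanish at infinity and not merely be regular, because it
        will be multiplied by sections of O(w_inf), which may have a simple pole. Hence the constant
        term is removed as well.\<close>
      have "(f - fls_const c) * (Y / X) \<in> loc_ring lam Inf"
      proof (cases "f - fls_const c = 0")
        case False
        then have "fls_subdegree (f - fls_const c) \<ge> 1"
          using c by (intro fls_subdegree_geI) auto
        then have "fls_subdegree ((f - fls_const c) * (Y / X)) \<ge> 0"
          using False by (simp add: fls_divide_subdegree)
        then show ?thesis unfolding O_Inf_iff using less.prems by (auto intro!: K_intros)
      qed (simp only: mult_zero_left, simp add: O_Inf_iff)
      then show ?thesis by (intro bexI[of _ "fls_const c"] exI[of _ 0]) auto
    next
      case 2
      then obtain c where c: "\<forall>n < - int 0. fls_nth (f - fls_const c * (X\<^sup>2 / Y)) n = 0"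
        using step[of "X\<^sup>2 / Y"] by (auto simp: fls_divide_subdegree fls_subdegree_pow)
      have "f - fls_const c * (X\<^sup>2 / Y) \<in> K" using less.prems by (intro K_intros) auto
      then obtain \<rho> \<kappa> where "\<rho> \<in> R" and *: "((f - fls_const c * (X\<^sup>2 / Y)) - \<rho> - fls_const \<kappa> * (X\<^sup>2 / Y)) * (Y / X) \<in> loc_ring lam Inf"
        using less.IH[of 0, OF _ c] 2 by auto
      have "(f - fls_const c * (X\<^sup>2 / Y)) - \<rho> - fls_const \<kappa> * (X\<^sup>2 / Y) = f - \<rho> - fls_const (c + \<kappa>) * (X\<^sup>2 / Y)"
        unfolding fls_const_add by (simp only: algebra_simps)
      with * show ?thesis using \<open>\<rho> \<in> R\<close> by metis
    next
      case 3
      show ?thesis using 3 by (intro red[of "X ^ j"]) (auto intro: R_intros simp: fls_subdegree_pow)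
    next
      case 4
      show ?thesis using 4 by (intro red[of "X ^ j * Y"]) (auto intro!: R_mult R_power simp: fls_subdegree_pow)
    qed
  qed
  show ?thesis
    by (rule main[of "nat (- fls_subdegree f)", OF _ assms]) auto
qed

end

section \<open>The non-trivial extension\<close>

lemma vec2_eq_iff: "(u :: 'a ^ 2) = v \<longleftrightarrow> u $ 1 = v $ 1 \<and> u $ 2 = v $ 2"
  by (simp add: vec_eq_iff forall_2)

lemma mult_mv2: "((A :: complex fls ^ 2 ^ 2) *v s) $ i = A $ i $ 1 * s $ 1 + A $ i $ 2 * s $ 2"
  by (simp add: matrix_vector_mult_def sum_2)

lemma axis_2 [simp]: "axis 1 x $ (1::2) = x" "axis 1 x $ (2::2) = 0"
  by (simp_all add: axis_def)

context elliptic
begin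

text \<open>
  Over the affine part, \<open>E\<close> is generated by \<open>(1, 0)\<close> and \<open>(h, 1)\<close>, and near infinity by \<open>(1, 0)\<close>
  and \<open>(y / x) (h, 1) + k x (1, 0)\<close>; the extension does not split because \<open>k \<noteq> 0\<close>.
\<close>

definition normal_form :: "2 vbundle \<Rightarrow> complex fls \<Rightarrow> complex \<Rightarrow> bool" where
  "normal_form E h k \<longleftrightarrow> h \<in> K \<and> k \<noteq> 0 \<and>
     (\<forall>w\<in>curve lam - {Inf}. \<forall>v. v \<in> E w \<longleftrightarrow> v $ 1 - h * v $ 2 \<in> loc_ring lam w \<and> v $ 2 \<in> loc_ring lam w) \<and>
     (\<forall>v. v \<in> E Inf \<longleftrightarrow> v $ 1 - h * v $ 2 - fls_const k * X * (X / Y * v $ 2) \<in> loc_ring lam Inf \<and>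
                        X / Y * v $ 2 \<in> loc_ring lam Inf)"

lemma div_inf_stalk:
  assumes "w \<in> curve lam"
  shows "f \<in> div_stalk lam div_inf w \<longleftrightarrow> f * (if w = Inf then X / Y else 1) \<in> loc_ring lam w"
proof -
  interpret curve_point lam w using assms by (rule curve_point)
  show ?thesis
    by (auto simp: div_stalk_iff div_inf_def Inf_unif)
qed

text \<open>A preimage \<open>v\<close> of the generator \<open>1 / n\<close> of O(w_inf) splits the
  extension near \<open>w\<close>: subtracting the right multiple of \<open>v\<close> from a local
  section leaves an element of the subsheaf O. The function \<open>c\<close> is the slope of
  \<open>v\<close>.\<close>

lemma extension_local_form:
  assumes E: "nontrivial_extension lam E" and w: "w \<in> curve lam"
  defines "n \<equiv> (if w = Inf then X / Y else 1)"
  shows "\<exists>c\<in>K. \<forall>u. u \<in> E w \<longleftrightarrow> u $ 2 * n \<in> loc_ring lam w \<and> u $ 1 - c * u $ 2 \<in> loc_ring lam w"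
proof -
  interpret w: curve_point lam w using w by (rule curve_point)
  from E w obtain M :: "complex fls ^ 2 ^ 2" where M: "\<And>i j. M $ i $ j \<in> K" "E w = {M *v v | v. \<forall>i. v $ i \<in> w.O_w}"
    unfolding nontrivial_extension_def vector_bundle_def by meson
  have E1: "f *s axis 1 1 \<in> E w \<longleftrightarrow> f \<in> w.O_w" for f
    using E w unfolding nontrivial_extension_def by blast
  have E2: "{v $ 2 | v. v \<in> E w} = div_stalk lam div_inf w"
    using E w unfolding nontrivial_extension_def by blast
  have add: "u + v \<in> E w" if "u \<in> E w" "v \<in> E w" for u v
  proof -
    obtain u' v' where "u = M *v u'" "v = M *v v'" "\<forall>i. u' $ i \<in> w.O_w" "\<forall>i. v' $ i \<in> w.O_w"
      using \<open>u \<in> E w\<close> \<open>v \<in> E w\<close> M by auto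
    then have "u + v = M *v (u' + v') \<and> (\<forall>i. (u' + v') $ i \<in> w.O_w)"
      by (auto simp: matrix_vector_right_distrib w.O_add)
    then show ?thesis unfolding M by blast
  qed
  have scale: "f *s u \<in> E w" if "f \<in> w.O_w" "u \<in> E w" for f u
  proof -
    obtain u' where "u = M *v u'" "\<forall>i. u' $ i \<in> w.O_w"
      using \<open>u \<in> E w\<close> M by auto
    then have "f *s u = M *v (f *s u') \<and> (\<forall>i. (f *s u') $ i \<in> w.O_w)"
      using that by (auto simp: vec2_eq_iff mult_mv2 w.O_mult algebra_simps)
    then show ?thesis unfolding M by blast
  qed
  have nn: "n \<noteq> 0" "n \<in> K" by (auto simp: n_def intro!: K_intros)
  have "1 / n \<in> div_stalk lam div_inf w"
    unfolding div_inf_stalk[OF w] by (auto simp: n_def)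
  then obtain v where v: "v \<in> E w" "v $ 2 = 1 / n" using E2 by (auto simp: set_eq_iff) metis
  have "v $ 1 \<in> K"
  proof -
    obtain v' where "v = M *v v'" "\<forall>i. v' $ i \<in> w.O_w" using v M by auto
    then show ?thesis using M(1) w.O_K by (auto simp: mult_mv2 intro!: K_intros)
  qed
  define c where "c = v $ 1 * n"
  show ?thesis
  proof (intro bexI[of _ c] allI iffI conjI)
    show "c \<in> K" using nn \<open>v $ 1 \<in> K\<close> by (simp add: c_def K_mult)
    fix u
    have dec: "u = (u $ 1 - c * u $ 2) *s axis 1 1 + (u $ 2 * n) *s v"
      using v(2) nn by (simp add: vec2_eq_iff c_def)
    {
      assume u: "u \<in> E w"
      then have "u $ 2 \<in> div_stalk lam div_inf w" using E2 by blast
      then show f: "u $ 2 * n \<in> w.O_w" by (simp add: div_inf_stalk[OF w] n_def)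
      then have "u + (- (u $ 2 * n)) *s v \<in> E w"
        using u v by (intro add scale w.O_uminus)
      also have "u + (- (u $ 2 * n)) *s v = (u $ 1 - c * u $ 2) *s axis 1 1"
        using v(2) nn by (simp add: vec2_eq_iff c_def)
      finally show "u $ 1 - c * u $ 2 \<in> w.O_w" by (simp only: E1)
    }
    assume "u $ 2 * n \<in> w.O_w \<and> u $ 1 - c * u $ 2 \<in> w.O_w"
    then have "(u $ 1 - c * u $ 2) *s axis 1 1 \<in> E w" "(u $ 2 * n) *s v \<in> E w"
      using v scale by (simp_all only: E1)
    then show "u \<in> E w"
      by (subst dec) (rule add)
  qed
qed

text \<open>The local slopes \<open>c w\<close> matter only modulo regular functions. A single
  rational function \<open>h\<close> matches all of them away from infinity, and at infinity up to a
  multiple \<open>k\<close> of the function with a simple pole. This \<open>k\<close> is the class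
  of the extension.\<close>

lemma extension_normal_form:
  assumes E: "nontrivial_extension lam E"
  shows "\<exists>h k. normal_form E h k"
proof -
  define n where "n w = (if w = Inf then X / Y else 1)" for w
  obtain c where c: "\<And>w. w \<in> curve lam \<Longrightarrow> c w \<in> K"
    "\<And>w u. w \<in> curve lam \<Longrightarrow> u \<in> E w \<longleftrightarrow> u $ 2 * n w \<in> loc_ring lam w \<and> u $ 1 - c w * u $ 2 \<in> loc_ring lam w"
    using extension_local_form[OF E] unfolding n_def by metis
  define B where "B = {w \<in> curve lam. E w \<noteq> {v. \<forall>i. v $ i \<in> loc_ring lam w}} - {Inf}"
  have B: "finite B" "B \<subseteq> curve lam - {Inf}"
    using E unfolding B_def nontrivial_extension_def vector_bundle_def by auto
  \<comment> \<open>Outside \<open>B\<close> the bundle is the standard lattice, so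
    \<open>(0, 1)\<close> belongs to the stalk, and testing it shows that \<open>c w\<close> is
    regular.\<close>
  have cB: "- c w \<in> loc_ring lam w" if "w \<in> curve lam - {Inf} - B" for w
  proof -
    interpret w: curve_point lam w using that by unfold_locales auto
    have "E w = {v. \<forall>i. v $ i \<in> w.O_w}" using that unfolding B_def by blast
    moreover have "\<forall>i. (vector [0, 1] :: complex fls ^ 2) $ i \<in> w.O_w" unfolding forall_2 by simp
    ultimately have "vector [0, 1] \<in> E w" by simp
    then have "(vector [0, 1] :: complex fls ^ 2) $ 1 - c w * (vector [0, 1] :: complex fls ^ 2) $ 2 \<in> w.O_w"
      using c(2)[of w "vector [0, 1]"] that by blast
    then show ?thesis by simp
  qed
  obtain h0 where h0: "h0 \<in> K" "\<forall>w\<in>B. h0 - c w \<in> loc_ring lam w" "\<forall>w\<in>curve lam - {Inf} - B. h0 \<in> loc_ring lam w"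
    using mittag_leffler[OF B] c(1) B(2) by blast
  have h0c: "h0 - c w \<in> loc_ring lam w" if w: "w \<in> curve lam - {Inf}" for w
  proof (cases "w \<in> B")
    case False
    interpret w: curve_point lam w using w by unfold_locales auto
    have "h0 + - c w \<in> w.O_w" using False w h0 cB by (intro w.O_add) auto
    then show ?thesis by simp
  qed (use h0 in auto)
  have "c Inf - h0 \<in> K" using c(1)[OF Inf_curve] h0 by (intro K_intros)
  then obtain \<rho> k where rho: "\<rho> \<in> R" "(c Inf - h0 - \<rho> - fls_const k * (X\<^sup>2 / Y)) * (Y / X) \<in> loc_ring lam Inf"
    using principal_part_Inf by blast
  \<comment> \<open>Adding \<open>\<rho>\<close> corrects the principal part at infinity without
    disturbing the affine part, since \<open>\<rho>\<close> is regular there.\<close>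
  define h where "h = h0 + \<rho>"
  have hc: "h - c w \<in> loc_ring lam w" if w: "w \<in> curve lam - {Inf}" for w
  proof -
    interpret w: curve_point lam w using w by unfold_locales auto
    have "(h0 - c w) + \<rho> \<in> w.O_w" using w h0c rho(1) regular_affine_R_iff by (intro w.O_add) auto
    then show ?thesis by (simp add: h_def algebra_simps)
  qed
  have "h \<in> K" unfolding h_def by (rule K_add[OF h0(1) K_R[OF rho(1)]])
  have aff: "v \<in> E w \<longleftrightarrow> v $ 1 - h * v $ 2 \<in> loc_ring lam w \<and> v $ 2 \<in> loc_ring lam w"
    if w: "w \<in> curve lam - {Inf}" for w v
  proof -
    interpret w: curve_point lam w using w by unfold_locales auto
    have "v $ 1 - c w * v $ 2 \<in> w.O_w \<longleftrightarrow> v $ 1 - h * v $ 2 \<in> w.O_w" if "v $ 2 \<in> w.O_w"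
    proof -
      have *: "(h - c w) * v $ 2 \<in> w.O_w" using hc[OF w] that by (rule w.O_mult)
      have "v $ 1 - c w * v $ 2 = (v $ 1 - h * v $ 2) + (h - c w) * v $ 2" by (simp add: algebra_simps)
      moreover have "v $ 1 - h * v $ 2 = (v $ 1 - c w * v $ 2) - (h - c w) * v $ 2" by (simp add: algebra_simps)
      ultimately show ?thesis using * w.O_add w.O_diff by metis
    qed
    then show ?thesis using c(2)[of w v] w by (auto simp: n_def)
  qed
  have inf: "v \<in> E Inf \<longleftrightarrow> v $ 1 - h * v $ 2 - fls_const k * X * (X / Y * v $ 2) \<in> loc_ring lam Inf \<and>
        X / Y * v $ 2 \<in> loc_ring lam Inf" for v
  proof -
    interpret w: curve_point lam Inf using Inf_curve by (rule curve_point)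
    have "v $ 1 - c Inf * v $ 2 \<in> w.O_w \<longleftrightarrow> v $ 1 - h * v $ 2 - fls_const k * X * (X / Y * v $ 2) \<in> w.O_w"
      if "X / Y * v $ 2 \<in> w.O_w"
    proof -
      define z where "z = ((c Inf - h0 - \<rho> - fls_const k * (X\<^sup>2 / Y)) * (Y / X)) * (X / Y * v $ 2)"
      have z: "z \<in> w.O_w" unfolding z_def using rho(2) that by (rule w.O_mult)
      have "z = (c Inf - h0 - \<rho> - fls_const k * (X\<^sup>2 / Y)) * v $ 2" by (simp add: z_def)
      then have "z = c Inf * v $ 2 - h * v $ 2 - fls_const k * X * (X / Y * v $ 2)"
        by (simp add: h_def algebra_simps power2_eq_square)
      then have "v $ 1 - h * v $ 2 - fls_const k * X * (X / Y * v $ 2) = (v $ 1 - c Inf * v $ 2) + z"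
        "v $ 1 - c Inf * v $ 2 = (v $ 1 - h * v $ 2 - fls_const k * X * (X / Y * v $ 2)) - z"
        by simp_all
      then show ?thesis using z w.O_add w.O_diff by metis
    qed
    then show ?thesis using c(2)[OF Inf_curve, of v] by (auto simp: n_def mult.commute)
  qed
  have "k \<noteq> 0"
  proof
    assume "k = 0"
    \<comment> \<open>With \<open>k = 0\<close> the vector \<open>(h, 1)\<close> would satisfy all
      stalk conditions and define a global splitting.\<close>
    have "f *s vector [h, 1] \<in> E w" if w: "w \<in> curve lam" and f: "f \<in> div_stalk lam div_inf w" for w f
    proof -
      interpret w: curve_point lam w using w by (rule curve_point)
      have f0: "f * (if w = Inf then X / Y else 1) \<in> loc_ring lam w"
        using f by (simp only: div_inf_stalk[OF w])
      show ?thesis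
      proof (cases "w = Inf")
        case True
        then show ?thesis using f0 w.O_01(1) inf[of "f *s vector [h, 1]"] \<open>k = 0\<close>
          by (simp add: mult.commute)
      next
        case False
        then show ?thesis using f0 aff[of w "f *s vector [h, 1]"] w
          by (simp add: mult.commute)
      qed
    qed
    moreover have "(vector [h, 1] :: complex fls ^ 2) $ 2 = 1" by simp
    ultimately show False using E unfolding nontrivial_extension_def by blast
  qed
  then have "normal_form E h k"
    unfolding normal_form_def using \<open>h \<in> K\<close> aff inf by blast
  then show ?thesis by blast
qed

end

section \<open>Connections written in the frame of the normal form\<close>

locale elliptic_bundle = elliptic +
  fixes E :: "2 vbundle" and h :: "complex fls" and \<kappa> :: complex
  assumes nf: "normal_form E h \<kappa>"
begin

lemma kappa_nz: "\<kappa> \<noteq> 0" and h_K: "h \<in> K"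
  using nf by (auto simp: normal_form_def)

lemma E_affine: "w \<in> curve lam \<Longrightarrow> w \<noteq> Inf \<Longrightarrow>
    v \<in> E w \<longleftrightarrow> v $ 1 - h * v $ 2 \<in> loc_ring lam w \<and> v $ 2 \<in> loc_ring lam w"
  and E_Inf: "v \<in> E Inf \<longleftrightarrow> v $ 1 - h * v $ 2 - fls_const \<kappa> * X * (X / Y * v $ 2) \<in> loc_ring lam Inf \<and>
                        X / Y * v $ 2 \<in> loc_ring lam Inf"
  using nf by (auto simp: normal_form_def)

definition frame :: "complex fls \<Rightarrow> complex fls \<Rightarrow> complex fls ^ 2" where
  "frame f1 f2 = vector [f1 + h * f2, f2]"

lemma frame_nth [simp]: "frame f1 f2 $ 1 = f1 + h * f2" "frame f1 f2 $ 2 = f2"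
  by (simp_all add: frame_def)

lemma frame_coords: "v = frame (v $ 1 - h * v $ 2) (v $ 2)"
  by (simp add: vec2_eq_iff)

lemma frame_cases: obtains f1 f2 where "v = frame f1 f2"
  using frame_coords by metis

lemma frame_add: "frame f1 f2 + frame g1 g2 = frame (f1 + g1) (f2 + g2)"
  and frame_diff: "frame f1 f2 - frame g1 g2 = frame (f1 - g1) (f2 - g2)"
  and frame_scale: "c *s frame f1 f2 = frame (c * f1) (c * f2)"
  by (auto simp: vec2_eq_iff algebra_simps)

lemma frame_affine: "w \<in> curve lam \<Longrightarrow> w \<noteq> Inf \<Longrightarrow>
    frame f1 f2 \<in> E w \<longleftrightarrow> f1 \<in> loc_ring lam w \<and> f2 \<in> loc_ring lam w"
  and frame_Inf: "frame f1 f2 \<in> E Inf \<longleftrightarrow> f1 - fls_const \<kappa> * X * (X / Y * f2) \<in> loc_ring lam Inf \<and>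
                        X / Y * f2 \<in> loc_ring lam Inf"
  by (simp_all add: E_affine E_Inf)

lemma E_scale:
  assumes w: "w \<in> curve lam" and f: "f \<in> loc_ring lam w" and v: "v \<in> E w"
  shows "f *s v \<in> E w"
proof -
  interpret w: curve_point lam w using w by (rule curve_point)
  obtain f1 f2 where v': "v = frame f1 f2" by (rule frame_cases)
  show ?thesis
  proof (cases "w = Inf")
    case True
    have "f * (f1 - fls_const \<kappa> * X * (X / Y * f2)) \<in> w.O_w" "f * (X / Y * f2) \<in> w.O_w"
      by (rule w.O_mult[OF f], use v True in \<open>simp only: v' frame_Inf\<close>)+
    moreover have "f * f1 - fls_const \<kappa> * X * (X / Y * (f * f2)) = f * (f1 - fls_const \<kappa> * X * (X / Y * f2))"
      "X / Y * (f * f2) = f * (X / Y * f2)" by (simp_all add: algebra_simps)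
    ultimately show ?thesis using True by (simp only: v' frame_scale frame_Inf)
  qed (use f v w in \<open>auto simp: v' frame_scale frame_affine w.O_mult\<close>)
qed

text \<open>The four coefficients of the connection divided by dx/y, after the gauge change to the
  frame \<open>(1, 0)\<close>, \<open>(h, 1)\<close>. The term \<open>del h\<close> in
  \<open>be\<close> comes from differentiating the second frame vector; \<open>mk\<close> is the
  inverse change.\<close>

definition al :: "complex fls ^ 2 ^ 2 \<Rightarrow> complex fls" where
  "al A = (A $ 1 $ 1 - h * A $ 2 $ 1) / eta"
definition ga :: "complex fls ^ 2 ^ 2 \<Rightarrow> complex fls" where
  "ga A = A $ 2 $ 1 / eta"
definition de :: "complex fls ^ 2 ^ 2 \<Rightarrow> complex fls" where
  "de A = (A $ 2 $ 2 + h * A $ 2 $ 1) / eta"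
definition be :: "complex fls ^ 2 ^ 2 \<Rightarrow> complex fls" where
  "be A = (A $ 1 $ 2 + h * (A $ 1 $ 1 - A $ 2 $ 2) - h\<^sup>2 * A $ 2 $ 1) / eta + del h"

definition mk :: "complex fls \<Rightarrow> complex fls \<Rightarrow> complex fls \<Rightarrow> complex fls \<Rightarrow> complex fls ^ 2 ^ 2" where
  "mk a b c d = vector [vector [eta * (a + h * c), eta * (b - del h + h * (d - a) - h\<^sup>2 * c)],
                        vector [eta * c, eta * (d - h * c)]]"

lemma mk_coords: "al (mk a b c d) = a" "be (mk a b c d) = b" "ga (mk a b c d) = c" "de (mk a b c d) = d"
proof -
  have e: "eta * x / eta = x" for x by simp
  have 1: "eta * (a + h * c) - h * (eta * c) = eta * a" by (simp add: algebra_simps)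
  have 2: "eta * (d - h * c) + h * (eta * c) = eta * d" by (simp add: algebra_simps)
  have 3: "eta * (b - del h + h * (d - a) - h\<^sup>2 * c) + h * (eta * (a + h * c) - eta * (d - h * c)) - h\<^sup>2 * (eta * c)
    = eta * (b - del h)" by (simp add: algebra_simps power2_eq_square)
  show "al (mk a b c d) = a" "be (mk a b c d) = b" "ga (mk a b c d) = c" "de (mk a b c d) = d"
    unfolding al_def be_def ga_def de_def mk_def vector_2 1 2 3 e by simp_all
qed

lemma coords_mk: "A = mk (al A) (be A) (ga A) (de A)"
proof -
  have e: "eta * (x / eta) = x" for x by simp
  have 1: "eta * (al A + h * ga A) = A $ 1 $ 1" "eta * ga A = A $ 2 $ 1" "eta * (de A - h * ga A) = A $ 2 $ 2"
    by (simp_all add: al_def ga_def de_def field_simps)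
  have "be A - del h + h * (de A - al A) - h\<^sup>2 * ga A = A $ 1 $ 2 / eta"
    unfolding be_def al_def ga_def de_def by (simp add: field_simps power2_eq_square)
  then have 2: "eta * (be A - del h + h * (de A - al A) - h\<^sup>2 * ga A) = A $ 1 $ 2" by simp
  show ?thesis unfolding mk_def 1 2 by (simp add: vec2_eq_iff)
qed

lemma conn_frame:
  "conn A (frame f1 f2) = eta *s frame (del f1 + al A * f1 + be A * f2) (del f2 + ga A * f1 + de A * f2)"
proof -
  obtain a b c d where A: "A = mk a b c d" using coords_mk by metis
  show ?thesis
    unfolding A mk_coords frame_scale
    by (simp add: vec2_eq_iff conn_def mult_mv2 mk_def deriv_eq_del del_add del_mult)
      (simp add: algebra_simps power2_eq_square)
qed

text \<open>The admissible forms at \<open>w\<close> are generated by \<open>eta / d\<close>, so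
  whenever a factorisation \<open>\<theta> *s v\<close> exists, one with this
  \<open>\<theta>\<close> does.\<close>

lemma stalk_condition:
  fixes S :: "point set"
  assumes w: "w \<in> curve lam"
  defines "d \<equiv> (if w \<in> S then unif w else 1)"
  shows "(\<forall>s\<in>E w. \<exists>\<theta>\<in>form_stalk lam S w. \<exists>v\<in>E w. conn A s = \<theta> *s v) \<longleftrightarrow>
    (\<forall>f1 f2. frame f1 f2 \<in> E w \<longrightarrow> d *s frame (del f1 + al A * f1 + be A * f2) (del f2 + ga A * f1 + de A * f2) \<in> E w)"
proof -
  interpret w: curve_point lam w using w by (rule curve_point)
  have d: "d \<noteq> 0" by (simp add: d_def)
  have 1: "(\<exists>\<theta>\<in>form_stalk lam S w. \<exists>v\<in>E w. eta *s s = \<theta> *s v) \<longleftrightarrow> d *s s \<in> E w" for s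
  proof
    assume "\<exists>\<theta>\<in>form_stalk lam S w. \<exists>v\<in>E w. eta *s s = \<theta> *s v"
    then obtain \<theta> v where "\<theta> \<in> form_stalk lam S w" "v \<in> E w" "eta *s s = \<theta> *s v"
      by blast
    then have *: "\<theta> / eta * d \<in> w.O_w" "v \<in> E w" "eta *s s = \<theta> *s v"
      by (simp_all only: w.form_stalk_iff d_def)
    have "d *s s = (\<theta> / eta * d) *s v"
      using *(3) by (simp add: vec2_eq_iff field_simps)
    with * w show "d *s s \<in> E w" using E_scale by metis
  next
    assume *: "d *s s \<in> E w"
    have "eta / d \<in> form_stalk lam S w"
      using d unfolding w.form_stalk_iff d_def[symmetric] by simp
    moreover have "eta *s s = (eta / d) *s (d *s s)" using d by (simp add: vec2_eq_iff)
    ultimately show "\<exists>\<theta>\<in>form_stalk lam S w. \<exists>v\<in>E w. eta *s s = \<theta> *s v" using * by blast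
  qed
  have 2: "(\<forall>s\<in>E w. P s) \<longleftrightarrow> (\<forall>f1 f2. frame f1 f2 \<in> E w \<longrightarrow> P (frame f1 f2))" for P
  proof (intro iffI ballI)
    fix s assume *: "\<forall>f1 f2. frame f1 f2 \<in> E w \<longrightarrow> P (frame f1 f2)" "s \<in> E w"
    obtain f1 f2 where "s = frame f1 f2" by (rule frame_cases)
    with * show "P s" by simp
  qed simp
  show ?thesis unfolding 2 conn_frame 1 ..
qed

lemma stalk_condition_affine:
  fixes S :: "point set"
  assumes w: "w \<in> curve lam" "w \<noteq> Inf"
  defines "d \<equiv> (if w \<in> S then unif w else 1)"
  shows "(\<forall>s\<in>E w. \<exists>\<theta>\<in>form_stalk lam S w. \<exists>v\<in>E w. conn A s = \<theta> *s v) \<longleftrightarrow>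
    d * al A \<in> loc_ring lam w \<and> d * be A \<in> loc_ring lam w \<and> d * ga A \<in> loc_ring lam w \<and> d * de A \<in> loc_ring lam w"
proof -
  interpret w: curve_point lam w using w by unfold_locales
  have d: "d \<in> w.O_w" by (simp add: d_def)
  show ?thesis
    unfolding stalk_condition[OF w(1)] d_def[symmetric] frame_scale frame_affine[OF w]
  proof (intro iffI allI impI)
    assume *: "\<forall>f1 f2. f1 \<in> w.O_w \<and> f2 \<in> w.O_w \<longrightarrow>
      d * (del f1 + al A * f1 + be A * f2) \<in> w.O_w \<and> d * (del f2 + ga A * f1 + de A * f2) \<in> w.O_w"
    show "d * al A \<in> w.O_w \<and> d * be A \<in> w.O_w \<and> d * ga A \<in> w.O_w \<and> d * de A \<in> w.O_w"
      using *[rule_format, of 1 0] *[rule_format, of 0 1] by simp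
  next
    assume *: "d * al A \<in> w.O_w \<and> d * be A \<in> w.O_w \<and> d * ga A \<in> w.O_w \<and> d * de A \<in> w.O_w"
    fix f1 f2 assume f: "f1 \<in> w.O_w \<and> f2 \<in> w.O_w"
    have "d * del f1 + (d * al A) * f1 + (d * be A) * f2 \<in> w.O_w"
      "d * del f2 + (d * ga A) * f1 + (d * de A) * f2 \<in> w.O_w"
      using f d * by (auto intro!: w.O_add w.O_mult[OF d] w.O_del intro: w.O_mult)
    then show "d * (del f1 + al A * f1 + be A * f2) \<in> w.O_w \<and> d * (del f2 + ga A * f1 + de A * f2) \<in> w.O_w"
      by (simp add: algebra_simps)
  qed
qed

text \<open>Regularity of the connection matrix in the frame \<open>(1, 0)\<close>,
  \<open>(Y / X) (h, 1) + \<kappa> X (1, 0)\<close> at infinity. The entries are listed as lower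
  left, upper left, lower right, upper right; the term \<open>\<kappa> * Y\<close> is
  \<open>del (\<kappa> * X)\<close>.\<close>

definition inf_cond :: "complex fls \<Rightarrow> complex fls \<Rightarrow> complex fls \<Rightarrow> complex fls \<Rightarrow> bool" where
  "inf_cond a b c d \<longleftrightarrow>
     X / Y * c \<in> loc_ring lam Inf \<and>
     a - fls_const \<kappa> * X * (X / Y * c) \<in> loc_ring lam Inf \<and>
     X / Y * (del (Y / X) + c * (fls_const \<kappa> * X) + d * (Y / X)) \<in> loc_ring lam Inf \<and>
     (fls_const \<kappa> * Y + a * (fls_const \<kappa> * X) + b * (Y / X)) -
       fls_const \<kappa> * X * (X / Y * (del (Y / X) + c * (fls_const \<kappa> * X) + d * (Y / X))) \<in> loc_ring lam Inf"

lemma stalk_condition_Inf: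
  assumes "Inf \<notin> S"
  shows "(\<forall>s\<in>E Inf. \<exists>\<theta>\<in>form_stalk lam S Inf. \<exists>v\<in>E Inf. conn A s = \<theta> *s v) \<longleftrightarrow>
    inf_cond (al A) (be A) (ga A) (de A)"
proof -
  interpret w: curve_point lam Inf using Inf_curve by (rule curve_point)
  define a b c d where "a = al A" "b = be A" "c = ga A" "d = de A"
  note abcd = a_b_c_d_def
  define k where "k = fls_const \<kappa>"
  have "(\<forall>s\<in>E Inf. \<exists>\<theta>\<in>form_stalk lam S Inf. \<exists>v\<in>E Inf. conn A s = \<theta> *s v) \<longleftrightarrow>
    (\<forall>f1 f2. frame f1 f2 \<in> E Inf \<longrightarrow> frame (del f1 + a * f1 + b * f2) (del f2 + c * f1 + d * f2) \<in> E Inf)"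
    unfolding stalk_condition[OF Inf_curve] abcd using assms by (simp add: frame_scale)
  \<comment> \<open>Change to the coordinates \<open>g1\<close>, \<open>g2\<close> of the frame at
    infinity, in which the sections of the bundle are exactly the pairs of regular
    functions.\<close>
  also have "\<dots> \<longleftrightarrow> (\<forall>g1 g2. g1 \<in> w.O_w \<and> g2 \<in> w.O_w \<longrightarrow>
     frame (del (g1 + k * X * g2) + a * (g1 + k * X * g2) + b * (Y / X * g2))
           (del (Y / X * g2) + c * (g1 + k * X * g2) + d * (Y / X * g2)) \<in> E Inf)"
  proof (intro iffI allI impI)
    fix g1 g2
    assume *: "\<forall>f1 f2. frame f1 f2 \<in> E Inf \<longrightarrow> frame (del f1 + a * f1 + b * f2) (del f2 + c * f1 + d * f2) \<in> E Inf"
      and g: "g1 \<in> w.O_w \<and> g2 \<in> w.O_w"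
    have "X / Y * (Y / X * g2) = g2" by simp
    then have "frame (g1 + k * X * g2) (Y / X * g2) \<in> E Inf"
      unfolding frame_Inf k_def using g by simp
    with * show "frame (del (g1 + k * X * g2) + a * (g1 + k * X * g2) + b * (Y / X * g2))
           (del (Y / X * g2) + c * (g1 + k * X * g2) + d * (Y / X * g2)) \<in> E Inf" by blast
  next
    fix f1 f2
    assume *: "\<forall>g1 g2. g1 \<in> w.O_w \<and> g2 \<in> w.O_w \<longrightarrow>
     frame (del (g1 + k * X * g2) + a * (g1 + k * X * g2) + b * (Y / X * g2))
           (del (Y / X * g2) + c * (g1 + k * X * g2) + d * (Y / X * g2)) \<in> E Inf"
      and f: "frame f1 f2 \<in> E Inf"
    define g1 g2 where "g1 = f1 - k * X * (X / Y * f2)" and "g2 = X / Y * f2"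
    have "g1 \<in> w.O_w" "g2 \<in> w.O_w" using f by (simp_all add: frame_Inf g1_def g2_def k_def)
    moreover have "g1 + k * X * g2 = f1" "Y / X * g2 = f2" by (simp_all add: g1_def g2_def)
    ultimately show "frame (del f1 + a * f1 + b * f2) (del f2 + c * f1 + d * f2) \<in> E Inf"
      using *[rule_format, of g1 g2] by simp
  qed
  also have "\<dots> \<longleftrightarrow> inf_cond a b c d"
  proof -
    define p where "p = del (Y / X) + c * (k * X) + d * (Y / X)"
    define q where "q = k * Y + a * (k * X) + b * (Y / X)"
    have e2: "del (Y / X * g2) + c * (g1 + k * X * g2) + d * (Y / X * g2) = Y / X * del g2 + c * g1 + p * g2" for g1 g2
      unfolding del_mult p_def by (simp add: algebra_simps)
    have e1: "del (g1 + k * X * g2) + a * (g1 + k * X * g2) + b * (Y / X * g2) = del g1 + a * g1 + k * X * del g2 + q * g2" for g1 g2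
      unfolding del_mult del_add q_def k_def by (simp add: algebra_simps)
    have x2: "X / Y * (Y / X * del g2 + c * g1 + p * g2) = del g2 + (X / Y * c) * g1 + (X / Y * p) * g2" for g1 g2
      by (simp add: algebra_simps)
    have x1: "(del g1 + a * g1 + k * X * del g2 + q * g2) - k * X * (del g2 + (X / Y * c) * g1 + (X / Y * p) * g2)
       = del g1 + (a - k * X * (X / Y * c)) * g1 + (q - k * X * (X / Y * p)) * g2" for g1 g2
      by (simp add: algebra_simps)
    show ?thesis
      unfolding e1 e2 frame_Inf k_def[symmetric] x2 x1 inf_cond_def p_def[symmetric] q_def[symmetric]
    proof (intro iffI allI impI)
      assume *: "\<forall>g1 g2. g1 \<in> w.O_w \<and> g2 \<in> w.O_w \<longrightarrow>
         del g1 + (a - k * X * (X / Y * c)) * g1 + (q - k * X * (X / Y * p)) * g2 \<in> w.O_w \<and>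
         del g2 + (X / Y * c) * g1 + (X / Y * p) * g2 \<in> w.O_w"
      show "X / Y * c \<in> w.O_w \<and> a - k * X * (X / Y * c) \<in> w.O_w \<and> X / Y * p \<in> w.O_w \<and> q - k * X * (X / Y * p) \<in> w.O_w"
        using *[rule_format, of 1 0] *[rule_format, of 0 1] by simp
    next
      fix g1 g2
      assume *: "X / Y * c \<in> w.O_w \<and> a - k * X * (X / Y * c) \<in> w.O_w \<and> X / Y * p \<in> w.O_w \<and> q - k * X * (X / Y * p) \<in> w.O_w"
        and g: "g1 \<in> w.O_w \<and> g2 \<in> w.O_w"
      show "del g1 + (a - k * X * (X / Y * c)) * g1 + (q - k * X * (X / Y * p)) * g2 \<in> w.O_w \<and>
         del g2 + (X / Y * c) * g1 + (X / Y * p) * g2 \<in> w.O_w"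
      proof
        show "del g1 + (a - k * X * (X / Y * c)) * g1 + (q - k * X * (X / Y * p)) * g2 \<in> w.O_w"
          by (rule w.O_add[OF w.O_add[OF w.O_del w.O_mult] w.O_mult]) (use * g in auto)
        show "del g2 + (X / Y * c) * g1 + (X / Y * p) * g2 \<in> w.O_w"
          by (rule w.O_add[OF w.O_add[OF w.O_del w.O_mult] w.O_mult]) (use * g in auto)
      qed
    qed
  qed
  finally show ?thesis unfolding abcd .
qed

end

section \<open>The two points over \<open>x = t\<close>\<close>

locale two_points = elliptic +
  fixes t r :: complex
  assumes r2: "r\<^sup>2 = cub t" and r_nz: "r \<noteq> 0"
begin

abbreviation "t1 \<equiv> Aff t r"
abbreviation "t2 \<equiv> Aff t (- r)"
abbreviation N :: "complex fls" where "N \<equiv> X - fls_const t"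

lemma t_curve: "t1 \<in> curve lam" "t2 \<in> curve lam"
  using r2 by (auto simp: curve_iff)

lemma N_nz [simp]: "N \<noteq> 0" "X \<noteq> fls_const t"
  using X_shift_nz[of t] by auto

text \<open>As \<open>r\<close> is nonzero, \<open>x\<close> is unramified over \<open>t\<close>, so
  \<open>N\<close> has simple zeros at the two points and no other affine zero. One function thus
  serves as uniformizer at both points and as common denominator.\<close>

lemma N_unit:
  assumes w: "w \<in> curve lam" "w \<noteq> Inf"
  shows "\<exists>u\<in>loc_ring lam w. ev w u \<noteq> 0 \<and> N = (if w \<in> {t1, t2} then unif w else 1) * u"
proof -
  obtain a b where ab: "w = Aff a b" "b\<^sup>2 = cub a" using w curve_iff by (cases w) auto
  interpret w: curve_point lam w using w by unfold_locales
  note A = Aff_point[OF ab(2), folded ab(1)]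
  have XY: "X \<in> w.O_w" "Y \<in> w.O_w" using A(1) by auto
  show ?thesis
  proof (cases "w \<in> {t1, t2}")
    case True
    then have "a = t" "b \<noteq> 0" using ab r_nz by auto
    moreover have "ev w (Y + fls_const b) = b + b" using XY A by (simp add: w.ev_add)
    moreover have "Y + fls_const b \<in> w.O_w" using XY by (intro w.O_add w.O_const)
    ultimately show ?thesis
      using unif_Aff(1)[OF ab(2)] True ab(1)
      by (intro bexI[of _ "Y + fls_const b"]) auto
  next
    case False
    have "a \<noteq> t"
    proof
      assume "a = t"
      then have "b\<^sup>2 = r\<^sup>2" using ab r2 by simp
      then show False using False ab \<open>a = t\<close> by (auto simp: power2_eq_iff)
    qed
    then show ?thesis using False XY A
      by (intro bexI[of _ N]) (auto intro!: w.O_diff simp: w.ev_diff)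
  qed
qed

lemma N_uniformizer: "w \<in> {t1, t2} \<Longrightarrow> uniformizer lam w N"
  using N_unit[of w] t_curve curve_point.uniformizer_iff[OF curve_point, of w] by auto

lemma pole_iff_point:
  assumes w: "w \<in> curve lam" "w \<noteq> Inf"
  shows "(if w \<in> {t1, t2} then unif w else 1) * f \<in> loc_ring lam w \<longleftrightarrow> N * f \<in> loc_ring lam w"
proof -
  interpret w: curve_point lam w using w by unfold_locales
  obtain u where u: "u \<in> w.O_w" "ev w u \<noteq> 0" "N = (if w \<in> {t1, t2} then unif w else 1) * u"
    using N_unit[OF w] by blast
  define d where "d = (if w \<in> {t1, t2} then unif w else 1)"
  have "N = d * u" "u \<noteq> 0" using u(3) w.ev_nz[OF u(2)] by (simp_all only: d_def not_False_eq_True)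
  then have "N * f = (d * f) * u" "d * f = (N * f) / u" by simp_all
  then show ?thesis unfolding d_def[symmetric] using u w.O_mult w.O_divide by metis
qed

lemma pole_iff:
  "(\<forall>w\<in>curve lam - {Inf}. (if w \<in> {t1, t2} then unif w else 1) * f \<in> loc_ring lam w) \<longleftrightarrow> N * f \<in> R"
  unfolding regular_affine_R_iff using pole_iff_point by auto

lemma K_of_pole: "N * f \<in> R \<Longrightarrow> f \<in> K"
proof -
  assume "N * f \<in> R"
  then have "N * f / N \<in> K" by (intro K_divide K_R R_diff) auto
  then show "f \<in> K" by (simp only: nonzero_mult_div_cancel_left[OF N_nz(1)])
qed

end

locale elliptic_setup = elliptic_bundle + two_points
begin

text \<open>Away from infinity, simple poles at the two points at most means that \<open>N\<close>
  times each coefficient lies in \<open>R\<close>. Rationality of the matrix entries follows from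
  this.\<close>

lemma log_connection_iff:
  "log_connection lam {t1, t2} E A \<longleftrightarrow>
     N * al A \<in> R \<and> N * be A \<in> R \<and> N * ga A \<in> R \<and> N * de A \<in> R \<and> inf_cond (al A) (be A) (ga A) (de A)"
proof -
  have Inf: "Inf \<notin> {t1, t2}" by simp
  have rat: "A $ i $ j \<in> rat_forms lam" if *: "N * al A \<in> R" "N * be A \<in> R" "N * ga A \<in> R" "N * de A \<in> R" for i j
  proof -
    have K: "al A \<in> K" "be A \<in> K" "ga A \<in> K" "de A \<in> K" using K_of_pole * by auto
    define a b c d where "a = al A" "b = be A" "c = ga A" "d = de A"
    have "(a + h * c) \<in> K" "c \<in> K" "(d - h * c) \<in> K" "(b - del h + h * (d - a) - h\<^sup>2 * c) \<in> K"
      using K h_K unfolding a_b_c_d_def by (auto intro!: K_intros del_K)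
    then show ?thesis unfolding rat_forms_iff
      using exhaust_2[of i] exhaust_2[of j] by (subst coords_mk) (auto simp: mk_def a_b_c_d_def)
  qed
  have split: "(\<forall>w\<in>curve lam. P w) \<longleftrightarrow> (\<forall>w\<in>curve lam - {Inf}. P w) \<and> P Inf" for P
    using Inf_curve by auto
  have aff: "(\<forall>w\<in>curve lam - {Inf}. \<forall>s\<in>E w. \<exists>\<theta>\<in>form_stalk lam {t1, t2} w. \<exists>v\<in>E w. conn A s = \<theta> *s v) \<longleftrightarrow>
     N * al A \<in> R \<and> N * be A \<in> R \<and> N * ga A \<in> R \<and> N * de A \<in> R"
    unfolding pole_iff[symmetric] using stalk_condition_affine[of _ "{t1, t2}" A] by fastforce
  show ?thesis
    unfolding log_connection_def split aff stalk_condition_Inf[OF Inf] using rat by blast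
qed

end

section \<open>Logarithmic connections on the extension\<close>

context elliptic
begin

text \<open>The logarithmic derivative of the local generator \<open>Y / X\<close> of O(w_inf); it
  is the gauge term of the trace at infinity, with a simple pole there.\<close>

lemma del_YX: "X / Y * del (Y / X) = (X\<^sup>2 - L) / (2 * Y)"
proof -
  have "X / Y * del (Y / X) = (2 * X * del Y - 2 * Y\<^sup>2) / (2 * X * Y)"
    by (simp add: del_divide field_simps power2_eq_square)
  also have "2 * X * del Y - 2 * Y\<^sup>2 = X * (2 * del Y) - 2 * Y\<^sup>2"
    by (simp only: mult.assoc mult.left_commute)
  also have "2 * del Y = 3 * X\<^sup>2 - 2 * (1 + L) * X + L" by (simp add: del_Y)
  also have "X * (3 * X\<^sup>2 - 2 * (1 + L) * X + L) - 2 * Y\<^sup>2 = X * (X\<^sup>2 - L)"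
    unfolding Y2 by (simp add: algebra_simps power2_eq_square power3_eq_cube)
  also have "X * (X\<^sup>2 - L) / (2 * X * Y) = (X\<^sup>2 - L) / (2 * Y)"
    by simp
  finally show ?thesis .
qed

interpretation I: curve_point lam Inf
  by (rule curve_point[OF Inf_curve])

lemma O_Inf_XY: "X / Y \<in> loc_ring lam Inf" "1 / Y \<in> loc_ring lam Inf" "ev Inf (X / Y) = 0" "ev Inf (1 / Y) = 0"
proof -
  show "X / Y \<in> loc_ring lam Inf" "ev Inf (X / Y) = 0" using I.O_pi I.ev_pi by (simp_all add: Inf_unif)
  show 1: "1 / Y \<in> loc_ring lam Inf" unfolding O_Inf_iff by (auto intro!: K_intros simp: fls_divide_subdegree)
  have "(1 / Y) / unif Inf \<in> loc_ring lam Inf"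
    unfolding Inf_unif O_Inf_iff by (auto intro!: K_intros simp: fls_divide_subdegree)
  then show "ev Inf (1 / Y) = 0" using I.ev_0_iff[OF 1] by blast
qed

lemma ev_g_inf: "g_inf \<in> loc_ring lam Inf" "ev Inf g_inf = 1"
proof -
  have 1: "(1 + L) * (X / Y)\<^sup>2 \<in> loc_ring lam Inf" "ev Inf ((1 + L) * (X / Y)\<^sup>2) = 0"
    using O_Inf_XY by (simp_all only: I.O_intros I.O_01 I.O_const I.ev_mult I.ev_power) simp_all
  have 2: "L * (X / Y) * (1 / Y) \<in> loc_ring lam Inf" "ev Inf (L * (X / Y) * (1 / Y)) = 0"
    using O_Inf_XY by (simp_all only: I.O_intros I.O_01 I.O_const I.ev_mult I.ev_power mult_zero_right)
  have 3: "1 + (1 + L) * (X / Y)\<^sup>2 \<in> loc_ring lam Inf" "ev Inf (1 + (1 + L) * (X / Y)\<^sup>2) = 1"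
    using 1 by (simp_all only: I.O_intros I.O_01 I.ev_add I.ev_01 add_0_right)
  show "g_inf \<in> loc_ring lam Inf" "ev Inf g_inf = 1"
    unfolding g_inf_def using 2 3 by (simp_all only: I.O_intros I.ev_diff diff_zero)
qed

lemma R_simple_pole_const:
  assumes "f \<in> R" "X / Y * f \<in> loc_ring lam Inf"
  shows "\<exists>c. f = fls_const c"
proof (rule R_subdegree_const[OF assms(1)])
  show "f = 0 \<or> fls_subdegree f \<ge> - 1"
  proof (cases "f = 0")
    case False
    then have "fls_subdegree (X / Y * f) = 1 + fls_subdegree f" "X / Y * f \<noteq> 0"
      using False by (auto simp: fls_divide_subdegree)
    then show ?thesis using O_Inf_subdegree[OF assms(2)] by linarith
  qed simp
qed

text \<open>\<open>X / Y * X\<close> has a genuine simple pole: times the uniformizer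
  \<open>X / Y\<close> it is \<open>g_inf\<close>, which takes the value 1 at infinity.\<close>

lemma no_simple_pole_Inf:
  assumes "fls_const c * (X / Y * X) \<in> loc_ring lam Inf"
  shows "c = 0"
proof -
  have "X / Y * (fls_const c * (X / Y * X)) \<in> loc_ring lam Inf" "ev Inf (X / Y * (fls_const c * (X / Y * X))) = 0"
    using assms O_Inf_XY by (simp_all only: I.O_mult I.ev_mult mult_zero_left)
  moreover have "X / Y * (fls_const c * (X / Y * X)) = fls_const c * g_inf"
    unfolding inf_pow(1) by (simp add: power2_eq_square)
  ultimately show ?thesis using ev_g_inf by (simp add: I.ev_mult)
qed

lemma O_Inf_quotient:
  assumes "n \<in> R" "d \<in> R" "d \<noteq> 0" "n = 0 \<or> fls_subdegree d \<le> fls_subdegree n"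
  shows "n / d \<in> loc_ring lam Inf"
proof -
  have "n / d \<in> K" using assms by (intro K_divide K_R)
  moreover have "n / d = 0 \<or> fls_subdegree (n / d) \<ge> 0"
    using assms by (cases "n = 0") (auto simp: fls_divide_subdegree)
  ultimately show ?thesis unfolding O_Inf_iff by blast
qed

lemma subdegree_fe_ge:
  assumes "2 * degree p \<le> m" "q = 0 \<or> 2 * degree q + 3 \<le> m"
  shows "fe p q = 0 \<or> fls_subdegree (fe p q) \<ge> - int m"
proof (cases "p = 0 \<and> q = 0")
  case False
  then have "p \<noteq> 0 \<or> q \<noteq> 0" by auto
  note sd = subdegree_fe[OF this]
  show ?thesis
  proof (cases "p = 0")
    case True
    then have "q \<noteq> 0" using False by auto
    then have "fls_subdegree (fe p q) \<ge> - 2 * int (degree q) - 3"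
      using subdegree_evalx[of q] True by (simp add: fe_def)
    then show ?thesis using assms \<open>q \<noteq> 0\<close> by auto
  next
    case p: False
    show ?thesis
    proof (cases "q = 0")
      case True
      then have "fls_subdegree (fe p q) \<ge> - 2 * int (degree p)"
        using subdegree_evalx[of p] p by (simp add: fe_def)
      then show ?thesis using assms by auto
    qed (use sd(4) assms in auto)
  qed
qed (auto simp: fe_def)

end

section \<open>The determinant connection, and connections with given residues\<close>

locale connection_setup = elliptic_setup +
  fixes a :: "complex fls ^ 1 ^ 1"
  assumes det: "det_connection lam t1 a"
begin

interpretation I: curve_point lam Inf
  by (rule curve_point[OF Inf_curve])
interpretation p1: curve_point lam t1
  by (rule curve_point[OF t_curve(1)])
interpretation p2: curve_point lam t2
  by (rule curve_point[OF t_curve(2)])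

definition tau :: "complex fls" where
  "tau = a $ 1 $ 1 / eta"

lemma conn_line: "conn a s $ 1 = eta * (del (s $ 1) + tau * s $ 1)"
  by (simp add: conn_def matrix_vector_mult_def tau_def deriv_eq_del sum_1 UNIV_1 algebra_simps)

lemma line_bundle_iff:
  "w \<in> curve lam \<Longrightarrow> s \<in> line_bundle lam div_inf w \<longleftrightarrow> s $ 1 * (if w = Inf then X / Y else 1) \<in> loc_ring lam w"
  by (simp add: line_bundle_def div_inf_stalk)

text \<open>The determinant connection is applied to the local generator \<open>n\<close> of
  O(w_inf). Dividing the result by \<open>n\<close> gives the connection form in the trivialisation
  by \<open>n\<close>.\<close>

lemma tau_local:
  assumes w: "w \<in> curve lam"
  defines "n \<equiv> (if w = Inf then Y / X else 1)"
  shows "(if w = t1 then unif w else 1) * (del n / n + tau) \<in> loc_ring lam w"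
proof -
  interpret w: curve_point lam w using w by (rule curve_point)
  have n: "n \<noteq> 0" by (auto simp: n_def)
  have "vec n \<in> line_bundle lam div_inf w"
    unfolding line_bundle_iff[OF w] by (auto simp: n_def)
  then obtain \<theta> v where tv: "\<theta> \<in> form_stalk lam {t1} w" "v \<in> line_bundle lam div_inf w" "conn a (vec n) = \<theta> *s v"
    using det w unfolding det_connection_def log_connection_def by meson
  have 1: "\<theta> / eta * (if w = t1 then w.\<pi> else 1) \<in> w.O_w"
    using tv(1) unfolding w.form_stalk_iff by simp
  have 2: "v $ 1 * (if w = Inf then X / Y else 1) \<in> w.O_w"
    using tv(2) unfolding line_bundle_iff[OF w] .
  have 3: "eta * (del n + tau * n) = \<theta> * v $ 1"
    using conn_line[of "vec n"] tv(3) by simp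
  have "(\<theta> / eta * (if w = t1 then w.\<pi> else 1)) * (v $ 1 * (if w = Inf then X / Y else 1)) \<in> w.O_w"
    by (rule w.O_mult[OF 1 2])
  also have "(if w = Inf then X / Y else 1) = 1 / n" by (auto simp: n_def)
  also have "(\<theta> / eta * (if w = t1 then w.\<pi> else 1)) * (v $ 1 * (1 / n)) =
      (if w = t1 then w.\<pi> else 1) * ((\<theta> * v $ 1) / eta / n)"
    by simp
  also have "(\<theta> * v $ 1) / eta / n = del n / n + tau"
    unfolding 3[symmetric] using n by (simp add: field_simps)
  finally show ?thesis .
qed

lemma tau_Inf: "tau + (X\<^sup>2 - L) / (2 * Y) \<in> loc_ring lam Inf"
proof -
  have "X / Y * del (Y / X) + tau \<in> loc_ring lam Inf"
    using tau_local[OF Inf_curve] by (simp add: mult.commute)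
  then show ?thesis unfolding del_YX by (simp add: add.commute)
qed

lemma tau_affine: "w \<in> curve lam \<Longrightarrow> w \<noteq> Inf \<Longrightarrow> (if w = t1 then unif w else 1) * tau \<in> loc_ring lam w"
  using tau_local[of w] by simp

lemma tau_R: "N * tau \<in> R"
  unfolding pole_iff[symmetric]
proof
  fix w assume w: "w \<in> curve lam - {Inf}"
  interpret w: curve_point lam w using w by unfold_locales auto
  show "(if w \<in> {t1, t2} then w.\<pi> else 1) * tau \<in> w.O_w"
    using tau_affine[of w] w r_nz w.O_mult[OF w.O_pi, of tau] by (cases "w = t1"; cases "w = t2") auto
qed

lemma tau_t2: "tau \<in> loc_ring lam t2"
  using tau_affine[of t2] t_curve r_nz by auto

lemma fibre_zero_line:
  assumes "w \<in> curve lam" "w \<noteq> Inf"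
  shows "s \<in> fibre_zero lam (line_bundle lam div_inf) w \<longleftrightarrow> s $ 1 \<in> loc_ring lam w \<and> ev w (s $ 1) = 0"
proof -
  interpret w: curve_point lam w using assms by unfold_locales
  show ?thesis
  proof
    assume "s \<in> fibre_zero lam (line_bundle lam div_inf) w"
    then obtain f v where "f \<in> max_ideal lam w" "v \<in> line_bundle lam div_inf w" "s = f *s v"
      unfolding fibre_zero_def by blast
    then show "s $ 1 \<in> w.O_w \<and> ev w (s $ 1) = 0"
      using assms by (simp add: line_bundle_iff w.max_ideal_ev w.O_mult w.ev_mult)
  next
    assume s: "s $ 1 \<in> w.O_w \<and> ev w (s $ 1) = 0"
    then have "vec (s $ 1 / w.\<pi>) \<in> line_bundle lam div_inf w"
      using assms w.ev_0_iff[of "s $ 1"] by (simp add: line_bundle_iff)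
    moreover have "s = w.\<pi> *s vec (s $ 1 / w.\<pi>)"
      by (simp add: vec_eq_iff forall_1)
    moreover have "w.\<pi> \<in> max_ideal lam w" by (simp add: w.max_ideal_ev)
    ultimately show "s \<in> fibre_zero lam (line_bundle lam div_inf) w"
      unfolding fibre_zero_def by blast
  qed
qed

text \<open>In rank one the eigenvalue is the residue itself: the derivative term is multiplied by
  \<open>\<rho> / del \<rho>\<close>, which vanishes at the point, and the value of the eigenvector
  cancels.\<close>

lemma res_tau: "p1.res tau = - 1"
proof -
  have t: "t1 \<in> curve lam" "t1 \<noteq> Inf" using t_curve by auto
  have ptau: "p1.\<pi> * tau \<in> p1.O_w" using tau_affine[OF t] by simp
  have "- 1 \<in> res_eigenvalues lam (line_bundle lam div_inf) t1 a"
    using det unfolding det_connection_def by simp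
  then obtain s where s: "s \<in> line_bundle lam div_inf t1" "s \<notin> fibre_zero lam (line_bundle lam div_inf) t1"
    "res_rep lam t1 a s - fls_const (- 1) *s s \<in> fibre_zero lam (line_bundle lam div_inf) t1"
    unfolding res_eigenvalues_def by blast
  have s1: "s $ 1 \<in> p1.O_w" "ev t1 (s $ 1) \<noteq> 0"
    using s(1,2) by (simp_all add: line_bundle_iff[OF t(1)] fibre_zero_line[OF t])
  define \<rho> where "\<rho> = (SOME \<rho>. uniformizer lam t1 \<rho>)"
  note rho = p1.res_uniformizer[OF p1.some_uniformizer ptau, folded \<rho>_def]
  have "res_rep lam t1 a s $ 1 = \<rho> / del \<rho> * del (s $ 1) + \<rho> / del \<rho> * tau * s $ 1"
    unfolding res_rep_def Let_def \<rho>_def[symmetric] using rho(5,6)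
    by (simp add: conn_line deriv_eq_del field_simps)
  then have "ev t1 (\<rho> / del \<rho> * del (s $ 1) + \<rho> / del \<rho> * tau * s $ 1 - fls_const (- 1) * s $ 1) = 0"
    using s(3) unfolding fibre_zero_line[OF t] by simp
  moreover have "\<rho> / del \<rho> * del (s $ 1) \<in> p1.O_w" "ev t1 (\<rho> / del \<rho> * del (s $ 1)) = 0"
    using rho(3,4) s1 by (simp_all only: p1.O_mult p1.ev_mult p1.O_del mult_zero_left)
  moreover have "\<rho> / del \<rho> * tau * s $ 1 \<in> p1.O_w" "ev t1 (\<rho> / del \<rho> * tau * s $ 1) = p1.res tau * ev t1 (s $ 1)"
    using rho(1,2) s1 by (simp_all only: p1.O_mult p1.ev_mult)
  moreover have "fls_const (- 1) * s $ 1 \<in> p1.O_w" "ev t1 (fls_const (- 1) * s $ 1) = - 1 * ev t1 (s $ 1)"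
    using s1 by (simp_all only: p1.O_mult p1.ev_mult p1.O_const p1.ev_const)
  ultimately have "0 + p1.res tau * ev t1 (s $ 1) - - 1 * ev t1 (s $ 1) = 0"
    by (simp only: p1.ev_diff p1.ev_add p1.O_add)
  then have "(p1.res tau + 1) * ev t1 (s $ 1) = 0" by (simp add: algebra_simps)
  then have "p1.res tau + 1 = 0" using s1(2) by simp
  then show ?thesis by (simp add: eq_neg_iff_add_eq_0)
qed

text \<open>The residues of \<open>f dx / y\<close>, computed with the uniformizer \<open>x - t\<close> at both points.\<close>

definition rs1 :: "complex fls \<Rightarrow> complex" where "rs1 f = ev t1 (N * f) / r"
definition rs2 :: "complex fls \<Rightarrow> complex" where "rs2 f = ev t2 (N * f) / (- r)"

lemma R_local: "f \<in> R \<Longrightarrow> f \<in> loc_ring lam t1" "f \<in> R \<Longrightarrow> f \<in> loc_ring lam t2"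
  using Aff_point(1)[of r t] Aff_point(1)[of "- r" t] r2 by auto

lemma ev_XY: "ev t1 X = t" "ev t1 Y = r" "ev t2 X = t" "ev t2 Y = - r"
  using Aff_point(2,3)[of r t] Aff_point(2,3)[of "- r" t] r2 by auto

lemma pole_local:
  assumes "N * f \<in> R"
  shows "p1.\<pi> * f \<in> p1.O_w" "p2.\<pi> * f \<in> p2.O_w"
  using pole_iff_point[of t1 f] pole_iff_point[of t2 f] t_curve R_local[OF assms] by auto

lemma res_eq_rs:
  assumes "N * f \<in> R"
  shows "p1.res f = rs1 f" "p2.res f = rs2 f"
proof -
  have N: "uniformizer lam t1 N" "uniformizer lam t2 N" by (simp_all add: N_uniformizer)
  \<comment> \<open>The values \<open>r\<close> and \<open>- r\<close> of \<open>Y\<close> at the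
    two points are the denominators in \<open>rs1\<close> and \<open>rs2\<close>.\<close>
  have d: "del N = Y" by (simp add: del_diff)
  have 1: "p1.res f = ev t1 (N * f / Y)" "p2.res f = ev t2 (N * f / Y)"
    using p1.res_uniformizer(2)[OF N(1) pole_local(1)[OF assms]] p2.res_uniformizer(2)[OF N(2) pole_local(2)[OF assms]]
    by (simp_all add: d)
  have "ev t1 (N * f / Y) = rs1 f" "ev t2 (N * f / Y) = rs2 f"
    using R_local[OF assms] R_local[OF R_Y] r_nz ev_XY
    by (simp_all add: p1.ev_divide p2.ev_divide rs1_def rs2_def)
  with 1 show "p1.res f = rs1 f" "p2.res f = rs2 f" by auto
qed

lemma rs_tau: "rs1 tau = - 1" "rs2 tau = 0"
proof -
  show "rs1 tau = - 1" using res_tau res_eq_rs(1)[OF tau_R] by simp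
  have "N \<in> p2.O_w" "ev t2 N = 0" using R_local(2)[OF R_X] ev_XY by (simp_all add: p2.O_diff p2.ev_diff)
  then show "rs2 tau = 0" using tau_t2 by (simp add: rs2_def p2.ev_mult)
qed

lemma rs_add: "N * f \<in> R \<Longrightarrow> N * g \<in> R \<Longrightarrow> rs1 (f + g) = rs1 f + rs1 g"
  "N * f \<in> R \<Longrightarrow> N * g \<in> R \<Longrightarrow> rs2 (f + g) = rs2 f + rs2 g"
  "N * f \<in> R \<Longrightarrow> N * g \<in> R \<Longrightarrow> rs1 (f - g) = rs1 f - rs1 g"
  "N * f \<in> R \<Longrightarrow> N * g \<in> R \<Longrightarrow> rs2 (f - g) = rs2 f - rs2 g"
  "N * f \<in> R \<Longrightarrow> rs1 (fls_const c * f) = c * rs1 f"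
  "N * f \<in> R \<Longrightarrow> rs2 (fls_const c * f) = c * rs2 f"
proof -
  have e: "N * (fls_const c * f) = fls_const c * (N * f)" for c f by simp
  show "N * f \<in> R \<Longrightarrow> N * g \<in> R \<Longrightarrow> rs1 (f + g) = rs1 f + rs1 g"
    "N * f \<in> R \<Longrightarrow> N * g \<in> R \<Longrightarrow> rs2 (f + g) = rs2 f + rs2 g"
    using R_local[of "N * f"] R_local[of "N * g"]
    by (simp_all only: rs1_def rs2_def distrib_left p1.ev_add p2.ev_add add_divide_distrib)
  show "N * f \<in> R \<Longrightarrow> N * g \<in> R \<Longrightarrow> rs1 (f - g) = rs1 f - rs1 g"
    "N * f \<in> R \<Longrightarrow> N * g \<in> R \<Longrightarrow> rs2 (f - g) = rs2 f - rs2 g"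
    using R_local[of "N * f"] R_local[of "N * g"]
    by (simp_all only: rs1_def rs2_def right_diff_distrib p1.ev_diff p2.ev_diff diff_divide_distrib)
  show "N * f \<in> R \<Longrightarrow> rs1 (fls_const c * f) = c * rs1 f"
    "N * f \<in> R \<Longrightarrow> rs2 (fls_const c * f) = c * rs2 f"
    using R_local[of "N * f"]
    by (simp_all only: rs1_def rs2_def e p1.ev_mult p2.ev_mult p1.O_const p2.O_const p1.ev_const p2.ev_const) simp_all
qed

lemma rs_zero_R:
  assumes "N * f \<in> R" "rs1 f = 0" "rs2 f = 0"
  shows "f \<in> R"
  unfolding regular_affine_R_iff
proof
  fix w assume w: "w \<in> curve lam - {Inf}"
  consider "w = t1" | "w = t2" | "w \<notin> {t1, t2}" by blast
  then show "f \<in> loc_ring lam w"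
  proof cases
    case 1
    then show ?thesis using p1.res_eq_0 pole_local[OF assms(1)] res_eq_rs[OF assms(1)] assms by auto
  next
    case 2
    then show ?thesis using p2.res_eq_0 pole_local[OF assms(1)] res_eq_rs[OF assms(1)] assms by auto
  next
    case 3
    have "(if w \<in> {t1, t2} then unif w else 1) * f \<in> loc_ring lam w"
      using pole_iff[of f] assms(1) w by blast
    then show ?thesis using 3 by simp
  qed
qed

text \<open>A trace-free endomorphism of \<open>E\<close> without poles is zero, since \<open>E\<close> is simple.\<close>

lemma connection_unique:
  assumes A: "log_connection lam {t1, t2} E A" and B: "log_connection lam {t1, t2} E B"
    and tr: "al A + de A = al B + de B"
    and rs: "rs1 (al A) = rs1 (al B)" "rs1 (be A) = rs1 (be B)" "rs1 (ga A) = rs1 (ga B)"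
      "rs2 (al A) = rs2 (al B)" "rs2 (be A) = rs2 (be B)" "rs2 (ga A) = rs2 (ga B)"
  shows "A = B"
proof -
  define a b c where "a = al A - al B" "b = be A - be B" "c = ga A - ga B"
  define k where "k = fls_const \<kappa>"
  have NR: "N * al A \<in> R" "N * be A \<in> R" "N * ga A \<in> R" "N * al B \<in> R" "N * be B \<in> R" "N * ga B \<in> R"
    using A B unfolding log_connection_iff by auto
  then have "N * a \<in> R" "N * b \<in> R" "N * c \<in> R"
    unfolding a_b_c_def right_diff_distrib[of N] by (simp_all only: R_diff)
  moreover have "rs1 a = 0" "rs2 a = 0" "rs1 b = 0" "rs2 b = 0" "rs1 c = 0" "rs2 c = 0"
    using NR rs unfolding a_b_c_def by (simp_all only: rs_add diff_self)
  ultimately have R: "a \<in> R" "b \<in> R" "c \<in> R"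
    by (simp_all only: rs_zero_R)
  define F where "F x b c d = (k * Y + x * (k * X) + b * (Y / X)) -
       k * X * (X / Y * (del (Y / X) + c * (k * X) + d * (Y / X)))" for x b c d
  have IA: "X / Y * ga A \<in> I.O_w" "al A - k * X * (X / Y * ga A) \<in> I.O_w" "F (al A) (be A) (ga A) (de A) \<in> I.O_w"
    and IB: "X / Y * ga B \<in> I.O_w" "al B - k * X * (X / Y * ga B) \<in> I.O_w" "F (al B) (be B) (ga B) (de B) \<in> I.O_w"
    using A B unfolding log_connection_iff inf_cond_def k_def F_def by blast+
  \<comment> \<open>The traces agree, so the difference is trace-free and three entries remain to be
    killed.\<close>
  have dd: "de A - de B = - a" using tr unfolding a_b_c_def by (simp add: algebra_simps)
  have 1: "X / Y * c \<in> I.O_w"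
    using I.O_diff[OF IA(1) IB(1)] unfolding a_b_c_def by (simp only: right_diff_distrib)
  have 2: "a - k * X * (X / Y * c) \<in> I.O_w"
  proof -
    have "(al A - k * X * (X / Y * ga A)) - (al B - k * X * (X / Y * ga B)) \<in> I.O_w"
      by (rule I.O_diff[OF IA(2) IB(2)])
    also have "(al A - k * X * (X / Y * ga A)) - (al B - k * X * (X / Y * ga B)) = a - k * X * (X / Y * c)"
      unfolding a_b_c_def by (simp add: algebra_simps)
    finally show ?thesis .
  qed
  obtain c0 where c0: "c = fls_const c0" using R_simple_pole_const[OF R(3) 1] by blast
  \<comment> \<open>With \<open>c\<close> constant, \<open>X / Y\<close> times the previous
    condition bounds the pole of \<open>a\<close> by order 1, so \<open>a\<close> is constant as
    well. The condition itself then leaves \<open>\<kappa> * c0\<close> times a genuine simple pole,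
    which forces \<open>c0 = 0\<close>.\<close>
  have "X / Y * (a - k * X * (X / Y * c)) + fls_const (\<kappa> * c0) * g_inf \<in> I.O_w"
    by (intro I.O_add I.O_mult[OF O_Inf_XY(1) 2] I.O_mult[OF I.O_const ev_g_inf(1)])
  also have "X / Y * (a - k * X * (X / Y * c)) + fls_const (\<kappa> * c0) * g_inf = X / Y * a"
    unfolding inf_pow(1) c0 k_def fls_const_mult by (simp add: algebra_simps power2_eq_square)
  finally obtain a0 where a0: "a = fls_const a0" using R_simple_pole_const[OF R(1)] by blast
  have "a - (a - k * X * (X / Y * c)) \<in> I.O_w"
    by (rule I.O_diff[OF _ 2]) (simp add: a0)
  also have "a - (a - k * X * (X / Y * c)) = fls_const (\<kappa> * c0) * (X / Y * X)"
    unfolding c0 k_def fls_const_mult by simp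
  finally have "\<kappa> * c0 = 0" by (rule no_simple_pole_Inf)
  then have c: "c = 0" using kappa_nz c0 by simp
  have 4: "2 * k * X * a + b * (Y / X) \<in> I.O_w"
  proof -
    have "F (al A) (be A) (ga A) (de A) - F (al B) (be B) (ga B) (de B) \<in> I.O_w"
      by (rule I.O_diff[OF IA(3) IB(3)])
    also have "F (al A) (be A) (ga A) (de A) - F (al B) (be B) (ga B) (de B) =
      a * (k * X) + b * (Y / X) - k * X * (X / Y * (c * (k * X))) - k * X * (X / Y * ((de A - de B) * (Y / X)))"
      unfolding F_def a_b_c_def by (simp only: ring_distribs) (simp add: algebra_simps)
    also have "\<dots> = 2 * k * X * a + b * (Y / X)"
      unfolding dd c by (simp add: algebra_simps)
    finally show ?thesis .
  qed
  \<comment> \<open>Multiplying by the square of \<open>X / Y\<close> turns \<open>X\<close> into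
    \<open>g_inf\<close> and bounds the pole of \<open>b\<close>, so \<open>b\<close> is constant.
    Comparing values at infinity then gives \<open>a0 = 0\<close>, after which
    \<open>b * (Y / X)\<close> is regular and \<open>b\<close> vanishes at infinity.\<close>
  have 5: "X / Y * b \<in> I.O_w"
  proof -
    have "(X / Y)\<^sup>2 * (2 * k * X * a + b * (Y / X)) - fls_const (2 * \<kappa> * a0) * g_inf \<in> I.O_w"
      by (intro I.O_diff I.O_mult[OF I.O_power[OF O_Inf_XY(1)] 4] I.O_mult[OF I.O_const ev_g_inf(1)])
    also have "(X / Y)\<^sup>2 * (2 * k * X * a + b * (Y / X)) - fls_const (2 * \<kappa> * a0) * g_inf = X / Y * b"
      unfolding inf_pow(1) a0 k_def fls_const_mult by (simp add: algebra_simps power2_eq_square)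
    finally show ?thesis .
  qed
  obtain b0 where b0: "b = fls_const b0" using R_simple_pole_const[OF R(2) 5] by blast
  have "ev Inf (fls_const (2 * \<kappa> * a0) * g_inf) = ev Inf ((X / Y)\<^sup>2 * (2 * k * X * a + b * (Y / X)) - X / Y * b)"
    unfolding inf_pow(1) a0 k_def fls_const_mult by (simp add: algebra_simps power2_eq_square)
  also have "\<dots> = 0"
  proof -
    have "ev Inf ((X / Y)\<^sup>2 * (2 * k * X * a + b * (Y / X))) = 0" "ev Inf (X / Y * b) = 0"
      using 4 O_Inf_XY by (simp_all add: I.ev_mult I.O_power I.ev_power b0 del: times_divide_eq_left times_divide_eq_right)
    moreover have "(X / Y)\<^sup>2 * (2 * k * X * a + b * (Y / X)) \<in> I.O_w"
      by (rule I.O_mult[OF I.O_power[OF O_Inf_XY(1)] 4])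
    ultimately show ?thesis using 5 by (simp only: I.ev_diff diff_self)
  qed
  finally have "2 * \<kappa> * a0 = 0" using ev_g_inf by (simp add: I.ev_mult)
  then have a: "a = 0" using kappa_nz a0 by simp
  have "ev Inf b = ev Inf (X / Y * (2 * k * X * a + b * (Y / X)))"
    unfolding a by simp
  also have "\<dots> = 0" using 4 O_Inf_XY by (simp only: I.ev_mult mult_zero_left)
  finally have b: "b = 0" using b0 by simp
  have "al A = al B" "be A = be B" "ga A = ga B" "de A = de B"
    using a b c dd unfolding a_b_c_def by auto
  then show ?thesis using coords_mk by metis
qed

text \<open>
  The connection with residues \<open>(c 0, c 1; c 2, *)\<close> at \<open>t\<^sub>1\<close> and \<open>(c 3, c 4; c 5, *)\<close> at \<open>t\<^sub>2\<close>. After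
  removing half of the trace, the entries are rational functions with denominator \<open>x - t\<close>; the
  coefficients of the numerators solve the linear system given by regularity at infinity and by
  the residues.
\<close>

definition kg2 where "kg2 c = (c 2 + c 5) / (2::complex)"
text \<open>The residues of \<open>num_a c / N\<close> are to be \<open>c 0 + 1 / 2\<close> and
  \<open>c 3\<close>, the 1/2 compensating half of \<open>tau\<close>. Their sum is
  \<open>2 * ka2 c\<close>, and regularity at infinity ties \<open>ka2\<close> to
  \<open>kg1\<close>. This is how the sum of the upper left residues reaches the lower left
  entry.\<close>

definition kg1 where "kg1 c = (c 0 + c 3) / (2 * \<kappa>)"
definition kg0 where "kg0 c = r * (c 2 - c 5) / 2 - kg1 c * t"
text \<open>The summand 1/4 cancels the polar part \<open>- X\<^sup>2 / (4 * Y)\<close> that half of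
  \<open>tau\<close> has at infinity.\<close>

definition ka2 where "ka2 c = \<kappa> * kg1 c + 1 / 4"
definition ka3 where "ka3 c = \<kappa> * kg2 c"
definition kb4 where "kb4 c = - \<kappa>\<^sup>2 * kg2 c"
definition kb3 where "kb3 c = - \<kappa>\<^sup>2 * kg1 c - \<kappa>"
definition ka1 where "ka1 c = ((1 + lam) * kb4 c + kb4 c * t - (c 1 + c 4) / 2) / (2 * \<kappa>)"
definition kb2 where "kb2 c = (c 1 + c 4) / 2 - kb4 c * t"
definition ka0 where "ka0 c = r * (c 0 + 1 / 2 - c 3) / 2 - ka1 c * t - ka3 c * t\<^sup>2"
definition kb1 where "kb1 c = 2 * \<kappa> * (1 + lam) * ka2 c + (1 + lam) * kb3 c + \<kappa>\<^sup>2 * kg0 c + \<kappa> * (1 + lam) + \<kappa> * t / 2"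
definition kb0 where "kb0 c = r * (c 1 - c 4) / 2 - kb1 c * t - kb3 c * t\<^sup>2"

text \<open>The digit in a coefficient name is the position of its monomial in the list 1,
  \<open>x\<close>, \<open>y\<close>, \<open>x\<^sup>2\<close>, \<open>x y\<close>, ordered by pole
  order at infinity.\<close>

definition num_g where "num_g c = fe [:kg0 c, kg1 c:] [:kg2 c:]"
definition num_a where "num_a c = fe [:ka0 c, ka1 c, ka3 c:] [:ka2 c:]"
definition num_b where "num_b c = fe [:kb0 c, kb1 c, kb3 c:] [:kb2 c, kb4 c:]"

definition con_mat :: "(nat \<Rightarrow> complex) \<Rightarrow> complex fls ^ 2 ^ 2" where
  "con_mat c = mk (fls_const (1 / 2) * tau + num_a c / N) (num_b c / N) (num_g c / N)
                  (fls_const (1 / 2) * tau - num_a c / N)"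

lemma num_R: "num_g c \<in> R" "num_a c \<in> R" "num_b c \<in> R"
  by (auto simp: num_g_def num_a_def num_b_def R_def)

lemma fe_R: "fe p q \<in> R"
  by (auto simp: R_def)

lemma fe_lin: "fe p q + fe p' q' = fe (p + p') (q + q')" "fe p q - fe p' q' = fe (p - p') (q - q')"
  "evalx X u * fe p q = fe (u * p) (u * q)" "Y * fe p q = fe (cubic * q) p" "evalx X p = fe p 0"
  by (simp_all add: fe_def evalx_add evalx_diff evalx_mult evalx_cubic algebra_simps power2_eq_square)

text \<open>Each condition is brought over a common denominator: \<open>N * Y\<close> with pole
  order 5, or \<open>N * X * Y\<close> with pole order 7. The coefficients were chosen to cancel
  every term of the numerator of larger pole order.\<close>

lemma con_mat_inf: "inf_cond (fls_const (1 / 2) * tau + num_a c / N) (num_b c / N) (num_g c / N)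
                  (fls_const (1 / 2) * tau - num_a c / N)"
proof -
  define k where "k = fls_const \<kappa>"
  define a b g where "a = num_a c / N" and "b = num_b c / N" and "g = num_g c / N"
  have num: "num_a c = N * a" "num_b c = N * b" "num_g c = N * g" by (simp_all add: a_def b_def g_def)
  have Nx: "N = evalx X [:- t, 1:]" by (simp add: fls_const_uminus)
  have x2: "X\<^sup>2 = evalx X [:0, 0, 1:]" and x4: "X ^ 4 = evalx X [:0, 0, 0, 0, 1:]" and x1: "X = evalx X [:0, 1:]"
    by (simp_all add: power2_eq_square power4_eq_xxxx mult.assoc)
  have kp: "k = evalx X [:\<kappa>:]" by (simp add: k_def)
  have sN: "fls_subdegree N = - 2" "N \<in> R"
    using subdegree_evalx[of "[:- t, 1:]"] unfolding Nx by (simp_all only: R_evalx) simp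
  have k2: "2 * k = evalx X [:2 * \<kappa>:]" 
    unfolding k_def fls_const_numeral[symmetric] fls_const_mult_const by simp
  have c1: "X / Y * g \<in> I.O_w"
  proof -
    have "X * num_g c = fe [:0, kg0 c, kg1 c:] [:0, kg2 c:]"
      using fe_lin(3)[of "[:0, 1:]" "[:kg0 c, kg1 c:]" "[:kg2 c:]"] by (simp add: num_g_def)
    then have "X * num_g c = 0 \<or> fls_subdegree (X * num_g c) \<ge> - int 5"
      using subdegree_fe_ge[of "[:0, kg0 c, kg1 c:]" 5 "[:0, kg2 c:]"] by (simp split: if_splits)
    then have "X * num_g c / (N * Y) \<in> I.O_w"
      using sN num_R by (intro O_Inf_quotient) (auto intro!: R_mult R_X R_Y)
    then show ?thesis by (simp add: num)
  qed
  have c2: "a - X\<^sup>2 / (4 * Y) - k * X * (X / Y * g) \<in> I.O_w"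
  proof -
    define P where "P = [:0, ka2 c * lam, - (1 + lam) * ka2 c + t / 4 - \<kappa> * kg0 c:]"
    define Q where "Q = [:ka0 c, ka1 c:]"
    have q: "fls_const (1 / 4) * N * X\<^sup>2 = fe ([:1 / 4:] * [:- t, 1:] * [:0, 0, 1:]) 0"
      unfolding fe_lin(5)[symmetric] evalx_mult by (simp add: fls_const_uminus power2_eq_square)
    have g: "k * X\<^sup>2 * num_g c = fe ([:\<kappa>:] * [:0, 0, 1:] * [:kg0 c, kg1 c:]) ([:\<kappa>:] * [:0, 0, 1:] * [:kg2 c:])"
      unfolding num_g_def fe_lin(3)[symmetric] evalx_mult by (simp add: k_def power2_eq_square)
    have "Y * num_a c - fls_const (1 / 4) * N * X\<^sup>2 - k * X\<^sup>2 * num_g c = fe P Q"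
      unfolding q g num_a_def fe_lin(2,4) P_def Q_def cubic_def ka2_def ka3_def
      by (simp add: algebra_simps)
    moreover have "Y * num_a c - fls_const (1 / 4) * N * X\<^sup>2 - k * X\<^sup>2 * num_g c
        = (a - X\<^sup>2 / (4 * Y) - k * X * (X / Y * g)) * (N * Y)"
      unfolding num fls_const_divide by (simp add: field_simps power2_eq_square)
    ultimately have "a - X\<^sup>2 / (4 * Y) - k * X * (X / Y * g) = fe P Q / (N * Y)"
      by (simp add: eq_divide_eq)
    moreover have "fe P Q = 0 \<or> fls_subdegree (fe P Q) \<ge> - int 5"
      by (rule subdegree_fe_ge) (simp_all add: P_def Q_def)
    then have "fe P Q / (N * Y) \<in> I.O_w"
      using sN by (intro O_Inf_quotient) (auto intro!: R_mult R_X R_Y fe_R)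
    ultimately show ?thesis by simp
  qed
  have c4: "2 * k * X * a + Y / X * b - k\<^sup>2 * X ^ 3 / Y * g + k * Y - k * X ^ 3 / (2 * Y) \<in> I.O_w"
  proof -
    define P where "P = [:0, lam * kb0 c, - (1 + lam) * kb0 c + lam * kb1 c - \<kappa> * t * lam,
      2 * \<kappa> * ka2 c * lam + kb0 c - (1 + lam) * kb1 c + lam * kb3 c + \<kappa> * (lam + (1 + lam) * t):]"
    define Q where "Q = [:0, lam * kb2 c, 2 * \<kappa> * ka0 c - (1 + lam) * kb2 c + lam * kb4 c:]"
    have n1: "2 * k * X\<^sup>2 * Y * num_a c = fe ([:2 * \<kappa>:] * [:0, 0, 1:] * (cubic * [:ka2 c:]))
        ([:2 * \<kappa>:] * [:0, 0, 1:] * [:ka0 c, ka1 c, ka3 c:])"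
      unfolding num_a_def fe_lin(3,4)[symmetric] evalx_mult k2[symmetric] x2[symmetric] by (simp add: mult.assoc)
    have n2: "Y\<^sup>2 * num_b c = fe (cubic * [:kb0 c, kb1 c, kb3 c:]) (cubic * [:kb2 c, kb4 c:])"
      unfolding num_b_def fe_lin(3)[symmetric] evalx_cubic ..
    have n3: "k\<^sup>2 * X ^ 4 * num_g c = fe ([:\<kappa>\<^sup>2:] * [:0, 0, 0, 0, 1:] * [:kg0 c, kg1 c:])
        ([:\<kappa>\<^sup>2:] * [:0, 0, 0, 0, 1:] * [:kg2 c:])"
      unfolding num_g_def fe_lin(3)[symmetric] evalx_mult x4[symmetric]
      by (simp add: k_def power2_eq_square mult.assoc)
    have n4: "(k * X * Y\<^sup>2 - fls_const (1 / 2) * k * X ^ 4) * N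
        = fe (([:\<kappa>:] * [:0, 1:] * cubic - [:1 / 2:] * [:\<kappa>:] * [:0, 0, 0, 0, 1:]) * [:- t, 1:]) 0"
      unfolding fe_lin(5)[symmetric] evalx_mult evalx_diff evalx_cubic x4[symmetric] kp[symmetric] x1[symmetric] Nx[symmetric]
      by simp
    \<comment> \<open>The equations \<open>b1\<close> to \<open>b4\<close> annihilate the
      coefficients of \<open>X^4\<close>, \<open>X^3 Y\<close>, \<open>X^5\<close> and
      \<open>X^4 Y\<close>, of pole orders 8 to 11. What remains, \<open>P\<close> and
      \<open>Q\<close>, has pole order at most 7.\<close>
    have b1: "kb1 c = 2 * \<kappa> * (1 + lam) * ka2 c + (1 + lam) * kb3 c + \<kappa>\<^sup>2 * kg0 c + \<kappa> * (1 + lam) + \<kappa> * t / 2"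
      by (rule kb1_def)
    have b2: "2 * \<kappa> * ka1 c + kb2 c - (1 + lam) * kb4 c = 0"
      using kappa_nz by (simp add: ka1_def kb2_def)
    have b3: "2 * \<kappa> * ka2 c + kb3 c - \<kappa>\<^sup>2 * kg1 c + \<kappa> / 2 = 0"
      by (simp add: ka2_def kb3_def algebra_simps power2_eq_square)
    have b4: "2 * \<kappa> * ka3 c + kb4 c - \<kappa>\<^sup>2 * kg2 c = 0"
      by (simp add: ka3_def kb4_def algebra_simps power2_eq_square)
    have P: "[:2 * \<kappa>:] * [:0, 0, 1:] * (cubic * [:ka2 c:]) + cubic * [:kb0 c, kb1 c, kb3 c:]
        - [:\<kappa>\<^sup>2:] * [:0, 0, 0, 0, 1:] * [:kg0 c, kg1 c:]
        + ([:\<kappa>:] * [:0, 1:] * cubic - [:1 / 2:] * [:\<kappa>:] * [:0, 0, 0, 0, 1:]) * [:- t, 1:]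
        = P + [:0, 0, 0, 0, - 2 * \<kappa> * (1 + lam) * ka2 c + kb1 c - (1 + lam) * kb3 c - \<kappa>\<^sup>2 * kg0 c - \<kappa> * (1 + lam) - \<kappa> * t / 2,
           2 * \<kappa> * ka2 c + kb3 c - \<kappa>\<^sup>2 * kg1 c + \<kappa> / 2:]"
      unfolding P_def cubic_def by (simp add: algebra_simps)
    have Q: "[:2 * \<kappa>:] * [:0, 0, 1:] * [:ka0 c, ka1 c, ka3 c:] + cubic * [:kb2 c, kb4 c:]
        - [:\<kappa>\<^sup>2:] * [:0, 0, 0, 0, 1:] * [:kg2 c:]
        = Q + [:0, 0, 0, 2 * \<kappa> * ka1 c + kb2 c - (1 + lam) * kb4 c, 2 * \<kappa> * ka3 c + kb4 c - \<kappa>\<^sup>2 * kg2 c:]"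
      unfolding Q_def cubic_def by (simp add: algebra_simps)
    have "2 * k * X\<^sup>2 * Y * num_a c + Y\<^sup>2 * num_b c - k\<^sup>2 * X ^ 4 * num_g c
        + (k * X * Y\<^sup>2 - fls_const (1 / 2) * k * X ^ 4) * N = fe P Q"
      unfolding n1 n2 n3 n4 fe_lin(1,2) P using Q b1 b2 b3 b4 by simp
    moreover have "2 * k * X\<^sup>2 * Y * num_a c + Y\<^sup>2 * num_b c - k\<^sup>2 * X ^ 4 * num_g c
        + (k * X * Y\<^sup>2 - fls_const (1 / 2) * k * X ^ 4) * N
        = (2 * k * X * a + Y / X * b - k\<^sup>2 * X ^ 3 / Y * g + k * Y - k * X ^ 3 / (2 * Y)) * (N * X * Y)"
      unfolding num fls_const_divide by (simp add: field_simps power2_eq_square power3_eq_cube power4_eq_xxxx)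
    ultimately have "2 * k * X * a + Y / X * b - k\<^sup>2 * X ^ 3 / Y * g + k * Y - k * X ^ 3 / (2 * Y) = fe P Q / (N * X * Y)"
      by (simp add: eq_divide_eq)
    moreover have "fe P Q = 0 \<or> fls_subdegree (fe P Q) \<ge> - int 7"
      by (rule subdegree_fe_ge) (simp_all add: P_def Q_def)
    then have "fe P Q / (N * X * Y) \<in> I.O_w"
      using sN by (intro O_Inf_quotient) (auto intro!: R_mult R_X R_Y fe_R)
    ultimately show ?thesis by simp
  qed
  \<comment> \<open>Only the polar part of \<open>tau\<close> at infinity is known; the rest of the
    determinant connection enters through this regular function.\<close>
  define T where "T = tau + (X\<^sup>2 - L) / (2 * Y)"
  have T: "T \<in> I.O_w" unfolding T_def by (rule tau_Inf)
  define h2 where "h2 = fls_const (1 / 2 :: complex)"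
  have hh: "h2 + h2 = 1" unfolding h2_def fls_const_add[symmetric] by simp
  have al: "h2 * tau + a - k * X * (X / Y * g) \<in> I.O_w"
  proof -
    have "h2 * T + (a - X\<^sup>2 / (4 * Y) - k * X * (X / Y * g)) + fls_const (lam / 4) * (1 / Y) \<in> I.O_w"
      unfolding h2_def by (intro I.O_add I.O_mult[OF I.O_const] T c2 O_Inf_XY)
    also have "h2 * T + (a - X\<^sup>2 / (4 * Y) - k * X * (X / Y * g)) + fls_const (lam / 4) * (1 / Y)
        = h2 * tau + a - k * X * (X / Y * g)"
      unfolding T_def h2_def fls_const_divide by (simp add: field_simps)
    finally show ?thesis .
  qed
  \<comment> \<open>In the frame at infinity the trace is \<open>T\<close>, so regularity of the
    lower right entry follows from that of the upper left one.\<close>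
  have de: "X / Y * (del (Y / X) + g * (k * X) + (h2 * tau - a) * (Y / X)) = T - (h2 * tau + a - k * X * (X / Y * g))"
  proof -
    have "X / Y * (del (Y / X) + g * (k * X) + (h2 * tau - a) * (Y / X))
        = X / Y * del (Y / X) + X / Y * g * k * X + (h2 * tau - a)"
      by (simp add: algebra_simps)
    also have "\<dots> = T - (h2 * tau + a - k * X * (X / Y * g)) + ((h2 + h2) * tau - tau)"
      unfolding del_YX T_def by (simp add: algebra_simps)
    finally show ?thesis unfolding hh by simp
  qed
  have be: "(k * Y + (h2 * tau + a) * (k * X) + b * (Y / X)) - k * X * (T - (h2 * tau + a - k * X * (X / Y * g)))
     = (2 * k * X * a + Y / X * b - k\<^sup>2 * X ^ 3 / Y * g + k * Y - k * X ^ 3 / (2 * Y)) + fls_const (\<kappa> * lam / 2) * (X / Y)"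
  proof -
    have "fls_const (\<kappa> * lam / 2) = k * L / 2" unfolding k_def fls_const_divide fls_const_mult by simp
    moreover have "h2 = 1 / 2" unfolding h2_def fls_const_divide by simp
    ultimately show ?thesis unfolding T_def by (simp add: field_simps power2_eq_square power3_eq_cube)
  qed
  show ?thesis
    unfolding inf_cond_def a_def[symmetric] b_def[symmetric] g_def[symmetric] k_def[symmetric] h2_def[symmetric] de be
    by (intro conjI c1 al I.O_diff[OF T al] I.O_add[OF c4] I.O_mult[OF I.O_const] O_Inf_XY)
qed

lemma con_mat_coords: "al (con_mat c) = fls_const (1 / 2) * tau + num_a c / N" "be (con_mat c) = num_b c / N"
  "ga (con_mat c) = num_g c / N" "de (con_mat c) = fls_const (1 / 2) * tau - num_a c / N"
  by (simp_all only: con_mat_def mk_coords)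

lemma con_mat_log: "log_connection lam {t1, t2} E (con_mat c)"
proof -
  have "N * (fls_const (1 / 2) * tau + num_a c / N) = fls_const (1 / 2) * (N * tau) + num_a c"
    "N * (fls_const (1 / 2) * tau - num_a c / N) = fls_const (1 / 2) * (N * tau) - num_a c"
    by (simp_all only: distrib_left right_diff_distrib mult.left_commute nonzero_mult_div_cancel_left[OF N_nz(1)] times_divide_eq_right)
  then show ?thesis
    unfolding log_connection_iff con_mat_coords using con_mat_inf tau_R num_R
    by (auto intro!: R_add R_diff R_mult[OF R_const])
qed

lemma con_mat_trace: "trace (con_mat c) = a $ 1 $ 1"
proof -
  have 1: "fls_const (1 / 2) * tau + num_a c / N + (fls_const (1 / 2) * tau - num_a c / N) = tau"
    by (simp add: fls_const_divide)
  have "trace (con_mat c) = eta * (fls_const (1 / 2) * tau + num_a c / N + (fls_const (1 / 2) * tau - num_a c / N))"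
    unfolding con_mat_def mk_def trace_def sum_2 by (simp add: algebra_simps)
  then show ?thesis unfolding 1 by (simp add: tau_def)
qed

lemma con_mat_res:
  "rs1 (al (con_mat c)) = c 0" "rs1 (be (con_mat c)) = c 1" "rs1 (ga (con_mat c)) = c 2"
  "rs2 (al (con_mat c)) = c 3" "rs2 (be (con_mat c)) = c 4" "rs2 (ga (con_mat c)) = c 5"
  "rs1 (de (con_mat c)) = - 1 - c 0" "rs2 (de (con_mat c)) = - c 3"
proof -
  have eva: "ev t1 (fe p q) = poly p t + poly q t * r" "ev t2 (fe p q) = poly p t - poly q t * r" for p q
    using R_local[OF R_evalx[of p]] R_local[OF R_evalx[of q]] R_local[OF R_Y] ev_XY
      Aff_point(4)[of r t] Aff_point(4)[of "- r" t] r2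
    by (simp_all add: fe_def p1.ev_add p1.ev_mult p1.O_mult p2.ev_add p2.ev_mult p2.O_mult)
  have q: "rs1 (f / N) = ev t1 f / r" "rs2 (f / N) = ev t2 f / (- r)" for f
    by (simp_all add: rs1_def rs2_def)
  have N: "N * (num_a c / N) \<in> R" "N * (fls_const (1 / 2) * tau) \<in> R"
    using num_R R_mult[OF R_const tau_R, of "1 / 2"] by (simp_all add: mult.left_commute)
  have A: "rs1 (num_a c / N) = c 0 + 1 / 2" "rs2 (num_a c / N) = c 3"
    unfolding q num_a_def eva using kappa_nz r_nz
    by (simp_all add: ka0_def ka2_def kg1_def field_simps power2_eq_square)
  have T: "rs1 (fls_const (1 / 2) * tau) = - 1 / 2" "rs2 (fls_const (1 / 2) * tau) = 0"
    using rs_add(5,6)[OF tau_R, of "1 / 2"] rs_tau by simp_all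
  show "rs1 (al (con_mat c)) = c 0" "rs2 (al (con_mat c)) = c 3"
    "rs1 (de (con_mat c)) = - 1 - c 0" "rs2 (de (con_mat c)) = - c 3"
    unfolding con_mat_coords rs_add(1,2)[OF N(2,1)] rs_add(3,4)[OF N(2,1)] A T by simp_all
  show "rs1 (be (con_mat c)) = c 1" "rs2 (be (con_mat c)) = c 4"
    unfolding con_mat_coords q num_b_def eva using r_nz
    by (simp_all add: kb0_def kb2_def field_simps power2_eq_square)
  show "rs1 (ga (con_mat c)) = c 2" "rs2 (ga (con_mat c)) = c 5"
    unfolding con_mat_coords q num_g_def eva using r_nz
    by (simp_all add: kg0_def kg2_def field_simps power2_eq_square)
qed

text \<open>The connection constructed from the residues of \<open>A\<close> has the same trace and
  residues as \<open>A\<close>, hence equals \<open>A\<close>. The six residues are therefore global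
  coordinates on these connections.\<close>

lemma log_connection_con_mat:
  assumes "log_connection lam {t1, t2} E A" "trace A = a $ 1 $ 1"
  shows "\<exists>c. A = con_mat c"
proof -
  have tr: "al B + de B = trace B / eta" for B
    unfolding al_def de_def trace_def sum_2 by (simp add: field_simps)
  define c where "c = (\<lambda>i::nat. [rs1 (al A), rs1 (be A), rs1 (ga A), rs2 (al A), rs2 (be A), rs2 (ga A)] ! i)"
  have "A = con_mat c"
    by (rule connection_unique[OF assms(1) con_mat_log])
      (simp_all add: con_mat_res tr con_mat_trace assms c_def)
  then show ?thesis by blast
qed

text \<open>A six-tuple of residues is encoded as a function on the naturals, of which the arguments
  below 6 enter.\<close>

lemma con_mat_cong: "(\<And>i. i < 6 \<Longrightarrow> c i = d i) \<Longrightarrow> con_mat c = con_mat d"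
  by (simp add: con_mat_def num_a_def num_b_def num_g_def kg2_def kg1_def kg0_def ka2_def ka3_def kb4_def kb3_def
    ka1_def kb2_def ka0_def kb1_def kb0_def)

end

section \<open>Lines in the fibres and residues\<close>

locale fibre_point = elliptic_bundle + curve_point +
  assumes w_aff: "w \<noteq> Inf"
begin

definition e1 :: "complex fls ^ 2 \<Rightarrow> complex" where "e1 v = ev w (v $ 1 - h * v $ 2)"
definition e2 :: "complex fls ^ 2 \<Rightarrow> complex" where "e2 v = ev w (v $ 2)"

text \<open>The preimage in the stalk of the line spanned by \<open>x (1, 0) + y (h, 1)\<close>. The
  line of the subbundle is the one with \<open>y = 0\<close>.\<close>

definition line :: "complex \<Rightarrow> complex \<Rightarrow> (complex fls ^ 2) set" where
  "line x y = {v \<in> E w. \<exists>c. e1 v = c * x \<and> e2 v = c * y}"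

lemma frame_E: "frame f1 f2 \<in> E w \<longleftrightarrow> f1 \<in> O_w \<and> f2 \<in> O_w"
  by (rule frame_affine[OF w_curve w_aff])

lemma e_frame [simp]: "e1 (frame f1 f2) = ev w f1" "e2 (frame f1 f2) = ev w f2"
  by (simp_all add: e1_def e2_def)

lemma E_cases: assumes "v \<in> E w" obtains f1 f2 where "v = frame f1 f2" "f1 \<in> O_w" "f2 \<in> O_w"
  using assms frame_cases frame_E by metis

lemma E_add: "u \<in> E w \<Longrightarrow> v \<in> E w \<Longrightarrow> u + v \<in> E w"
  and E_diff: "u \<in> E w \<Longrightarrow> v \<in> E w \<Longrightarrow> u - v \<in> E w"
  by (auto elim!: E_cases simp: frame_add frame_diff frame_E O_add O_diff)

lemma E_smult: "f \<in> O_w \<Longrightarrow> v \<in> E w \<Longrightarrow> f *s v \<in> E w"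
  using E_scale w_curve by blast

lemma e_add: "u \<in> E w \<Longrightarrow> v \<in> E w \<Longrightarrow> e1 (u + v) = e1 u + e1 v \<and> e2 (u + v) = e2 u + e2 v"
  and e_diff: "u \<in> E w \<Longrightarrow> v \<in> E w \<Longrightarrow> e1 (u - v) = e1 u - e1 v \<and> e2 (u - v) = e2 u - e2 v"
  and e_smult: "f \<in> O_w \<Longrightarrow> v \<in> E w \<Longrightarrow> e1 (f *s v) = ev w f * e1 v \<and> e2 (f *s v) = ev w f * e2 v"
  by (auto elim!: E_cases simp: frame_add frame_diff frame_scale ev_add ev_diff ev_mult)

lemma fibre_zero_iff: "v \<in> fibre_zero lam E w \<longleftrightarrow> v \<in> E w \<and> e1 v = 0 \<and> e2 v = 0"
proof
  assume "v \<in> fibre_zero lam E w"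
  then obtain f u where "f \<in> max_ideal lam w" "u \<in> E w" "v = f *s u"
    unfolding fibre_zero_def by blast
  then show "v \<in> E w \<and> e1 v = 0 \<and> e2 v = 0"
    by (simp add: max_ideal_ev E_smult e_smult)
next
  assume v: "v \<in> E w \<and> e1 v = 0 \<and> e2 v = 0"
  then obtain f1 f2 where f: "v = frame f1 f2" "f1 \<in> O_w" "f2 \<in> O_w" by (auto elim: E_cases)
  then have "frame (f1 / \<pi>) (f2 / \<pi>) \<in> E w" using v ev_0_iff by (simp add: frame_E)
  moreover have "v = \<pi> *s frame (f1 / \<pi>) (f2 / \<pi>)" by (simp add: f frame_scale)
  moreover have "\<pi> \<in> max_ideal lam w" by (simp add: max_ideal_ev)
  ultimately show "v \<in> fibre_zero lam E w" unfolding fibre_zero_def by blast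
qed

lemma line_eq:
  assumes v: "v \<in> E w"
  shows "{fls_const c *s v + z | c z. z \<in> fibre_zero lam E w} = line (e1 v) (e2 v)"
proof (intro set_eqI iffI)
  fix u assume "u \<in> {fls_const c *s v + z | c z. z \<in> fibre_zero lam E w}"
  then obtain c z where u: "u = fls_const c *s v + z" "z \<in> fibre_zero lam E w" by blast
  then have "e1 u = c * e1 v \<and> e2 u = c * e2 v" "u \<in> E w"
    using v by (simp_all add: fibre_zero_iff e_add e_smult E_smult E_add)
  then show "u \<in> line (e1 v) (e2 v)" unfolding line_def by blast
next
  fix u assume "u \<in> line (e1 v) (e2 v)"
  then obtain c where c: "u \<in> E w" "e1 u = c * e1 v" "e2 u = c * e2 v" unfolding line_def by blast
  have cv: "fls_const c *s v \<in> E w" using v by (simp add: E_smult)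
  have "u - fls_const c *s v \<in> fibre_zero lam E w"
    using e_smult[of "fls_const c" v] e_diff[OF c(1) cv] c v
    by (simp add: fibre_zero_iff E_diff cv)
  moreover have "u = fls_const c *s v + (u - fls_const c *s v)" by simp
  ultimately show "u \<in> {fls_const c *s v + z | c z. z \<in> fibre_zero lam E w}" by blast
qed

lemma frame_const: "frame (fls_const x) (fls_const y) \<in> E w"
  by (simp add: frame_E)

lemma fibre_lines_eq: "fibre_lines lam E w = {line x y | x y. x \<noteq> 0 \<or> y \<noteq> 0}"
proof (intro set_eqI iffI)
  fix l assume "l \<in> fibre_lines lam E w"
  then obtain v where v: "v \<in> E w" "v \<notin> fibre_zero lam E w" "l = {fls_const c *s v + z | c z. z \<in> fibre_zero lam E w}"
    unfolding fibre_lines_def by blast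
  then have "l = line (e1 v) (e2 v)" using line_eq by simp
  moreover have "e1 v \<noteq> 0 \<or> e2 v \<noteq> 0" using v fibre_zero_iff by blast
  ultimately show "l \<in> {line x y | x y. x \<noteq> 0 \<or> y \<noteq> 0}" by blast
next
  fix l assume "l \<in> {line x y | x y. x \<noteq> 0 \<or> y \<noteq> 0}"
  then obtain x y where xy: "l = line x y" "x \<noteq> 0 \<or> y \<noteq> 0" by blast
  define v where "v = frame (fls_const x) (fls_const y)"
  have v: "v \<in> E w" "e1 v = x" "e2 v = y" by (simp_all add: v_def frame_const)
  have "l = {fls_const c *s v + z | c z. z \<in> fibre_zero lam E w}"
    using line_eq[OF v(1)] v xy by simp
  moreover have "v \<in> E w - fibre_zero lam E w" using v xy fibre_zero_iff by auto
  ultimately show "l \<in> fibre_lines lam E w" unfolding fibre_lines_def by blast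
qed

lemma line_scale: "k \<noteq> 0 \<Longrightarrow> line (k * x) (k * y) = line x y"
proof -
  assume k: "k \<noteq> 0"
  have "(\<exists>c. e1 v = c * (k * x) \<and> e2 v = c * (k * y)) \<longleftrightarrow> (\<exists>c. e1 v = c * x \<and> e2 v = c * y)" for v
  proof
    assume "\<exists>c. e1 v = c * x \<and> e2 v = c * y"
    then obtain c where "e1 v = c * x" "e2 v = c * y" by blast
    then show "\<exists>c. e1 v = c * (k * x) \<and> e2 v = c * (k * y)"
      using k by (intro exI[of _ "c / k"]) simp
  qed (metis mult.assoc)
  then show ?thesis unfolding line_def by blast
qed

lemma e_functionals: "e1 \<in> fibre_functionals lam E w" "e2 \<in> fibre_functionals lam E w"
  unfolding fibre_functionals_def by (simp_all add: e_add e_smult fibre_zero_iff)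

lemma functional_eq:
  assumes a: "\<alpha> \<in> fibre_functionals lam E w" and v: "v \<in> E w"
  shows "\<alpha> v = \<alpha> (frame 1 0) * e1 v + \<alpha> (frame 0 1) * e2 v"
proof -
  have lin: "\<And>u v. u \<in> E w \<Longrightarrow> v \<in> E w \<Longrightarrow> \<alpha> (u + v) = \<alpha> u + \<alpha> v"
    "\<And>c v. v \<in> E w \<Longrightarrow> \<alpha> (fls_const c *s v) = c * \<alpha> v"
    "\<And>v. v \<in> fibre_zero lam E w \<Longrightarrow> \<alpha> v = 0"
    using a unfolding fibre_functionals_def by blast+
  define u where "u = fls_const (e1 v) *s frame 1 0 + fls_const (e2 v) *s frame 0 1"
  have f: "frame 1 0 \<in> E w" "frame 0 1 \<in> E w" by (simp_all add: frame_E)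
  have u: "u \<in> E w" unfolding u_def using f by (intro E_add E_smult) auto
  have eu: "e1 u = e1 v" "e2 u = e2 v"
    unfolding u_def frame_scale frame_add by simp_all
  have z: "v - u \<in> fibre_zero lam E w" using u v eu e_diff by (simp add: fibre_zero_iff E_diff)
  have "\<alpha> v = \<alpha> (u + (v - u))" by simp
  also have "\<dots> = \<alpha> u" using lin(1)[OF u, of "v - u"] lin(3)[OF z] u v by (simp add: E_diff)
  also have "\<alpha> u = e1 v * \<alpha> (frame 1 0) + e2 v * \<alpha> (frame 0 1)"
    unfolding u_def using f by (simp add: lin E_smult)
  finally show ?thesis by (simp add: mult.commute)
qed

text \<open>On a line both functionals scale by the same factor, so their quotient is well defined.
  The vector with constant coordinates \<open>x\<close>, \<open>y\<close> shows that it is the only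
  candidate.\<close>

lemma ratio_line:
  assumes "\<alpha> \<in> fibre_functionals lam E w" "\<beta> \<in> fibre_functionals lam E w"
  defines "a x y \<equiv> \<alpha> (frame 1 0) * x + \<alpha> (frame 0 1) * y"
    and "b x y \<equiv> \<beta> (frame 1 0) * x + \<beta> (frame 0 1) * y"
  shows "ratio \<alpha> \<beta> (line x y) = (if b x y \<noteq> 0 then Some (a x y / b x y) else None)"
proof -
  have \<alpha>: "\<alpha> v = c * a x y" and \<beta>: "\<beta> v = c * b x y"
    if "v \<in> E w" "e1 v = c * x" "e2 v = c * y" for v c
    using functional_eq[OF assms(1) that(1)] functional_eq[OF assms(2) that(1)] that
    by (simp_all add: a_def b_def algebra_simps)
  define v0 where "v0 = frame (fls_const x) (fls_const y)"
  have v0: "v0 \<in> E w" "e1 v0 = 1 * x" "e2 v0 = 1 * y" by (simp_all add: v0_def frame_const)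
  have v0l: "v0 \<in> line x y" unfolding line_def using v0 by blast
  show ?thesis
  proof (cases "b x y = 0")
    case True
    then have "\<not> (\<exists>v\<in>line x y. \<beta> v \<noteq> 0)" using \<beta> unfolding line_def by fastforce
    then show ?thesis using True by (simp add: ratio_def)
  next
    case False
    then have ex: "\<exists>v\<in>line x y. \<beta> v \<noteq> 0" using \<beta>[OF v0] by (intro bexI[OF _ v0l]) simp
    have "(THE c. \<forall>v\<in>line x y. \<alpha> v = c * \<beta> v) = a x y / b x y"
    proof (rule the_equality)
      show "\<forall>v\<in>line x y. \<alpha> v = a x y / b x y * \<beta> v"
      proof
        fix v assume "v \<in> line x y"
        then obtain c where "v \<in> E w" "e1 v = c * x" "e2 v = c * y" unfolding line_def by blast
        then have "\<alpha> v = c * a x y" "\<beta> v = c * b x y" by (rule \<alpha>, rule \<beta>)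
        then show "\<alpha> v = a x y / b x y * \<beta> v" using False by simp
      qed
      fix c assume "\<forall>v\<in>line x y. \<alpha> v = c * \<beta> v"
      then have "\<alpha> v0 = c * \<beta> v0" using v0l by blast
      then show "c = a x y / b x y" using \<alpha>[OF v0] \<beta>[OF v0] False by (simp add: field_simps)
    qed
    then show ?thesis using ex False by (simp add: ratio_def)
  qed
qed

lemma line_inj:
  assumes "line x y = line x' y'" "x \<noteq> 0 \<or> y \<noteq> 0"
  shows "x * y' = x' * y"
proof -
  have "frame (fls_const x) (fls_const y) \<in> line x y"
    unfolding line_def using frame_const by (auto intro!: exI[of _ 1])
  then have "frame (fls_const x) (fls_const y) \<in> line x' y'" using assms(1) by simp
  then obtain c where "e1 (frame (fls_const x) (fls_const y)) = c * x'" "e2 (frame (fls_const x) (fls_const y)) = c * y'"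
    unfolding line_def by blast
  then have "x = c * x'" "y = c * y'" by simp_all
  then show ?thesis by simp
qed

text \<open>The derivatives of the coordinates are multiplied by \<open>\<rho> / del \<rho>\<close>,
  which vanishes at the point. What survives on the fibre is the matrix of residues.\<close>

lemma conn_res:
  assumes A: "\<pi> * al A \<in> O_w" "\<pi> * be A \<in> O_w" "\<pi> * ga A \<in> O_w" "\<pi> * de A \<in> O_w" and v: "v \<in> E w"
  shows "res_rep lam w A v \<in> E w"
    "e1 (res_rep lam w A v) = res (al A) * e1 v + res (be A) * e2 v"
    "e2 (res_rep lam w A v) = res (ga A) * e1 v + res (de A) * e2 v"
proof -
  define \<rho> where "\<rho> = (SOME \<rho>. uniformizer lam w \<rho>)"
  have \<rho>: "uniformizer lam w \<rho>" unfolding \<rho>_def by (rule some_uniformizer)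
  note ru = res_uniformizer[OF \<rho>]
  define q where "q = \<rho> / del \<rho>"
  obtain f1 f2 where f: "v = frame f1 f2" "f1 \<in> O_w" "f2 \<in> O_w" using v by (rule E_cases)
  have "\<rho> / fls_deriv \<rho> * eta = q" using ru(5,6)[OF A(1)] by (simp add: q_def deriv_eq_del)
  then have "res_rep lam w A v = q *s frame (del f1 + al A * f1 + be A * f2) (del f2 + ga A * f1 + de A * f2)"
    unfolding res_rep_def Let_def \<rho>_def[symmetric] f conn_frame by simp
  also have "\<dots> = frame (q * del f1 + q * al A * f1 + q * be A * f2) (q * del f2 + q * ga A * f1 + q * de A * f2)"
    unfolding frame_scale by (simp add: algebra_simps)
  finally have eq: "res_rep lam w A v = frame (q * del f1 + q * al A * f1 + q * be A * f2) (q * del f2 + q * ga A * f1 + q * de A * f2)" .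
  have q: "q \<in> O_w" "ev w q = 0" using ru(3,4)[OF A(1)] by (simp_all add: q_def)
  have qd: "q * del f \<in> O_w" "ev w (q * del f) = 0" if "f \<in> O_w" for f
    using q O_del[OF that] by (simp_all add: O_mult ev_mult)
  have qa: "q * x * f \<in> O_w" "ev w (q * x * f) = res x * ev w f" if "\<pi> * x \<in> O_w" "f \<in> O_w" for f x
    using ru(1,2)[OF that(1)] that(2) by (simp_all add: q_def[symmetric] O_mult ev_mult)
  note m = qd[OF f(2)] qd[OF f(3)] qa[OF A(1) f(2)] qa[OF A(2) f(3)] qa[OF A(3) f(2)] qa[OF A(4) f(3)]
  show "res_rep lam w A v \<in> E w"
    unfolding eq frame_E by (intro conjI O_add m)
  show "e1 (res_rep lam w A v) = res (al A) * e1 v + res (be A) * e2 v"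
    "e2 (res_rep lam w A v) = res (ga A) * e1 v + res (de A) * e2 v"
    unfolding eq unfolding f(1) e_frame using m by (simp_all add: ev_add O_add)
qed

definition eig :: "complex fls ^ 2 ^ 2 \<Rightarrow> complex \<Rightarrow> complex \<Rightarrow> complex \<Rightarrow> bool" where
  "eig A c x y \<longleftrightarrow> res (al A) * x + res (be A) * y = c * x \<and> res (ga A) * x + res (de A) * y = c * y"

lemma res_diff_zero_iff:
  assumes A: "\<pi> * al A \<in> O_w" "\<pi> * be A \<in> O_w" "\<pi> * ga A \<in> O_w" "\<pi> * de A \<in> O_w" and v: "v \<in> E w"
  shows "res_rep lam w A v - fls_const c *s v \<in> fibre_zero lam E w \<longleftrightarrow> eig A c (e1 v) (e2 v)"
proof -
  note cr = conn_res[OF A v]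
  have cv: "fls_const c *s v \<in> E w" using v by (simp add: E_smult)
  have "e1 (res_rep lam w A v - fls_const c *s v) = res (al A) * e1 v + res (be A) * e2 v - c * e1 v"
    "e2 (res_rep lam w A v - fls_const c *s v) = res (ga A) * e1 v + res (de A) * e2 v - c * e2 v"
    using e_diff[OF cr(1) cv] e_smult[of "fls_const c" v] v cr(2,3) by simp_all
  then show ?thesis
    unfolding fibre_zero_iff eig_def using E_diff[OF cr(1) cv] by simp
qed

lemma res_eigenvalues_eq:
  assumes A: "\<pi> * al A \<in> O_w" "\<pi> * be A \<in> O_w" "\<pi> * ga A \<in> O_w" "\<pi> * de A \<in> O_w"
  shows "res_eigenvalues lam E w A = {c. \<exists>x y. (x \<noteq> 0 \<or> y \<noteq> 0) \<and> eig A c x y}"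
proof (intro set_eqI iffI)
  fix c assume "c \<in> res_eigenvalues lam E w A"
  then obtain v where "v \<in> E w" "v \<notin> fibre_zero lam E w" "res_rep lam w A v - fls_const c *s v \<in> fibre_zero lam E w"
    unfolding res_eigenvalues_def by blast
  then show "c \<in> {c. \<exists>x y. (x \<noteq> 0 \<or> y \<noteq> 0) \<and> eig A c x y}"
    using res_diff_zero_iff[OF A] fibre_zero_iff by blast
next
  fix c assume "c \<in> {c. \<exists>x y. (x \<noteq> 0 \<or> y \<noteq> 0) \<and> eig A c x y}"
  then obtain x y where xy: "x \<noteq> 0 \<or> y \<noteq> 0" "eig A c x y" by blast
  have v: "frame (fls_const x) (fls_const y) \<in> E w" by (rule frame_const)
  show "c \<in> res_eigenvalues lam E w A"
    unfolding res_eigenvalues_def mem_Collect_eq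
    by (rule bexI[of _ "frame (fls_const x) (fls_const y)"])
      (use xy v res_diff_zero_iff[OF A v] in \<open>auto simp: fibre_zero_iff\<close>)
qed

lemma line_eig_iff:
  assumes A: "\<pi> * al A \<in> O_w" "\<pi> * be A \<in> O_w" "\<pi> * ga A \<in> O_w" "\<pi> * de A \<in> O_w"
  shows "(\<forall>s\<in>line x y. res_rep lam w A s - fls_const c *s s \<in> fibre_zero lam E w) \<longleftrightarrow> eig A c x y"
proof
  assume *: "\<forall>s\<in>line x y. res_rep lam w A s - fls_const c *s s \<in> fibre_zero lam E w"
  have v: "frame (fls_const x) (fls_const y) \<in> E w" by (rule frame_const)
  then have "frame (fls_const x) (fls_const y) \<in> line x y"
    unfolding line_def by (auto intro!: exI[of _ 1])
  then have "eig A c (e1 (frame (fls_const x) (fls_const y))) (e2 (frame (fls_const x) (fls_const y)))"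
    using * res_diff_zero_iff[OF A v] by blast
  then show "eig A c x y" by simp
next
  assume eig: "eig A c x y"
  show "\<forall>s\<in>line x y. res_rep lam w A s - fls_const c *s s \<in> fibre_zero lam E w"
  proof
    fix s assume "s \<in> line x y"
    then obtain k where s: "s \<in> E w" "e1 s = k * x" "e2 s = k * y" unfolding line_def by blast
    have "eig A c (k * x) (k * y)"
    proof -
      have "res (al A) * (k * x) + res (be A) * (k * y) = k * (res (al A) * x + res (be A) * y)"
        "res (ga A) * (k * x) + res (de A) * (k * y) = k * (res (ga A) * x + res (de A) * y)"
        by (simp_all add: algebra_simps)
      then show ?thesis using eig unfolding eig_def by simp
    qed
    then show "res_rep lam w A s - fls_const c *s s \<in> fibre_zero lam E w"
      using res_diff_zero_iff[OF A s(1)] s by simp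
  qed
qed

text \<open>One eigenvalue and the trace determine the characteristic polynomial as
  \<open>(b - c) * (b - d)\<close>. The eigenvalue conditions on a residue thus follow from its
  eigenline and its trace.\<close>

lemma eigenvalues_trace:
  assumes "eig A c x y" "x \<noteq> 0 \<or> y \<noteq> 0" "res (al A) + res (de A) = c + d"
  shows "{b. \<exists>x y. (x \<noteq> 0 \<or> y \<noteq> 0) \<and> eig A b x y} = {c, d}"
proof -
  define p q r s where "p = res (al A)" "q = res (be A)" "r = res (ga A)" "s = res (de A)"
  note pq = p_q_r_s_def
  have ex: "(\<exists>x y. (x \<noteq> 0 \<or> y \<noteq> 0) \<and> eig A b x y) \<longleftrightarrow> (p - b) * (s - b) = q * r" for b
  proof
    assume "\<exists>x y. (x \<noteq> 0 \<or> y \<noteq> 0) \<and> eig A b x y"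
    then obtain x y where xy: "x \<noteq> 0 \<or> y \<noteq> 0" "p * x + q * y = b * x" "r * x + s * y = b * y"
      unfolding eig_def pq by blast
    have 1: "(p - b) * x = - q * y" "(s - b) * y = - r * x" using xy(2,3) by (simp_all add: algebra_simps)
    have "((p - b) * (s - b) - q * r) * x = 0" "((p - b) * (s - b) - q * r) * y = 0"
      using 1 by algebra+
    then show "(p - b) * (s - b) = q * r" using xy(1) by auto
  next
    assume det: "(p - b) * (s - b) = q * r"
    show "\<exists>x y. (x \<noteq> 0 \<or> y \<noteq> 0) \<and> eig A b x y"
    \<comment> \<open>The vector \<open>(q, b - p)\<close> lies in the kernel by its first row and
      by the determinant. If it is zero, \<open>(b - s, r)\<close> takes its place, and if that is
      zero too, the matrix is scalar.\<close>
    proof (cases "q = 0 \<and> p = b")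
      case False
      then show ?thesis using det
        by (intro exI[of _ q] exI[of _ "b - p"]) (auto simp: eig_def pq[symmetric] algebra_simps)
    next
      case True
      show ?thesis
      proof (cases "r = 0 \<and> s = b")
        case True
        with \<open>q = 0 \<and> p = b\<close> show ?thesis by (intro exI[of _ 1] exI[of _ 0]) (simp add: eig_def pq[symmetric])
      next
        case False
        with \<open>q = 0 \<and> p = b\<close> show ?thesis
          by (intro exI[of _ "b - s"] exI[of _ r]) (auto simp: eig_def pq[symmetric] algebra_simps)
      qed
    qed
  qed
  have "(p - c) * (s - c) = q * r" using ex[of c] assms(1,2) by blast
  moreover have "s = c + d - p" using assms(3) by (simp add: pq algebra_simps)
  ultimately have "(p - b) * (s - b) - q * r = (b - c) * (b - d)" for b by algebra
  then have "(p - b) * (s - b) = q * r \<longleftrightarrow> b = c \<or> b = d" for b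
    by (metis eq_iff_diff_eq_0 mult_eq_0_iff)
  then show ?thesis unfolding ex by auto
qed

end

locale marked_point = fibre_point lam E h \<kappa> "Aff t b" for lam E h \<kappa> t b +
  assumes b_nz: "b \<noteq> 0"
begin

lemma b2: "b\<^sup>2 = cub t"
  using w_curve curve_iff by simp

lemma XY_O: "X \<in> O_w" "Y \<in> O_w" "ev (Aff t b) X = t" "ev (Aff t b) Y = b"
  using Aff_point[OF b2] by auto

text \<open>The second component must vanish at \<open>w_i\<close> and may have a double pole at
  infinity, which suggests \<open>X - i\<close>. The first must match
  \<open>\<kappa> * X * (X / Y) * (X - i)\<close> up to a simple pole, and
  \<open>\<kappa> * Y\<close> does so while also vanishing at \<open>w_i\<close>.\<close>

definition sec :: "complex \<Rightarrow> complex fls ^ 2" where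
  "sec i = frame (fls_const \<kappa> * Y) (X - fls_const i)"

lemma L_section_sec:
  assumes i: "i \<in> {0, 1, lam}"
  shows "L_section lam E i (sec i)"
proof -
  have ci: "cub i = 0" using i by (auto simp: cub_def)
  have "f *s sec i \<in> E v" if v: "v \<in> curve lam" and f: "f \<in> div_stalk lam (\<lambda>w. of_bool (w = Aff i 0) - of_bool (w = Inf)) v" for v f
  proof -
    interpret v: curve_point lam v using v by (rule curve_point)
    show ?thesis
    proof (cases "v = Inf")
      case True
      interpret I: curve_point lam Inf by (rule curve_point[OF Inf_curve])
      have f: "f / (X / Y) \<in> I.O_w"
        using f unfolding True I.div_stalk_iff by (simp add: power_int_minus Inf_unif field_simps)
      have i2: "(X / Y)\<^sup>2 \<in> I.O_w" "(X / Y)\<^sup>2 * (X - fls_const i) \<in> I.O_w"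
      proof -
        show "(X / Y)\<^sup>2 \<in> I.O_w" using O_Inf_XY by (intro I.O_power)
        then have "g_inf - fls_const i * (X / Y)\<^sup>2 \<in> I.O_w"
          by (intro I.O_diff ev_g_inf I.O_mult[OF I.O_const])
        then show "(X / Y)\<^sup>2 * (X - fls_const i) \<in> I.O_w"
          unfolding inf_pow(1) by (simp add: algebra_simps)
      qed
      have 1: "X / Y * (f * (X - fls_const i)) \<in> I.O_w"
      proof -
        have "f / (X / Y) * ((X / Y)\<^sup>2 * (X - fls_const i)) \<in> I.O_w" by (rule I.O_mult[OF f i2(2)])
        also have "f / (X / Y) * ((X / Y)\<^sup>2 * (X - fls_const i)) = X / Y * (f * (X - fls_const i))"
          by (simp add: power2_eq_square)
        finally show ?thesis .
      qed
      have 2: "f * (fls_const \<kappa> * Y) - fls_const \<kappa> * X * (X / Y * (f * (X - fls_const i))) \<in> I.O_w"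
      proof -
        \<comment> \<open>By the equation of the curve, the leading cubic terms of
          \<open>Y\<^sup>2\<close> and \<open>X\<^sup>2 * (X - i)\<close> cancel; the remaining
          multiples of \<open>X\<^sup>2\<close> and \<open>X\<close> are small enough.\<close>
        have "fls_const \<kappa> * (f / (X / Y)) * ((fls_const i - 1 - L) * ((X / Y)\<^sup>2 * X) + L * (X / Y)\<^sup>2) \<in> I.O_w"
          unfolding inf_pow(1)[symmetric]
          by (intro I.O_mult I.O_add I.O_diff f i2 I.O_const I.O_01 ev_g_inf)
        also have "fls_const \<kappa> * (f / (X / Y)) * ((fls_const i - 1 - L) * ((X / Y)\<^sup>2 * X) + L * (X / Y)\<^sup>2)
            = fls_const \<kappa> * f * (Y\<^sup>2 - X\<^sup>2 * (X - fls_const i)) / Y"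
          unfolding Y2 by (simp add: field_simps power2_eq_square power3_eq_cube)
        also have "\<dots> = f * (fls_const \<kappa> * Y) - fls_const \<kappa> * X * (X / Y * (f * (X - fls_const i)))"
          by (simp add: field_simps power2_eq_square)
        finally show ?thesis .
      qed
      show ?thesis unfolding True sec_def frame_scale frame_Inf using 1 2 by simp
    next
      case False
      then obtain x y where v': "v = Aff x y" "y\<^sup>2 = cub x" using v curve_iff by (cases v) auto
      note A = Aff_point[OF v'(2), folded v'(1)]
      have XY: "X \<in> v.O_w" "Y \<in> v.O_w" using A(1) by auto
      have "f * (fls_const \<kappa> * Y) \<in> v.O_w \<and> f * (X - fls_const i) \<in> v.O_w"
      proof (cases "v = Aff i 0")
        case False
        then have "f \<in> v.O_w" using f \<open>v \<noteq> Inf\<close> unfolding v.div_stalk_iff by simp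
        then show ?thesis using XY by (auto intro!: v.O_mult v.O_diff)
      next
        case True
        then have f: "f * v.\<pi> \<in> v.O_w" using f unfolding v.div_stalk_iff by simp
        have "x = i" "y = 0" using True v'(1) by auto
        then have "ev v Y = 0" "ev v (X - fls_const i) = 0" "X - fls_const i \<in> v.O_w"
          using A(2,3) XY by (simp_all add: v.ev_diff v.O_diff)
        then have q: "Y / v.\<pi> \<in> v.O_w" "(X - fls_const i) / v.\<pi> \<in> v.O_w" using v.ev_0_iff XY by blast+
        have "fls_const \<kappa> * ((f * v.\<pi>) * (Y / v.\<pi>)) \<in> v.O_w" "(f * v.\<pi>) * ((X - fls_const i) / v.\<pi>) \<in> v.O_w"
          by (rule v.O_mult[OF v.O_const v.O_mult[OF f q(1)]], rule v.O_mult[OF f q(2)])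
        then show ?thesis by (simp add: mult.left_commute)
      qed
      then show ?thesis unfolding sec_def frame_scale frame_affine[OF v False] .
    qed
  qed
  moreover have "sec i \<noteq> 0"
  proof
    assume "sec i = 0"
    then have "sec i $ 2 = 0" by simp
    then show False using X_shift_nz[of i] by (simp add: sec_def)
  qed
  ultimately show ?thesis unfolding L_section_def by blast
qed

lemma L_line_sec:
  assumes i: "i \<in> {0, 1, lam}"
  shows "L_line lam E i (sec i) (Aff t b) = line (\<kappa> * b) (t - i)"
proof -
  have sE: "sec i \<in> E (Aff t b)"
    using XY_O by (simp add: sec_def frame_E O_mult O_diff)
  have es: "e1 (sec i) = \<kappa> * b" "e2 (sec i) = t - i"
    using XY_O by (simp_all add: sec_def ev_mult ev_diff)
  \<comment> \<open>As \<open>b\<close> is nonzero, the marked point is neither \<open>w_i\<close>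
    nor infinity, so the twist by the divisor is trivial there.\<close>
  have 0: "of_bool (Aff t b = Aff i 0) - of_bool (Aff t b = Inf) = (0 :: int)" using b_nz by simp
  have st: "f \<in> div_stalk lam (\<lambda>w. of_bool (w = Aff i 0) - of_bool (w = Inf)) (Aff t b) \<longleftrightarrow> f \<in> O_w" for f
    unfolding div_stalk_iff 0 by simp
  have "L_line lam E i (sec i) (Aff t b) = {fls_const c *s sec i + z | c z. z \<in> fibre_zero lam E (Aff t b)}"
    unfolding L_line_def st
  proof (intro set_eqI iffI)
    fix u assume "u \<in> {f *s sec i + z |f z. f \<in> O_w \<and> z \<in> fibre_zero lam E (Aff t b)}"
    then obtain f z where u: "u = f *s sec i + z" "f \<in> O_w" "z \<in> fibre_zero lam E (Aff t b)" by blast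
    define c where "c = ev (Aff t b) f"
    have "f *s sec i + z - fls_const c *s sec i \<in> fibre_zero lam E (Aff t b)"
      using u sE by (simp add: fibre_zero_iff E_add E_diff E_smult e_add e_diff e_smult c_def)
    moreover have "u = fls_const c *s sec i + (f *s sec i + z - fls_const c *s sec i)" using u by simp
    ultimately show "u \<in> {fls_const c *s sec i + z | c z. z \<in> fibre_zero lam E (Aff t b)}" by blast
  qed (use O_const in blast)
  then show ?thesis using line_eq[OF sE] es by simp
qed

text \<open>
  \<open>z\<close> is a fractional linear function of the slope \<open>e2 / e1\<close>; it is determined by its values at the
  three lines \<open>L\<^sub>i\<close> of slope \<open>(t - i) / (\<kappa> b)\<close>.
\<close>

lemma coordinate_ex:
  assumes z: "normalized_coordinate lam E (Aff t b) z"
  shows "\<exists>\<alpha> \<beta> k. \<alpha> \<in> fibre_functionals lam E (Aff t b) \<and> \<beta> \<in> fibre_functionals lam E (Aff t b) \<and>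
    k \<noteq> 0 \<and> (\<forall>l\<in>fibre_lines lam E (Aff t b). z l = ratio \<alpha> \<beta> l) \<and>
    \<alpha> (frame 1 0) = k * t \<and> \<alpha> (frame 0 1) = - k * (\<kappa> * b) \<and> \<beta> (frame 1 0) = k \<and> \<beta> (frame 0 1) = 0"
proof -
  obtain \<alpha> \<beta> where ab: "\<alpha> \<in> fibre_functionals lam E (Aff t b)" "\<beta> \<in> fibre_functionals lam E (Aff t b)"
    "\<forall>v\<in>E (Aff t b) - fibre_zero lam E (Aff t b). \<alpha> v \<noteq> 0 \<or> \<beta> v \<noteq> 0"
    "\<forall>l\<in>fibre_lines lam E (Aff t b). z l = ratio \<alpha> \<beta> l"
    using z unfolding normalized_coordinate_def proj_coordinate_def by blast
  define a1 a2 b1 b2 where "a1 = \<alpha> (frame 1 0)" "a2 = \<alpha> (frame 0 1)" "b1 = \<beta> (frame 1 0)" "b2 = \<beta> (frame 0 1)"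
  note d = a1_a2_b1_b2_def
  define q where "q = \<kappa> * b"
  have q: "q \<noteq> 0" using kappa_nz b_nz by (simp add: q_def)
  have eq: "a1 * q + a2 * (t - i) = i * (b1 * q + b2 * (t - i))" if i: "i \<in> {0, 1, lam}" for i
  proof -
    have "line q (t - i) \<in> fibre_lines lam E (Aff t b)" unfolding fibre_lines_eq using q by blast
    then have "z (line q (t - i)) = ratio \<alpha> \<beta> (line q (t - i))" using ab(4) by blast
    moreover have "z (line q (t - i)) = Some i"
      using z L_section_sec[OF i] L_line_sec[OF i] i unfolding normalized_coordinate_def q_def by metis
    ultimately have "ratio \<alpha> \<beta> (line q (t - i)) = Some i" by simp
    then show ?thesis
      unfolding ratio_line[OF ab(1,2)] d[symmetric] by (simp split: if_splits) (simp add: field_simps)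
  qed
  have e0: "a1 * q + a2 * t = 0" using eq[of 0] by simp
  have e1: "- a2 = b1 * q + b2 * (t - 1)" using eq[of 1] e0 by (simp add: algebra_simps)
  have el: "- a2 * lam = lam * (b1 * q + b2 * (t - lam))" using eq[of lam] e0 by (simp add: algebra_simps)
  then have "- a2 = b1 * q + b2 * (t - lam)" using lam_nz by (metis mult.commute mult_left_cancel)
  \<comment> \<open>Comparing the conditions at 1 and \<open>lam\<close> removes \<open>b2\<close>,
    so the denominator of the coordinate is a multiple of \<open>e1\<close>; the condition at 0 then
    fixes the numerator.\<close>
  then have "b2 * (t - 1) = b2 * (t - lam)" using e1 by simp
  then have "b2 = 0" using lam_nz by auto
  then have a2: "a2 = - b1 * q" using e1 by (metis add.right_neutral minus_minus mult_minus_left mult_zero_left)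
  have "a1 * q = b1 * t * q" using e0 a2 by (simp add: algebra_simps)
  then have a1: "a1 = b1 * t" using q by simp
  have "b1 \<noteq> 0"
  proof
    assume "b1 = 0"
    then have "\<alpha> (frame 1 0) = 0" "\<beta> (frame 1 0) = 0" using a1 d by auto
    moreover have "frame 1 0 \<in> E (Aff t b)" "frame 1 0 \<notin> fibre_zero lam E (Aff t b)"
      by (simp_all add: frame_E fibre_zero_iff)
    ultimately show False using ab(3) by blast
  qed
  then show ?thesis
    using ab a1 a2 \<open>b2 = 0\<close> d unfolding q_def by (intro exI[of _ \<alpha>] exI[of _ \<beta>] exI[of _ b1]) (simp add: mult.commute)
qed

end

section \<open>Regular functions\<close>

text \<open>A regular partial function given as a domain together with a total function, which
  replaces reasoning about options by reasoning about domains.\<close>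

definition regf :: "('a \<Rightarrow> complex option) set \<Rightarrow> 'a set \<Rightarrow> ('a \<Rightarrow> complex) \<Rightarrow> bool" where
  "regf G D \<phi> \<longleftrightarrow> (\<lambda>p. if p \<in> D then Some (\<phi> p) else None) \<in> regular_partial G"

lemma regf_cong: "regf G D \<phi> \<Longrightarrow> D = D' \<Longrightarrow> (\<And>p. p \<in> D \<Longrightarrow> \<phi> p = \<psi> p) \<Longrightarrow> regf G D' \<psi>"
proof -
  assume "regf G D \<phi>" "D = D'" "\<And>p. p \<in> D \<Longrightarrow> \<phi> p = \<psi> p"
  moreover from this have "(\<lambda>p. if p \<in> D then Some (\<phi> p) else None) = (\<lambda>p. if p \<in> D' then Some (\<psi> p) else None)"
    by auto
  ultimately show "regf G D' \<psi>" by (simp add: regf_def)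
qed

lemma regf_gen: "g \<in> G \<Longrightarrow> regf G (dom g) (\<lambda>p. the (g p))"
proof -
  assume "g \<in> G"
  moreover have "(\<lambda>p. if p \<in> dom g then Some (the (g p)) else None) = g" by (auto simp: fun_eq_iff dom_def)
  ultimately show ?thesis by (simp add: regf_def regular_partial.gen)
qed

lemma regf_const: "regf G UNIV (\<lambda>_. c)"
  using regular_partial.const[of c G] by (simp add: regf_def)

lemma regf_add: "regf G D \<phi> \<Longrightarrow> regf G D' \<psi> \<Longrightarrow> regf G (D \<inter> D') (\<lambda>p. \<phi> p + \<psi> p)"
  unfolding regf_def
  by (drule (1) regular_partial.add, erule back_subst[where P = "\<lambda>f. f \<in> regular_partial G"]) (auto split: option.splits)

lemma regf_mult: "regf G D \<phi> \<Longrightarrow> regf G D' \<psi> \<Longrightarrow> regf G (D \<inter> D') (\<lambda>p. \<phi> p * \<psi> p)"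
  unfolding regf_def
  by (drule (1) regular_partial.mult, erule back_subst[where P = "\<lambda>f. f \<in> regular_partial G"]) (auto split: option.splits)

lemma regf_inverse: "regf G D \<phi> \<Longrightarrow> regf G (D \<inter> {p. \<phi> p \<noteq> 0}) (\<lambda>p. inverse (\<phi> p))"
  unfolding regf_def
  by (drule regular_partial.inv, erule back_subst[where P = "\<lambda>f. f \<in> regular_partial G"]) (auto split: option.splits)

lemma regf_cmult: "regf G D \<phi> \<Longrightarrow> regf G D (\<lambda>p. c * \<phi> p)"
  using regf_mult[OF regf_const[of G c], of D \<phi>] by simp

lemma regf_diff: "regf G D \<phi> \<Longrightarrow> regf G D' \<psi> \<Longrightarrow> regf G (D \<inter> D') (\<lambda>p. \<phi> p - \<psi> p)"
  using regf_add[of G D \<phi> D' "\<lambda>p. - 1 * \<psi> p"] regf_cmult[of G D' \<psi> "- 1"] by simp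

lemma regf_same:
  shows "regf G D \<phi> \<Longrightarrow> regf G D \<psi> \<Longrightarrow> regf G D (\<lambda>p. \<phi> p + \<psi> p)"
    and "regf G D \<phi> \<Longrightarrow> regf G D \<psi> \<Longrightarrow> regf G D (\<lambda>p. \<phi> p * \<psi> p)"
    and "regf G D \<phi> \<Longrightarrow> regf G D \<psi> \<Longrightarrow> regf G D (\<lambda>p. \<phi> p - \<psi> p)"
  using regf_add[of G D \<phi> D \<psi>] regf_mult[of G D \<phi> D \<psi>] regf_diff[of G D \<phi> D \<psi>] by simp_all

lemma regf_const_on: "regf G D \<phi> \<Longrightarrow> regf G D (\<lambda>_. c)"
  using regf_add[OF regf_const[of G c] regf_cmult[of G D \<phi> 0]] by simp

lemma regf_sum:
  assumes "regf G D \<theta>" "finite I" "\<And>i. i \<in> I \<Longrightarrow> regf G D (\<phi> i)"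
  shows "regf G D (\<lambda>p. \<Sum>i\<in>I. \<phi> i p)"
  using assms(2,3)
  by (induction I rule: finite_induct) (auto intro: regf_same regf_const_on[OF assms(1)])

lemma regf_comp:
  assumes "\<And>g. g \<in> G \<Longrightarrow> g \<circ> f \<in> H" "regf G D \<phi>"
  shows "regf H (f -` D) (\<phi> \<circ> f)"
proof -
  have "g \<circ> f \<in> regular_partial H" if "g \<in> regular_partial G" for g
    using that
  proof induction
    case (gen g) then show ?case by (intro regular_partial.gen assms)
  next
    case (const c) then show ?case using regular_partial.const[of c H] by (simp add: comp_def)
  next
    case (add g g') then show ?case using regular_partial.add[OF add.IH] unfolding comp_def by simp
  next
    case (mult g g') then show ?case using regular_partial.mult[OF mult.IH] unfolding comp_def by simp
  next
    case (inv g) then show ?case using regular_partial.inv[OF inv.IH] unfolding comp_def by simp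
  qed
  then have "(\<lambda>p. if p \<in> D then Some (\<phi> p) else None) \<circ> f \<in> regular_partial H"
    using assms(2) unfolding regf_def by blast
  then show ?thesis unfolding regf_def comp_def by simp
qed

lemma regf_fst: "regf G D \<phi> \<Longrightarrow> regf (prod_gens G H) (fst -` D) (\<phi> \<circ> fst)"
  by (rule regf_comp; auto simp: prod_gens_def)

lemma regf_snd: "regf H D \<phi> \<Longrightarrow> regf (prod_gens G H) (snd -` D) (\<phi> \<circ> snd)"
  by (rule regf_comp; auto simp: prod_gens_def)

lemma regular_map_regf:
  assumes "\<And>p h. p \<in> U \<Longrightarrow> h \<in> H \<Longrightarrow> F p \<in> dom h \<Longrightarrow>
    \<exists>D \<phi>. regf G D \<phi> \<and> p \<in> D \<and> (\<forall>q\<in>U \<inter> D. h (F q) = Some (\<phi> q))"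
  shows "regular_map U G H F"
  unfolding regular_map_def
proof (intro ballI impI)
  fix p h assume "p \<in> U" "h \<in> H" "F p \<in> dom h"
  then obtain D \<phi> where D: "regf G D \<phi>" "p \<in> D" "\<forall>q\<in>U \<inter> D. h (F q) = Some (\<phi> q)"
    using assms by blast
  show "\<exists>f\<in>regular_partial G. p \<in> dom f \<and> (\<forall>q\<in>U \<inter> dom f. h (F q) = f q)"
    by (rule bexI[of _ "\<lambda>p. if p \<in> D then Some (\<phi> p) else None"])
      (use D in \<open>auto simp: regf_def split: if_splits\<close>)
qed

lemma zariski_open:
  assumes "U \<subseteq> X" "\<And>p. p \<in> U \<Longrightarrow> \<exists>D \<phi>. regf G D \<phi> \<and> p \<in> D \<and> X \<inter> D \<subseteq> U"
  shows "openin (zariski X G) U"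
proof (subst openin_subopen, intro ballI)
  fix p assume p: "p \<in> U"
  then obtain D \<phi> where D: "regf G D \<phi>" "p \<in> D" "X \<inter> D \<subseteq> U" using assms(2) by blast
  define f where "f = (\<lambda>p. if p \<in> D then Some (\<phi> p) else None)"
  have "dom f = D" by (auto simp: f_def split: if_splits)
  moreover have "f \<in> regular_partial G" using D(1) by (simp add: regf_def f_def)
  ultimately have "X \<inter> D \<in> {X \<inter> dom f | f. f \<in> regular_partial G}" by blast
  then have "openin (zariski X G) (X \<inter> D)"
    unfolding zariski_def by (rule topology_generated_by_Basis)
  then show "\<exists>T. openin (zariski X G) T \<and> p \<in> T \<and> T \<subseteq> U"
    using D p assms(1) by blast
qed

lemma topspace_zariski: "topspace (zariski X G) = X"
proof
  show "topspace (zariski X G) \<subseteq> X"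
    unfolding zariski_def topology_generated_by_topspace by auto
  have "openin (zariski X G) X"
    by (rule zariski_open[OF order_refl]) (use regf_const[of G 0] in blast)
  then show "X \<subseteq> topspace (zariski X G)" by (rule openin_subset)
qed

text \<open>The product of two regular functions is defined where both are, so the generating sets
  are closed under intersection and form a base.\<close>

lemma zariski_base:
  assumes "openin (zariski X G) T" "p \<in> T"
  shows "\<exists>f\<in>regular_partial G. p \<in> dom f \<and> X \<inter> dom f \<subseteq> T"
proof -
  have "generate_topology_on {X \<inter> dom f | f. f \<in> regular_partial G} T"
    using assms(1) unfolding zariski_def openin_topology_generated_by_iff .
  then show ?thesis using assms(2)
  proof induction
    case (Int A B)
    then obtain f g where f: "f \<in> regular_partial G" "p \<in> dom f" "X \<inter> dom f \<subseteq> A"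
      and g: "g \<in> regular_partial G" "p \<in> dom g" "X \<inter> dom g \<subseteq> B" by blast
    let ?m = "\<lambda>p. case (f p, g p) of (Some a, Some b) \<Rightarrow> Some (a * b) | _ \<Rightarrow> None"
    have dm: "dom ?m = dom f \<inter> dom g" by (auto split: option.splits)
    show ?case
      by (rule bexI[OF _ regular_partial.mult[OF f(1) g(1)]]) (use dm f g in auto)
  qed blast+
qed

text \<open>
  Density is shown analytically: a domain of definition contains, along with a point, the tail of
  every sequence for which all generators converge to their value at the point.
\<close>

definition conv :: "('a \<Rightarrow> complex option) set \<Rightarrow> (nat \<Rightarrow> 'a) \<Rightarrow> 'a \<Rightarrow> bool" where
  "conv G m p \<longleftrightarrow> (\<forall>g\<in>G. \<forall>c. g p = Some c \<longrightarrow>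
     (\<exists>\<psi>. (\<forall>\<^sub>F n in sequentially. g (m n) = Some (\<psi> n)) \<and> \<psi> \<longlonglongrightarrow> c))"

text \<open>The constructors of \<open>regular_partial\<close> respect limits. For inversion, a
  nonzero limit keeps the sequence eventually nonzero and hence inside the domain.\<close>

lemma conv_regular_partial: "conv G m p \<Longrightarrow> conv (regular_partial G) m p"
proof -
  assume conv: "conv G m p"
  have "\<exists>\<psi>. (\<forall>\<^sub>F n in sequentially. f (m n) = Some (\<psi> n)) \<and> \<psi> \<longlonglongrightarrow> c"
    if "f \<in> regular_partial G" "f p = Some c" for f c
    using that
  proof (induction arbitrary: c)
    case (gen g)
    then show ?case using conv unfolding conv_def by blast
  next
    case (const d)
    then show ?case by (intro exI[of _ "\<lambda>_. c"]) simp
  next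
    case (add f g)
    then obtain a b where ab: "f p = Some a" "g p = Some b" "c = a + b" by (auto split: option.splits)
    obtain \<phi> \<psi> where "\<forall>\<^sub>F n in sequentially. f (m n) = Some (\<phi> n)" "\<phi> \<longlonglongrightarrow> a"
      "\<forall>\<^sub>F n in sequentially. g (m n) = Some (\<psi> n)" "\<psi> \<longlonglongrightarrow> b"
      using add.IH ab by blast
    then show ?case unfolding ab(3)
      by (intro exI[of _ "\<lambda>n. \<phi> n + \<psi> n"]) (auto elim: eventually_elim2 intro: tendsto_add)
  next
    case (mult f g)
    then obtain a b where ab: "f p = Some a" "g p = Some b" "c = a * b" by (auto split: option.splits)
    obtain \<phi> \<psi> where "\<forall>\<^sub>F n in sequentially. f (m n) = Some (\<phi> n)" "\<phi> \<longlonglongrightarrow> a"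
      "\<forall>\<^sub>F n in sequentially. g (m n) = Some (\<psi> n)" "\<psi> \<longlonglongrightarrow> b"
      using mult.IH ab by blast
    then show ?case unfolding ab(3)
      by (intro exI[of _ "\<lambda>n. \<phi> n * \<psi> n"]) (auto elim: eventually_elim2 intro: tendsto_mult)
  next
    case (inv f)
    then obtain a where a: "f p = Some a" "a \<noteq> 0" "c = inverse a" by (auto split: option.splits if_splits)
    obtain \<phi> where \<phi>: "\<forall>\<^sub>F n in sequentially. f (m n) = Some (\<phi> n)" "\<phi> \<longlonglongrightarrow> a"
      using inv.IH a by blast
    have "\<forall>\<^sub>F n in sequentially. \<phi> n \<noteq> 0" using tendsto_imp_eventually_ne[OF \<phi>(2) a(2)] .
    then show ?case unfolding a(3) using \<phi> a(2)
      by (intro exI[of _ "\<lambda>n. inverse (\<phi> n)"]) (auto elim: eventually_elim2 intro: tendsto_inverse)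
  qed
  then show ?thesis unfolding conv_def by blast
qed

lemma zariski_dense:
  assumes "U \<subseteq> X" "\<And>p. p \<in> X \<Longrightarrow> \<exists>m. (\<forall>n. m n \<in> U) \<and> conv G m p"
  shows "zariski X G closure_of U = X"
proof (intro equalityI subsetI)
  fix p assume p: "p \<in> X"
  obtain m where m: "\<forall>n. m n \<in> U" "conv G m p" using assms(2)[OF p] by (elim exE conjE)
  show "p \<in> zariski X G closure_of U"
    unfolding in_closure_of topspace_zariski
  proof (rule conjI[OF p], intro allI impI)
    fix T assume T: "p \<in> T \<and> openin (zariski X G) T"
    obtain f where f: "f \<in> regular_partial G" "p \<in> dom f" "X \<inter> dom f \<subseteq> T"
      using zariski_base[OF conjunct2[OF T] conjunct1[OF T]] by (elim bexE conjE) (rule that)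
    then obtain c where "f p = Some c" by blast
    then obtain \<psi> where "\<forall>\<^sub>F n in sequentially. f (m n) = Some (\<psi> n)"
      using conv_regular_partial[OF m(2)] f(1) unfolding conv_def by meson
    then obtain n where "f (m n) = Some (\<psi> n)" by (meson eventually_happens' sequentially_bot)
    then have "m n \<in> T" using f(3) m(1) assms(1) by blast
    then show "\<exists>y. y \<in> U \<and> y \<in> T" using m(1) by blast
  qed
qed (use closure_of_subset_topspace[of "zariski X G" U] in \<open>auto simp: topspace_zariski\<close>)

lemma conv_prod:
  assumes "conv G (\<lambda>n. fst (m n)) (fst p)" "conv H (\<lambda>n. snd (m n)) (snd p)"
  shows "conv (prod_gens G H) m p"
  using assms unfolding conv_def prod_gens_def by auto

lemma conv_const: "conv G (\<lambda>_. p :: 'a) p"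
  unfolding conv_def
proof (intro ballI allI impI)
  fix g :: "'a \<Rightarrow> complex option" and c assume "g p = Some c"
  then show "\<exists>\<psi>. (\<forall>\<^sub>F n in sequentially. g p = Some (\<psi> n)) \<and> \<psi> \<longlonglongrightarrow> c"
    by (intro exI[of _ "\<lambda>_. c"]) simp
qed

lemma conv_P1: "\<psi> \<longlonglongrightarrow> c \<Longrightarrow> conv P1_gens (\<lambda>n. Some (\<psi> n)) (Some c)"
  unfolding conv_def P1_gens_def
proof (intro ballI allI impI)
  fix g d assume \<psi>: "\<psi> \<longlonglongrightarrow> c" and g: "g \<in> {\<lambda>z. z, \<lambda>z. case z of None \<Rightarrow> Some 0 | Some c \<Rightarrow> if c = 0 then None else Some (inverse c)}"
    and gd: "g (Some c) = Some d"
  from g consider "g = (\<lambda>z. z)" | "g = (\<lambda>z. case z of None \<Rightarrow> Some 0 | Some c \<Rightarrow> if c = 0 then None else Some (inverse c))"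
    by blast
  then show "\<exists>\<phi>. (\<forall>\<^sub>F n in sequentially. g (Some (\<psi> n)) = Some (\<phi> n)) \<and> \<phi> \<longlonglongrightarrow> d"
  proof cases
    case 1
    then show ?thesis using \<psi> gd by (intro exI[of _ \<psi>]) simp
  next
    case 2
    then have c: "c \<noteq> 0" "d = inverse c" using gd by (auto split: if_splits)
    have "\<forall>\<^sub>F n in sequentially. \<psi> n \<noteq> 0" using tendsto_imp_eventually_ne[OF \<psi> c(1)] .
    then show ?thesis using 2 \<psi> c
      by (intro exI[of _ "\<lambda>n. inverse (\<psi> n)"]) (auto elim: eventually_mono intro: tendsto_inverse)
  qed
qed

lemma fls_functionals_iff:
  "l \<in> fls_functionals \<longleftrightarrow> (\<forall>f g. l (f + g) = l f + l g) \<and> (\<forall>c f. l (fls_const c * f) = c * l f)"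
proof
  assume "l \<in> fls_functionals"
  then interpret l: Vector_Spaces.linear "\<lambda>c f. fls_const c * f" "(*)" l
    by (simp add: fls_functionals_def)
  show "(\<forall>f g. l (f + g) = l f + l g) \<and> (\<forall>c f. l (fls_const c * f) = c * l f)"
    using l.add l.scale by simp
next
  assume *: "(\<forall>f g. l (f + g) = l f + l g) \<and> (\<forall>c f. l (fls_const c * f) = c * l f)"
  have "Vector_Spaces.linear (\<lambda>c f. fls_const c * f) (*) l"
    by unfold_locales (use * in \<open>simp_all add: algebra_simps fls_const_add\<close>)
  then show "l \<in> fls_functionals" by (simp add: fls_functionals_def)
qed

lemma ratio_span:
  assumes "\<alpha> \<in> fls_functionals" "\<beta> \<in> fls_functionals"
  shows "ratio \<alpha> \<beta> {fls_const c * \<omega> | c. True} = (if \<beta> \<omega> \<noteq> 0 then Some (\<alpha> \<omega> / \<beta> \<omega>) else None)"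
proof -
  have a: "\<alpha> (fls_const c * \<omega>) = c * \<alpha> \<omega>" and b: "\<beta> (fls_const c * \<omega>) = c * \<beta> \<omega>" for c
    using assms unfolding fls_functionals_iff by simp_all
  have w: "\<omega> \<in> {fls_const c * \<omega> | c. True}" by (auto intro: exI[of _ 1])
  show ?thesis
  proof (cases "\<beta> \<omega> = 0")
    case True
    then have "\<not> (\<exists>v\<in>{fls_const c * \<omega> | c. True}. \<beta> v \<noteq> 0)" using b by auto
    then show ?thesis using True by (simp add: ratio_def)
  next
    case False
    then have ex: "\<exists>v\<in>{fls_const c * \<omega> | c. True}. \<beta> v \<noteq> 0" using w by blast
    have "(THE c. \<forall>v\<in>{fls_const c * \<omega> | c. True}. \<alpha> v = c * \<beta> v) = \<alpha> \<omega> / \<beta> \<omega>"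
    proof (rule the_equality)
      show "\<forall>v\<in>{fls_const c * \<omega> | c. True}. \<alpha> v = \<alpha> \<omega> / \<beta> \<omega> * \<beta> v"
        using False a b by auto
      fix c assume "\<forall>v\<in>{fls_const c * \<omega> | c. True}. \<alpha> v = c * \<beta> v"
      then have "\<alpha> \<omega> = c * \<beta> \<omega>" using w by blast
      then show "c = \<alpha> \<omega> / \<beta> \<omega>" using False by simp
    qed
    then show ?thesis using ex False by (simp only: ratio_def) simp
  qed
qed

section \<open>The moduli spaces in coordinates\<close>

text \<open>Affine dependence on the six residues gives both regularity, by
  \<open>caff_regf\<close>, and limits along sequences, by \<open>caff_tendsto\<close>.\<close>

definition caff :: "((nat \<Rightarrow> complex) \<Rightarrow> complex) \<Rightarrow> bool" where
  "caff f \<longleftrightarrow> (\<exists>k0 k. \<forall>c. f c = k0 + (\<Sum>i<6. k i * c i))"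

lemma caff_const: "caff (\<lambda>_. k)"
  unfolding caff_def by (intro exI[of _ k] exI[of _ "\<lambda>_. 0"]) simp

lemma caff_coord: "j < 6 \<Longrightarrow> caff (\<lambda>c. c j)"
  unfolding caff_def
  by (intro exI[of _ 0] exI[of _ "\<lambda>i. if i = j then 1 else 0"]) (simp add: if_distrib[of "\<lambda>x. x * _"] cong: if_cong)

lemma caff_add: "caff f \<Longrightarrow> caff g \<Longrightarrow> caff (\<lambda>c. f c + g c)"
proof -
  assume "caff f" "caff g"
  then obtain k0 k l0 l where "\<And>c. f c = k0 + (\<Sum>i<6. k i * c i)" "\<And>c. g c = l0 + (\<Sum>i<6. l i * c i)"
    unfolding caff_def by blast
  then show ?thesis unfolding caff_def
    by (intro exI[of _ "k0 + l0"] exI[of _ "\<lambda>i. k i + l i"]) (simp add: sum.distrib algebra_simps)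
qed

lemma caff_cmult: "caff f \<Longrightarrow> caff (\<lambda>c. b * f c)"
proof -
  assume "caff f"
  then obtain k0 k where "\<And>c. f c = k0 + (\<Sum>i<6. k i * c i)" unfolding caff_def by blast
  then show ?thesis unfolding caff_def
    by (intro exI[of _ "b * k0"] exI[of _ "\<lambda>i. b * k i"]) (simp add: sum_distrib_left algebra_simps)
qed

lemma caff_rules: "caff f \<Longrightarrow> caff (\<lambda>c. f c * b)" "caff f \<Longrightarrow> caff (\<lambda>c. f c / b)"
  "caff f \<Longrightarrow> caff (\<lambda>c. - f c)" "caff f \<Longrightarrow> caff g \<Longrightarrow> caff (\<lambda>c. f c - g c)"
  using caff_cmult[of f b] caff_cmult[of f "1 / b"] caff_cmult[of f "- 1"]
    caff_add[of f "\<lambda>c. - 1 * g c"] caff_cmult[of g "- 1"]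
  by (simp_all add: mult.commute)

lemma caff_regf:
  assumes "caff f" "\<And>i. i < 6 \<Longrightarrow> regf G D (\<lambda>p. c p i)"
  shows "regf G D (\<lambda>p. f (c p))"
proof -
  obtain k0 k where k: "\<And>c. f c = k0 + (\<Sum>i<6. k i * c i)" using assms(1) unfolding caff_def by blast
  have 0: "regf G D (\<lambda>p. c p 0)" using assms(2) by simp
  have "regf G D (\<lambda>p. \<Sum>i\<in>{..<6}. k i * c p i)"
    using assms(2) by (intro regf_sum[OF 0]) (auto intro: regf_cmult)
  then have "regf G D (\<lambda>p. k0 + (\<Sum>i\<in>{..<6}. k i * c p i))"
    by (rule regf_same(1)[OF regf_const_on[OF 0]])
  then show ?thesis by (simp add: k)
qed

lemma caff_tendsto:
  assumes "caff f" "\<And>i. i < 6 \<Longrightarrow> (\<lambda>n. cn n i) \<longlonglongrightarrow> c i"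
  shows "(\<lambda>n. f (cn n)) \<longlonglongrightarrow> f c"
proof -
  obtain k0 k where k: "\<And>c. f c = k0 + (\<Sum>i<6. k i * c i)" using assms(1) unfolding caff_def by blast
  show ?thesis unfolding k using assms(2) by (intro tendsto_intros) auto
qed

lemma (in marked_point) conv_lines:
  assumes "yn \<longlonglongrightarrow> y"
  shows "conv (proj_gens (fibre_functionals lam E (Aff t b))) (\<lambda>n. line x (yn n)) (line x y)"
  unfolding conv_def proj_gens_def
proof (intro ballI allI impI)
  fix g c assume "g \<in> {ratio \<alpha> \<beta> | \<alpha> \<beta>. \<alpha> \<in> fibre_functionals lam E (Aff t b) \<and> \<beta> \<in> fibre_functionals lam E (Aff t b)}"
    and gc: "g (line x y) = Some c"
  then obtain \<alpha> \<beta> where g: "g = ratio \<alpha> \<beta>" and f: "\<alpha> \<in> fibre_functionals lam E (Aff t b)" "\<beta> \<in> fibre_functionals lam E (Aff t b)"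
    by blast
  define A B where "A y = \<alpha> (frame 1 0) * x + \<alpha> (frame 0 1) * y" and "B y = \<beta> (frame 1 0) * x + \<beta> (frame 0 1) * y" for y
  have r: "g (line x y) = (if B y \<noteq> 0 then Some (A y / B y) else None)" for y
    unfolding g ratio_line[OF f] A_def B_def ..
  have B: "B y \<noteq> 0" "c = A y / B y" using gc unfolding r by (auto split: if_splits)
  have lim: "(\<lambda>n. A (yn n)) \<longlonglongrightarrow> A y" "(\<lambda>n. B (yn n)) \<longlonglongrightarrow> B y"
    unfolding A_def B_def using assms by (auto intro!: tendsto_intros)
  have "\<forall>\<^sub>F n in sequentially. B (yn n) \<noteq> 0" using tendsto_imp_eventually_ne[OF lim(2) B(1)] .
  then show "\<exists>\<psi>. (\<forall>\<^sub>F n in sequentially. g (line x (yn n)) = Some (\<psi> n)) \<and> \<psi> \<longlonglongrightarrow> c"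
    unfolding r B(2) using lim B(1)
    by (intro exI[of _ "\<lambda>n. A (yn n) / B (yn n)"]) (auto elim: eventually_mono intro: tendsto_divide)
qed

sublocale connection_setup \<subseteq> F1: marked_point lam E h \<kappa> t r
  by unfold_locales (use t_curve r_nz in auto)
sublocale connection_setup \<subseteq> F2: marked_point lam E h \<kappa> t "- r"
  by unfold_locales (use t_curve r_nz in auto)

context connection_setup
begin

text \<open>Stated through arbitrary linear functionals because these generate the regular functions
  on connections; no continuity of the functionals is assumed.\<close>

definition faff :: "((nat \<Rightarrow> complex) \<Rightarrow> complex fls) \<Rightarrow> bool" where
  "faff F \<longleftrightarrow> (\<forall>l\<in>fls_functionals. caff (\<lambda>c. l (F c)))"

lemma functional_mult: "l \<in> fls_functionals \<Longrightarrow> (\<lambda>f. l (u * f)) \<in> fls_functionals"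
  unfolding fls_functionals_iff by (simp only: distrib_left mult.left_commute[of u]) simp

lemma faff_const: "faff (\<lambda>_. u)"
  unfolding faff_def by (auto intro: caff_const)

lemma faff_caff: "caff f \<Longrightarrow> faff (\<lambda>c. fls_const (f c))"
  unfolding faff_def
proof
  fix l assume f: "caff f" and "l \<in> fls_functionals"
  then have "l (fls_const k * 1) = k * l 1" for k unfolding fls_functionals_iff by blast
  then have "l (fls_const k) = k * l 1" for k by simp
  then show "caff (\<lambda>c. l (fls_const (f c)))"
    by (simp only:) (rule caff_rules(1)[OF f])
qed

lemma faff_add: "faff F \<Longrightarrow> faff F' \<Longrightarrow> faff (\<lambda>c. F c + F' c)"
  unfolding faff_def
proof
  fix l assume F: "\<forall>l\<in>fls_functionals. caff (\<lambda>c. l (F c))" "\<forall>l\<in>fls_functionals. caff (\<lambda>c. l (F' c))"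
    and l: "l \<in> fls_functionals"
  have "l (F c + F' c) = l (F c) + l (F' c)" for c using l unfolding fls_functionals_iff by blast
  then show "caff (\<lambda>c. l (F c + F' c))"
    by (simp only:) (rule caff_add[OF bspec[OF F(1) l] bspec[OF F(2) l]])
qed

lemma faff_mult: "faff F \<Longrightarrow> faff (\<lambda>c. u * F c)"
  unfolding faff_def using bspec[OF _ functional_mult[of _ u], of "\<lambda>l. caff (\<lambda>c. l (F c))"] by simp

lemma faff_rules: "faff F \<Longrightarrow> faff (\<lambda>c. F c * u)" "faff F \<Longrightarrow> faff (\<lambda>c. F c / u)" "faff F \<Longrightarrow> faff (\<lambda>c. - F c)"
  "faff F \<Longrightarrow> faff F' \<Longrightarrow> faff (\<lambda>c. F c - F' c)"
  using faff_mult[of F u] faff_mult[of F "1 / u"] faff_mult[of F "- 1"] faff_mult[of F' "- 1"]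
    faff_add[of F "\<lambda>c. - 1 * F' c"]
  by (simp_all add: mult.commute)

text \<open>\<open>tau\<close>, \<open>h\<close> and \<open>N\<close> are fixed and the numerators
  are combinations of fixed functions, so it suffices that their coefficients are affine in the
  residues.\<close>

lemma con_mat_affine: "l \<in> fls_functionals \<Longrightarrow> caff (\<lambda>c. l (con_mat c $ i $ j))"
proof -
  note ca = caff_add caff_rules caff_cmult caff_coord caff_const
  have "caff kg2" "caff kg1" unfolding kg2_def kg1_def by (intro ca; simp)+
  note c1 = this
  have "caff kg0" "caff ka2" "caff ka3" "caff kb4" "caff kb3" unfolding kg0_def ka2_def ka3_def kb4_def kb3_def
    by (intro ca c1[unfolded kg2_def kg1_def] c1; simp)+
  note c2 = c1 this
  have "caff ka1" "caff kb2" unfolding ka1_def kb2_def by (intro ca c2; simp)+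
  note c3 = c2 this
  have "caff ka0" "caff kb1" unfolding ka0_def kb1_def by (intro ca c3; simp)+
  note c4 = c3 this
  have "caff kb0" unfolding kb0_def by (intro ca c4; simp)+
  note c5 = c4 this
  have fe2: "faff (\<lambda>c. fe [:f0 c, f1 c:] [:f2 c:])" if "caff f0" "caff f1" "caff f2" for f0 f1 f2
    unfolding fe_def using that by (auto intro!: faff_add faff_mult faff_rules(1) faff_caff)
  have fe3: "faff (\<lambda>c. fe [:f0 c, f1 c, f2 c:] [:f3 c, f4 c:])" if "caff f0" "caff f1" "caff f2" "caff f3" "caff f4" for f0 f1 f2 f3 f4
    unfolding fe_def using that by (auto intro!: faff_add faff_mult faff_rules(1) faff_caff)
  have fe4: "faff (\<lambda>c. fe [:f0 c, f1 c, f2 c:] [:f3 c:])" if "caff f0" "caff f1" "caff f2" "caff f3" for f0 f1 f2 f3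
    unfolding fe_def using that by (auto intro!: faff_add faff_mult faff_rules(1) faff_caff)
  have num: "faff num_g" "faff num_a" "faff num_b"
    unfolding num_g_def num_a_def num_b_def by (intro fe2 fe3 fe4 c5)+
  have "faff (\<lambda>c. con_mat c $ i $ j)"
    using exhaust_2[of i] exhaust_2[of j]
    by (auto simp: con_mat_def mk_def intro!: faff_add faff_mult faff_rules faff_const num)
  then show "l \<in> fls_functionals \<Longrightarrow> caff (\<lambda>c. l (con_mat c $ i $ j))"
    unfolding faff_def by blast
qed

text \<open>The lower left entry of \<open>con_mat\<close>, as a function of the three combinations
  of residues on which it depends. They become the homogeneous coordinates of the target plane of
  the apparent map.\<close>

definition omega :: "complex \<Rightarrow> complex \<Rightarrow> complex \<Rightarrow> complex fls" where
  "omega x y z = eta * fe [:r * (x - y) / 2 - z * t / (2 * \<kappa>), z / (2 * \<kappa>):] [:(x + y) / 2:] / N"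

lemma con_mat_21: "con_mat c $ 2 $ 1 = omega (c 2) (c 5) (c 0 + c 3)"
  by (simp add: con_mat_def mk_def omega_def num_g_def kg0_def kg1_def kg2_def)

lemma conn_21: "conn (A :: connection) (axis 1 1) $ 2 = A $ 2 $ 1"
  by (simp add: conn_def mult_mv2)

lemma omega_eq_0: "omega x y z = 0 \<longleftrightarrow> x = 0 \<and> y = 0 \<and> z = 0"
proof -
  have "omega x y z = 0 \<longleftrightarrow> r * (x - y) / 2 - z * t / (2 * \<kappa>) = 0 \<and> z / (2 * \<kappa>) = 0 \<and> (x + y) / 2 = 0"
    by (simp add: omega_def)
  also have "\<dots> \<longleftrightarrow> x = 0 \<and> y = 0 \<and> z = 0"
    using kappa_nz r_nz by (auto simp: add_eq_0_iff)
  finally show ?thesis .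
qed

text \<open>For a section, \<open>N * (\<omega> / eta)\<close> has pole order at most 2 + 1 at
  infinity and no other pole, hence is a combination of 1, \<open>X\<close> and \<open>Y\<close>.
  These three coefficients are an invertible transform of the arguments of
  \<open>omega\<close>.\<close>

lemma app_sections_eq: "app_sections lam t1 t2 = {omega x y z | x y z. True}"
proof -
  interpret I: curve_point lam Inf by (rule curve_point[OF Inf_curve])
  have iff: "\<omega> \<in> app_sections lam t1 t2 \<longleftrightarrow> N * (\<omega> / eta) \<in> R \<and> X / Y * (\<omega> / eta) \<in> I.O_w" for \<omega>
  proof -
    have loc: "(\<exists>f\<in>div_stalk lam div_inf w. \<exists>\<theta>\<in>form_stalk lam {t1, t2} w. \<omega> = f * \<theta>) \<longleftrightarrow>
      (if w = Inf then X / Y else 1) * ((if w \<in> {t1, t2} then unif w else 1) * (\<omega> / eta)) \<in> loc_ring lam w" if w: "w \<in> curve lam" for w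
    proof -
      interpret w: curve_point lam w using w by (rule curve_point)
      define n d where "n = (if w = Inf then X / Y else 1)" and "d = (if w \<in> {t1, t2} then w.\<pi> else 1)"
      have nd: "n \<noteq> 0" "d \<noteq> 0" by (auto simp: n_def d_def)
      have "(\<exists>f\<in>div_stalk lam div_inf w. \<exists>\<theta>\<in>form_stalk lam {t1, t2} w. \<omega> = f * \<theta>) \<longleftrightarrow>
          (\<exists>f \<theta>. f * n \<in> w.O_w \<and> \<theta> / eta * d \<in> w.O_w \<and> \<omega> = f * \<theta>)"
        unfolding Bex_def div_inf_stalk[OF w] w.form_stalk_iff n_def d_def by blast
      also have "\<dots> \<longleftrightarrow> n * (d * (\<omega> / eta)) \<in> w.O_w"
      proof
        assume "\<exists>f \<theta>. f * n \<in> w.O_w \<and> \<theta> / eta * d \<in> w.O_w \<and> \<omega> = f * \<theta>"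
        then obtain f \<theta> where f: "f * n \<in> w.O_w" "\<theta> / eta * d \<in> w.O_w" "\<omega> = f * \<theta>" by blast
        have "(f * n) * (\<theta> / eta * d) \<in> w.O_w" by (rule w.O_mult[OF f(1,2)])
        also have "(f * n) * (\<theta> / eta * d) = n * (d * (\<omega> / eta))" unfolding f(3) by (simp add: field_simps)
        finally show "n * (d * (\<omega> / eta)) \<in> w.O_w" .
      next
        assume "n * (d * (\<omega> / eta)) \<in> w.O_w"
        then show "\<exists>f \<theta>. f * n \<in> w.O_w \<and> \<theta> / eta * d \<in> w.O_w \<and> \<omega> = f * \<theta>"
          using nd by (intro exI[of _ "1 / n"] exI[of _ "n * \<omega>"]) (simp add: field_simps)
      qed
      finally show ?thesis unfolding n_def d_def .
    qed
    have "\<omega> \<in> app_sections lam t1 t2 \<longleftrightarrow> (\<forall>w\<in>curve lam. (if w = Inf then X / Y else 1) * ((if w \<in> {t1, t2} then unif w else 1) * (\<omega> / eta)) \<in> loc_ring lam w)"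
      unfolding app_sections_def mem_Collect_eq using loc by blast
    also have "\<dots> \<longleftrightarrow> (\<forall>w\<in>curve lam - {Inf}. (if w \<in> {t1, t2} then unif w else 1) * (\<omega> / eta) \<in> loc_ring lam w) \<and>
        X / Y * (\<omega> / eta) \<in> I.O_w"
      using Inf_curve by auto
    finally show ?thesis unfolding pole_iff .
  qed
  show ?thesis
  proof (intro set_eqI iffI)
    fix \<omega> assume "\<omega> \<in> app_sections lam t1 t2"
    then have w: "N * (\<omega> / eta) \<in> R" "X / Y * (\<omega> / eta) \<in> I.O_w" using iff by auto
    have sN: "fls_subdegree N = - 2" using subdegree_evalx[of "[:- t, 1:]"] by (simp add: fls_const_uminus)
    have "N * (\<omega> / eta) = 0 \<or> fls_subdegree (N * (\<omega> / eta)) \<ge> - 3"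
    proof (cases "\<omega> / eta = 0")
      case False
      then have "fls_subdegree (X / Y * (\<omega> / eta)) = 1 + fls_subdegree (\<omega> / eta)"
        by (subst fls_subdegree_mult) (auto simp: fls_divide_subdegree)
      moreover have "fls_subdegree (X / Y * (\<omega> / eta)) \<ge> 0" using O_Inf_subdegree[OF w(2)] False by auto
      moreover have "fls_subdegree (N * (\<omega> / eta)) = - 2 + fls_subdegree (\<omega> / eta)"
        using False sN by (subst fls_subdegree_mult) auto
      ultimately show ?thesis by simp
    qed simp
    then obtain c0 c1 c2 where "N * (\<omega> / eta) = fls_const c0 + fls_const c1 * X + fls_const c2 * Y"
      using R_subdegree_3[OF w(1)] by blast
    then have c: "N * (\<omega> / eta) = fe [:c0, c1:] [:c2:]" by (simp add: fe_def mult.commute)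
    \<comment> \<open>Solved from the definition of \<open>omega\<close>: \<open>s\<close> is half
      the difference of its first two arguments, and their half-sum is \<open>c2\<close>.\<close>
    define z s where "z = 2 * \<kappa> * c1" and "s = (c0 + c1 * t) / r"
    have "omega (c2 + s) (c2 - s) z = eta * fe [:c0, c1:] [:c2:] / N"
    proof -
      have "r * ((c2 + s) - (c2 - s)) / 2 - z * t / (2 * \<kappa>) = c0" "z / (2 * \<kappa>) = c1" "((c2 + s) + (c2 - s)) / 2 = c2"
        using kappa_nz r_nz by (simp_all add: z_def s_def field_simps)
      then show ?thesis unfolding omega_def by (simp only:)
    qed
    also have "\<dots> = \<omega>" unfolding c[symmetric] by simp
    finally show "\<omega> \<in> {omega x y z | x y z. True}" by blast
  next
    fix \<omega> assume "\<omega> \<in> {omega x y z | x y z. True}"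
    then obtain x y z where "\<omega> = omega x y z" by blast
    \<comment> \<open>Conversely, every \<open>omega x y z\<close> is the lower left entry of a
      logarithmic connection and inherits the regularity conditions from it.\<close>
    then have "\<omega> = con_mat (\<lambda>i. [z, 0, x, 0, 0, y] ! i) $ 2 $ 1" by (simp add: con_mat_21)
    moreover have "con_mat c $ 2 $ 1 / eta = ga (con_mat c)" for c by (simp add: ga_def)
    ultimately show "\<omega> \<in> app_sections lam t1 t2"
      unfolding iff using con_mat_log unfolding log_connection_iff inf_cond_def by simp
  qed
qed

text \<open>The coordinates are read off from the Laurent coefficients of
  \<open>N * \<omega> / eta\<close> of orders -3, -2 and 0: order -3 sees \<open>Y\<close> only, and
  \<open>X\<close> is the single monomial of order -2. As linear functionals they are available for
  describing regular functions on the target.\<close>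

lemma omega_functionals:
  "\<exists>l1\<in>fls_functionals. \<exists>l2\<in>fls_functionals. \<exists>l3\<in>fls_functionals.
     \<forall>x y z. l1 (omega x y z) = x \<and> l2 (omega x y z) = y \<and> l3 (omega x y z) = z"
proof -
  define q where "q n \<omega> = fls_nth (N / eta * \<omega>) n" for n \<omega>
  have q: "q n (f + g) = q n f + q n g" "q n (fls_const c * f) = c * q n f" for n f g c
    unfolding q_def mult.left_commute[of "N / eta" "fls_const c" f] by (simp_all only: distrib_left fls_plus_nth fls_mult_const_nth)
  have qo: "q n (omega x y z) = (r * (x - y) / 2 - z * t / (2 * \<kappa>)) * (if n = 0 then 1 else 0)
      + z / (2 * \<kappa>) * fls_nth X n + (x + y) / 2 * fls_nth Y n" for n x y z
  proof -
    define u0 u1 u2 where "u0 = r * (x - y) / 2 - z * t / (2 * \<kappa>)" "u1 = z / (2 * \<kappa>)" "u2 = (x + y) / 2"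
    have "N / eta * omega x y z = fls_const u0 + fls_const u1 * X + fls_const u2 * Y"
      unfolding omega_def u0_u1_u2_def[symmetric] by (simp add: fe_def mult.commute)
    then show ?thesis unfolding q_def u0_u1_u2_def[symmetric] by simp
  qed
  define y3 where "y3 = fls_nth Y (- 3)"
  have y3: "y3 \<noteq> 0" using nth_fls_subdegree_nonzero[OF Y_nz] unfolding y3_def subdegree_Y .
  have X: "fls_nth X (- 3) = 0" "fls_nth X (- 2) = 1" "fls_nth X 0 = 0" by (simp_all add: x_fun_def)
  define c2 where "c2 \<omega> = q (- 3) \<omega> / y3" for \<omega>
  define c1 where "c1 \<omega> = q (- 2) \<omega> - c2 \<omega> * fls_nth Y (- 2)" for \<omega>
  define c0 where "c0 \<omega> = q 0 \<omega> - c2 \<omega> * fls_nth Y 0" for \<omega>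
  have v: "c2 (omega x y z) = (x + y) / 2" "c1 (omega x y z) = z / (2 * \<kappa>)"
    "c0 (omega x y z) = r * (x - y) / 2 - z * t / (2 * \<kappa>)" for x y z
    unfolding c0_def c1_def c2_def qo X y3_def[symmetric] using y3 by simp_all
  define s where "s \<omega> = (c0 \<omega> + c1 \<omega> * t) / r" for \<omega>
  have l: "(\<lambda>\<omega>. c2 \<omega> + s \<omega>) \<in> fls_functionals" "(\<lambda>\<omega>. c2 \<omega> - s \<omega>) \<in> fls_functionals" "(\<lambda>\<omega>. 2 * \<kappa> * c1 \<omega>) \<in> fls_functionals"
  proof -
    have 2: "c2 (f + g) = c2 f + c2 g" "c2 (fls_const c * f) = c * c2 f" for f g c
      unfolding c2_def q by (simp_all add: add_divide_distrib)
    have 1: "c1 (f + g) = c1 f + c1 g" "c1 (fls_const c * f) = c * c1 f" for f g c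
      unfolding c1_def q 2 by (simp_all add: algebra_simps)
    have 0: "c0 (f + g) = c0 f + c0 g" "c0 (fls_const c * f) = c * c0 f" for f g c
      unfolding c0_def q 2 by (simp_all add: algebra_simps)
    have s: "s (f + g) = s f + s g" "s (fls_const c * f) = c * s f" for f g c
      unfolding s_def 0 1 by (simp_all add: algebra_simps add_divide_distrib)
    show "(\<lambda>\<omega>. c2 \<omega> + s \<omega>) \<in> fls_functionals" "(\<lambda>\<omega>. c2 \<omega> - s \<omega>) \<in> fls_functionals" "(\<lambda>\<omega>. 2 * \<kappa> * c1 \<omega>) \<in> fls_functionals"
      unfolding fls_functionals_iff 1 2 s by (simp_all add: algebra_simps)
  qed
  have "c2 (omega x y z) + s (omega x y z) = x \<and> c2 (omega x y z) - s (omega x y z) = y \<and> 2 * \<kappa> * c1 (omega x y z) = z" for x y z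
    unfolding s_def v using r_nz kappa_nz by (simp add: field_simps)
  then show ?thesis
    by - (rule bexI[OF _ l(1)], rule bexI[OF _ l(2)], rule bexI[OF _ l(3)], intro allI)
qed

text \<open>The eigenvector equations for both residues. The lower right entries
  \<open>- 1 - c 0\<close> and \<open>- c 3\<close> come from the traces -1 and 0 of the determinant
  connection at the two points.\<close>

definition con_eqs :: "complex \<Rightarrow> complex \<Rightarrow> (nat \<Rightarrow> complex) \<Rightarrow> complex \<Rightarrow> complex \<Rightarrow> complex \<Rightarrow> complex \<Rightarrow> bool" where
  "con_eqs n1 n2 c x1 y1 x2 y2 \<longleftrightarrow> (x1 \<noteq> 0 \<or> y1 \<noteq> 0) \<and> (x2 \<noteq> 0 \<or> y2 \<noteq> 0) \<and>
     c 0 * x1 + c 1 * y1 = n1 * x1 \<and> c 2 * x1 + (- 1 - c 0) * y1 = n1 * y1 \<and>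
     c 3 * x2 + c 4 * y2 = n2 * x2 \<and> c 5 * x2 - c 3 * y2 = n2 * y2"

text \<open>The residues are free coordinates, so only the eigenline conditions remain; by
  \<open>eigenvalues_trace\<close> they imply the prescribed sets of eigenvalues.\<close>

lemma Con_eq:
  "Con lam t1 t2 nu1 nu2 a E = {(con_mat c, F1.line x1 y1, F2.line x2 y2) | c x1 y1 x2 y2.
     con_eqs (nu1 / 2 - 1 / 2) (nu2 / 2) c x1 y1 x2 y2}"
proof -
  define n1 n2 where "n1 = nu1 / 2 - 1 / 2" and "n2 = nu2 / 2"
  have m1: "- nu1 / 2 - 1 / 2 = - 1 - n1" and m2: "- nu2 / 2 = - n2" by (simp_all add: n1_def n2_def field_simps)
  have NR: "N * al (con_mat c) \<in> R" "N * be (con_mat c) \<in> R" "N * ga (con_mat c) \<in> R" "N * de (con_mat c) \<in> R" for c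
    using con_mat_log[of c] unfolding log_connection_iff by blast+
  note pl1 = pole_local(1)[OF NR(1)] pole_local(1)[OF NR(2)] pole_local(1)[OF NR(3)] pole_local(1)[OF NR(4)]
  note pl2 = pole_local(2)[OF NR(1)] pole_local(2)[OF NR(2)] pole_local(2)[OF NR(3)] pole_local(2)[OF NR(4)]
  have eig1: "F1.eig (con_mat c) k x y \<longleftrightarrow> c 0 * x + c 1 * y = k * x \<and> c 2 * x + (- 1 - c 0) * y = k * y" for c k x y
    unfolding F1.eig_def using NR con_mat_res by (simp add: res_eq_rs)
  have eig2: "F2.eig (con_mat c) k x y \<longleftrightarrow> c 3 * x + c 4 * y = k * x \<and> c 5 * x - c 3 * y = k * y" for c k x y
    unfolding F2.eig_def using NR con_mat_res by (simp add: res_eq_rs)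
  have tr1: "F1.res (al (con_mat c)) + F1.res (de (con_mat c)) = n1 + (- 1 - n1)" for c
    using NR con_mat_res by (simp add: res_eq_rs)
  have tr2: "F2.res (al (con_mat c)) + F2.res (de (con_mat c)) = n2 + (- n2)" for c
    using NR con_mat_res by (simp add: res_eq_rs)
  show ?thesis
    unfolding n1_def[symmetric] n2_def[symmetric]
  proof (intro set_eqI iffI)
    fix m assume "m \<in> Con lam t1 t2 nu1 nu2 a E"
    then obtain A p1 p2 where m: "m = (A, p1, p2)" and A: "log_connection lam {t1, t2} E A" "trace A = a $ 1 $ 1"
      and p: "p1 \<in> fibre_lines lam E t1" "p2 \<in> fibre_lines lam E t2"
      and s: "\<forall>s \<in> p1. res_rep lam t1 A s - fls_const n1 *s s \<in> fibre_zero lam E t1"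
        "\<forall>s \<in> p2. res_rep lam t2 A s - fls_const n2 *s s \<in> fibre_zero lam E t2"
      unfolding Con_def parabolic_space_def n1_def n2_def by auto
    obtain c where c: "A = con_mat c" using log_connection_con_mat A by blast
    obtain x1 y1 where l1: "p1 = F1.line x1 y1" "x1 \<noteq> 0 \<or> y1 \<noteq> 0" using p(1) unfolding F1.fibre_lines_eq by blast
    obtain x2 y2 where l2: "p2 = F2.line x2 y2" "x2 \<noteq> 0 \<or> y2 \<noteq> 0" using p(2) unfolding F2.fibre_lines_eq by blast
    have "F1.eig (con_mat c) n1 x1 y1" "F2.eig (con_mat c) n2 x2 y2"
      using s unfolding c l1(1) l2(1) F1.line_eig_iff[OF pl1] F2.line_eig_iff[OF pl2] .
    then have "con_eqs n1 n2 c x1 y1 x2 y2" unfolding eig1 eig2 con_eqs_def using l1 l2 by blast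
    then show "m \<in> {(con_mat c, F1.line x1 y1, F2.line x2 y2) | c x1 y1 x2 y2. con_eqs n1 n2 c x1 y1 x2 y2}"
      using m c l1 l2 by blast
  next
    fix m assume "m \<in> {(con_mat c, F1.line x1 y1, F2.line x2 y2) | c x1 y1 x2 y2. con_eqs n1 n2 c x1 y1 x2 y2}"
    then obtain c x1 y1 x2 y2 where m: "m = (con_mat c, F1.line x1 y1, F2.line x2 y2)" and e: "con_eqs n1 n2 c x1 y1 x2 y2"
      by blast
    have eg: "F1.eig (con_mat c) n1 x1 y1" "F2.eig (con_mat c) n2 x2 y2" and nz: "x1 \<noteq> 0 \<or> y1 \<noteq> 0" "x2 \<noteq> 0 \<or> y2 \<noteq> 0"
      using e unfolding eig1 eig2 con_eqs_def by blast+
    have "F1.line x1 y1 \<in> fibre_lines lam E t1" "F2.line x2 y2 \<in> fibre_lines lam E t2"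
      unfolding F1.fibre_lines_eq F2.fibre_lines_eq using nz by blast+
    moreover have "res_eigenvalues lam E t1 (con_mat c) = {n1, - 1 - n1}"
      unfolding F1.res_eigenvalues_eq[OF pl1] by (rule F1.eigenvalues_trace[OF eg(1) nz(1) tr1])
    moreover have "res_eigenvalues lam E t2 (con_mat c) = {n2, - n2}"
      unfolding F2.res_eigenvalues_eq[OF pl2] by (rule F2.eigenvalues_trace[OF eg(2) nz(2) tr2])
    ultimately show "m \<in> Con lam t1 t2 nu1 nu2 a E"
      using con_mat_log[of c] con_mat_trace[of c] eg
      unfolding m Con_def mem_Collect_eq prod.case parabolic_space_def mem_Times_iff fst_conv snd_conv
        m1 m2 n1_def[symmetric] n2_def[symmetric] F1.line_eig_iff[OF pl1] F2.line_eig_iff[OF pl2]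
      by blast
  qed
qed

lemma App_con_mat: "App (con_mat c, p) = {fls_const k * omega (c 2) (c 5) (c 0 + c 3) | k. True}"
  by (simp add: App_def conn_21 con_mat_21)

lemma con_mat_inj: "con_mat c = con_mat d \<Longrightarrow> i < 6 \<Longrightarrow> c i = d i"
proof -
  assume "con_mat c = con_mat d" "i < 6"
  moreover from this have "i \<in> {0, 1, 2, 3, 4, 5}" by auto
  ultimately show ?thesis using con_mat_res[of c] con_mat_res[of d] by auto
qed

end

section \<open>Birationality\<close>

definition span1 :: "complex fls \<Rightarrow> complex fls set" where
  "span1 \<omega> = {fls_const c * \<omega> | c. True}"

lemma span1_scale: "k \<noteq> 0 \<Longrightarrow> span1 (fls_const k * \<omega>) = span1 \<omega>"
proof -
  assume k: "k \<noteq> 0"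
  have "(\<exists>c. x = fls_const c * (fls_const k * \<omega>)) \<longleftrightarrow> (\<exists>c. x = fls_const c * \<omega>)" for x
  proof
    assume "\<exists>c. x = fls_const c * \<omega>"
    then obtain c where "x = fls_const c * \<omega>" by blast
    moreover have "fls_const (c / k) * fls_const k = fls_const c" using k by simp
    ultimately have "x = fls_const (c / k) * (fls_const k * \<omega>)" by (metis mult.assoc)
    then show "\<exists>c. x = fls_const c * (fls_const k * \<omega>)" by blast
  qed (metis mult.assoc fls_const_mult)
  then show ?thesis unfolding span1_def by simp
qed

lemma null_sequence_if: "(\<lambda>n. if P n then 0 else 1 / of_nat (Suc n) :: complex) \<longlonglongrightarrow> 0"
proof (rule Lim_null_comparison)
  show "\<forall>\<^sub>F n in sequentially. norm (if P n then 0 else 1 / of_nat (Suc n) :: complex) \<le> 1 / real (Suc n)"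
    by (rule always_eventually) (auto simp: norm_divide simp del: of_nat_Suc)
  show "(\<lambda>n. 1 / real (Suc n)) \<longlonglongrightarrow> 0"
    using LIMSEQ_inverse_real_of_nat by (simp add: inverse_eq_divide)
qed

lemma complex_null_sequence: "(\<lambda>n. 1 / of_nat (Suc n) :: complex) \<longlonglongrightarrow> 0"
  using null_sequence_if[of "\<lambda>_. False"] by simp

text \<open>
  Every pair of a line and a residue with this eigenline is a limit of such pairs with the line
  different from \<open>(1 : 0)\<close>.
\<close>

lemma eigenline_deformation:
  fixes \<alpha> \<beta> \<gamma> T \<nu> x y :: complex
  assumes "x \<noteq> 0 \<or> y \<noteq> 0" and e: "\<alpha> * x + \<beta> * y = \<nu> * x" "\<gamma> * x + (T - \<alpha>) * y = \<nu> * y"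
  shows "\<exists>\<alpha>n \<gamma>n yn. \<alpha>n \<longlonglongrightarrow> \<alpha> \<and> \<gamma>n \<longlonglongrightarrow> \<gamma> \<and> yn \<longlonglongrightarrow> y \<and>
    (\<forall>n. yn n \<noteq> 0 \<and> \<alpha>n n * x + \<beta> * yn n = \<nu> * x \<and> \<gamma>n n * x + (T - \<alpha>n n) * yn n = \<nu> * yn n)"
proof (cases "y = 0")
  case False
  then show ?thesis
    using e by (intro exI[of _ "\<lambda>_. \<alpha>"] exI[of _ "\<lambda>_. \<gamma>"] exI[of _ "\<lambda>_. y"]) simp
next
  case True
  then have x: "x \<noteq> 0" and a: "\<alpha> = \<nu>" "\<gamma> = 0" using assms by auto
  define \<epsilon> where "\<epsilon> n = (1 / of_nat (Suc n) :: complex)" for n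
  have eps: "\<epsilon> \<longlonglongrightarrow> 0" "\<And>n. \<epsilon> n \<noteq> 0"
    using complex_null_sequence unfolding \<epsilon>_def by (auto simp del: of_nat_Suc)
  \<comment> \<open>The line moves from \<open>(1 : 0)\<close> to \<open>(1 : \<epsilon> n)\<close>
    while \<open>\<beta>\<close> is kept. The two eigenvector equations then determine the diagonal
    and the lower left entry.\<close>
  define \<alpha>n where "\<alpha>n n = \<nu> - \<beta> * \<epsilon> n" for n
  define \<gamma>n where "\<gamma>n n = \<epsilon> n * (\<nu> - T + \<alpha>n n)" for n
  have "\<alpha>n \<longlonglongrightarrow> \<nu> - \<beta> * 0" unfolding \<alpha>n_def by (intro tendsto_intros eps)
  then have la: "\<alpha>n \<longlonglongrightarrow> \<alpha>" using a by simp
  have "\<gamma>n \<longlonglongrightarrow> 0 * (\<nu> - T + \<alpha>)" unfolding \<gamma>n_def by (intro tendsto_intros eps la)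
  then have lg: "\<gamma>n \<longlonglongrightarrow> \<gamma>" using a by simp
  have "(\<lambda>n. \<epsilon> n * x) \<longlonglongrightarrow> 0 * x" by (intro tendsto_intros eps)
  then have ly: "(\<lambda>n. \<epsilon> n * x) \<longlonglongrightarrow> y" using True by simp
  show ?thesis
    using la lg ly x eps(2)
    by (intro exI[of _ \<alpha>n] exI[of _ \<gamma>n] exI[of _ "\<lambda>n. \<epsilon> n * x"]) (auto simp: \<alpha>n_def \<gamma>n_def algebra_simps)
qed

text \<open>Solves \<open>z = t - \<rho> / q\<close> for \<open>q\<close>; the line with
  \<open>q = 0\<close> lies at \<open>z\<close> infinite, hence the value 0 there.\<close>

definition slope_inv :: "complex \<Rightarrow> complex \<Rightarrow> complex option \<Rightarrow> complex" where
  "slope_inv t \<rho> z = (case z of None \<Rightarrow> 0 | Some c \<Rightarrow> \<rho> / (t - c))"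

lemma slope_inv_regular:
  assumes "z \<noteq> Some t"
  shows "\<exists>D \<phi>. regf P1_gens D \<phi> \<and> z \<in> D \<and> Some t \<notin> D \<and> (\<forall>z'\<in>D. \<phi> z' = slope_inv t \<rho> z')"
proof (cases z)
  case (Some c)
  have "(\<lambda>z. z) \<in> P1_gens" by (simp add: P1_gens_def)
  then have g: "regf P1_gens (dom (\<lambda>z. z)) (\<lambda>z. the z)" by (rule regf_gen)
  define D where "D = (UNIV \<inter> dom (\<lambda>z. z)) \<inter> {z. t - the z \<noteq> 0}"
  have "regf P1_gens D (\<lambda>z. inverse (t - the z))"
    unfolding D_def by (rule regf_inverse[OF regf_diff[OF regf_const g]])
  then have "regf P1_gens D (\<lambda>z. \<rho> * inverse (t - the z))" by (rule regf_cmult)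
  moreover have "z \<in> D" "Some t \<notin> D" using Some assms by (auto simp: D_def)
  moreover have "\<forall>z'\<in>D. \<rho> * inverse (t - the z') = slope_inv t \<rho> z'"
    by (auto simp: D_def slope_inv_def divide_inverse)
  ultimately show ?thesis by blast
next
  case None
  define w where "w = (\<lambda>z. case z of None \<Rightarrow> Some (0::complex) | Some c \<Rightarrow> if c = 0 then None else Some (inverse c))"
  have "w \<in> P1_gens" by (simp add: P1_gens_def w_def)
  then have g: "regf P1_gens (dom w) (\<lambda>z. the (w z))" by (rule regf_gen)
  \<comment> \<open>In the chart \<open>w = 1 / z\<close> the function
    \<open>\<rho> / (t - z)\<close> becomes \<open>\<rho> * w / (t * w - 1)\<close>, which is
    regular at \<open>w = 0\<close>.\<close>
  define D where "D = (dom w \<inter> UNIV) \<inter> {z. t * the (w z) - 1 \<noteq> 0}"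
  have "regf P1_gens D (\<lambda>z. inverse (t * the (w z) - 1))"
    unfolding D_def by (rule regf_inverse[OF regf_diff[OF regf_cmult[OF g] regf_const]])
  moreover have "regf P1_gens (dom w) (\<lambda>z. \<rho> * the (w z))" by (rule regf_cmult[OF g])
  ultimately have "regf P1_gens (D \<inter> dom w) (\<lambda>z. inverse (t * the (w z) - 1) * (\<rho> * the (w z)))" by (rule regf_mult)
  moreover have "z \<in> D \<inter> dom w" "Some t \<notin> D \<inter> dom w" using None by (auto simp: D_def w_def)
  moreover have "inverse (t * the (w z') - 1) * (\<rho> * the (w z')) = slope_inv t \<rho> z'" if "z' \<in> D \<inter> dom w" for z'
  proof (cases z')
    case (Some c)
    then have c: "c \<noteq> 0" "t / c - 1 \<noteq> 0" using that by (auto simp: D_def w_def divide_inverse split: if_splits)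
    then have "inverse (t / c - 1) * (\<rho> / c) = \<rho> / (t - c)"
      by (simp add: field_simps)
    then show ?thesis using Some c by (simp add: slope_inv_def w_def divide_inverse)
  qed (simp add: slope_inv_def w_def)
  ultimately show ?thesis by blast
qed

text \<open>Value of the normalised coordinate on the line \<open>(x : y)\<close>, where
  \<open>\<rho>\<close> is \<open>\<kappa>\<close> times the \<open>y\<close>-coordinate of the
  marked point.\<close>

definition slope_coord :: "complex \<Rightarrow> complex \<Rightarrow> complex \<Rightarrow> complex \<Rightarrow> complex option" where
  "slope_coord t \<rho> x y = (if x = 0 then None else Some (t - \<rho> * y / x))"

lemma slope_coord_inv: "\<rho> \<noteq> 0 \<Longrightarrow> slope_inv t \<rho> (slope_coord t \<rho> q 1) = q"
  by (simp add: slope_inv_def slope_coord_def)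

lemma slope_inv_coord: "\<rho> \<noteq> 0 \<Longrightarrow> z \<noteq> Some t \<Longrightarrow> slope_coord t \<rho> (slope_inv t \<rho> z) 1 = z"
  by (cases z) (auto simp: slope_inv_def slope_coord_def)

lemma slope_coord_neq: "\<rho> \<noteq> 0 \<Longrightarrow> x \<noteq> 0 \<or> y \<noteq> 0 \<Longrightarrow> slope_coord t \<rho> x y = Some t \<longleftrightarrow> y = 0"
  by (auto simp: slope_coord_def)

context marked_point
begin

lemma coordinate_line:
  assumes z: "normalized_coordinate lam E (Aff t b) z" and xy: "x \<noteq> 0 \<or> y \<noteq> 0"
  shows "z (line x y) = slope_coord t (\<kappa> * b) x y"
proof -
  obtain \<alpha> \<beta> k where c: "\<alpha> \<in> fibre_functionals lam E (Aff t b)" "\<beta> \<in> fibre_functionals lam E (Aff t b)"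
    "k \<noteq> 0" "\<forall>l\<in>fibre_lines lam E (Aff t b). z l = ratio \<alpha> \<beta> l"
    "\<alpha> (frame 1 0) = k * t" "\<alpha> (frame 0 1) = - k * (\<kappa> * b)" "\<beta> (frame 1 0) = k" "\<beta> (frame 0 1) = 0"
    using coordinate_ex[OF z] by blast
  have "z (line x y) = ratio \<alpha> \<beta> (line x y)" using c(4) xy unfolding fibre_lines_eq by blast
  also have "\<dots> = slope_coord t (\<kappa> * b) x y"
    unfolding ratio_line[OF c(1,2)] c(5-8) slope_coord_def using c(3) by (simp add: field_simps)
  finally show ?thesis .
qed

lemma coordinate_gens:
  assumes z: "normalized_coordinate lam E (Aff t b) z" and g: "g \<in> P1_gens"
  shows "\<exists>\<gamma>\<in>proj_gens (fibre_functionals lam E (Aff t b)). \<forall>x y. (x \<noteq> 0 \<or> y \<noteq> 0) \<longrightarrow> g (z (line x y)) = \<gamma> (line x y)"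
proof -
  obtain \<alpha> \<beta> k where c: "\<alpha> \<in> fibre_functionals lam E (Aff t b)" "\<beta> \<in> fibre_functionals lam E (Aff t b)"
    "k \<noteq> 0" "\<forall>l\<in>fibre_lines lam E (Aff t b). z l = ratio \<alpha> \<beta> l"
    "\<alpha> (frame 1 0) = k * t" "\<alpha> (frame 0 1) = - k * (\<kappa> * b)" "\<beta> (frame 1 0) = k" "\<beta> (frame 0 1) = 0"
    using coordinate_ex[OF z] by blast
  have r: "ratio \<alpha> \<beta> \<in> proj_gens (fibre_functionals lam E (Aff t b))" "ratio \<beta> \<alpha> \<in> proj_gens (fibre_functionals lam E (Aff t b))"
    unfolding proj_gens_def using c(1,2) by blast+
  have kb: "\<kappa> * b \<noteq> 0" using kappa_nz b_nz by simp
  have zl: "z (line x y) = ratio \<alpha> \<beta> (line x y)" if "x \<noteq> 0 \<or> y \<noteq> 0" for x y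
    using c(4) that unfolding fibre_lines_eq by blast
  from g consider "g = (\<lambda>z. z)" | "g = (\<lambda>z. case z of None \<Rightarrow> Some 0 | Some c \<Rightarrow> if c = 0 then None else Some (inverse c))"
    unfolding P1_gens_def by blast
  then show ?thesis
  proof cases
    case 1
    then show ?thesis using r(1) zl by auto
  next
    case 2
    have "g (z (line x y)) = ratio \<beta> \<alpha> (line x y)" if xy: "x \<noteq> 0 \<or> y \<noteq> 0" for x y
      unfolding zl[OF xy] ratio_line[OF c(1,2)] ratio_line[OF c(2,1)] c(5-8) 2
      using c(3) xy kb kappa_nz b_nz by (auto simp: inverse_eq_divide)
    then show ?thesis using r(2) by blast
  qed
qed

lemma ratio_e: "ratio e1 e2 (line x y) = (if y \<noteq> 0 then Some (x / y) else None)"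
  "ratio e1 e2 \<in> proj_gens (fibre_functionals lam E (Aff t b))"
proof -
  show "ratio e1 e2 (line x y) = (if y \<noteq> 0 then Some (x / y) else None)"
    unfolding ratio_line[OF e_functionals] by simp
  show "ratio e1 e2 \<in> proj_gens (fibre_functionals lam E (Aff t b))"
    unfolding proj_gens_def using e_functionals by blast
qed

lemma regf_line:
  assumes \<gamma>: "\<gamma> \<in> proj_gens (fibre_functionals lam E (Aff t b))" and q: "regf G D q"
  shows "\<exists>D' \<phi>. regf G D' \<phi> \<and> (\<forall>p\<in>D. \<gamma> (line (q p) 1) = (if p \<in> D' then Some (\<phi> p) else None)) \<and> D' \<subseteq> D"
proof -
  obtain \<alpha> \<beta> where g: "\<gamma> = ratio \<alpha> \<beta>" and f: "\<alpha> \<in> fibre_functionals lam E (Aff t b)" "\<beta> \<in> fibre_functionals lam E (Aff t b)"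
    using \<gamma> unfolding proj_gens_def by blast
  define A B where "A p = \<alpha> (frame 1 0) * q p + \<alpha> (frame 0 1) * 1" and "B p = \<beta> (frame 1 0) * q p + \<beta> (frame 0 1) * 1" for p
  have A: "regf G D A" and B: "regf G D B"
    unfolding A_def B_def by (intro regf_same(1) regf_cmult q regf_const_on[OF q])+
  have "regf G (D \<inter> (D \<inter> {p. B p \<noteq> 0})) (\<lambda>p. A p * inverse (B p))"
    by (rule regf_mult[OF A regf_inverse[OF B]])
  moreover have "\<gamma> (line (q p) 1) = (if B p \<noteq> 0 then Some (A p * inverse (B p)) else None)" for p
    unfolding g ratio_line[OF f] A_def B_def by (simp add: divide_inverse)
  ultimately show ?thesis by (intro exI[of _ "D \<inter> (D \<inter> {p. B p \<noteq> 0})"] exI[of _ "\<lambda>p. A p * inverse (B p)"]) auto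
qed

end

section \<open>The birational map, its inverse, and the fibres over parabolic bundles\<close>

locale moduli = connection_setup +
  fixes nu1 nu2 :: complex and z1 z2 :: "(complex fls ^ 2) set \<Rightarrow> complex option"
  assumes odd_sum: "\<not> (\<exists>k::int. odd k \<and> nu1 + nu2 = of_int k)"
    and odd_diff: "\<not> (\<exists>k::int. odd k \<and> nu1 - nu2 = of_int k)"
    and z1: "normalized_coordinate lam E t1 z1"
    and z2: "normalized_coordinate lam E t2 z2"
    and nu_nz: "nu1 + nu2 + 1 \<noteq> 0"
begin

definition n1 where "n1 = nu1 / 2 - 1 / 2"
definition n2 where "n2 = nu2 / 2"
text \<open>The sum of the upper left residues when both lower left residues vanish and neither line
  is that of the subbundle.\<close>

definition \<delta> where "\<delta> = - 1 - n1 - n2"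

lemma delta_nz: "\<delta> \<noteq> 0"
proof
  have "nu1 + nu2 + 1 = - 2 * \<delta>" unfolding \<delta>_def n1_def n2_def by (simp add: field_simps)
  moreover assume "\<delta> = 0"
  ultimately show False using nu_nz by (simp only: mult_zero_right)
qed

abbreviation CON where "CON \<equiv> Con lam t1 t2 nu1 nu2 a E"
abbreviation CG where "CG \<equiv> Con_gens lam t1 t2 E"
abbreviation YS :: "((complex option \<times> complex option) \<times> complex fls set) set" where
  "YS \<equiv> (UNIV \<times> UNIV) \<times> app_space lam t1 t2"
abbreviation YG where "YG \<equiv> prod_gens (prod_gens P1_gens P1_gens) (proj_gens fls_functionals)"
abbreviation r1 where "r1 \<equiv> \<kappa> * r"
abbreviation r2' where "r2' \<equiv> \<kappa> * (- r)"

definition bun_app :: "connection \<times> parabolic \<Rightarrow> (complex option \<times> complex option) \<times> complex fls set" where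
  "bun_app m = ((z1 (fst (Bun m)), z2 (snd (Bun m))), App m)"

lemma rho_nz: "r1 \<noteq> 0" "r2' \<noteq> 0"
  using kappa_nz r_nz by simp_all

lemma CON_eq: "CON = {(con_mat c, F1.line x1 y1, F2.line x2 y2) | c x1 y1 x2 y2. con_eqs n1 n2 c x1 y1 x2 y2}"
  unfolding Con_eq n1_def n2_def ..

lemma App_span: "App (con_mat c, p) = span1 (omega (c 2) (c 5) (c 0 + c 3))"
  by (simp add: App_con_mat span1_def)

lemma app_space_eq: "app_space lam t1 t2 = {span1 (omega x y z) | x y z. x \<noteq> 0 \<or> y \<noteq> 0 \<or> z \<noteq> 0}"
proof -
  have "app_space lam t1 t2 = {span1 \<omega> | \<omega>. \<omega> \<in> app_sections lam t1 t2 - {0}}"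
    unfolding app_space_def span1_def ..
  also have "\<dots> = {span1 (omega x y z) | x y z. x \<noteq> 0 \<or> y \<noteq> 0 \<or> z \<noteq> 0}"
    unfolding app_sections_eq using omega_eq_0 by blast
  finally show ?thesis .
qed

text \<open>
  If the apparent map vanished, the subbundle \<open>\<O>\<close> would be invariant, and the residue theorem on it
  would make \<open>\<nu>\<^sub>1 \<plusminus> \<nu>\<^sub>2\<close> an odd integer.
\<close>

lemma App_nz:
  assumes "con_eqs n1 n2 c x1 y1 x2 y2"
  shows "c 2 \<noteq> 0 \<or> c 5 \<noteq> 0 \<or> c 0 + c 3 \<noteq> 0"
proof (rule ccontr)
  assume "\<not> ?thesis"
  then have z: "c 2 = 0" "c 5 = 0" "c 0 + c 3 = 0" by auto
  \<comment> \<open>With lower left entry 0 the residue is triangular, so its upper left entry is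
    one of the two eigenvalues; which one depends on whether the line is that of the
    subbundle.\<close>
  have a: "c 0 = n1 \<or> c 0 = - 1 - n1"
  proof (cases "y1 = 0")
    case False
    have "(- 1 - c 0) * y1 = n1 * y1" using assms z unfolding con_eqs_def by simp
    then have "- 1 - c 0 = n1" using False by simp
    then show ?thesis by (auto simp: algebra_simps)
  qed (use assms in \<open>auto simp: con_eqs_def\<close>)
  have b: "c 3 = n2 \<or> c 3 = - n2"
  proof (cases "y2 = 0")
    case False
    have "- c 3 * y2 = n2 * y2" using assms z unfolding con_eqs_def by simp
    then have "- c 3 = n2" using False mult_right_cancel by blast
    then have "c 3 = - n2" by (metis minus_minus)
    then show ?thesis ..
  qed (use assms in \<open>auto simp: con_eqs_def\<close>)
  have "nu1 + nu2 = 1 \<or> nu1 - nu2 = 1 \<or> nu1 - nu2 = - 1 \<or> nu1 + nu2 = - 1"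
  proof -
    have "n1 + n2 = 0 \<or> n1 - n2 = 0 \<or> n1 - n2 = - 1 \<or> n1 + n2 = - 1"
      using a b z(3) by (elim disjE) (simp_all add: algebra_simps eq_neg_iff_add_eq_0)
    moreover have "p = 1 \<or> q = 1 \<or> q = - 1 \<or> p = - 1"
      if "s = 0 \<or> d = 0 \<or> d = - 1 \<or> s = - 1" "p = 2 * s + 1" "q = 2 * d + 1" for p q s d :: complex
      using that by auto
    moreover have "nu1 + nu2 = 2 * (n1 + n2) + 1" "nu1 - nu2 = 2 * (n1 - n2) + 1"
      by (simp_all add: n1_def n2_def field_simps)
    ultimately show ?thesis by blast
  qed
  then have "nu1 + nu2 = of_int 1 \<or> nu1 - nu2 = of_int 1 \<or> nu1 - nu2 = of_int (- 1) \<or> nu1 + nu2 = of_int (- 1)"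
    by simp
  moreover have "odd (1::int)" "odd (- 1 :: int)" by simp_all
  ultimately show False using odd_sum odd_diff by blast
qed

lemma App_app_space: "m \<in> CON \<Longrightarrow> App m \<in> app_space lam t1 t2"
  unfolding CON_eq app_space_eq using App_nz App_span by auto metis

lemma omega_scale: "fls_const k * omega x y z = omega (k * x) (k * y) (k * z)"
proof -
  have "fls_const k * fe [:u, v:] [:w:] = fe [:k * u, k * v:] [:k * w:]" for u v w
    using fe_lin(3)[of "[:k:]" "[:u, v:]" "[:w:]"] by (simp add: mult.commute)
  then have "fls_const k * omega x y z = eta * fe [:k * (r * (x - y) / 2 - z * t / (2 * \<kappa>)), k * (z / (2 * \<kappa>)):] [:k * ((x + y) / 2):] / N"
    unfolding omega_def by (simp add: mult.left_commute)
  also have "\<dots> = omega (k * x) (k * y) (k * z)"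
    unfolding omega_def by (simp add: algebra_simps)
  finally show ?thesis .
qed

lemma omega_add: "omega x y z + omega x' y' z' = omega (x + x') (y + y') (z + z')"
proof -
  have "omega x y z + omega x' y' z' = eta * (fe [:r * (x - y) / 2 - z * t / (2 * \<kappa>), z / (2 * \<kappa>):] [:(x + y) / 2:] +
     fe [:r * (x' - y') / 2 - z' * t / (2 * \<kappa>), z' / (2 * \<kappa>):] [:(x' + y') / 2:]) / N"
    unfolding omega_def by (simp only: distrib_left add_divide_distrib)
  also have "\<dots> = omega (x + x') (y + y') (z + z')"
    unfolding fe_lin(1) omega_def by (simp add: algebra_simps add_divide_distrib diff_divide_distrib)
  finally show ?thesis .
qed

lemma omega_functional: "l \<in> fls_functionals \<Longrightarrow> l (omega x y (z + e)) = l (omega x y z) + e * l (omega 0 0 1)"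
proof -
  assume l: "l \<in> fls_functionals"
  have "omega x y (z + e) = omega x y z + fls_const e * omega 0 0 1"
    unfolding omega_scale omega_add by simp
  then show ?thesis using l unfolding fls_functionals_iff by simp
qed

lemma span_omega_eqD:
  assumes "span1 (omega x y z) = span1 (omega x' y' z')"
  shows "\<exists>k. x = k * x' \<and> y = k * y' \<and> z = k * z'"
proof -
  obtain l1 l2 l3 where l: "\<forall>x y z. l1 (omega x y z) = x \<and> l2 (omega x y z) = y \<and> l3 (omega x y z) = z"
    using omega_functionals by blast
  have "omega x y z \<in> span1 (omega x y z)" unfolding span1_def by (auto intro: exI[of _ 1])
  then have "omega x y z \<in> span1 (omega x' y' z')" using assms by simp
  then obtain k where "omega x y z = fls_const k * omega x' y' z'" unfolding span1_def by blast
  then have "omega x y z = omega (k * x') (k * y') (k * z')" by (simp add: omega_scale)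
  then show ?thesis using l by metis
qed

text \<open>
  A residue with given trace and eigenvalue on the line spanned by \<open>(q, 1)\<close> is determined by \<open>q\<close>
  and its lower left entry \<open>g\<close>.
\<close>

definition cc :: "complex \<Rightarrow> complex \<Rightarrow> complex \<Rightarrow> complex \<Rightarrow> nat \<Rightarrow> complex" where
  "cc q1 g1 q2 g2 i = [- 1 - n1 + g1 * q1, (2 * n1 + 1) * q1 - g1 * q1 * q1, g1,
     - n2 + g2 * q2, 2 * n2 * q2 - g2 * q2 * q2, g2] ! i"

definition pt :: "complex \<Rightarrow> complex \<Rightarrow> complex \<Rightarrow> complex \<Rightarrow> connection \<times> parabolic" where
  "pt q1 g1 q2 g2 = (con_mat (cc q1 g1 q2 g2), F1.line q1 1, F2.line q2 1)"

lemma cc_nth [simp]: "cc q1 g1 q2 g2 0 = - 1 - n1 + g1 * q1" "cc q1 g1 q2 g2 (Suc 0) = (2 * n1 + 1) * q1 - g1 * q1 * q1"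
  "cc q1 g1 q2 g2 2 = g1" "cc q1 g1 q2 g2 3 = - n2 + g2 * q2" "cc q1 g1 q2 g2 4 = 2 * n2 * q2 - g2 * q2 * q2"
  "cc q1 g1 q2 g2 5 = g2"
  by (simp_all add: cc_def)

lemma con_eqs_cc: "con_eqs n1 n2 (cc q1 g1 q2 g2) q1 1 q2 1"
  unfolding con_eqs_def by (simp add: algebra_simps)

lemma con_eqs_normalize:
  assumes e: "con_eqs n1 n2 c x1 y1 x2 y2" and y: "y1 \<noteq> 0" "y2 \<noteq> 0"
  shows "(con_mat c, F1.line x1 y1, F2.line x2 y2) = pt (x1 / y1) (c 2) (x2 / y2) (c 5)"
proof -
  have l: "F1.line x1 y1 = F1.line (x1 / y1) 1" "F2.line x2 y2 = F2.line (x2 / y2) 1"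
    using F1.line_scale[of y1 "x1 / y1" 1] F2.line_scale[of y2 "x2 / y2" 1] y by simp_all
  define q1 q2 where "q1 = x1 / y1" and "q2 = x2 / y2"
  have x: "x1 = q1 * y1" "x2 = q2 * y2" using y by (simp_all add: q1_def q2_def)
  have eqs: "(c 0 * q1 + c 1) * y1 = (n1 * q1) * y1" "(c 2 * q1 + (- 1 - c 0)) * y1 = n1 * y1"
    "(c 3 * q2 + c 4) * y2 = (n2 * q2) * y2" "(c 5 * q2 - c 3) * y2 = n2 * y2"
    using e unfolding con_eqs_def x by (simp_all add: algebra_simps)
  then have eqs': "c 0 * q1 + c 1 = n1 * q1" "c 2 * q1 + (- 1 - c 0) = n1" "c 3 * q2 + c 4 = n2 * q2" "c 5 * q2 - c 3 = n2"
    using y by (metis mult_right_cancel)+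
  have c: "c 0 = - 1 - n1 + c 2 * q1" "c 3 = - n2 + c 5 * q2" using eqs'(2,4) by (simp_all add: algebra_simps)
  have "c 1 = n1 * q1 - c 0 * q1" "c 4 = n2 * q2 - c 3 * q2" using eqs'(1,3) by (simp_all add: algebra_simps)
  then have c': "c 1 = (2 * n1 + 1) * q1 - c 2 * q1 * q1" "c 4 = 2 * n2 * q2 - c 5 * q2 * q2"
    unfolding c by (simp_all add: algebra_simps)
  have "con_mat c = con_mat (cc q1 (c 2) q2 (c 5))"
  proof (rule con_mat_cong)
    fix i :: nat assume "i < 6"
    then have "i \<in> {0, 1, 2, 3, 4, 5}" by auto
    then show "c i = cc q1 (c 2) q2 (c 5) i" using c c' by auto
  qed
  then show ?thesis unfolding pt_def l q1_def q2_def by simp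
qed

definition con_open where "con_open = {pt q1 g1 q2 g2 | q1 g1 q2 g2. True}"

text \<open>The image of the chart. For fixed lines of slopes \<open>q1\<close>, \<open>q2\<close>
  the values of the apparent map satisfy \<open>z - q1 * x - q2 * y = \<delta>\<close> in the given
  representative, so they avoid exactly one line of the plane.\<close>

definition slope_open :: "((complex option \<times> complex option) \<times> complex fls set) set" where
  "slope_open = {((\<zeta>1, \<zeta>2), span1 (omega x y z)) | \<zeta>1 \<zeta>2 x y z. \<zeta>1 \<noteq> Some t \<and> \<zeta>2 \<noteq> Some t \<and>
     z - slope_inv t r1 \<zeta>1 * x - slope_inv t r2' \<zeta>2 * y \<noteq> 0}"

lemma con_open_CON: "con_open \<subseteq> CON"
  unfolding con_open_def CON_eq pt_def using con_eqs_cc by blast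

lemma CON_con_open: "con_eqs n1 n2 c x1 y1 x2 y2 \<Longrightarrow> y1 \<noteq> 0 \<Longrightarrow> y2 \<noteq> 0 \<Longrightarrow> (con_mat c, F1.line x1 y1, F2.line x2 y2) \<in> con_open"
  unfolding con_open_def using con_eqs_normalize by blast

lemma slope_open_YS: "slope_open \<subseteq> YS"
proof
  fix p assume "p \<in> slope_open"
  then obtain \<zeta>1 \<zeta>2 x y z where "p = ((\<zeta>1, \<zeta>2), span1 (omega x y z))"
    "z - slope_inv t r1 \<zeta>1 * x - slope_inv t r2' \<zeta>2 * y \<noteq> 0" unfolding slope_open_def by blast
  moreover from this have "x \<noteq> 0 \<or> y \<noteq> 0 \<or> z \<noteq> 0" by auto
  ultimately show "p \<in> YS" unfolding app_space_eq by auto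
qed

lemma coords_line: "x \<noteq> 0 \<or> y \<noteq> 0 \<Longrightarrow> z1 (F1.line x y) = slope_coord t r1 x y"
  "x \<noteq> 0 \<or> y \<noteq> 0 \<Longrightarrow> z2 (F2.line x y) = slope_coord t r2' x y"
  by (rule F1.coordinate_line[OF z1], assumption) (rule F2.coordinate_line[OF z2], assumption)

lemma bun_app_pt: "bun_app (pt q1 g1 q2 g2) =
  ((slope_coord t r1 q1 1, slope_coord t r2' q2 1), span1 (omega g1 g2 (\<delta> + g1 * q1 + g2 * q2)))"
proof -
  have "App (pt q1 g1 q2 g2) = span1 (omega g1 g2 (\<delta> + g1 * q1 + g2 * q2))"
    unfolding pt_def App_span by (simp add: \<delta>_def algebra_simps)
  then show ?thesis
    unfolding bun_app_def Bun_def pt_def using coords_line[of q1 1] coords_line[of q2 1] by simp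
qed

lemma bun_app_pt_slope_open: "bun_app (pt q1 g1 q2 g2) \<in> slope_open"
proof -
  have "\<delta> + g1 * q1 + g2 * q2 - slope_inv t r1 (slope_coord t r1 q1 1) * g1 - slope_inv t r2' (slope_coord t r2' q2 1) * g2 \<noteq> 0"
    unfolding slope_coord_inv[OF rho_nz(1)] slope_coord_inv[OF rho_nz(2)] using delta_nz by simp
  moreover have "slope_coord t r1 q1 1 \<noteq> Some t" "slope_coord t r2' q2 1 \<noteq> Some t"
    using slope_coord_neq[OF rho_nz(1), of q1 1 t] slope_coord_neq[OF rho_nz(2), of q2 1 t] by simp_all
  ultimately show ?thesis unfolding bun_app_pt slope_open_def by blast
qed

lemma App_pt_inj:
  assumes "App (pt q1 g1 q2 g2) = App (pt q1 g1' q2 g2')"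
  shows "g1 = g1' \<and> g2 = g2'"
proof -
  have A: "App (pt q1 g1 q2 g2) = span1 (omega g1 g2 (\<delta> + g1 * q1 + g2 * q2))" for g1 g2
    using bun_app_pt[of q1 g1 q2 g2] unfolding bun_app_def by simp
  obtain k where k: "g1 = k * g1'" "g2 = k * g2'" "\<delta> + g1 * q1 + g2 * q2 = k * (\<delta> + g1' * q1 + g2' * q2)"
    using span_omega_eqD assms unfolding A by blast
  then have "\<delta> = k * \<delta>" by (simp add: algebra_simps)
  then have "k = 1" using delta_nz by simp
  then show ?thesis using k by simp
qed

lemma bun_app_inj: "inj_on bun_app con_open"
proof (rule inj_onI)
  fix m m' assume "m \<in> con_open" "m' \<in> con_open" and eq: "bun_app m = bun_app m'"
  then obtain q1 g1 q2 g2 q1' g1' q2' g2' where m: "m = pt q1 g1 q2 g2" "m' = pt q1' g1' q2' g2'"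
    unfolding con_open_def by blast
  have "slope_coord t r1 q1 1 = slope_coord t r1 q1' 1" "slope_coord t r2' q2 1 = slope_coord t r2' q2' 1"
    using eq unfolding m bun_app_pt by auto
  then have q: "q1 = q1'" "q2 = q2'"
    using slope_coord_inv[OF rho_nz(1)] slope_coord_inv[OF rho_nz(2)] by metis+
  have "App m = App m'" using eq unfolding bun_app_def by simp
  then show "m = m'" using App_pt_inj unfolding m q by blast
qed

text \<open>The representative \<open>(x, y, z)\<close> is rescaled by \<open>\<delta>\<close> over
  the denominator, after which \<open>z - q1 * x - q2 * y\<close> equals \<open>\<delta>\<close>.
  Its first two components are then the lower left residues.\<close>

lemma bun_app_preimage:
  assumes "\<zeta>1 \<noteq> Some t" "\<zeta>2 \<noteq> Some t"
  defines "q1 \<equiv> slope_inv t r1 \<zeta>1" and "q2 \<equiv> slope_inv t r2' \<zeta>2"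
  assumes d: "z - q1 * x - q2 * y \<noteq> 0"
  shows "bun_app (pt q1 (\<delta> * x / (z - q1 * x - q2 * y)) q2 (\<delta> * y / (z - q1 * x - q2 * y))) = ((\<zeta>1, \<zeta>2), span1 (omega x y z))"
proof -
  define d where "d = z - q1 * x - q2 * y"
  have "d \<noteq> 0" using d by (simp add: d_def)
  have "\<delta> + \<delta> * x / d * q1 + \<delta> * y / d * q2 = \<delta> * (d + q1 * x + q2 * y) / d"
    using \<open>d \<noteq> 0\<close> by (simp add: field_simps)
  also have "d + q1 * x + q2 * y = z" by (simp add: d_def)
  finally have e: "\<delta> + \<delta> * x / d * q1 + \<delta> * y / d * q2 = \<delta> / d * z" by simp
  have "omega (\<delta> * x / d) (\<delta> * y / d) (\<delta> / d * z) = fls_const (\<delta> / d) * omega x y z"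
    unfolding omega_scale by simp
  then have "span1 (omega (\<delta> * x / d) (\<delta> * y / d) (\<delta> / d * z)) = span1 (omega x y z)"
    using span1_scale[of "\<delta> / d"] delta_nz \<open>d \<noteq> 0\<close> by simp
  then show ?thesis
    unfolding bun_app_pt d_def[symmetric] e unfolding q1_def q2_def
    using slope_inv_coord[OF rho_nz(1) assms(1)] slope_inv_coord[OF rho_nz(2) assms(2)] by simp
qed

lemma bun_app_bij: "bij_betw bun_app con_open slope_open"
  unfolding bij_betw_def
proof (intro conjI bun_app_inj equalityI subsetI)
  fix p assume "p \<in> bun_app ` con_open"
  then show "p \<in> slope_open" using bun_app_pt_slope_open unfolding con_open_def by blast
next
  fix p assume "p \<in> slope_open"
  then obtain \<zeta>1 \<zeta>2 x y z where p: "p = ((\<zeta>1, \<zeta>2), span1 (omega x y z))" "\<zeta>1 \<noteq> Some t" "\<zeta>2 \<noteq> Some t"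
    "z - slope_inv t r1 \<zeta>1 * x - slope_inv t r2' \<zeta>2 * y \<noteq> 0" unfolding slope_open_def by blast
  show "p \<in> bun_app ` con_open"
    unfolding p(1) bun_app_preimage[OF p(2-4), symmetric] con_open_def by blast
qed

lemma regf_CG:
  "regf conn_gens D \<phi> \<Longrightarrow> regf CG {m. fst m \<in> D} (\<lambda>m. \<phi> (fst m))"
  "regf (proj_gens (fibre_functionals lam E t1)) D1 \<psi> \<Longrightarrow> regf CG {m. fst (snd m) \<in> D1} (\<lambda>m. \<psi> (fst (snd m)))"
  "regf (proj_gens (fibre_functionals lam E t2)) D1 \<psi> \<Longrightarrow> regf CG {m. snd (snd m) \<in> D1} (\<lambda>m. \<psi> (snd (snd m)))"
proof -
  let ?P1 = "proj_gens (fibre_functionals lam E t1)" and ?P2 = "proj_gens (fibre_functionals lam E t2)"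
  show "regf CG {m. fst m \<in> D} (\<lambda>m. \<phi> (fst m))" if "regf conn_gens D \<phi>"
    using regf_fst[where H = "prod_gens ?P1 ?P2", OF that] by (simp add: Con_gens_def vimage_def comp_def)
  show "regf CG {m. fst (snd m) \<in> D1} (\<lambda>m. \<psi> (fst (snd m)))" if "regf ?P1 D1 \<psi>"
    using regf_snd[where G = conn_gens, OF regf_fst[where H = ?P2, OF that]] by (simp add: Con_gens_def vimage_def comp_def)
  show "regf CG {m. snd (snd m) \<in> D1} (\<lambda>m. \<psi> (snd (snd m)))" if "regf ?P2 D1 \<psi>"
    using regf_snd[where G = conn_gens, OF regf_snd[where G = ?P1, OF that]] by (simp add: Con_gens_def vimage_def comp_def)
qed

lemma regf_YG:
  "regf P1_gens D \<phi> \<Longrightarrow> regf YG {p. fst (fst p) \<in> D} (\<lambda>p. \<phi> (fst (fst p)))"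
  "regf P1_gens D \<phi> \<Longrightarrow> regf YG {p. snd (fst p) \<in> D} (\<lambda>p. \<phi> (snd (fst p)))"
  "regf (proj_gens fls_functionals) D1 \<psi> \<Longrightarrow> regf YG {p. snd p \<in> D1} (\<lambda>p. \<psi> (snd p))"
proof -
  show "regf YG {p. fst (fst p) \<in> D} (\<lambda>p. \<phi> (fst (fst p)))" if "regf P1_gens D \<phi>"
    using regf_fst[where H = "proj_gens fls_functionals", OF regf_fst[where H = P1_gens, OF that]] by (simp add: vimage_def comp_def)
  show "regf YG {p. snd (fst p) \<in> D} (\<lambda>p. \<phi> (snd (fst p)))" if "regf P1_gens D \<phi>"
    using regf_fst[where H = "proj_gens fls_functionals", OF regf_snd[where G = P1_gens, OF that]] by (simp add: vimage_def comp_def)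
  show "regf YG {p. snd p \<in> D1} (\<lambda>p. \<psi> (snd p))" if "regf (proj_gens fls_functionals) D1 \<psi>"
    using regf_snd[where G = "prod_gens P1_gens P1_gens", OF that] by (simp add: vimage_def comp_def)
qed

lemma con_open_open: "openin (zariski CON CG) con_open"
proof (rule zariski_open[OF con_open_CON])
  fix p assume "p \<in> con_open"
  then obtain q1 g1 q2 g2 where p: "p = pt q1 g1 q2 g2" unfolding con_open_def by blast
  define D where "D = {m :: connection \<times> parabolic. fst (snd m) \<in> dom (ratio F1.e1 F1.e2)} \<inter> {m. snd (snd m) \<in> dom (ratio F2.e1 F2.e2)}"
  \<comment> \<open>Only the domain of this sum matters: it realises the intersection of the two
    conditions on the lines as the domain of one regular function.\<close>
  have "regf CG D (\<lambda>m. the (ratio F1.e1 F1.e2 (fst (snd m))) + the (ratio F2.e1 F2.e2 (snd (snd m))))"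
    unfolding D_def
    by (rule regf_add[OF regf_CG(2)[OF regf_gen[OF F1.ratio_e(2)]] regf_CG(3)[OF regf_gen[OF F2.ratio_e(2)]]])
  moreover have "p \<in> D"
    unfolding p pt_def D_def using F1.ratio_e(1)[of q1 1] F2.ratio_e(1)[of q2 1] by auto
  moreover have "CON \<inter> D \<subseteq> con_open"
  proof
    fix m assume m: "m \<in> CON \<inter> D"
    then obtain c x1 y1 x2 y2 where e: "m = (con_mat c, F1.line x1 y1, F2.line x2 y2)" "con_eqs n1 n2 c x1 y1 x2 y2"
      unfolding CON_eq by blast
    have "ratio F1.e1 F1.e2 (F1.line x1 y1) \<noteq> None" "ratio F2.e1 F2.e2 (F2.line x2 y2) \<noteq> None"
      using m unfolding e(1) D_def by auto
    then have "y1 \<noteq> 0" "y2 \<noteq> 0" unfolding F1.ratio_e(1) F2.ratio_e(1) by (auto split: if_splits)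
    then show "m \<in> con_open" unfolding e(1) using CON_con_open[OF e(2)] by blast
  qed
  ultimately show "\<exists>D \<phi>. regf CG D \<phi> \<and> p \<in> D \<and> CON \<inter> D \<subseteq> con_open" by blast
qed

text \<open>The deformations at the two points can be carried out independently: since the residues
  are free coordinates, the deformed six-tuple again comes from a connection on the bundle.\<close>

lemma con_open_dense: "zariski CON CG closure_of con_open = CON"
proof (rule zariski_dense[OF con_open_CON])
  fix m assume "m \<in> CON"
  then obtain c x1 y1 x2 y2 where m: "m = (con_mat c, F1.line x1 y1, F2.line x2 y2)" and e: "con_eqs n1 n2 c x1 y1 x2 y2"
    unfolding CON_eq by blast
  have e': "x1 \<noteq> 0 \<or> y1 \<noteq> 0" "x2 \<noteq> 0 \<or> y2 \<noteq> 0"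
     "c 0 * x1 + c 1 * y1 = n1 * x1" "c 2 * x1 + (- 1 - c 0) * y1 = n1 * y1"
     "c 3 * x2 + c 4 * y2 = n2 * x2" "c 5 * x2 + (0 - c 3) * y2 = n2 * y2"
    using e unfolding con_eqs_def by simp_all
  obtain c0 c2 w1 where 1: "c0 \<longlonglongrightarrow> c 0" "c2 \<longlonglongrightarrow> c 2" "w1 \<longlonglongrightarrow> y1"
    "\<forall>n. w1 n \<noteq> 0 \<and> c0 n * x1 + c 1 * w1 n = n1 * x1 \<and> c2 n * x1 + (- 1 - c0 n) * w1 n = n1 * w1 n"
    using eigenline_deformation[OF e'(1,3,4)] by blast
  obtain c3 c5 w2 where 2: "c3 \<longlonglongrightarrow> c 3" "c5 \<longlonglongrightarrow> c 5" "w2 \<longlonglongrightarrow> y2"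
    "\<forall>n. w2 n \<noteq> 0 \<and> c3 n * x2 + c 4 * w2 n = n2 * x2 \<and> c5 n * x2 + (0 - c3 n) * w2 n = n2 * w2 n"
    using eigenline_deformation[OF e'(2,5,6)] by blast
  define cn where "cn n i = [c0 n, c 1, c2 n, c3 n, c 4, c5 n] ! i" for n and i :: nat
  define mn where "mn n = (con_mat (cn n), F1.line x1 (w1 n), F2.line x2 (w2 n))" for n
  have ce: "con_eqs n1 n2 (cn n) x1 (w1 n) x2 (w2 n)" for n
    unfolding con_eqs_def cn_def using 1(4) 2(4) by simp
  have "mn n \<in> con_open" for n unfolding mn_def using CON_con_open[OF ce] 1(4) 2(4) by blast
  moreover have lim: "(\<lambda>n. cn n i) \<longlonglongrightarrow> c i" if "i < 6" for i
  proof -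
    have "i \<in> {0, 1, 2, 3, 4, 5}" using that by auto
    then show ?thesis unfolding cn_def using 1 2 by auto
  qed
  have "conv CG mn m"
    unfolding Con_gens_def
  proof (intro conv_prod)
    show "conv conn_gens (\<lambda>n. fst (mn n)) (fst m)"
      unfolding conv_def
    proof (intro ballI allI impI)
      fix g d assume "g \<in> conn_gens" and gd: "g (fst m) = Some d"
      then obtain l i j where g: "g = (\<lambda>A. Some (l (A $ i $ j)))" "l \<in> fls_functionals" unfolding conn_gens_def by blast
      have d: "d = l (con_mat c $ i $ j)" using gd by (simp add: g m)
      have "(\<lambda>n. l (con_mat (cn n) $ i $ j)) \<longlonglongrightarrow> d"
        unfolding d by (rule caff_tendsto[OF con_mat_affine[OF g(2)] lim])
      then show "\<exists>\<psi>. (\<forall>\<^sub>F n in sequentially. g (fst (mn n)) = Some (\<psi> n)) \<and> \<psi> \<longlonglongrightarrow> d"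
        by (intro exI[of _ "\<lambda>n. l (con_mat (cn n) $ i $ j)"]) (simp add: g mn_def)
    qed
    show "conv (proj_gens (fibre_functionals lam E t1)) (\<lambda>n. fst (snd (mn n))) (fst (snd m))"
      using F1.conv_lines[OF 1(3), of x1] by (simp add: mn_def m)
    show "conv (proj_gens (fibre_functionals lam E t2)) (\<lambda>n. snd (snd (mn n))) (snd (snd m))"
      using F2.conv_lines[OF 2(3), of x2] by (simp add: mn_def m)
  qed
  ultimately show "\<exists>m'. (\<forall>n. m' n \<in> con_open) \<and> conv CG m' m" by blast
qed

lemma conv_span:
  assumes "e \<longlonglongrightarrow> 0"
  shows "conv (proj_gens fls_functionals) (\<lambda>n. span1 (omega x y (z + e n))) (span1 (omega x y z))"
  unfolding conv_def
proof (intro ballI allI impI)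
  fix g c assume "g \<in> proj_gens fls_functionals" and gc: "g (span1 (omega x y z)) = Some c"
  then obtain \<alpha> \<beta> where g: "g = ratio \<alpha> \<beta>" and ab: "\<alpha> \<in> fls_functionals" "\<beta> \<in> fls_functionals"
    unfolding proj_gens_def by blast
  have gr: "g (span1 \<omega>) = (if \<beta> \<omega> \<noteq> 0 then Some (\<alpha> \<omega> / \<beta> \<omega>) else None)" for \<omega>
    unfolding g span1_def by (rule ratio_span[OF ab])
  have c: "\<beta> (omega x y z) \<noteq> 0" "c = \<alpha> (omega x y z) / \<beta> (omega x y z)"
    using gc unfolding gr by (auto split: if_splits)
  have lim: "(\<lambda>n. l (omega x y (z + e n))) \<longlonglongrightarrow> l (omega x y z)" if l: "l \<in> fls_functionals" for l
  proof -
    have "(\<lambda>n. l (omega x y z) + e n * l (omega 0 0 1)) \<longlonglongrightarrow> l (omega x y z) + 0 * l (omega 0 0 1)"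
      by (intro tendsto_intros assms)
    then show ?thesis unfolding omega_functional[OF l] by simp
  qed
  have "\<forall>\<^sub>F n in sequentially. \<beta> (omega x y (z + e n)) \<noteq> 0"
    using tendsto_imp_eventually_ne[OF lim[OF ab(2)] c(1)] .
  then show "\<exists>\<psi>. (\<forall>\<^sub>F n in sequentially. g (span1 (omega x y (z + e n))) = Some (\<psi> n)) \<and> \<psi> \<longlonglongrightarrow> c"
    unfolding gr c(2) using lim[OF ab(1)] lim[OF ab(2)] c(1)
    by (intro exI[of _ "\<lambda>n. \<alpha> (omega x y (z + e n)) / \<beta> (omega x y (z + e n))"])
      (auto elim: eventually_mono intro: tendsto_divide)
qed

lemma slope_open_dense: "zariski YS YG closure_of slope_open = YS"
proof (rule zariski_dense[OF slope_open_YS])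
  fix p assume "p \<in> YS"
  then obtain \<zeta>1 \<zeta>2 x y z where p: "p = ((\<zeta>1, \<zeta>2), span1 (omega x y z))" unfolding app_space_eq by auto
  have P1: "\<exists>\<zeta>n. (\<forall>n. \<zeta>n n \<noteq> Some t) \<and> conv P1_gens \<zeta>n \<zeta>" for \<zeta>
  proof (cases "\<zeta> = Some t")
    case True
    have "(\<lambda>n. t + 1 / of_nat (Suc n)) \<longlonglongrightarrow> t + 0"
      by (intro tendsto_intros complex_null_sequence)
    then have "conv P1_gens (\<lambda>n. Some (t + 1 / of_nat (Suc n))) \<zeta>" unfolding True by (intro conv_P1) simp
    moreover have "Some (t + 1 / of_nat (Suc n)) \<noteq> Some t" for n by (simp del: of_nat_Suc)
    ultimately show ?thesis by (intro exI[of _ "\<lambda>n. Some (t + 1 / of_nat (Suc n))"]) blast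
  next
    case False
    then show ?thesis by (intro exI[of _ "\<lambda>_. \<zeta>"]) (simp add: conv_const)
  qed
  obtain \<zeta>1n where z1n: "\<forall>n. \<zeta>1n n \<noteq> Some t" "conv P1_gens \<zeta>1n \<zeta>1" using P1 by blast
  obtain \<zeta>2n where z2n: "\<forall>n. \<zeta>2n n \<noteq> Some t" "conv P1_gens \<zeta>2n \<zeta>2" using P1 by blast
  define w where "w n = z - slope_inv t r1 (\<zeta>1n n) * x - slope_inv t r2' (\<zeta>2n n) * y" for n
  \<comment> \<open>The third coordinate is moved only at those indices where the sequence of slopes
    would land on the excluded line of the plane.\<close>
  define e where "e n = (if w n \<noteq> 0 then 0 else 1 / of_nat (Suc n) :: complex)" for n
  have e: "e \<longlonglongrightarrow> 0" unfolding e_def by (rule null_sequence_if)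
  have "w n + e n \<noteq> 0" for n by (simp add: e_def del: of_nat_Suc)
  then have "z + e n - slope_inv t r1 (\<zeta>1n n) * x - slope_inv t r2' (\<zeta>2n n) * y \<noteq> 0" for n
    by (simp add: w_def algebra_simps)
  then have "((\<zeta>1n n, \<zeta>2n n), span1 (omega x y (z + e n))) \<in> slope_open" for n
    unfolding slope_open_def using z1n(1) z2n(1) by blast
  moreover have "conv YG (\<lambda>n. ((\<zeta>1n n, \<zeta>2n n), span1 (omega x y (z + e n)))) p"
    unfolding p by (intro conv_prod) (use z1n(2) z2n(2) conv_span[OF e] in simp_all)
  ultimately show "\<exists>m. (\<forall>n. m n \<in> slope_open) \<and> conv YG m p"
    by (intro exI[of _ "\<lambda>n. ((\<zeta>1n n, \<zeta>2n n), span1 (omega x y (z + e n)))"]) blast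
qed

lemma bun_app_regular: "regular_map con_open CG YG bun_app"
proof (rule regular_map_regf)
  fix p h assume p: "p \<in> con_open" and h: "h \<in> YG" and dom: "bun_app p \<in> dom h"
  have lines: "\<exists>c x1 y1 x2 y2. m = (con_mat c, F1.line x1 y1, F2.line x2 y2) \<and> (x1 \<noteq> 0 \<or> y1 \<noteq> 0) \<and> (x2 \<noteq> 0 \<or> y2 \<noteq> 0)" if "m \<in> con_open" for m
    using that unfolding con_open_def pt_def by force
  from h consider (1) g where "g \<in> P1_gens" "h = g \<circ> fst \<circ> fst" | (2) g where "g \<in> P1_gens" "h = g \<circ> snd \<circ> fst"
    | (3) \<alpha> \<beta> where "\<alpha> \<in> fls_functionals" "\<beta> \<in> fls_functionals" "h = ratio \<alpha> \<beta> \<circ> snd"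
    unfolding prod_gens_def proj_gens_def by blast
  then show "\<exists>D \<phi>. regf CG D \<phi> \<and> p \<in> D \<and> (\<forall>q\<in>con_open \<inter> D. h (bun_app q) = Some (\<phi> q))"
  proof cases
    case 1
    obtain \<gamma> where \<gamma>: "\<gamma> \<in> proj_gens (fibre_functionals lam E t1)"
      "\<forall>x y. (x \<noteq> 0 \<or> y \<noteq> 0) \<longrightarrow> g (z1 (F1.line x y)) = \<gamma> (F1.line x y)"
      using F1.coordinate_gens[OF z1 1(1)] by blast
    have eq: "h (bun_app m) = \<gamma> (fst (snd m))" if "m \<in> con_open" for m
      using lines[OF that] \<gamma>(2) unfolding 1(2) bun_app_def Bun_def by auto
    have "regf CG {m. fst (snd m) \<in> dom \<gamma>} (\<lambda>m. the (\<gamma> (fst (snd m))))"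
      by (rule regf_CG(2)[OF regf_gen[OF \<gamma>(1)]])
    moreover have "p \<in> {m. fst (snd m) \<in> dom \<gamma>}" using dom eq[OF p] by (simp add: domIff)
    ultimately show ?thesis using eq
      by (intro exI[of _ "{m. fst (snd m) \<in> dom \<gamma>}"] exI[of _ "\<lambda>m. the (\<gamma> (fst (snd m)))"]) auto
  next
    case 2
    obtain \<gamma> where \<gamma>: "\<gamma> \<in> proj_gens (fibre_functionals lam E t2)"
      "\<forall>x y. (x \<noteq> 0 \<or> y \<noteq> 0) \<longrightarrow> g (z2 (F2.line x y)) = \<gamma> (F2.line x y)"
      using F2.coordinate_gens[OF z2 2(1)] by blast
    have eq: "h (bun_app m) = \<gamma> (snd (snd m))" if "m \<in> con_open" for m
      using lines[OF that] \<gamma>(2) unfolding 2(2) bun_app_def Bun_def by auto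
    have "regf CG {m. snd (snd m) \<in> dom \<gamma>} (\<lambda>m. the (\<gamma> (snd (snd m))))"
      by (rule regf_CG(3)[OF regf_gen[OF \<gamma>(1)]])
    moreover have "p \<in> {m. snd (snd m) \<in> dom \<gamma>}" using dom eq[OF p] by (simp add: domIff)
    ultimately show ?thesis using eq
      by (intro exI[of _ "{m. snd (snd m) \<in> dom \<gamma>}"] exI[of _ "\<lambda>m. the (\<gamma> (snd (snd m)))"]) auto
  next
    case 3
    have gen: "regf CG UNIV (\<lambda>m. l (fst m $ 2 $ 1))" if l: "l \<in> fls_functionals" for l
    proof -
      have "(\<lambda>A. Some (l (A $ 2 $ 1))) \<in> conn_gens" unfolding conn_gens_def using l by blast
      from regf_CG(1)[OF regf_gen[OF this]] show ?thesis by (rule regf_cong) auto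
    qed
    define D where "D = UNIV \<inter> (UNIV \<inter> {m :: connection \<times> parabolic. \<beta> (fst m $ 2 $ 1) \<noteq> 0})"
    have "regf CG D (\<lambda>m. \<alpha> (fst m $ 2 $ 1) * inverse (\<beta> (fst m $ 2 $ 1)))"
      unfolding D_def by (rule regf_mult[OF gen[OF 3(1)] regf_inverse[OF gen[OF 3(2)]]])
    moreover have eq: "h (bun_app m) = (if \<beta> (fst m $ 2 $ 1) \<noteq> 0 then Some (\<alpha> (fst m $ 2 $ 1) / \<beta> (fst m $ 2 $ 1)) else None)" for m
      unfolding 3(3) bun_app_def App_def conn_21 comp_def snd_conv by (rule ratio_span[OF 3(1,2)])
    moreover have "p \<in> D" using dom eq[of p] by (auto simp: D_def split: if_splits)
    ultimately show ?thesis
      by (intro exI[of _ D] exI[of _ "\<lambda>m. \<alpha> (fst m $ 2 $ 1) * inverse (\<beta> (fst m $ 2 $ 1))"])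
        (auto simp: D_def divide_inverse)
  qed
qed

text \<open>A functional \<open>lj\<close> that is nonzero at \<open>p\<close> dehomogenises the
  target plane, so the coordinates become regular functions near \<open>p\<close>. Inserting them
  into the explicit preimage gives formulas for slopes and lower left residues on a whole
  neighbourhood.\<close>

lemma local_inverse:
  assumes p: "p \<in> slope_open"
  shows "\<exists>D q1 g1 q2 g2. regf YG D q1 \<and> regf YG D g1 \<and> regf YG D q2 \<and> regf YG D g2 \<and> p \<in> D \<and>
    (\<forall>p'\<in>YS \<inter> D. p' \<in> slope_open \<and> inv_into con_open bun_app p' = pt (q1 p') (g1 p') (q2 p') (g2 p'))"
proof -
  obtain \<zeta>1 \<zeta>2 x y z where pe: "p = ((\<zeta>1, \<zeta>2), span1 (omega x y z))" "\<zeta>1 \<noteq> Some t" "\<zeta>2 \<noteq> Some t"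
    "z - slope_inv t r1 \<zeta>1 * x - slope_inv t r2' \<zeta>2 * y \<noteq> 0" using p unfolding slope_open_def by blast
  obtain D1 \<phi>1 where D1: "regf P1_gens D1 \<phi>1" "\<zeta>1 \<in> D1" "Some t \<notin> D1" "\<forall>z\<in>D1. \<phi>1 z = slope_inv t r1 z"
    using slope_inv_regular[OF pe(2)] by blast
  obtain D2 \<phi>2 where D2: "regf P1_gens D2 \<phi>2" "\<zeta>2 \<in> D2" "Some t \<notin> D2" "\<forall>z\<in>D2. \<phi>2 z = slope_inv t r2' z"
    using slope_inv_regular[OF pe(3)] by blast
  obtain l1 l2 l3 where l: "l1 \<in> fls_functionals" "l2 \<in> fls_functionals" "l3 \<in> fls_functionals"
    "\<And>x y z. l1 (omega x y z) = x" "\<And>x y z. l2 (omega x y z) = y" "\<And>x y z. l3 (omega x y z) = z"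
    using omega_functionals by blast
  have "x \<noteq> 0 \<or> y \<noteq> 0 \<or> z \<noteq> 0" using pe(4) by auto
  then obtain lj where lj: "lj \<in> fls_functionals" "lj (omega x y z) \<noteq> 0" using l by metis
  define P where "P i = {p :: (complex option \<times> complex option) \<times> complex fls set. snd p \<in> dom (ratio i lj)}" for i
  define \<rho> where "\<rho> i p = the (ratio i lj (snd p))" for i and p :: "(complex option \<times> complex option) \<times> complex fls set"
  have R: "regf YG (P i) (\<rho> i)" if "i \<in> fls_functionals" for i
  proof -
    have "ratio i lj \<in> proj_gens fls_functionals" unfolding proj_gens_def using that lj by blast
    from regf_YG(3)[OF regf_gen[OF this]] show ?thesis unfolding P_def \<rho>_def .
  qed
  have rsp: "ratio i lj (span1 \<omega>) = (if lj \<omega> \<noteq> 0 then Some (i \<omega> / lj \<omega>) else None)" if "i \<in> fls_functionals" for i \<omega>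
    unfolding span1_def by (rule ratio_span[OF that lj(1)])
  define D0 where "D0 = {p. fst (fst p) \<in> D1} \<inter> {p. snd (fst p) \<in> D2} \<inter> (P l1 \<inter> P l2 \<inter> P l3)"
  define q1 where "q1 p = \<phi>1 (fst (fst p))" for p :: "(complex option \<times> complex option) \<times> complex fls set"
  define q2 where "q2 p = \<phi>2 (snd (fst p))" for p :: "(complex option \<times> complex option) \<times> complex fls set"
  have restrict: "regf YG D0 \<phi>" if "regf YG D' \<phi>" "D0 \<subseteq> D'" for D' \<phi>
  proof -
    \<comment> \<open>A zero function with domain \<open>D0\<close>; adding it restricts any regular
      function to \<open>D0\<close> without changing its values. The same device is used for
      \<open>D\<close> below.\<close>
    have "regf YG D0 (\<lambda>p. 0 * (q1 p * q2 p * (\<rho> l1 p * \<rho> l2 p * \<rho> l3 p)))"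
      unfolding D0_def q1_def q2_def
      by (intro regf_cmult regf_mult regf_YG(1)[OF D1(1)] regf_YG(2)[OF D2(1)] R l)
    from regf_add[OF this that(1)] show ?thesis using that(2) by (auto elim!: regf_cong)
  qed
  have q: "regf YG D0 q1" "regf YG D0 q2" "regf YG D0 (\<rho> l1)" "regf YG D0 (\<rho> l2)" "regf YG D0 (\<rho> l3)"
    unfolding q1_def q2_def
    by (rule restrict[OF regf_YG(1)[OF D1(1)]], force simp: D0_def)
      (rule restrict[OF regf_YG(2)[OF D2(1)]], force simp: D0_def,
       (rule restrict[OF R[OF l(1)]], force simp: D0_def),
       (rule restrict[OF R[OF l(2)]], force simp: D0_def),
       (rule restrict[OF R[OF l(3)]], force simp: D0_def))
  define dn where "dn p = \<rho> l3 p - q1 p * \<rho> l1 p - q2 p * \<rho> l2 p" for p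
  have dn: "regf YG D0 dn" unfolding dn_def by (intro regf_same q)
  define D where "D = D0 \<inter> {p. dn p \<noteq> 0}"
  have DD: "D0 \<inter> D = D" by (auto simp: D_def)
  have inv: "regf YG D (\<lambda>p. inverse (dn p))" unfolding D_def by (rule regf_inverse[OF dn])
  have rD: "regf YG D \<phi>" if "regf YG D0 \<phi>" for \<phi>
    using regf_add[OF that regf_cmult[OF inv, of 0]] unfolding DD by simp
  \<comment> \<open>\<open>bun_app_preimage\<close> with numerator and denominator both divided by
    \<open>lj\<close>, which leaves the quotient unchanged.\<close>
  define g1 where "g1 p = \<delta> * \<rho> l1 p * inverse (dn p)" for p
  define g2 where "g2 p = \<delta> * \<rho> l2 p * inverse (dn p)" for p
  have g: "regf YG D g1" "regf YG D g2"
    unfolding g1_def g2_def by (intro regf_same(2) regf_cmult rD q inv)+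
  have val: "\<rho> l1 ((\<zeta>1', \<zeta>2'), span1 (omega x' y' z')) = x' / lj (omega x' y' z')"
    "\<rho> l2 ((\<zeta>1', \<zeta>2'), span1 (omega x' y' z')) = y' / lj (omega x' y' z')"
    "\<rho> l3 ((\<zeta>1', \<zeta>2'), span1 (omega x' y' z')) = z' / lj (omega x' y' z')"
    if "lj (omega x' y' z') \<noteq> 0" for \<zeta>1' \<zeta>2' x' y' z'
    using that l unfolding \<rho>_def snd_conv by (simp_all add: rsp)
  have dnv: "dn ((\<zeta>1', \<zeta>2'), span1 (omega x' y' z')) = (z' - slope_inv t r1 \<zeta>1' * x' - slope_inv t r2' \<zeta>2' * y') / lj (omega x' y' z')"
    if "lj (omega x' y' z') \<noteq> 0" "\<zeta>1' \<in> D1" "\<zeta>2' \<in> D2" for \<zeta>1' \<zeta>2' x' y' z'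
    unfolding dn_def val[OF that(1)] q1_def q2_def fst_conv snd_conv using D1(4) D2(4) that
    by (simp add: diff_divide_distrib)
  have pD: "p \<in> D"
    unfolding D_def D0_def P_def pe(1) using D1(2) D2(2) lj(2) pe(4) dnv[OF lj(2) D1(2) D2(2)] rsp l(1-3) by auto
  have "p' \<in> slope_open \<and> inv_into con_open bun_app p' = pt (q1 p') (g1 p') (q2 p') (g2 p')" if p': "p' \<in> YS \<inter> D" for p'
  proof -
    obtain \<zeta>1' \<zeta>2' x' y' z' where e: "p' = ((\<zeta>1', \<zeta>2'), span1 (omega x' y' z'))"
      using p' unfolding app_space_eq by auto
    have z: "\<zeta>1' \<in> D1" "\<zeta>2' \<in> D2" and j: "lj (omega x' y' z') \<noteq> 0" and d: "dn p' \<noteq> 0"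
      using p' rsp[OF l(1)] unfolding D_def D0_def P_def e by (auto split: if_splits)
    define b where "b = z' - slope_inv t r1 \<zeta>1' * x' - slope_inv t r2' \<zeta>2' * y'"
    have dv: "dn p' = b / lj (omega x' y' z')" unfolding e b_def by (rule dnv[OF j z])
    then have b: "b \<noteq> 0" using d by auto
    have nt: "\<zeta>1' \<noteq> Some t" "\<zeta>2' \<noteq> Some t" using z D1(3) D2(3) by blast+
    have V: "p' \<in> slope_open" unfolding slope_open_def e using nt b unfolding b_def by blast
    have qv: "q1 p' = slope_inv t r1 \<zeta>1'" "q2 p' = slope_inv t r2' \<zeta>2'"
      using z D1(4) D2(4) by (simp_all add: q1_def q2_def e)
    have gv: "g1 p' = \<delta> * x' / b" "g2 p' = \<delta> * y' / b"
      unfolding g1_def g2_def dv using val[OF j] j b by (simp_all add: e field_simps)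
    have "bun_app (pt (q1 p') (g1 p') (q2 p') (g2 p')) = p'"
      unfolding qv gv using bun_app_preimage[OF nt, of z' x' y'] b unfolding b_def e by blast
    moreover have "pt (q1 p') (g1 p') (q2 p') (g2 p') \<in> con_open" unfolding con_open_def by blast
    ultimately have "inv_into con_open bun_app p' = pt (q1 p') (g1 p') (q2 p') (g2 p')"
      using inv_into_f_eq[OF bun_app_inj] by blast
    with V show ?thesis by blast
  qed
  then show ?thesis using rD[OF q(1)] rD[OF q(2)] g pD by blast
qed

lemma slope_open_open: "openin (zariski YS YG) slope_open"
  by (rule zariski_open[OF slope_open_YS]) (use local_inverse in blast)

lemma inv_regular: "regular_map slope_open YG CG (inv_into con_open bun_app)"
proof (rule regular_map_regf)
  fix p h assume p: "p \<in> slope_open" and h: "h \<in> CG" and dom: "inv_into con_open bun_app p \<in> dom h"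
  obtain D q1 g1 q2 g2 where D: "regf YG D q1" "regf YG D g1" "regf YG D q2" "regf YG D g2" "p \<in> D"
    and inv: "\<forall>p'\<in>YS \<inter> D. p' \<in> slope_open \<and> inv_into con_open bun_app p' = pt (q1 p') (g1 p') (q2 p') (g2 p')"
    using local_inverse[OF p] by blast
  have inv': "inv_into con_open bun_app p' = pt (q1 p') (g1 p') (q2 p') (g2 p')" if "p' \<in> slope_open \<inter> D" for p'
    using inv that slope_open_YS by blast
  from h consider (1) l i j where "l \<in> fls_functionals" "h = (\<lambda>A. Some (l (A $ i $ j))) \<circ> fst"
    | (2) \<gamma> where "\<gamma> \<in> proj_gens (fibre_functionals lam E t1)" "h = \<gamma> \<circ> fst \<circ> snd"
    | (3) \<gamma> where "\<gamma> \<in> proj_gens (fibre_functionals lam E t2)" "h = \<gamma> \<circ> snd \<circ> snd"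
    unfolding Con_gens_def prod_gens_def conn_gens_def by blast
  then show "\<exists>D \<phi>. regf YG D \<phi> \<and> p \<in> D \<and> (\<forall>q\<in>slope_open \<inter> D. h (inv_into con_open bun_app q) = Some (\<phi> q))"
  proof cases
    case 1
    have "regf YG D (\<lambda>p. cc (q1 p) (g1 p) (q2 p) (g2 p) i)" if "i < 6" for i
    proof -
      note rs = regf_same regf_cmult regf_const_on[OF D(1)] D
      have "i \<in> {0, Suc 0, 2, 3, 4, 5}" using that by auto
      then consider "i = 0" | "i = Suc 0" | "i = 2" | "i = 3" | "i = 4" | "i = 5" by blast
      then show ?thesis by cases (simp_all, (intro rs)+)
    qed
    then have "regf YG D (\<lambda>p. l (con_mat (cc (q1 p) (g1 p) (q2 p) (g2 p)) $ i $ j))"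
      by (rule caff_regf[OF con_mat_affine[OF 1(1)]])
    then show ?thesis using D(5) inv'
      by (intro exI[of _ D] exI[of _ "\<lambda>p. l (con_mat (cc (q1 p) (g1 p) (q2 p) (g2 p)) $ i $ j)"])
        (simp add: 1(2) pt_def)
  next
    case 2
    obtain D' \<phi> where \<phi>: "regf YG D' \<phi>" "\<forall>p\<in>D. \<gamma> (F1.line (q1 p) 1) = (if p \<in> D' then Some (\<phi> p) else None)" "D' \<subseteq> D"
      using F1.regf_line[OF 2(1) D(1)] by blast
    have eq: "h (inv_into con_open bun_app p') = (if p' \<in> D' then Some (\<phi> p') else None)" if "p' \<in> slope_open \<inter> D" for p'
      using inv'[OF that] \<phi>(2) that by (simp add: 2(2) pt_def)
    have "p \<in> D'" using dom eq[of p] p D(5) by (auto split: if_splits)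
    then show ?thesis using \<phi>(1,3) eq by (intro exI[of _ D'] exI[of _ \<phi>]) auto
  next
    case 3
    obtain D' \<phi> where \<phi>: "regf YG D' \<phi>" "\<forall>p\<in>D. \<gamma> (F2.line (q2 p) 1) = (if p \<in> D' then Some (\<phi> p) else None)" "D' \<subseteq> D"
      using F2.regf_line[OF 3(1) D(3)] by blast
    have eq: "h (inv_into con_open bun_app p') = (if p' \<in> D' then Some (\<phi> p') else None)" if "p' \<in> slope_open \<inter> D" for p'
      using inv'[OF that] \<phi>(2) that by (simp add: 3(2) pt_def)
    have "p \<in> D'" using dom eq[of p] p D(5) by (auto split: if_splits)
    then show ?thesis using \<phi>(1,3) eq by (intro exI[of _ D'] exI[of _ \<phi>]) auto
  qed
qed

lemma birational: "birational_map CON CG YS YG bun_app"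
  unfolding birational_map_def
  using con_open_open con_open_dense slope_open_open slope_open_dense bun_app_bij bun_app_regular inv_regular by blast

lemma fibre_injective:
  assumes p: "p \<in> parabolic_space lam t1 t2 E"
  shows "inj_on App (Bun_fibre lam t1 t2 nu1 nu2 a E p) \<longleftrightarrow> z1 (fst p) \<noteq> Some t \<and> z2 (snd p) \<noteq> Some t"
proof -
  obtain x1 y1 x2 y2 where pe: "p = (F1.line x1 y1, F2.line x2 y2)" and nz: "x1 \<noteq> 0 \<or> y1 \<noteq> 0" "x2 \<noteq> 0 \<or> y2 \<noteq> 0"
    using p unfolding parabolic_space_def F1.fibre_lines_eq F2.fibre_lines_eq by auto
  have zt: "z1 (fst p) = Some t \<longleftrightarrow> y1 = 0" "z2 (snd p) = Some t \<longleftrightarrow> y2 = 0"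
    unfolding pe fst_conv snd_conv coords_line(1)[OF nz(1)] coords_line(2)[OF nz(2)]
    using slope_coord_neq[OF rho_nz(1) nz(1)] slope_coord_neq[OF rho_nz(2) nz(2)] by simp_all
  show ?thesis
  proof (cases "y1 \<noteq> 0 \<and> y2 \<noteq> 0")
    case True
    have "\<exists>g1 g2. m = pt (x1 / y1) g1 (x2 / y2) g2" if m: "m \<in> Bun_fibre lam t1 t2 nu1 nu2 a E p" for m
    proof -
      obtain c x1' y1' x2' y2' where c: "m = (con_mat c, F1.line x1' y1', F2.line x2' y2')" "con_eqs n1 n2 c x1' y1' x2' y2'"
        using m unfolding Bun_fibre_def CON_eq by blast
      have l: "F1.line x1' y1' = F1.line x1 y1" "F2.line x2' y2' = F2.line x2 y2"
        using m unfolding Bun_fibre_def Bun_def c(1) pe by auto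
      have nz': "x1' \<noteq> 0 \<or> y1' \<noteq> 0" "x2' \<noteq> 0 \<or> y2' \<noteq> 0" using c(2) unfolding con_eqs_def by blast+
      have cr: "x1' * y1 = x1 * y1'" "x2' * y2 = x2 * y2'"
        using F1.line_inj[OF l(1) nz'(1)] F2.line_inj[OF l(2) nz'(2)] by simp_all
      have y': "y1' \<noteq> 0" "y2' \<noteq> 0" using cr nz' True by auto
      have "x1' / y1' = x1 / y1" "x2' / y2' = x2 / y2" using cr y' True by (simp_all add: field_simps)
      then show ?thesis using con_eqs_normalize[OF c(2) y'] c(1) by metis
    qed
    then have "inj_on App (Bun_fibre lam t1 t2 nu1 nu2 a E p)"
      by (intro inj_onI) (metis App_pt_inj)
    then show ?thesis using zt True by simp
  next
    case False
    \<comment> \<open>At each point some residue with the prescribed eigenline exists. If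
      \<open>y1\<close> is nonzero, lower left entry 0 forces lower right entry \<open>n1\<close>,
      and the first equation is solved for the upper right entry.\<close>
    have ex1: "\<exists>a b c. a * x1 + b * y1 = n1 * x1 \<and> c * x1 + (- 1 - a) * y1 = n1 * y1"
    proof (cases "y1 = 0")
      case True then show ?thesis by (intro exI[of _ n1] exI[of _ 0]) simp
    next
      case False then show ?thesis
        by (intro exI[of _ "- 1 - n1"] exI[of _ "(2 * n1 + 1) * x1 / y1"] exI[of _ 0]) (simp add: field_simps)
    qed
    have ex2: "\<exists>a b c. a * x2 + b * y2 = n2 * x2 \<and> c * x2 - a * y2 = n2 * y2"
    proof (cases "y2 = 0")
      case True then show ?thesis by (intro exI[of _ n2] exI[of _ 0]) simp
    next
      case False then show ?thesis
        by (intro exI[of _ "- n2"] exI[of _ "2 * n2 * x2 / y2"] exI[of _ 0]) (simp add: field_simps)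
    qed
    obtain c0 c1 c2 where 1: "c0 * x1 + c1 * y1 = n1 * x1" "c2 * x1 + (- 1 - c0) * y1 = n1 * y1" using ex1 by blast
    obtain c3 c4 c5 where 2: "c3 * x2 + c4 * y2 = n2 * x2" "c5 * x2 - c3 * y2 = n2 * y2" using ex2 by blast
    \<comment> \<open>The index of an upper right residue at a point whose line is that of the
      subbundle. There it is multiplied by 0 in the eigenvector equations, and the apparent map
      involves only the indices 0, 2, 3 and 5.\<close>
    define i where "i = (if y1 = 0 then 1 else 4 :: nat)"
    define d where "d = (\<lambda>j::nat. [c0, c1, c2, c3, c4, c5] ! j)"
    define d' where "d' = d(i := d i + 1)"
    have "con_eqs n1 n2 d x1 y1 x2 y2" "con_eqs n1 n2 d' x1 y1 x2 y2"
      using 1 2 nz False unfolding con_eqs_def d'_def d_def i_def by auto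
    then have "(con_mat d, p) \<in> CON" "(con_mat d', p) \<in> CON"
      unfolding CON_eq pe by blast+
    then have mem: "(con_mat d, p) \<in> Bun_fibre lam t1 t2 nu1 nu2 a E p" "(con_mat d', p) \<in> Bun_fibre lam t1 t2 nu1 nu2 a E p"
      unfolding Bun_fibre_def Bun_def by simp_all
    have "App (con_mat d, p) = App (con_mat d', p)"
      unfolding App_span d'_def i_def by simp
    moreover have "con_mat d \<noteq> con_mat d'"
    proof
      assume "con_mat d = con_mat d'"
      moreover have "i < 6" by (simp add: i_def)
      ultimately have "d i = d' i" by (rule con_mat_inj)
      then show False by (simp add: d'_def)
    qed
    ultimately have "\<not> inj_on App (Bun_fibre lam t1 t2 nu1 nu2 a E p)"
      using mem unfolding inj_on_def by blast
    then show ?thesis using zt False by auto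
  qed
qed

end

theorem theorem3:
  fixes lam t r nu1 nu2 :: complex
    and a :: "complex fls ^ 1 ^ 1"
    and E :: "2 vbundle"
    and z1 z2 :: "(complex fls ^ 2) set \<Rightarrow> complex option"
    and t1 t2 :: point
  defines "t1 \<equiv> Aff t r" and "t2 \<equiv> Aff t (- r)"
  assumes "lam \<notin> {0, 1}"
    and "t \<notin> {0, 1, lam}"
    and "t1 \<in> curve lam"
    and "\<not> (\<exists>k::int. odd k \<and> nu1 + nu2 = of_int k)"
    and "\<not> (\<exists>k::int. odd k \<and> nu1 - nu2 = of_int k)"
    and "det_connection lam t1 a"
    and "nontrivial_extension lam E"
    and "normalized_coordinate lam E t1 z1"
    and "normalized_coordinate lam E t2 z2"
    and "nu1 + nu2 + 1 \<noteq> 0"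
  shows "birational_map
           (Con lam t1 t2 nu1 nu2 a E) (Con_gens lam t1 t2 E)
           ((UNIV \<times> UNIV) \<times> app_space lam t1 t2)
           (prod_gens (prod_gens P1_gens P1_gens) (proj_gens fls_functionals))
           (\<lambda>m. ((z1 (fst (Bun m)), z2 (snd (Bun m))), App m)) \<and>
         (\<forall>p \<in> parabolic_space lam t1 t2 E.
            App \<in> Bun_fibre lam t1 t2 nu1 nu2 a E p \<rightarrow> app_space lam t1 t2 \<and>
            (inj_on App (Bun_fibre lam t1 t2 nu1 nu2 a E p) \<longleftrightarrow>
               p \<notin> {p. z1 (fst p) = Some t} \<union> {p. z2 (snd p) = Some t}))"
proof -
  interpret elliptic lam using assms by unfold_locales
  obtain h k where nf: "normal_form E h k"
    using extension_normal_form assms by blast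
  have r2: "r\<^sup>2 = cub t" using assms curve_iff by simp
  \<comment> \<open>\<open>t\<close> avoids the branch values, so \<open>r\<close> is nonzero and
    the two marked points are distinct.\<close>
  have "cub t \<noteq> 0" using assms by (simp add: cub_def)
  then have "r \<noteq> 0" using r2 by auto
  interpret moduli lam E h k t r a nu1 nu2 z1 z2
    using nf r2 \<open>r \<noteq> 0\<close> assms by unfold_locales auto
  have "bun_app = (\<lambda>m. ((z1 (fst (Bun m)), z2 (snd (Bun m))), App m))"
    by (simp add: bun_app_def fun_eq_iff)
  moreover have "App \<in> Bun_fibre lam (Aff t r) (Aff t (- r)) nu1 nu2 a E p \<rightarrow> app_space lam (Aff t r) (Aff t (- r))" for p
    using App_app_space unfolding Bun_fibre_def by blast
  ultimately show ?thesis
    using birational fibre_injective unfolding t1_def t2_def by auto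
qed

end
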